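(* Let $\mathfrak{M}=(\mathcal{Q},\mathcal{W},\mathcal{R})$ be an hereditary abelian model structure on an abelian category $\mathcal{A}$. For each $n\in\mathbb{Z}$, $\mathrm{Ext}^n_{\mathrm{Ho}(\mathfrak{M})}(A,B)$ defines a functor (in each of the variables $A,B\in\mathcal{A}$) with the following properties. (1) $\mathrm{Ext}^n_{\mathrm{Ho}(\mathfrak{M})}(A,-):\mathcal{A}\to\mathbf{Ab}$ is a covariant additive functor, and short exact sequences in $\mathcal{A}$ are sent to long exact cohomology sequences of $\mathrm{Ext}^n_{\mathrm{Ho}(\mathfrak{M})}$ groups. $\mathrm{Ext}^n_{\mathrm{Ho}(\mathfrak{M})}(A,-)$ descends via $\gamma_{\mathfrak{M}}:\mathcal{A}\to\mathrm{Ho}(\mathfrak{M})$ to a well-defined functor on $\mathrm{Ho}(\mathfrak{M})$. (2) $\mathrm{Ext}^n_{\mathrm{Ho}(\mathfrak{M})}(-,B):\mathcal{A}\to\mathbf{Ab}$ is a contravariant additive functor, and short exact sequences in $\mathcal{A}$ are sent to long exact cohomology sequences of $\mathrm{Ext}^n_{\mathrm{Ho}(\mathfrak{M})}$ groups. $\mathrm{Ext}^n_{\mathrm{Ho}(\mathfrak{M})}(-,B)$ descends via $\gamma_{\mathfrak{M}}:\mathcal{A}\to\mathrm{Ho}(\mathfrak{M})$ to a well-defined functor on $\mathrm{Ho}(\mathfrak{M})$. (3) There are isomorphisms, natural in both $A$ and $B$, $$\mathrm{Ext}^n_{\mathrm{Ho}(\mathfrak{M})}(A,B)\cong\mathrm{Ext}^n_{\mathfrak{M}}(QA,RB).$$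 In particular, the group $\mathrm{Ext}^n_{\mathrm{Ho}(\mathfrak{M})}(A,B)$ may be computed either by applying $H^n[\mathrm{Hom}_{\mathcal{A}}(-,RB)]$ to a canonical resolution of $A$, or by applying $H^n[\mathrm{Hom}_{\mathcal{A}}(QA,-)]$ to a canonical coresolution of $B$.
   Context: $\mathbf{Ab}$ is the category of abelian groups; $\mathrm{Ext}^n_{\mathcal{A}}$ denotes Yoneda Ext in $\mathcal{A}$. A cotorsion pair is a pair of classes $(\mathcal{X},\mathcal{Y})$ with $\mathcal{Y}=\{Y:\mathrm{Ext}^1_{\mathcal{A}}(X,Y)=0\ \forall X\in\mathcal{X}\}$ and $\mathcal{X}=\{X:\mathrm{Ext}^1_{\mathcal{A}}(X,Y)=0\ \forall Y\in\mathcal{Y}\}$. It is complete if every object $A$ admits short exact sequences $0\to Y\to X\to A\to0$ and $0\to A\to Y'\to X'\to 0$ with $X,X'\in\mathcal{X}$, $Y,Y'\in\mathcal{Y}$; hereditary if $\mathrm{Ext}^i_{\mathcal{A}}(X,Y)=0$ for all $X\in\mathcal{X}$, $Y\in\mathcal{Y}$, $i\ge1$. An hereditary abelian model structure is a triple $\mathfrak{M}=(\mathcal{Q},\mathcal{W},\mathcal{R})$ of classes of objects such that $\mathcal{W}$ is thick (2 out of 3 property on short exact sequences) and, with $\mathcal{Q}_{\mathcal{W}}=\mathcal{Q}\cap\mathcal{W}$ and $\mathcal{R}_{\mathcal{W}}=\mathcal{W}\cap\mathcal{R}$, both $(\mathcal{Q},\mathcal{R}_{\mathcal{W}})$ and $(\mathcal{Q}_{\mathcal{W}},\mathcal{R})$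 are complete hereditary cotorsion pairs. Objects of $\mathcal{Q}$ are cofibrant, objects of $\mathcal{R}$ fibrant. The core is $\omega=\mathcal{Q}\cap\mathcal{W}\cap\mathcal{R}$; $f\sim^\omega g$ means $g-f$ factors through an object of $\omega$, and $\underline{\mathrm{Hom}}_\omega(A,B)=\mathrm{Hom}_{\mathcal{A}}(A,B)/\sim^\omega$. A cofibrant replacement $QA$ of $A$ is given by a short exact sequence $0\to F\to QA\xrightarrow{p_A} A\to0$ with $QA\in\mathcal{Q}$, $F\in\mathcal{R}_{\mathcal{W}}$; a fibrant replacement $RA$ by $0\to A\xrightarrow{j_A} RA\to C\to0$ with $RA\in\mathcal{R}$, $C\in\mathcal{Q}_{\mathcal{W}}$. $\mathrm{Ho}(\mathfrak{M})$ has the objects of $\mathcal{A}$ and $\mathrm{Ho}(\mathfrak{M})(A,B)=\underline{\mathrm{Hom}}_\omega(RQA,RQB)$. The canonical functor $\gamma_{\mathfrak{M}}:\mathcal{A}\to\mathrm{Ho}(\mathfrak{M})$ is the identity on objects and sends $f:A\to B$ to $[R(Q(f))]_\omega$, where $Q(f):QA\to QB$ and $R(Q(f)):RQA\to RQB$ are any morphisms with $p_BQ(f)=fp_A$ and $R(Q(f))j_{QA}=j_{QB}Q(f)$. An $\mathfrak{M}$-resolution of $A$ is an exact chain complex $W_A\equiv\cdots\to Q_1\xrightarrow{d_1}Q_0\xrightarrow{d_0}R_{-1}\xrightarrow{d_{-1}}R_{-2}\to\cdots$ with $d_0=\eta\epsilon$, where $\cdots\to Q_1\to Q_0\xrightarrow{\epsilon}A\to0$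 is exact with each $Q_i\in\mathcal{Q}_{\mathcal{W}}$ and all kernels $\ker\epsilon$, $\ker d_i$ ($i\ge1$) in $\mathcal{R}$, and $0\to A\xrightarrow{\eta}R_{-1}\to R_{-2}\to\cdots$ is exact with each $R_i\in\mathcal{R}_{\mathcal{W}}$ and all cokernels $\mathrm{cok}\,\eta$, $\mathrm{cok}\,d_i$ ($i\le-1$) in $\mathcal{Q}$. An $\mathfrak{M}$-coresolution $W^B$ of $B$ is the same kind of complex written as a cochain complex $\cdots\to Q^{-2}\to Q^{-1}\to R^0\to R^1\to\cdots$, with $d^{-1}$ factoring as $Q^{-1}\twoheadrightarrow B\hookrightarrow R^0$. A canonical resolution of $A$ is an $\mathfrak{M}$-resolution $W_{QA}$ of any cofibrant replacement $QA$; a canonical coresolution of $B$ is an $\mathfrak{M}$-coresolution $W^{RB}$ of any fibrant replacement $RB$. Define $\ell\mathrm{Ext}^n_{\mathfrak{M}}(A,B)=H^n[\mathrm{Hom}_{\mathcal{A}}(W_A,B)]$ and $r\mathrm{Ext}^n_{\mathfrak{M}}(A,B)=H^n[\mathrm{Hom}_{\mathcal{A}}(A,W^B)]$ (bifunctors, independent of choices up to canonical isomorphism). When $A$ is cofibrant and $B$ is fibrant they are canonically isomorphic, and the common group is denoted $\mathrm{Ext}^n_{\mathfrak{M}}(A,B)$. Finally $\mathrm{Ext}^n_{\mathrm{Ho}(\mathfrak{M})}(A,B):=\mathrm{Ext}^n_{\mathfrak{M}}(RQA,RQB)$, where $RQA,RQB$ are bifibrant replacements; morphisms of $\mathcal{A}$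 act via their bifibrant replacements $R(Q(f))$. *)

theory Defs
  imports "HOL-Algebra.Coset"
begin

section \<open>Abelian categories\<close>

text \<open>Every arrow has one domain and one codomain, so that hom-sets are disjoint. \<open>Cmp C g f\<close> is
  "first \<open>f\<close>, then \<open>g\<close>"; it is meaningful only if \<open>Cod C f = Dom C g\<close>. Likewise \<open>Add\<close> is meaningful
  only on parallel arrows, and \<open>Zer C A B\<close> is the zero arrow from \<open>A\<close> to \<open>B\<close>.\<close>

record ('o, 'm) add_cat =
  Ob :: "'o set"
  Arr :: "'m set"
  Dom :: "'m \<Rightarrow> 'o"
  Cod :: "'m \<Rightarrow> 'o"
  Idn :: "'o \<Rightarrow> 'm"
  Cmp :: "'m \<Rightarrow> 'm \<Rightarrow> 'm" (infixr "\<odot>\<index>" 70)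
  Add :: "'m \<Rightarrow> 'm \<Rightarrow> 'm"
  Zer :: "'o \<Rightarrow> 'o \<Rightarrow> 'm"

definition Hom :: "('o, 'm) add_cat \<Rightarrow> 'o \<Rightarrow> 'o \<Rightarrow> 'm set" where
  "Hom C A B = {f \<in> Arr C. Dom C f = A \<and> Cod C f = B}"

definition hom_group :: "('o, 'm) add_cat \<Rightarrow> 'o \<Rightarrow> 'o \<Rightarrow> 'm monoid" where
  "hom_group C A B = \<lparr>carrier = Hom C A B, mult = Add C, one = Zer C A B\<rparr>"

definition op_cat :: "('o, 'm) add_cat \<Rightarrow> ('o, 'm) add_cat" where
  "op_cat C = \<lparr>Ob = Ob C, Arr = Arr C, Dom = Cod C, Cod = Dom C, Idn = Idn C,
     Cmp = (\<lambda>g f. Cmp C f g), Add = Add C, Zer = (\<lambda>A B. Zer C B A)\<rparr>"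

locale category =
  fixes C :: "('o, 'm) add_cat" (structure)
  assumes dom_cod: "f \<in> Arr C \<Longrightarrow> Dom C f \<in> Ob C \<and> Cod C f \<in> Ob C"
    and idn: "A \<in> Ob C \<Longrightarrow> Idn C A \<in> Hom C A A"
    and cmp: "\<lbrakk>f \<in> Hom C A B; g \<in> Hom C B D\<rbrakk> \<Longrightarrow> g \<odot> f \<in> Hom C A D"
    and cmp_idn: "f \<in> Hom C A B \<Longrightarrow> f \<odot> Idn C A = f"
    and idn_cmp: "f \<in> Hom C A B \<Longrightarrow> Idn C B \<odot> f = f"
    and cmp_assoc: "\<lbrakk>f \<in> Hom C A B; g \<in> Hom C B D; h \<in> Hom C D E\<rbrakk>
                      \<Longrightarrow> (h \<odot> g) \<odot> f = h \<odot> (g \<odot> f)"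

locale preadditive_category = category +
  assumes hom_comm_group: "\<lbrakk>A \<in> Ob C; B \<in> Ob C\<rbrakk> \<Longrightarrow> comm_group (hom_group C A B)"
    and cmp_add: "\<lbrakk>f \<in> Hom C A B; f' \<in> Hom C A B; g \<in> Hom C B D\<rbrakk>
                    \<Longrightarrow> g \<odot> Add C f f' = Add C (g \<odot> f) (g \<odot> f')"
    and add_cmp: "\<lbrakk>f \<in> Hom C A B; g \<in> Hom C B D; g' \<in> Hom C B D\<rbrakk>
                    \<Longrightarrow> Add C g g' \<odot> f = Add C (g \<odot> f) (g' \<odot> f)"

definition monic :: "('o, 'm) add_cat \<Rightarrow> 'm \<Rightarrow> bool" where
  "monic C m \<longleftrightarrow> m \<in> Arr C \<and>
     (\<forall>X. \<forall>g \<in> Hom C X (Dom C m). \<forall>h \<in> Hom C X (Dom C m). Cmp C m g = Cmp C m h \<longrightarrow> g = h)"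

definition epic :: "('o, 'm) add_cat \<Rightarrow> 'm \<Rightarrow> bool" where
  "epic C e \<longleftrightarrow> e \<in> Arr C \<and>
     (\<forall>X. \<forall>g \<in> Hom C (Cod C e) X. \<forall>h \<in> Hom C (Cod C e) X. Cmp C g e = Cmp C h e \<longrightarrow> g = h)"

definition is_ker :: "('o, 'm) add_cat \<Rightarrow> 'm \<Rightarrow> 'm \<Rightarrow> bool" where
  "is_ker C k f \<longleftrightarrow> k \<in> Arr C \<and> f \<in> Arr C \<and> Cod C k = Dom C f \<and>
     Cmp C f k = Zer C (Dom C k) (Cod C f) \<and>
     (\<forall>X. \<forall>g \<in> Hom C X (Dom C f). Cmp C f g = Zer C X (Cod C f) \<longrightarrow>
        (\<exists>!h. h \<in> Hom C X (Dom C k) \<and> Cmp C k h = g))"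

definition is_coker :: "('o, 'm) add_cat \<Rightarrow> 'm \<Rightarrow> 'm \<Rightarrow> bool" where
  "is_coker C c f \<longleftrightarrow> c \<in> Arr C \<and> f \<in> Arr C \<and> Dom C c = Cod C f \<and>
     Cmp C c f = Zer C (Dom C f) (Cod C c) \<and>
     (\<forall>X. \<forall>g \<in> Hom C (Cod C f) X. Cmp C g f = Zer C (Dom C f) X \<longrightarrow>
        (\<exists>!h. h \<in> Hom C (Cod C c) X \<and> Cmp C h c = g))"

locale abelian_category = preadditive_category +
  assumes zero_object: "\<exists>Z \<in> Ob C. \<forall>A \<in> Ob C. (\<exists>!f. f \<in> Hom C Z A) \<and> (\<exists>!f. f \<in> Hom C A Z)"
    and biproduct: "\<lbrakk>A \<in> Ob C; B \<in> Ob C\<rbrakk> \<Longrightarrow> \<exists>P \<in> Ob C. \<exists>i j p q.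
        i \<in> Hom C A P \<and> j \<in> Hom C B P \<and> p \<in> Hom C P A \<and> q \<in> Hom C P B \<and>
        p \<odot> i = Idn C A \<and> q \<odot> j = Idn C B \<and> q \<odot> i = Zer C A B \<and> p \<odot> j = Zer C B A \<and>
        Add C (i \<odot> p) (j \<odot> q) = Idn C P"
    and has_ker: "f \<in> Arr C \<Longrightarrow> \<exists>k. is_ker C k f"
    and has_coker: "f \<in> Arr C \<Longrightarrow> \<exists>c. is_coker C c f"
    and monic_is_ker: "monic C m \<Longrightarrow> \<exists>f. is_ker C m f"
    and epic_is_coker: "epic C e \<Longrightarrow> \<exists>f. is_coker C e f"

text \<open>Exactness of \<open>f\<close> followed by \<open>g\<close>: the image of \<open>f\<close>, i.e. the kernel of its cokernel, is the
  kernel of \<open>g\<close>.\<close>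

definition exact :: "('o, 'm) add_cat \<Rightarrow> 'm \<Rightarrow> 'm \<Rightarrow> bool" where
  "exact C f g \<longleftrightarrow> f \<in> Arr C \<and> g \<in> Arr C \<and> Cod C f = Dom C g \<and>
     (\<exists>c k. is_coker C c f \<and> is_ker C k c \<and> is_ker C k g)"

definition short_exact :: "('o, 'm) add_cat \<Rightarrow> 'm \<Rightarrow> 'm \<Rightarrow> bool" where
  "short_exact C f g \<longleftrightarrow> monic C f \<and> exact C f g \<and> epic C g"


section \<open>Yoneda Ext\<close>

text \<open>For \<open>n \<ge> 1\<close>, an \<open>n\<close>-fold extension \<open>0 \<rightarrow> Y \<rightarrow> E\<^sub>n \<rightarrow> \<dots> \<rightarrow> E\<^sub>1 \<rightarrow> X \<rightarrow> 0\<close> is given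
  by the list of its \<open>n + 1\<close> arrows, from left to right.\<close>

definition yoneda_seq :: "('o, 'm) add_cat \<Rightarrow> nat \<Rightarrow> 'o \<Rightarrow> 'o \<Rightarrow> 'm list set" where
  "yoneda_seq C n X Y = {es. length es = Suc n \<and> Dom C (es ! 0) = Y \<and> Cod C (es ! n) = X \<and>
     monic C (es ! 0) \<and> (\<forall>i < n. exact C (es ! i) (es ! Suc i)) \<and> epic C (es ! n)}"

definition yoneda_mor :: "('o, 'm) add_cat \<Rightarrow> nat \<Rightarrow> 'o \<Rightarrow> 'o \<Rightarrow> 'm list \<Rightarrow> 'm list \<Rightarrow> bool" where
  "yoneda_mor C n X Y es es' \<longleftrightarrow> es \<in> yoneda_seq C n X Y \<and> es' \<in> yoneda_seq C n X Y \<and>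
     (\<exists>\<phi> :: nat \<Rightarrow> 'm. \<phi> 0 = Idn C Y \<and> \<phi> (Suc n) = Idn C X \<and>
        (\<forall>i \<le> n. \<phi> i \<in> Hom C (Dom C (es ! i)) (Dom C (es' ! i)) \<and>
                  Cmp C (\<phi> (Suc i)) (es ! i) = Cmp C (es' ! i) (\<phi> i)))"

definition yoneda_rel :: "('o, 'm) add_cat \<Rightarrow> nat \<Rightarrow> 'o \<Rightarrow> 'o \<Rightarrow> ('m list \<times> 'm list) set" where
  "yoneda_rel C n X Y = {(es, es'). es \<in> yoneda_seq C n X Y \<and> es' \<in> yoneda_seq C n X Y \<and>
     equivclp (yoneda_mor C n X Y) es es'}"

definition yoneda_Ext :: "('o, 'm) add_cat \<Rightarrow> nat \<Rightarrow> 'o \<Rightarrow> 'o \<Rightarrow> 'm list set set" where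
  "yoneda_Ext C n X Y = yoneda_seq C n X Y // yoneda_rel C n X Y"

text \<open>The group structure (Baer sum) is not needed to express vanishing: a group is zero iff its
  underlying set has exactly one element.\<close>

definition Ext_vanishes :: "('o, 'm) add_cat \<Rightarrow> nat \<Rightarrow> 'o \<Rightarrow> 'o \<Rightarrow> bool" where
  "Ext_vanishes C n X Y \<longleftrightarrow> (\<exists>z. yoneda_Ext C n X Y = {z})"


section \<open>Hereditary abelian model structures\<close>

definition cotorsion_pair :: "('o, 'm) add_cat \<Rightarrow> 'o set \<Rightarrow> 'o set \<Rightarrow> bool" where
  "cotorsion_pair C \<X> \<Y> \<longleftrightarrow>
     \<Y> = {Y \<in> Ob C. \<forall>X \<in> \<X>. Ext_vanishes C 1 X Y} \<and>
     \<X> = {X \<in> Ob C. \<forall>Y \<in> \<Y>. Ext_vanishes C 1 X Y}"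

definition complete_pair :: "('o, 'm) add_cat \<Rightarrow> 'o set \<Rightarrow> 'o set \<Rightarrow> bool" where
  "complete_pair C \<X> \<Y> \<longleftrightarrow> (\<forall>A \<in> Ob C.
     (\<exists>i p. short_exact C i p \<and> Dom C i \<in> \<Y> \<and> Dom C p \<in> \<X> \<and> Cod C p = A) \<and>
     (\<exists>j q. short_exact C j q \<and> Dom C j = A \<and> Cod C j \<in> \<Y> \<and> Cod C q \<in> \<X>))"

definition hereditary_pair :: "('o, 'm) add_cat \<Rightarrow> 'o set \<Rightarrow> 'o set \<Rightarrow> bool" where
  "hereditary_pair C \<X> \<Y> \<longleftrightarrow> (\<forall>X \<in> \<X>. \<forall>Y \<in> \<Y>. \<forall>i \<ge> 1. Ext_vanishes C i X Y)"

definition thick :: "('o, 'm) add_cat \<Rightarrow> 'o set \<Rightarrow> bool" where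
  "thick C \<W> \<longleftrightarrow> \<W> \<subseteq> Ob C \<and> (\<forall>f g. short_exact C f g \<longrightarrow>
     (Dom C f \<in> \<W> \<and> Cod C f \<in> \<W> \<longrightarrow> Cod C g \<in> \<W>) \<and>
     (Dom C f \<in> \<W> \<and> Cod C g \<in> \<W> \<longrightarrow> Cod C f \<in> \<W>) \<and>
     (Cod C f \<in> \<W> \<and> Cod C g \<in> \<W> \<longrightarrow> Dom C f \<in> \<W>))"

record 'o triple =
  Cofib :: "'o set"
  Triv :: "'o set"
  Fib :: "'o set"

definition hereditary_model :: "('o, 'm) add_cat \<Rightarrow> 'o triple \<Rightarrow> bool" where
  "hereditary_model C M \<longleftrightarrow> Cofib M \<subseteq> Ob C \<and> Fib M \<subseteq> Ob C \<and> thick C (Triv M) \<and>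
     (\<forall>(\<X>, \<Y>) \<in> {(Cofib M, Triv M \<inter> Fib M), (Cofib M \<inter> Triv M, Fib M)}.
        cotorsion_pair C \<X> \<Y> \<and> complete_pair C \<X> \<Y> \<and> hereditary_pair C \<X> \<Y>)"

definition core :: "'o triple \<Rightarrow> 'o set" where
  "core M = Cofib M \<inter> Triv M \<inter> Fib M"

definition factors_through_core :: "('o, 'm) add_cat \<Rightarrow> 'o triple \<Rightarrow> 'm \<Rightarrow> bool" where
  "factors_through_core C M h \<longleftrightarrow> (\<exists>u \<in> Arr C. \<exists>v \<in> Arr C.
     Cod C u \<in> core M \<and> Dom C v = Cod C u \<and> h = Cmp C v u)"

definition core_equiv :: "('o, 'm) add_cat \<Rightarrow> 'o triple \<Rightarrow> 'm \<Rightarrow> 'm \<Rightarrow> bool" where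
  "core_equiv C M f g \<longleftrightarrow> f \<in> Arr C \<and> g \<in> Hom C (Dom C f) (Cod C f) \<and>
     factors_through_core C M (Add C g (inv\<^bsub>hom_group C (Dom C f) (Cod C f)\<^esub> f))"

definition core_class :: "('o, 'm) add_cat \<Rightarrow> 'o triple \<Rightarrow> 'm \<Rightarrow> 'm set" where
  "core_class C M f = {g. core_equiv C M f g}"

text \<open>\<open>core_hom C M A B\<close> is the quotient of \<open>Hom C A B\<close> by \<open>core_equiv\<close>.\<close>

definition core_hom :: "('o, 'm) add_cat \<Rightarrow> 'o triple \<Rightarrow> 'o \<Rightarrow> 'o \<Rightarrow> 'm set set" where
  "core_hom C M A B = core_class C M ` Hom C A B"


section \<open>Replacements and resolutions\<close>

definition cofibrant_replacement :: "('o, 'm) add_cat \<Rightarrow> 'o triple \<Rightarrow> 'o \<Rightarrow> 'o \<Rightarrow> 'm \<Rightarrow> bool" where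
  "cofibrant_replacement C M A QA p \<longleftrightarrow> p \<in> Hom C QA A \<and> QA \<in> Cofib M \<and>
     (\<exists>i. short_exact C i p \<and> Dom C i \<in> Triv M \<inter> Fib M)"

definition fibrant_replacement :: "('o, 'm) add_cat \<Rightarrow> 'o triple \<Rightarrow> 'o \<Rightarrow> 'o \<Rightarrow> 'm \<Rightarrow> bool" where
  "fibrant_replacement C M A RA j \<longleftrightarrow> j \<in> Hom C A RA \<and> RA \<in> Fib M \<and>
     (\<exists>q. short_exact C j q \<and> Cod C q \<in> Cofib M \<inter> Triv M)"

text \<open>Chain-complex indexing: \<open>diff n\<close> goes from \<open>obj n\<close> to \<open>obj (n - 1)\<close>; the objects are
  \<open>Q\<^sub>n\<close> for \<open>n \<ge> 0\<close> and \<open>R\<^sub>n\<close> for \<open>n < 0\<close>.\<close>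

record ('o, 'm) resol =
  obj :: "int \<Rightarrow> 'o"
  diff :: "int \<Rightarrow> 'm"
  eps :: "'m"
  eta :: "'m"

definition M_resolution :: "('o, 'm) add_cat \<Rightarrow> 'o triple \<Rightarrow> 'o \<Rightarrow> ('o, 'm) resol \<Rightarrow> bool" where
  "M_resolution C M A V \<longleftrightarrow>
     (\<forall>n. diff V n \<in> Hom C (obj V n) (obj V (n - 1))) \<and>
     (\<forall>n. exact C (diff V (n + 1)) (diff V n)) \<and>
     eps V \<in> Hom C (obj V 0) A \<and> eta V \<in> Hom C A (obj V (-1)) \<and>
     diff V 0 = Cmp C (eta V) (eps V) \<and>
     epic C (eps V) \<and> exact C (diff V 1) (eps V) \<and>
     monic C (eta V) \<and> exact C (eta V) (diff V (-1)) \<and>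
     (\<forall>n \<ge> 0. obj V n \<in> Cofib M \<inter> Triv M) \<and>
     (\<forall>n < 0. obj V n \<in> Triv M \<inter> Fib M) \<and>
     (\<forall>k. is_ker C k (eps V) \<longrightarrow> Dom C k \<in> Fib M) \<and>
     (\<forall>n \<ge> 1. \<forall>k. is_ker C k (diff V n) \<longrightarrow> Dom C k \<in> Fib M) \<and>
     (\<forall>c. is_coker C c (eta V) \<longrightarrow> Cod C c \<in> Cofib M) \<and>
     (\<forall>n \<le> -1. \<forall>c. is_coker C c (diff V n) \<longrightarrow> Cod C c \<in> Cofib M)"

definition resol_lift ::
  "('o, 'm) add_cat \<Rightarrow> ('o, 'm) resol \<Rightarrow> ('o, 'm) resol \<Rightarrow> 'm \<Rightarrow> (int \<Rightarrow> 'm) \<Rightarrow> bool" where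
  "resol_lift C V V' f \<phi> \<longleftrightarrow>
     (\<forall>n. \<phi> n \<in> Hom C (obj V n) (obj V' n) \<and>
          Cmp C (diff V' n) (\<phi> n) = Cmp C (\<phi> (n - 1)) (diff V n)) \<and>
     Cmp C (eps V') (\<phi> 0) = Cmp C f (eps V) \<and>
     Cmp C (\<phi> (-1)) (eta V) = Cmp C (eta V') f"

text \<open>A coresolution \<open>W\<^sup>B\<close> is a resolution of \<open>B\<close> written as a cochain complex: its object in
  cohomological degree \<open>n\<close> is \<open>obj V (-n - 1)\<close>, so that \<open>R\<^sup>0\<close> is \<open>R\<^sub>-\<^sub>1\<close> and \<open>Q\<^sup>-\<^sup>1\<close> is \<open>Q\<^sub>0\<close>;
  its differential out of degree \<open>n\<close> is \<open>diff V (-n - 1)\<close>.\<close>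

definition co_obj :: "('o, 'm) resol \<Rightarrow> int \<Rightarrow> 'o" where
  "co_obj V n = obj V (-n - 1)"

definition co_diff :: "('o, 'm) resol \<Rightarrow> int \<Rightarrow> 'm" where
  "co_diff V n = diff V (-n - 1)"


section \<open>Cohomology\<close>

definition boundaries :: "(int \<Rightarrow> 'g monoid) \<Rightarrow> (int \<Rightarrow> 'g \<Rightarrow> 'g) \<Rightarrow> int \<Rightarrow> 'g set" where
  "boundaries G \<delta> n = \<delta> (n - 1) ` carrier (G (n - 1))"

definition cohomology :: "(int \<Rightarrow> 'g monoid) \<Rightarrow> (int \<Rightarrow> 'g \<Rightarrow> 'g) \<Rightarrow> int \<Rightarrow> 'g set monoid" where
  "cohomology G \<delta> n = (G n)\<lparr>carrier := kernel (G n) (G (n + 1)) (\<delta> n)\<rparr> Mod boundaries G \<delta> n"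

text \<open>The map to the \<open>n\<close>-th cohomology of \<open>(G, \<delta>)\<close> induced by the degree-\<open>n\<close> component \<open>\<phi>\<close> of a cochain map:
  the class \<open>c\<close> goes to the class of \<open>\<phi> x\<close>, for any representative \<open>x\<close> of \<open>c\<close>.\<close>

definition cohomology_map ::
  "(int \<Rightarrow> 'g monoid) \<Rightarrow> (int \<Rightarrow> 'g \<Rightarrow> 'g) \<Rightarrow> int \<Rightarrow> ('g \<Rightarrow> 'g) \<Rightarrow> 'g set \<Rightarrow> 'g set" where
  "cohomology_map G \<delta> n \<phi> c = (\<Union>x \<in> c. boundaries G \<delta> n #>\<^bsub>G n\<^esub> \<phi> x)"

text \<open>\<open>lH C V B n\<close> is the \<open>n\<close>-th cohomology of \<open>Hom(V, B)\<close>, and \<open>rH C A V n\<close> that of \<open>Hom(A, V)\<close> for \<open>V\<close> a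
  coresolution.\<close>

definition lH :: "('o, 'm) add_cat \<Rightarrow> ('o, 'm) resol \<Rightarrow> 'o \<Rightarrow> int \<Rightarrow> 'm set monoid" where
  "lH C V B = cohomology (\<lambda>n. hom_group C (obj V n) B) (\<lambda>n h. Cmp C h (diff V (n + 1)))"

definition lH_map ::
  "('o, 'm) add_cat \<Rightarrow> ('o, 'm) resol \<Rightarrow> 'o \<Rightarrow> int \<Rightarrow> ('m \<Rightarrow> 'm) \<Rightarrow> 'm set \<Rightarrow> 'm set" where
  "lH_map C V B = cohomology_map (\<lambda>n. hom_group C (obj V n) B) (\<lambda>n h. Cmp C h (diff V (n + 1)))"

definition rH :: "('o, 'm) add_cat \<Rightarrow> 'o \<Rightarrow> ('o, 'm) resol \<Rightarrow> int \<Rightarrow> 'm set monoid" where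
  "rH C A V = cohomology (\<lambda>n. hom_group C A (co_obj V n)) (\<lambda>n h. Cmp C (co_diff V n) h)"

definition rH_map ::
  "('o, 'm) add_cat \<Rightarrow> 'o \<Rightarrow> ('o, 'm) resol \<Rightarrow> int \<Rightarrow> ('m \<Rightarrow> 'm) \<Rightarrow> 'm set \<Rightarrow> 'm set" where
  "rH_map C A V = cohomology_map (\<lambda>n. hom_group C A (co_obj V n)) (\<lambda>n h. Cmp C (co_diff V n) h)"


section \<open>Choices\<close>

text \<open>All the choices on which the constructions below depend: cofibrant and fibrant replacements,
  resolutions and coresolutions of all objects, and lifts of all morphisms to them. Every construction
  takes an arbitrary such \<open>S\<close> with \<open>choices C M S\<close>.\<close>

record ('o, 'm) choice =
  QO :: "'o \<Rightarrow> 'o"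
  pr :: "'o \<Rightarrow> 'm"
  QM :: "'m \<Rightarrow> 'm"
  RO :: "'o \<Rightarrow> 'o"
  inc :: "'o \<Rightarrow> 'm"
  RM :: "'m \<Rightarrow> 'm"
  res :: "'o \<Rightarrow> ('o, 'm) resol"
  res_lift :: "'m \<Rightarrow> int \<Rightarrow> 'm"
  cores :: "'o \<Rightarrow> ('o, 'm) resol"
  cores_lift :: "'m \<Rightarrow> int \<Rightarrow> 'm"

definition choices :: "('o, 'm) add_cat \<Rightarrow> 'o triple \<Rightarrow> ('o, 'm) choice \<Rightarrow> bool" where
  "choices C M S \<longleftrightarrow>
     (\<forall>A \<in> Ob C. cofibrant_replacement C M A (QO S A) (pr S A) \<and>
                 fibrant_replacement C M A (RO S A) (inc S A) \<and>
                 M_resolution C M A (res S A) \<and> M_resolution C M A (cores S A)) \<and>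
     (\<forall>A B. \<forall>f \<in> Hom C A B.
        QM S f \<in> Hom C (QO S A) (QO S B) \<and> Cmp C (pr S B) (QM S f) = Cmp C f (pr S A) \<and>
        RM S f \<in> Hom C (RO S A) (RO S B) \<and> Cmp C (RM S f) (inc S A) = Cmp C (inc S B) f \<and>
        resol_lift C (res S A) (res S B) f (res_lift S f) \<and>
        resol_lift C (cores S A) (cores S B) f (cores_lift S f))"

definition RQO :: "('o, 'm) choice \<Rightarrow> 'o \<Rightarrow> 'o" where
  "RQO S A = RO S (QO S A)"

definition RQM :: "('o, 'm) choice \<Rightarrow> 'm \<Rightarrow> 'm" where
  "RQM S f = RM S (QM S f)"


section \<open>The homotopy category\<close>

text \<open>An arrow from \<open>A\<close> to \<open>B\<close> is tagged with \<open>A\<close> and \<open>B\<close>, because these are not determined by their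
  bifibrant replacements. Composition and addition are those of representatives.\<close>

definition Ho ::
  "('o, 'm) add_cat \<Rightarrow> 'o triple \<Rightarrow> ('o, 'm) choice \<Rightarrow> ('o, 'o \<times> 'm set \<times> 'o) add_cat" where
  "Ho C M S = \<lparr>
     Ob = Ob C,
     Arr = {(A, c, B). A \<in> Ob C \<and> B \<in> Ob C \<and> c \<in> core_hom C M (RQO S A) (RQO S B)},
     Dom = (\<lambda>(A, c, B). A),
     Cod = (\<lambda>(A, c, B). B),
     Idn = (\<lambda>A. (A, core_class C M (Idn C (RQO S A)), A)),
     Cmp = (\<lambda>(B, d, D) (A, c, B'). (A, \<Union>g \<in> d. \<Union>f \<in> c. core_class C M (Cmp C g f), D)),
     Add = (\<lambda>(A, c, B) (A', c', B'). (A, \<Union>f \<in> c. \<Union>f' \<in> c'. core_class C M (Add C f f'), B)),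
     Zer = (\<lambda>A B. (A, core_class C M (Zer C (RQO S A) (RQO S B)), B))\<rparr>"

text \<open>The canonical functor on arrows; it is the identity on objects.\<close>

definition gamma ::
  "('o, 'm) add_cat \<Rightarrow> 'o triple \<Rightarrow> ('o, 'm) choice \<Rightarrow> 'm \<Rightarrow> 'o \<times> 'm set \<times> 'o" where
  "gamma C M S f = (Dom C f, core_class C M (RQM S f), Cod C f)"


section \<open>The Ext groups\<close>

text \<open>For each of the functors: the groups, the action of an arrow \<open>g\<close> in the second variable
  (the first one being fixed), and the action of an arrow \<open>f\<close> in the first variable (the
  second one being fixed).\<close>

definition lExt :: "('o, 'm) add_cat \<Rightarrow> ('o, 'm) choice \<Rightarrow> int \<Rightarrow> 'o \<Rightarrow> 'o \<Rightarrow> 'm set monoid" where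
  "lExt C S n A B = lH C (res S A) B n"

definition lExt_snd ::
  "('o, 'm) add_cat \<Rightarrow> ('o, 'm) choice \<Rightarrow> int \<Rightarrow> 'o \<Rightarrow> 'm \<Rightarrow> 'm set \<Rightarrow> 'm set" where
  "lExt_snd C S n A g = lH_map C (res S A) (Cod C g) n (\<lambda>h. Cmp C g h)"

definition lExt_fst ::
  "('o, 'm) add_cat \<Rightarrow> ('o, 'm) choice \<Rightarrow> int \<Rightarrow> 'm \<Rightarrow> 'o \<Rightarrow> 'm set \<Rightarrow> 'm set" where
  "lExt_fst C S n f B = lH_map C (res S (Dom C f)) B n (\<lambda>h. Cmp C h (res_lift S f n))"

definition rExt :: "('o, 'm) add_cat \<Rightarrow> ('o, 'm) choice \<Rightarrow> int \<Rightarrow> 'o \<Rightarrow> 'o \<Rightarrow> 'm set monoid" where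
  "rExt C S n A B = rH C A (cores S B) n"

definition rExt_snd ::
  "('o, 'm) add_cat \<Rightarrow> ('o, 'm) choice \<Rightarrow> int \<Rightarrow> 'o \<Rightarrow> 'm \<Rightarrow> 'm set \<Rightarrow> 'm set" where
  "rExt_snd C S n A g = rH_map C A (cores S (Cod C g)) n (\<lambda>h. Cmp C (cores_lift S g (-n - 1)) h)"

definition rExt_fst ::
  "('o, 'm) add_cat \<Rightarrow> ('o, 'm) choice \<Rightarrow> int \<Rightarrow> 'm \<Rightarrow> 'o \<Rightarrow> 'm set \<Rightarrow> 'm set" where
  "rExt_fst C S n f B = rH_map C (Dom C f) (cores S B) n (\<lambda>h. Cmp C h f)"

text \<open>The common value of \<open>lExt\<close> and \<open>rExt\<close> on bifibrant objects is represented by \<open>lExt\<close>.\<close>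

definition Ext_Ho :: "('o, 'm) add_cat \<Rightarrow> ('o, 'm) choice \<Rightarrow> int \<Rightarrow> 'o \<Rightarrow> 'o \<Rightarrow> 'm set monoid" where
  "Ext_Ho C S n A B = lExt C S n (RQO S A) (RQO S B)"

definition Ext_Ho_snd ::
  "('o, 'm) add_cat \<Rightarrow> ('o, 'm) choice \<Rightarrow> int \<Rightarrow> 'o \<Rightarrow> 'm \<Rightarrow> 'm set \<Rightarrow> 'm set" where
  "Ext_Ho_snd C S n A g = lExt_snd C S n (RQO S A) (RQM S g)"

definition Ext_Ho_fst ::
  "('o, 'm) add_cat \<Rightarrow> ('o, 'm) choice \<Rightarrow> int \<Rightarrow> 'm \<Rightarrow> 'o \<Rightarrow> 'm set \<Rightarrow> 'm set" where
  "Ext_Ho_fst C S n f B = lExt_fst C S n (RQM S f) (RQO S B)"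


section \<open>Functors to abelian groups\<close>

text \<open>Contravariant functors on \<open>D\<close> are functors on \<open>op_cat D\<close>. Equality of group homomorphisms is
  equality on the carrier.\<close>

definition ab_functor ::
  "('o, 'm) add_cat \<Rightarrow> ('o \<Rightarrow> 'g monoid) \<Rightarrow> ('m \<Rightarrow> 'g \<Rightarrow> 'g) \<Rightarrow> bool" where
  "ab_functor D F Fm \<longleftrightarrow>
     (\<forall>A \<in> Ob D. comm_group (F A)) \<and>
     (\<forall>A B. \<forall>f \<in> Hom D A B. Fm f \<in> hom (F A) (F B)) \<and>
     (\<forall>A \<in> Ob D. \<forall>x \<in> carrier (F A). Fm (Idn D A) x = x) \<and>
     (\<forall>A B E. \<forall>f \<in> Hom D A B. \<forall>g \<in> Hom D B E. \<forall>x \<in> carrier (F A).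
        Fm (Cmp D g f) x = Fm g (Fm f x))"

definition additive_ab_functor ::
  "('o, 'm) add_cat \<Rightarrow> ('o \<Rightarrow> 'g monoid) \<Rightarrow> ('m \<Rightarrow> 'g \<Rightarrow> 'g) \<Rightarrow> bool" where
  "additive_ab_functor D F Fm \<longleftrightarrow> ab_functor D F Fm \<and>
     (\<forall>A B. \<forall>f \<in> Hom D A B. \<forall>g \<in> Hom D A B. \<forall>x \<in> carrier (F A).
        Fm (Add D f g) x = Fm f x \<otimes>\<^bsub>F B\<^esub> Fm g x)"

definition ab_exact ::
  "'a monoid \<Rightarrow> ('a \<Rightarrow> 'b) \<Rightarrow> 'b monoid \<Rightarrow> ('b \<Rightarrow> 'c) \<Rightarrow> 'c monoid \<Rightarrow> bool" where
  "ab_exact G \<phi> H \<psi> K \<longleftrightarrow> \<phi> \<in> hom G H \<and> \<psi> \<in> hom H K \<and> \<phi> ` carrier G = kernel H K \<psi>"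

text \<open>A short exact sequence \<open>0 \<rightarrow> X \<rightarrow> Y \<rightarrow> Z \<rightarrow> 0\<close> in \<open>D\<close> yields a long exact sequence
  \<open>\<dots> \<rightarrow> F n X \<rightarrow> F n Y \<rightarrow> F n Z \<rightarrow> F (n + 1) X \<rightarrow> \<dots>\<close>, infinite in both directions.\<close>

definition long_exact_sequences ::
  "('o, 'm) add_cat \<Rightarrow> (int \<Rightarrow> 'o \<Rightarrow> 'g monoid) \<Rightarrow> (int \<Rightarrow> 'm \<Rightarrow> 'g \<Rightarrow> 'g) \<Rightarrow> bool" where
  "long_exact_sequences D F Fm \<longleftrightarrow> (\<forall>X Y Z f g.
     f \<in> Hom D X Y \<and> g \<in> Hom D Y Z \<and> short_exact D f g \<longrightarrow>
     (\<exists>\<delta> :: int \<Rightarrow> 'g \<Rightarrow> 'g. \<forall>n.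
        ab_exact (F n X) (Fm n f) (F n Y) (Fm n g) (F n Z) \<and>
        ab_exact (F n Y) (Fm n g) (F n Z) (\<delta> n) (F (n + 1) X) \<and>
        ab_exact (F n Z) (\<delta> n) (F (n + 1) X) (Fm (n + 1) f) (F (n + 1) Y)))"

text \<open>\<open>F\<close> on \<open>D\<close> descends along a functor \<open>D \<rightarrow> E\<close> that is the identity on objects and \<open>\<gamma>\<close> on arrows.\<close>

definition descends ::
  "('o, 'm) add_cat \<Rightarrow> ('o, 'k) add_cat \<Rightarrow> ('m \<Rightarrow> 'k) \<Rightarrow>
    ('o \<Rightarrow> 'g monoid) \<Rightarrow> ('m \<Rightarrow> 'g \<Rightarrow> 'g) \<Rightarrow> bool" where
  "descends D E \<gamma> F Fm \<longleftrightarrow> (\<exists>F' :: 'k \<Rightarrow> 'g \<Rightarrow> 'g. ab_functor E F F' \<and>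
     (\<forall>f \<in> Arr D. \<forall>x \<in> carrier (F (Dom D f)). F' (\<gamma> f) x = Fm f x))"

text \<open>Isomorphism, natural in both variables, of two functors that are contravariant in the first
  and covariant in the second variable, given by groups \<open>F A B\<close> and actions \<open>F1 f B\<close>, \<open>F2 A g\<close>.\<close>

definition naturally_isomorphic ::
  "('o, 'm) add_cat \<Rightarrow>
    ('o \<Rightarrow> 'o \<Rightarrow> 'g monoid) \<Rightarrow> ('m \<Rightarrow> 'o \<Rightarrow> 'g \<Rightarrow> 'g) \<Rightarrow> ('o \<Rightarrow> 'm \<Rightarrow> 'g \<Rightarrow> 'g) \<Rightarrow>
    ('o \<Rightarrow> 'o \<Rightarrow> 'h monoid) \<Rightarrow> ('m \<Rightarrow> 'o \<Rightarrow> 'h \<Rightarrow> 'h) \<Rightarrow> ('o \<Rightarrow> 'm \<Rightarrow> 'h \<Rightarrow> 'h) \<Rightarrow> bool" where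
  "naturally_isomorphic C F F1 F2 G G1 G2 \<longleftrightarrow> (\<exists>\<Phi> :: 'o \<Rightarrow> 'o \<Rightarrow> 'g \<Rightarrow> 'h.
     (\<forall>A \<in> Ob C. \<forall>B \<in> Ob C. \<Phi> A B \<in> iso (F A B) (G A B)) \<and>
     (\<forall>A' A. \<forall>f \<in> Hom C A' A. \<forall>B \<in> Ob C. \<forall>x \<in> carrier (F A B).
        \<Phi> A' B (F1 f B x) = G1 f B (\<Phi> A B x)) \<and>
     (\<forall>A \<in> Ob C. \<forall>B B'. \<forall>g \<in> Hom C B B'. \<forall>x \<in> carrier (F A B).
        \<Phi> A B' (F2 A g x) = G2 A g (\<Phi> A B x)))"

end

theory Submission
  imports Defs
begin

text \<open>
  For cofibrant \<open>P\<close> all cokernels in an \<open>M\<close>-resolution \<open>V\<close> of \<open>P\<close> are cofibrant, so \<open>Hom(V, N)\<close> is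
  exact for trivially fibrant \<open>N\<close>; dually \<open>Hom(X, U)\<close> is exact for trivially cofibrant \<open>X\<close> and a
  coresolution \<open>U\<close> of a fibrant object \<open>N\<close>. Hence a cocycle \<open>V\<^sub>n \<rightarrow> N\<close>, and likewise a cocycle \<open>P \<rightarrow> U\<^sup>n\<close>,
  extends to a chain map \<open>V \<rightarrow> U\<close> of degree \<open>-n\<close>, unique up to homotopy. Reading off the two ends of this
  chain map identifies \<open>\<ell>Ext\<close> with \<open>rExt\<close>, compatibly with every choice of lifts; each \<open>\<ell>Ext\<close> or \<open>rExt\<close> is
  functorial on the nose in one variable, so this makes both functorial in both variables.

  Morphisms that factor through the core act as zero on \<open>\<ell>Ext(P, -)\<close>, and epimorphisms with trivially
  fibrant kernel act as isomorphisms. This compares \<open>RQB\<close> with \<open>RB\<close>, and different fibrant replacements of \<open>B\<close>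
  with each other. A short exact sequence has a short exact sequence of fibrant replacements, obtained by
  pushout, and on fibrant objects the long exact sequence is that of a short exact sequence of complexes.
  Everything else follows by passing to the opposite category.
\<close>

section \<open>Opposite categories\<close>

text \<open>The Ext groups of the cotorsion pairs enter only through vanishing, and only in degrees
  1 and 2. Degree 1 becomes the splitting of short exact sequences. Degree 2, where Yoneda
  equivalence is a zigzag of morphisms, yields that cofibrant objects are closed under kernels of
  epimorphisms between them, and dually; this closure is what makes the cokernels in positive
  degrees of a resolution cofibrant. A resolution is unbounded in both directions, so no induction
  can start at an end. A chain map or a homotopy is started in one degree and propagated both ways,
  upwards by lifting against the coresolution and downwards by extending over the resolution; this
  is why exactness is needed in both variables. Homotopy is only ever recorded in a single degree.
  The abelian category is abstract, so elements are replaced by arrows and the choice of a preimage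
  by an epimorphic cover.\<close>

lemma op_cat_simps [simp]:
  "Ob (op_cat C) = Ob C" "Arr (op_cat C) = Arr C" "Dom (op_cat C) = Cod C" "Cod (op_cat C) = Dom C"
  "Idn (op_cat C) = Idn C" "Cmp (op_cat C) g f = Cmp C f g" "Add (op_cat C) = Add C"
  "Zer (op_cat C) A B = Zer C B A"
  by (simp_all add: op_cat_def)

lemma Hom_op [simp]: "Hom (op_cat C) A B = Hom C B A"
  by (auto simp: Hom_def)

lemma hom_group_op [simp]: "hom_group (op_cat C) A B = hom_group C B A"
  by (simp add: hom_group_def)

lemma op_op [simp]: "op_cat (op_cat C) = C"
  by (simp add: op_cat_def)

lemma monic_op [simp]: "monic (op_cat C) m \<longleftrightarrow> epic C m"
  by (simp add: monic_def epic_def)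

lemma epic_op [simp]: "epic (op_cat C) m \<longleftrightarrow> monic C m"
  by (simp add: monic_def epic_def)

lemma is_ker_op [simp]: "is_ker (op_cat C) k f \<longleftrightarrow> is_coker C k f"
  by (auto simp: is_ker_def is_coker_def)

lemma is_coker_op [simp]: "is_coker (op_cat C) k f \<longleftrightarrow> is_ker C k f"
  by (auto simp: is_ker_def is_coker_def)

text \<open>The inverse is taken in the hom-group between the arrow's own ends, so that
  \<open>sub C g f\<close> is literally the difference occurring in
  \<open>core_equiv\<close>.\<close>

definition neg :: "('o, 'm) add_cat \<Rightarrow> 'm \<Rightarrow> 'm" where
  "neg C f = inv\<^bsub>hom_group C (Dom C f) (Cod C f)\<^esub> f"

definition sub :: "('o, 'm) add_cat \<Rightarrow> 'm \<Rightarrow> 'm \<Rightarrow> 'm" where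
  "sub C f g = Add C f (neg C g)"

lemma neg_op [simp]: "neg (op_cat C) f = neg C f"
  by (simp add: neg_def)

lemma sub_op [simp]: "sub (op_cat C) f g = sub C f g"
  by (simp add: sub_def)

lemma category_op:
  assumes "category C" shows "category (op_cat C)"
proof -
  interpret category C by fact
  show ?thesis
  proof
    fix f A B g D h E
    assume "f \<in> Hom (op_cat C) A B" "g \<in> Hom (op_cat C) B D" "h \<in> Hom (op_cat C) D E"
    then show "Cmp (op_cat C) (Cmp (op_cat C) h g) f = Cmp (op_cat C) h (Cmp (op_cat C) g f)"
      using cmp_assoc by simp
  qed (auto simp: dom_cod idn cmp_idn idn_cmp intro: cmp)
qed

lemma preadditive_op:
  assumes "preadditive_category C" shows "preadditive_category (op_cat C)"
proof -
  interpret preadditive_category C by fact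
  interpret op: category "op_cat C" using category_op[OF category_axioms] .
  show ?thesis
    by (intro preadditive_category.intro preadditive_category_axioms.intro op.category_axioms)
      (simp_all add: hom_comm_group cmp_add add_cmp)
qed

lemma abelian_op:
  assumes "abelian_category C" shows "abelian_category (op_cat C)"
proof -
  interpret abelian_category C by fact
  interpret op: preadditive_category "op_cat C" using preadditive_op[OF preadditive_category_axioms] .
  show ?thesis
  proof
    show "\<exists>Z\<in>Ob (op_cat C). \<forall>A\<in>Ob (op_cat C).
            (\<exists>!f. f \<in> Hom (op_cat C) Z A) \<and> (\<exists>!f. f \<in> Hom (op_cat C) A Z)"
      using zero_object by (simp only: op_cat_simps Hom_op conj_commute)
    fix A B assume "A \<in> Ob (op_cat C)" "B \<in> Ob (op_cat C)"
    then obtain P i j p q where "P \<in> Ob C" "i \<in> Hom C A P" "j \<in> Hom C B P" "p \<in> Hom C P A" "q \<in> Hom C P B"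
      "Cmp C p i = Idn C A" "Cmp C q j = Idn C B" "Cmp C q i = Zer C A B" "Cmp C p j = Zer C B A"
      "Add C (Cmp C i p) (Cmp C j q) = Idn C P"
      using biproduct[of A B] by auto
    \<comment> \<open>A biproduct is self-dual: projections become injections and
      conversely.\<close>
    then show "\<exists>P\<in>Ob (op_cat C). \<exists>i j p q. i \<in> Hom (op_cat C) A P \<and> j \<in> Hom (op_cat C) B P \<and>
      p \<in> Hom (op_cat C) P A \<and> q \<in> Hom (op_cat C) P B \<and>
      Cmp (op_cat C) p i = Idn (op_cat C) A \<and> Cmp (op_cat C) q j = Idn (op_cat C) B \<and>
      Cmp (op_cat C) q i = Zer (op_cat C) A B \<and> Cmp (op_cat C) p j = Zer (op_cat C) B A \<and>
      Add (op_cat C) (Cmp (op_cat C) i p) (Cmp (op_cat C) j q) = Idn (op_cat C) P"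
      by (intro bexI[of _ P] exI[of _ p] exI[of _ q] exI[of _ i] exI[of _ j]) auto
  qed (auto simp: has_ker has_coker monic_is_ker epic_is_coker)
qed

section \<open>Preadditive categories\<close>

context category begin

lemma arr_homI: "f \<in> Arr C \<Longrightarrow> f \<in> Hom C (Dom C f) (Cod C f)"
  by (simp add: Hom_def)

lemma hom_arr: "f \<in> Hom C A B \<Longrightarrow> f \<in> Arr C"
  and hom_dom: "f \<in> Hom C A B \<Longrightarrow> Dom C f = A"
  and hom_cod: "f \<in> Hom C A B \<Longrightarrow> Cod C f = B"
  by (simp_all add: Hom_def)

lemma hom_ob: "f \<in> Hom C A B \<Longrightarrow> A \<in> Ob C \<and> B \<in> Ob C"
  using dom_cod by (auto simp: Hom_def)

lemma ob [simp]: "f \<in> Arr C \<Longrightarrow> Dom C f \<in> Ob C" "f \<in> Arr C \<Longrightarrow> Cod C f \<in> Ob C"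
  using dom_cod by auto

lemma idn_arr [simp]: "A \<in> Ob C \<Longrightarrow> Idn C A \<in> Arr C"
  "A \<in> Ob C \<Longrightarrow> Dom C (Idn C A) = A" "A \<in> Ob C \<Longrightarrow> Cod C (Idn C A) = A"
  using idn[of A] by (simp_all add: Hom_def)

lemma cmp_arr [simp]:
  assumes "f \<in> Arr C" "g \<in> Arr C" "Cod C f = Dom C g"
  shows "g \<odot> f \<in> Arr C" "Dom C (g \<odot> f) = Dom C f" "Cod C (g \<odot> f) = Cod C g"
  using cmp[OF arr_homI arr_homI[of g, folded assms(3)], OF assms(1,2)] by (simp_all add: Hom_def)

lemma cmp_idn' [simp]: "f \<in> Arr C \<Longrightarrow> Dom C f = A \<Longrightarrow> f \<odot> Idn C A = f"
  and idn_cmp' [simp]: "f \<in> Arr C \<Longrightarrow> Cod C f = B \<Longrightarrow> Idn C B \<odot> f = f"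
  using cmp_idn[OF arr_homI] idn_cmp[OF arr_homI] by auto

lemma assoc [simp]:
  assumes "f \<in> Arr C" "g \<in> Arr C" "h \<in> Arr C" "Cod C f = Dom C g" "Cod C g = Dom C h"
  shows "(h \<odot> g) \<odot> f = h \<odot> (g \<odot> f)"
  by (rule cmp_assoc[of f "Dom C f" "Cod C f" g "Cod C g" h "Cod C h"]) (simp_all add: Hom_def assms)

text \<open>As a simplification rule, \<open>assoc\<close> brackets composites to the right, which
  hides a known composite \<open>h \<odot> g\<close> inside \<open>h \<odot> (g \<odot> f)\<close>;
  this rule reaches it there.\<close>

lemma reassoc:
  assumes "h \<odot> g = u" "f \<in> Arr C" "g \<in> Arr C" "h \<in> Arr C" "Cod C f = Dom C g" "Cod C g = Dom C h"
  shows "h \<odot> (g \<odot> f) = u \<odot> f"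
  using assoc[OF assms(2-)] assms(1) by simp

end

context preadditive_category begin

section \<open>Arithmetic of arrows\<close>

lemma grp: "A \<in> Ob C \<Longrightarrow> B \<in> Ob C \<Longrightarrow> group (hom_group C A B)"
  using hom_comm_group comm_group.axioms(2) by blast

lemma mon: "A \<in> Ob C \<Longrightarrow> B \<in> Ob C \<Longrightarrow> monoid (hom_group C A B)"
  using grp group.is_monoid by blast

lemma add_hom: "f \<in> Hom C A B \<Longrightarrow> g \<in> Hom C A B \<Longrightarrow> Add C f g \<in> Hom C A B"
  using monoid.m_closed[OF mon, of A B f g] hom_ob by (auto simp: hom_group_def)

lemma zer_hom: "A \<in> Ob C \<Longrightarrow> B \<in> Ob C \<Longrightarrow> Zer C A B \<in> Hom C A B"
  using monoid.one_closed[OF mon, of A B] by (auto simp: hom_group_def)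

lemma neg_hom: assumes "f \<in> Hom C A B" shows "neg C f \<in> Hom C A B"
  using group.inv_closed[OF grp, of A B f] hom_ob[OF assms] assms
  by (simp add: neg_def hom_group_def Hom_def)

lemma sub_hom: "f \<in> Hom C A B \<Longrightarrow> g \<in> Hom C A B \<Longrightarrow> sub C f g \<in> Hom C A B"
  by (simp add: sub_def add_hom neg_hom)

lemma add_arr [simp]:
  assumes "f \<in> Arr C" "g \<in> Arr C" "Dom C f = Dom C g" "Cod C f = Cod C g"
  shows "Add C f g \<in> Arr C" "Dom C (Add C f g) = Dom C g" "Cod C (Add C f g) = Cod C g"
  using add_hom[of f "Dom C g" "Cod C g" g] assms by (auto simp: Hom_def)

lemma zer_arr [simp]:
  assumes "A \<in> Ob C" "B \<in> Ob C"
  shows "Zer C A B \<in> Arr C" "Dom C (Zer C A B) = A" "Cod C (Zer C A B) = B"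
  using zer_hom[OF assms] by (auto simp: Hom_def)

lemma neg_arr [simp]:
  assumes "f \<in> Arr C"
  shows "neg C f \<in> Arr C" "Dom C (neg C f) = Dom C f" "Cod C (neg C f) = Cod C f"
  using neg_hom[OF arr_homI[OF assms]] by (auto simp: Hom_def)

lemma sub_arr [simp]:
  assumes "f \<in> Arr C" "g \<in> Arr C" "Dom C f = Dom C g" "Cod C f = Cod C g"
  shows "sub C f g \<in> Arr C" "Dom C (sub C f g) = Dom C g" "Cod C (sub C f g) = Cod C g"
  using assms by (simp_all add: sub_def)

lemma add_assoc:
  assumes "f \<in> Arr C" "g \<in> Arr C" "h \<in> Arr C" "Dom C f = Dom C g" "Cod C f = Cod C g"
    "Dom C g = Dom C h" "Cod C g = Cod C h"
  shows "Add C (Add C f g) h = Add C f (Add C g h)"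
  using monoid.m_assoc[OF mon, of "Dom C h" "Cod C h" f g h] assms
  by (simp add: hom_group_def Hom_def)

lemma add_comm:
  assumes "f \<in> Arr C" "g \<in> Arr C" "Dom C f = Dom C g" "Cod C f = Cod C g"
  shows "Add C f g = Add C g f"
  using comm_monoid.m_comm[OF comm_group.axioms(1)[OF hom_comm_group], of "Dom C g" "Cod C g" f g] assms
  by (simp add: hom_group_def Hom_def)

lemma add_zer [simp]:
  assumes "f \<in> Arr C" "Dom C f = A" "Cod C f = B"
  shows "Add C f (Zer C A B) = f" "Add C (Zer C A B) f = f"
  using monoid.r_one[OF mon, of A B f] monoid.l_one[OF mon, of A B f] assms
  by (auto simp: hom_group_def Hom_def)

lemma add_neg [simp]:
  assumes "f \<in> Arr C"
  shows "Add C f (neg C f) = Zer C (Dom C f) (Cod C f)" "Add C (neg C f) f = Zer C (Dom C f) (Cod C f)"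
  using group.r_inv[OF grp, of "Dom C f" "Cod C f" f] group.l_inv[OF grp, of "Dom C f" "Cod C f" f] assms
  by (auto simp: hom_group_def Hom_def neg_def)

lemma sub_self [simp]: "f \<in> Arr C \<Longrightarrow> sub C f f = Zer C (Dom C f) (Cod C f)"
  by (simp add: sub_def)

lemma sub_add [simp]:
  assumes "f \<in> Arr C" "g \<in> Arr C" "Dom C f = Dom C g" "Cod C f = Cod C g"
  shows "Add C (sub C f g) g = f" "Add C g (sub C f g) = f" "sub C (Add C f g) g = f" "sub C (Add C g f) g = f"
proof -
  show 1: "Add C (sub C f g) g = f" using assms by (simp add: sub_def add_assoc)
  show "Add C g (sub C f g) = f" using assms by (subst add_comm) (simp_all add: 1)
  show 2: "sub C (Add C f g) g = f" using assms by (simp add: sub_def add_assoc)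
  show "sub C (Add C g f) g = f" using assms by (subst add_comm) (simp_all add: 2)
qed

lemma add_left_cancel:
  assumes "f \<in> Arr C" "g \<in> Arr C" "h \<in> Arr C" "Dom C f = Dom C g" "Cod C f = Cod C g"
    "Dom C h = Dom C g" "Cod C h = Cod C g" "Add C f g = Add C h g"
  shows "f = h"
proof -
  have "sub C (Add C f g) g = sub C (Add C h g) g" using assms(8) by simp
  then show ?thesis using assms(1-7) by simp
qed

lemma sub_zer_iff:
  assumes "f \<in> Arr C" "g \<in> Arr C" "Dom C f = Dom C g" "Cod C f = Cod C g"
    "A = Dom C g" "B = Cod C g"
  shows "sub C f g = Zer C A B \<longleftrightarrow> f = g"
proof
  assume "sub C f g = Zer C A B"
  then have "Add C (sub C f g) g = Add C (Zer C A B) g" by simp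
  then show "f = g" using assms by simp
qed (use assms in simp)

lemma neg_unique:
  assumes "f \<in> Arr C" "g \<in> Arr C" "Dom C f = Dom C g" "Cod C f = Cod C g"
    "Add C f g = Zer C (Dom C g) (Cod C g)"
  shows "f = neg C g"
  by (rule add_left_cancel[of f g]) (use assms in simp_all)

lemma neg_zer [simp]: "A \<in> Ob C \<Longrightarrow> B \<in> Ob C \<Longrightarrow> neg C (Zer C A B) = Zer C A B"
  by (rule neg_unique[symmetric]) simp_all

lemma neg_neg [simp]: "f \<in> Arr C \<Longrightarrow> neg C (neg C f) = f"
  by (rule neg_unique[symmetric]) simp_all

lemma sub_zer [simp]:
  assumes "f \<in> Arr C" "Dom C f = A" "Cod C f = B"
  shows "sub C f (Zer C A B) = f" 
  using assms by (auto simp: sub_def)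

lemma add_left_comm:
  assumes "f \<in> Arr C" "g \<in> Arr C" "h \<in> Arr C" "Dom C f = Dom C g" "Cod C f = Cod C g"
    "Dom C g = Dom C h" "Cod C g = Cod C h"
  shows "Add C f (Add C g h) = Add C g (Add C f h)"
proof -
  have "Add C f (Add C g h) = Add C (Add C f g) h" using assms by (simp add: add_assoc)
  also have "Add C f g = Add C g f" using assms by (intro add_comm) simp_all
  finally show ?thesis using assms by (simp add: add_assoc)
qed

lemma neg_add:
  assumes "f \<in> Arr C" "g \<in> Arr C" "Dom C f = Dom C g" "Cod C f = Cod C g"
  shows "neg C (Add C f g) = Add C (neg C f) (neg C g)"
proof (rule neg_unique[symmetric])
  have "Add C (Add C (neg C f) (neg C g)) (Add C f g) = Add C (neg C g) (Add C (neg C f) (Add C f g))"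
    using assms by (simp add: add_assoc add_left_comm)
  also have "Add C (neg C f) (Add C f g) = g"
    using assms add_assoc[of "neg C f" f g] by simp
  finally show "Add C (Add C (neg C f) (neg C g)) (Add C f g) = Zer C (Dom C (Add C f g)) (Cod C (Add C f g))"
    using assms by simp
qed (use assms in simp_all)

lemma cmp_add' [simp]:
  assumes "f \<in> Arr C" "f' \<in> Arr C" "g \<in> Arr C" "Dom C f = Dom C f'" "Cod C f = Cod C f'" "Cod C f' = Dom C g"
  shows "g \<odot> Add C f f' = Add C (g \<odot> f) (g \<odot> f')"
  by (rule cmp_add[of f "Dom C f'" "Dom C g" _ _ "Cod C g"]) (simp_all add: Hom_def assms)

lemma add_cmp' [simp]:
  assumes "f \<in> Arr C" "g' \<in> Arr C" "g \<in> Arr C" "Dom C g = Dom C g'" "Cod C g = Cod C g'" "Cod C f = Dom C g'"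
  shows "Add C g g' \<odot> f = Add C (g \<odot> f) (g' \<odot> f)"
  by (rule add_cmp[of f "Dom C f" "Dom C g'" _ "Cod C g'"]) (simp_all add: Hom_def assms)

text \<open>By distributivity the composite \<open>z\<close> satisfies \<open>Add C z z = z\<close>,
  and cancellation leaves zero.\<close>

lemma cmp_zer [simp]:
  assumes "g \<in> Arr C" "A \<in> Ob C" "B = Dom C g"
  shows "g \<odot> Zer C A B = Zer C A (Cod C g)"
proof -
  let ?z = "g \<odot> Zer C A B"
  have "Add C ?z ?z = g \<odot> Add C (Zer C A B) (Zer C A B)"
    by (rule cmp_add'[symmetric]) (use assms in simp_all)
  then have "Add C ?z ?z = ?z" using assms by simp
  then have "Add C ?z ?z = Add C (Zer C A (Cod C g)) ?z" using assms by simp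
  then show ?thesis using assms by - (rule add_left_cancel[of _ ?z], simp_all)
qed

lemma zer_cmp [simp]:
  assumes "g \<in> Arr C" "B \<in> Ob C" "A = Cod C g"
  shows "Zer C A B \<odot> g = Zer C (Dom C g) B"
proof -
  let ?z = "Zer C A B \<odot> g"
  have "Add C ?z ?z = Add C (Zer C A B) (Zer C A B) \<odot> g"
    by (rule add_cmp'[symmetric]) (use assms in simp_all)
  then have "Add C ?z ?z = ?z" using assms by simp
  then have "Add C ?z ?z = Add C (Zer C (Dom C g) B) ?z" using assms by simp
  then show ?thesis using assms by - (rule add_left_cancel[of _ ?z], simp_all)
qed

lemma cmp_neg [simp]:
  assumes "g \<in> Arr C" "f \<in> Arr C" "Cod C f = Dom C g"
  shows "g \<odot> neg C f = neg C (g \<odot> f)"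
proof (rule neg_unique)
  have "Add C (g \<odot> neg C f) (g \<odot> f) = g \<odot> Add C (neg C f) f"
    by (rule cmp_add'[symmetric]) (use assms in simp_all)
  then show "Add C (g \<odot> neg C f) (g \<odot> f) = Zer C (Dom C (g \<odot> f)) (Cod C (g \<odot> f))"
    using assms by simp
qed (use assms in simp_all)

lemma neg_cmp [simp]:
  assumes "g \<in> Arr C" "f \<in> Arr C" "Cod C f = Dom C g"
  shows "neg C g \<odot> f = neg C (g \<odot> f)"
proof (rule neg_unique)
  have "Add C (neg C g \<odot> f) (g \<odot> f) = Add C (neg C g) g \<odot> f"
    by (rule add_cmp'[symmetric]) (use assms in simp_all)
  then show "Add C (neg C g \<odot> f) (g \<odot> f) = Zer C (Dom C (g \<odot> f)) (Cod C (g \<odot> f))"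
    using assms by simp
qed (use assms in simp_all)

lemma cmp_sub [simp]:
  assumes "f \<in> Arr C" "f' \<in> Arr C" "g \<in> Arr C" "Dom C f = Dom C f'" "Cod C f = Cod C f'" "Cod C f' = Dom C g"
  shows "g \<odot> sub C f f' = sub C (g \<odot> f) (g \<odot> f')"
  using assms by (simp add: sub_def)

lemma sub_cmp [simp]:
  assumes "f \<in> Arr C" "g' \<in> Arr C" "g \<in> Arr C" "Dom C g = Dom C g'" "Cod C g = Cod C g'" "Cod C f = Dom C g'"
  shows "sub C g g' \<odot> f = sub C (g \<odot> f) (g' \<odot> f)"
  using assms by (simp add: sub_def)

section \<open>Monomorphisms, epimorphisms, kernels and cokernels, tested on zero composites\<close>

lemma monicI:
  assumes "m \<in> Arr C"
    "\<And>x A. x \<in> Arr C \<Longrightarrow> Dom C x = A \<Longrightarrow> Cod C x = Dom C m \<Longrightarrow> m \<odot> x = Zer C A (Cod C m) \<Longrightarrow>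
       x = Zer C A (Dom C m)"
  shows "monic C m"
  unfolding monic_def
proof (intro conjI allI ballI impI assms(1))
  fix X g h assume *: "g \<in> Hom C X (Dom C m)" "h \<in> Hom C X (Dom C m)" "m \<odot> g = m \<odot> h"
  then have gh: "g \<in> Arr C" "h \<in> Arr C" "Dom C g = Dom C h" "Cod C g = Cod C h" "Dom C h = X" "Cod C h = Dom C m"
    by (auto simp: Hom_def)
  then have "sub C g h = Zer C X (Dom C m)"
    by - (rule assms(2), use assms(1) *(3) gh in simp_all)
  then show "g = h" using gh by (subst (asm) sub_zer_iff) simp_all
qed

lemma monicD:
  assumes "monic C m" "g \<in> Arr C" "h \<in> Arr C" "Dom C g = Dom C h" "Cod C g = Dom C m" "Cod C h = Dom C m"
    "m \<odot> g = m \<odot> h"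
  shows "g = h"
  using assms unfolding monic_def Hom_def by auto

lemma monic_zer:
  assumes "monic C m" "g \<in> Arr C" "Dom C g = A" "Cod C g = Dom C m" "m \<odot> g = Zer C A (Cod C m)" "Dom C m = B"
  shows "g = Zer C A B"
  by (rule monicD[OF assms(1)]) (use assms in \<open>auto simp: monic_def\<close>)

lemma epicD:
  assumes "epic C e" "g \<in> Arr C" "h \<in> Arr C" "Cod C g = Cod C h" "Dom C g = Cod C e" "Dom C h = Cod C e"
    "g \<odot> e = h \<odot> e"
  shows "g = h"
  using assms unfolding epic_def Hom_def by auto

end

lemma (in category) monic_arr: "monic C m \<Longrightarrow> m \<in> Arr C" by (simp add: monic_def)
lemma (in category) epic_arr: "epic C m \<Longrightarrow> m \<in> Arr C" by (simp add: epic_def)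

context preadditive_category begin

lemma epicI:
  assumes "m \<in> Arr C"
    "\<And>x A. x \<in> Arr C \<Longrightarrow> Cod C x = A \<Longrightarrow> Dom C x = Cod C m \<Longrightarrow> x \<odot> m = Zer C (Dom C m) A \<Longrightarrow>
       x = Zer C (Cod C m) A"
  shows "epic C m"
proof -
  interpret op: preadditive_category "op_cat C" using preadditive_op[OF preadditive_category_axioms] .
  show ?thesis by (rule op.monicI[of m, simplified]) (use assms in simp_all)
qed

lemma epic_zer:
  assumes "epic C m" "g \<in> Arr C" "Cod C g = A" "Dom C g = Cod C m" "g \<odot> m = Zer C (Dom C m) A" "Cod C m = B"
  shows "g = Zer C B A"
proof -
  interpret op: preadditive_category "op_cat C" using preadditive_op[OF preadditive_category_axioms] .
  show ?thesis by (rule op.monic_zer[of m g A B, simplified]) (use assms in simp_all)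
qed

lemma monic_cmp:
  assumes "monic C f" "monic C g" "Cod C f = Dom C g" shows "monic C (g \<odot> f)"
proof (rule monicI)
  have a: "f \<in> Arr C" "g \<in> Arr C" using assms monic_arr by auto
  show "g \<odot> f \<in> Arr C" using a assms by simp
  fix x A assume x: "x \<in> Arr C" "Dom C x = A" "Cod C x = Dom C (g \<odot> f)" "(g \<odot> f) \<odot> x = Zer C A (Cod C (g \<odot> f))"
  have "f \<odot> x = Zer C A (Cod C f)" by (rule monic_zer[OF assms(2)]) (use x a assms in simp_all)
  then show "x = Zer C A (Dom C (g \<odot> f))" by - (rule monic_zer[OF assms(1)], use a assms x in simp_all)
qed

lemma epic_cmp:
  assumes "epic C f" "epic C g" "Cod C f = Dom C g" shows "epic C (g \<odot> f)"
proof -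
  interpret op: preadditive_category "op_cat C" using preadditive_op[OF preadditive_category_axioms] .
  show ?thesis by (rule op.monic_cmp[of g f, simplified]) (use assms in simp_all)
qed

lemma epic_cancel:
  assumes "epic C (g \<odot> f)" "f \<in> Arr C" "g \<in> Arr C" "Cod C f = Dom C g" shows "epic C g"
proof (rule epicI)
  fix x A assume x: "x \<in> Arr C" "Cod C x = A" "Dom C x = Cod C g" "x \<odot> g = Zer C (Dom C g) A"
  then have "x \<odot> (g \<odot> f) = Zer C (Dom C f) A" using reassoc[OF x(4), of f] assms by auto
  then show "x = Zer C (Cod C g) A" by - (rule epic_zer[OF assms(1)], use assms x in simp_all)
qed (use assms in simp)

lemma monic_cancel:
  assumes "monic C (g \<odot> f)" "f \<in> Arr C" "g \<in> Arr C" "Cod C f = Dom C g" shows "monic C f"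
proof -
  interpret op: preadditive_category "op_cat C" using preadditive_op[OF preadditive_category_axioms] .
  show ?thesis by (rule op.epic_cancel[of f g, simplified]) (use assms in simp_all)
qed

lemma epic_idn: "A \<in> Ob C \<Longrightarrow> epic C (Idn C A)"
  by (auto simp: epic_def Hom_def)

lemma monic_idn: "A \<in> Ob C \<Longrightarrow> monic C (Idn C A)"
  by (auto simp: monic_def Hom_def)

lemma is_kerD:
  assumes "is_ker C k f"
  shows "k \<in> Arr C" "f \<in> Arr C" "Cod C k = Dom C f" "f \<odot> k = Zer C (Dom C k) (Cod C f)"
  using assms by (auto simp: is_ker_def)

lemma ker_lift:
  assumes "is_ker C k f" "t \<in> Arr C" "Cod C t = Dom C f" "f \<odot> t = Zer C (Dom C t) (Cod C f)"
  obtains h where "h \<in> Arr C" "Dom C h = Dom C t" "Cod C h = Dom C k" "k \<odot> h = t"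
  using assms unfolding is_ker_def Hom_def by blast

text \<open>Uniqueness of the factorization of the zero arrow is all that \<open>monicI\<close> asks
  for.\<close>

lemma ker_monic: assumes "is_ker C k f" shows "monic C k"
proof (rule monicI)
  note k = is_kerD[OF assms]
  show "k \<in> Arr C" by fact
  fix x A assume x: "x \<in> Arr C" "Dom C x = A" "Cod C x = Dom C k" "k \<odot> x = Zer C A (Cod C k)"
  have "\<exists>!h. h \<in> Hom C A (Dom C k) \<and> k \<odot> h = Zer C A (Cod C k)"
  proof -
    have "Zer C A (Cod C k) \<in> Hom C A (Dom C f)" using x k by (auto simp: Hom_def)
    moreover have "f \<odot> Zer C A (Cod C k) = Zer C A (Cod C f)" using x k by auto
    ultimately show ?thesis using assms unfolding is_ker_def by blast
  qed
  moreover have "x \<in> Hom C A (Dom C k)" "Zer C A (Dom C k) \<in> Hom C A (Dom C k)"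
     "k \<odot> Zer C A (Dom C k) = Zer C A (Cod C k)" using x k by (auto simp: Hom_def)
  ultimately show "x = Zer C A (Dom C k)" using x by blast
qed

lemma is_kerI:
  assumes "monic C k" "f \<in> Arr C" "Cod C k = Dom C f" "f \<odot> k = Zer C (Dom C k) (Cod C f)"
    "\<And>t. t \<in> Arr C \<Longrightarrow> Cod C t = Dom C f \<Longrightarrow> f \<odot> t = Zer C (Dom C t) (Cod C f) \<Longrightarrow>
       \<exists>h. h \<in> Arr C \<and> Dom C h = Dom C t \<and> Cod C h = Dom C k \<and> k \<odot> h = t"
  shows "is_ker C k f"
  unfolding is_ker_def
proof (intro conjI allI ballI impI)
  fix X g assume g: "g \<in> Hom C X (Dom C f)" "f \<odot> g = Zer C X (Cod C f)"
  then obtain h where h: "h \<in> Arr C" "Dom C h = X" "Cod C h = Dom C k" "k \<odot> h = g"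
    using assms(5)[of g] by (auto simp: Hom_def)
  show "\<exists>!h. h \<in> Hom C X (Dom C k) \<and> k \<odot> h = g"
  proof (rule ex1I[of _ h])
    show "h \<in> Hom C X (Dom C k) \<and> k \<odot> h = g" using h by (simp add: Hom_def)
    fix h' assume "h' \<in> Hom C X (Dom C k) \<and> k \<odot> h' = g"
    then show "h' = h" using h by - (rule monicD[OF assms(1)], auto simp: Hom_def)
  qed
qed (use assms in \<open>auto simp: monic_def\<close>)

lemma is_cokerD:
  assumes "is_coker C k f"
  shows "k \<in> Arr C" "f \<in> Arr C" "Dom C k = Cod C f" "k \<odot> f = Zer C (Dom C f) (Cod C k)"
  using assms by (auto simp: is_coker_def)

lemma coker_desc:
  assumes "is_coker C k f" "t \<in> Arr C" "Dom C t = Cod C f" "t \<odot> f = Zer C (Dom C f) (Cod C t)"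
  obtains h where "h \<in> Arr C" "Dom C h = Cod C k" "Cod C h = Cod C t" "h \<odot> k = t"
  using assms unfolding is_coker_def Hom_def by blast

lemma coker_epic: assumes "is_coker C k f" shows "epic C k"
proof -
  interpret op: preadditive_category "op_cat C" using preadditive_op[OF preadditive_category_axioms] .
  show ?thesis by (rule op.ker_monic[of k f, simplified]) (use assms in simp_all)
qed

lemma is_cokerI:
  assumes "epic C k" "f \<in> Arr C" "Dom C k = Cod C f" "k \<odot> f = Zer C (Dom C f) (Cod C k)"
    "\<And>t. t \<in> Arr C \<Longrightarrow> Dom C t = Cod C f \<Longrightarrow> t \<odot> f = Zer C (Dom C f) (Cod C t) \<Longrightarrow>
       \<exists>h. h \<in> Arr C \<and> Dom C h = Cod C k \<and> Cod C h = Cod C t \<and> h \<odot> k = t"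
  shows "is_coker C k f"
proof -
  interpret op: preadditive_category "op_cat C" using preadditive_op[OF preadditive_category_axioms] .
  have "is_ker (op_cat C) k f"
    by (rule op.is_kerI) (use assms in auto)
  then show ?thesis by simp
qed

end

section \<open>Abelian categories\<close>

definition is_pullback :: "('o, 'm) add_cat \<Rightarrow> 'm \<Rightarrow> 'm \<Rightarrow> 'm \<Rightarrow> 'm \<Rightarrow> bool" where
  "is_pullback C p q f g \<longleftrightarrow> p \<in> Arr C \<and> q \<in> Arr C \<and> f \<in> Arr C \<and> g \<in> Arr C \<and>
     Dom C p = Dom C q \<and> Cod C p = Dom C f \<and> Cod C q = Dom C g \<and> Cod C f = Cod C g \<and>
     Cmp C f p = Cmp C g q \<and>
     (\<forall>u v. u \<in> Arr C \<longrightarrow> v \<in> Arr C \<longrightarrow> Dom C u = Dom C v \<longrightarrow> Cod C u = Dom C f \<longrightarrow> Cod C v = Dom C g \<longrightarrow>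
        Cmp C f u = Cmp C g v \<longrightarrow>
        (\<exists>!h. h \<in> Hom C (Dom C u) (Dom C p) \<and> Cmp C p h = u \<and> Cmp C q h = v))"

text \<open>Objects are read off the arrows: \<open>i\<close>, \<open>j\<close> are the injections,
  \<open>p\<close>, \<open>q\<close> the projections, the summands are \<open>Dom C i\<close> and
  \<open>Dom C j\<close>, and the sum is \<open>Dom C q\<close>.\<close>

definition is_biprod :: "('o, 'm) add_cat \<Rightarrow> 'm \<Rightarrow> 'm \<Rightarrow> 'm \<Rightarrow> 'm \<Rightarrow> bool" where
  "is_biprod C i j p q \<longleftrightarrow> i \<in> Arr C \<and> j \<in> Arr C \<and> p \<in> Arr C \<and> q \<in> Arr C \<and>
     Cod C p = Dom C i \<and> Cod C q = Dom C j \<and> Cod C i = Dom C q \<and> Cod C j = Dom C q \<and> Dom C p = Dom C q \<and>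
     Cmp C p i = Idn C (Dom C i) \<and> Cmp C q j = Idn C (Dom C j) \<and>
     Cmp C q i = Zer C (Dom C i) (Dom C j) \<and> Cmp C p j = Zer C (Dom C j) (Dom C i) \<and>
     Add C (Cmp C i p) (Cmp C j q) = Idn C (Dom C q)"

lemma is_biprodD:
  assumes "is_biprod C i j p q"
  shows "i \<in> Arr C" "j \<in> Arr C" "p \<in> Arr C" "q \<in> Arr C"
    "Cod C p = Dom C i" "Cod C q = Dom C j" "Cod C i = Dom C q" "Cod C j = Dom C q" "Dom C p = Dom C q"
    "Cmp C p i = Idn C (Dom C i)" "Cmp C q j = Idn C (Dom C j)"
    "Cmp C q i = Zer C (Dom C i) (Dom C j)" "Cmp C p j = Zer C (Dom C j) (Dom C i)"
    "Add C (Cmp C i p) (Cmp C j q) = Idn C (Dom C q)"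
  using assms unfolding is_biprod_def by blast+

lemma is_pullbackD:
  assumes "is_pullback C p q f g"
  shows "p \<in> Arr C" "q \<in> Arr C" "f \<in> Arr C" "g \<in> Arr C"
    "Dom C p = Dom C q" "Cod C p = Dom C f" "Cod C q = Dom C g" "Cod C f = Cod C g"
    "Cmp C f p = Cmp C g q"
  using assms unfolding is_pullback_def by blast+

lemma is_pullback_sym: assumes pb: "is_pullback C p q f g" shows "is_pullback C q p g f"
  unfolding is_pullback_def
proof (intro conjI allI impI)
  note P = is_pullbackD[OF pb]
  fix u v assume "u \<in> Arr C" "v \<in> Arr C" "Dom C u = Dom C v" "Cod C u = Dom C g" "Cod C v = Dom C f"
    "Cmp C g u = Cmp C f v"
  then have "\<exists>!h. h \<in> Hom C (Dom C v) (Dom C p) \<and> Cmp C p h = v \<and> Cmp C q h = u"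
    and d: "Dom C v = Dom C u" "Dom C p = Dom C q"
    using pb[unfolded is_pullback_def] by metis+
  then show "\<exists>!h. h \<in> Hom C (Dom C u) (Dom C q) \<and> Cmp C q h = u \<and> Cmp C p h = v"
    by (simp only: conj_ac)
qed (use is_pullbackD[OF pb] in simp_all)

lemma pullback_lift:
  assumes "is_pullback C p q f g" "u \<in> Arr C" "v \<in> Arr C" "Dom C u = Dom C v" "Cod C u = Dom C f"
    "Cod C v = Dom C g" "Cmp C f u = Cmp C g v"
  obtains h where "h \<in> Arr C" "Dom C h = Dom C v" "Cod C h = Dom C q" "Cmp C p h = u" "Cmp C q h = v"
proof -
  have "\<exists>h. h \<in> Hom C (Dom C u) (Dom C p) \<and> Cmp C p h = u \<and> Cmp C q h = v"
    using assms unfolding is_pullback_def by blast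
  then show thesis using that is_pullbackD[OF assms(1)] assms(4) by (auto simp: Hom_def)
qed

text \<open>The form in which vanishing of Ext in degree 1 is used; the condition is put on the
  epimorphism of a short exact sequence.\<close>

definition splits :: "('o, 'm) add_cat \<Rightarrow> 'm \<Rightarrow> bool" where
  "splits C p \<longleftrightarrow> (\<exists>s \<in> Arr C. Dom C s = Cod C p \<and> Cod C s = Dom C p \<and> Cmp C p s = Idn C (Cod C p))"

context preadditive_category begin

lemma cmp_cancel:
  assumes "p \<odot> i = Idn C (Dom C i)" "i \<in> Arr C" "p \<in> Arr C" "Cod C i = Dom C p" "x \<in> Arr C" "Cod C x = Dom C i"
  shows "p \<odot> (i \<odot> x) = x"
proof -
  have "p \<odot> (i \<odot> x) = (p \<odot> i) \<odot> x" by (rule assoc[symmetric]) (use assms in simp_all)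
  then show ?thesis using assms by simp
qed

lemma cmp_dom: "g \<odot> f = h \<Longrightarrow> f \<in> Arr C \<Longrightarrow> g \<in> Arr C \<Longrightarrow> Cod C f = Dom C g \<Longrightarrow> Dom C f = Dom C h"
  and cmp_cod: "g \<odot> f = h \<Longrightarrow> f \<in> Arr C \<Longrightarrow> g \<in> Arr C \<Longrightarrow> Cod C f = Dom C g \<Longrightarrow> Cod C g = Cod C h"
  by auto

lemma zer_cancel:
  assumes "p \<odot> i = Zer C (Dom C i) (Cod C p)" "i \<in> Arr C" "p \<in> Arr C" "Cod C i = Dom C p" "x \<in> Arr C" "Cod C x = Dom C i"
  shows "p \<odot> (i \<odot> x) = Zer C (Dom C x) (Cod C p)"
proof -
  have "p \<odot> (i \<odot> x) = (p \<odot> i) \<odot> x" by (rule assoc[symmetric]) (use assms in simp_all)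
  then show ?thesis using assms by simp
qed

text \<open>Rewrites along a commutative square inside a composite bracketed to the right;
  \<open>cmp_cancel\<close> and \<open>zer_cancel\<close> are the same device for identities and
  zeros.\<close>

lemma assoc_eq:
  assumes "p \<odot> i = p' \<odot> i'" "i \<in> Arr C" "p \<in> Arr C" "Cod C i = Dom C p" "i' \<in> Arr C" "p' \<in> Arr C" "Cod C i' = Dom C p'"
    "x \<in> Arr C" "Cod C x = Dom C i"
  shows "p \<odot> (i \<odot> x) = p' \<odot> (i' \<odot> x)"
proof -
  have d: "Dom C i = Dom C i'" using arg_cong[OF assms(1), of "Dom C"] assms(2-7) by simp
  have "p \<odot> (i \<odot> x) = (p \<odot> i) \<odot> x" by (rule assoc[symmetric]) (use assms in simp_all)
  also have "\<dots> = (p' \<odot> i') \<odot> x" by (simp only: assms(1))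
  also have "\<dots> = p' \<odot> (i' \<odot> x)" by (rule assoc) (use assms d in simp_all)
  finally show ?thesis .
qed

end

lemma (in category) pullback_unique:
  assumes pb: "is_pullback C p q f g" and s: "s \<in> Arr C" "Cod C s = Dom C q"
    and t: "t \<in> Arr C" "Cod C t = Dom C q" "Dom C t = Dom C s" and eq: "p \<odot> s = p \<odot> t" "q \<odot> s = q \<odot> t"
  shows "s = t"
proof -
  note P = is_pullbackD[OF pb]
  have "f \<odot> (p \<odot> s) = (f \<odot> p) \<odot> s" by (rule assoc[symmetric]) (use P s in simp_all)
  also have "\<dots> = (g \<odot> q) \<odot> s" by (simp only: P)
  also have "\<dots> = g \<odot> (q \<odot> s)" by (rule assoc) (use P s in simp_all)
  finally have e: "f \<odot> (p \<odot> s) = g \<odot> (q \<odot> s)" .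
  have d: "p \<odot> s \<in> Arr C" "q \<odot> s \<in> Arr C" "Dom C (p \<odot> s) = Dom C (q \<odot> s)"
    "Cod C (p \<odot> s) = Dom C f" "Cod C (q \<odot> s) = Dom C g" using P s by simp_all
  have "\<exists>!h. h \<in> Hom C (Dom C (p \<odot> s)) (Dom C p) \<and> p \<odot> h = p \<odot> s \<and> q \<odot> h = q \<odot> s"
    using pb d e unfolding is_pullback_def by blast
  moreover have "s \<in> Hom C (Dom C (p \<odot> s)) (Dom C p)" "t \<in> Hom C (Dom C (p \<odot> s)) (Dom C p)"
    using P s t by (simp_all add: Hom_def)
  ultimately show ?thesis using eq by metis
qed

context abelian_category begin

lemma op_abelian: "abelian_category (op_cat C)"
  by (rule abelian_op[OF abelian_category_axioms])

lemma biprod_exists: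
  assumes "A \<in> Ob C" "B \<in> Ob C"
  obtains i j p q where "is_biprod C i j p q" "Dom C i = A" "Dom C j = B"
proof -
  from biproduct[OF assms] obtain P i j p q where
    "i \<in> Hom C A P" "j \<in> Hom C B P" "p \<in> Hom C P A" "q \<in> Hom C P B" "p \<odot> i = Idn C A" "q \<odot> j = Idn C B"
    "q \<odot> i = Zer C A B" "p \<odot> j = Zer C B A" "Add C (i \<odot> p) (j \<odot> q) = Idn C P" by blast
  then have "is_biprod C i j p q" "Dom C i = A" "Dom C j = B" unfolding is_biprod_def Hom_def by auto
  then show thesis using that by blast
qed

text \<open>\<open>m\<close> is a kernel of some \<open>f\<close>, and \<open>f\<close> factors
  through the cokernel \<open>c\<close>; so whatever \<open>c\<close> kills is killed by
  \<open>f\<close> and lifts along \<open>m\<close>.\<close>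

lemma ker_coker:
  assumes "monic C m" "is_coker C c m" shows "is_ker C m c"
proof -
  obtain f where f: "is_ker C m f" using monic_is_ker assms(1) by blast
  note m = is_kerD[OF f] and c = is_cokerD[OF assms(2)]
  obtain f' where f': "f' \<in> Arr C" "Dom C f' = Cod C c" "Cod C f' = Cod C f" "f' \<odot> c = f"
    by (rule coker_desc[OF assms(2), of f]) (use m in auto)
  show ?thesis
  proof (rule is_kerI)
    fix t assume t: "t \<in> Arr C" "Cod C t = Dom C c" "c \<odot> t = Zer C (Dom C t) (Cod C c)"
    have "f \<odot> t = f' \<odot> (c \<odot> t)" using f' t c assoc[of t c f'] by auto
    then have "f \<odot> t = Zer C (Dom C t) (Cod C f)" using f' t c m by simp
    then show "\<exists>h. h \<in> Arr C \<and> Dom C h = Dom C t \<and> Cod C h = Dom C m \<and> m \<odot> h = t"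
      using ker_lift[OF f t(1)] t m c by auto
  qed (use m c assms in auto)
qed

lemma coker_ker:
  assumes "epic C e" "is_ker C k e" shows "is_coker C e k"
proof -
  interpret op: abelian_category "op_cat C" by (rule op_abelian)
  show ?thesis by (rule op.ker_coker[simplified, OF assms])
qed

text \<open>To see that \<open>e\<close> is epic, let \<open>g \<odot> e\<close> vanish and let
  \<open>l\<close> be a kernel of \<open>g\<close>. Then \<open>f\<close> factors through the
  monomorphism \<open>k \<odot> l\<close>, so a cokernel \<open>d\<close> of the latter kills
  \<open>f\<close>, factors through \<open>c\<close> and kills \<open>k\<close>. Hence
  \<open>k\<close> factors through \<open>k \<odot> l\<close>, \<open>l\<close> is a split
  epimorphism, and \<open>g\<close> is zero.\<close>

lemma image_factor:
  assumes "is_coker C c f" "is_ker C k c"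
  obtains e where "epic C e" "Dom C e = Dom C f" "Cod C e = Dom C k" "k \<odot> e = f"
proof -
  note c = is_cokerD[OF assms(1)] and k = is_kerD[OF assms(2)]
  obtain e where e: "e \<in> Arr C" "Dom C e = Dom C f" "Cod C e = Dom C k" "k \<odot> e = f"
    by (rule ker_lift[OF assms(2), of f]) (use c in auto)
  have "epic C e"
  proof (rule epicI)
    fix g A assume g: "g \<in> Arr C" "Cod C g = A" "Dom C g = Cod C e" "g \<odot> e = Zer C (Dom C e) A"
    obtain l where l: "is_ker C l g" using has_ker g by blast
    note l' = is_kerD[OF l]
    obtain e' where e': "e' \<in> Arr C" "Dom C e' = Dom C e" "Cod C e' = Dom C l" "l \<odot> e' = e"
      by (rule ker_lift[OF l, of e]) (use g e in auto)
    have kl: "monic C (k \<odot> l)" by (rule monic_cmp) (use ker_monic[OF assms(2)] ker_monic[OF l] l' g e in auto)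
    obtain d where d: "is_coker C d (k \<odot> l)" using has_coker kl monic_arr by blast
    note d' = is_cokerD[OF d]
    have kl_ker: "is_ker C (k \<odot> l) d" by (rule ker_coker[OF kl d])
    have "f = (k \<odot> l) \<odot> e'" using e e' l' k g by simp
    then have "d \<odot> f = d \<odot> ((k \<odot> l) \<odot> e')" by (rule arg_cong)
    also have "\<dots> = Zer C (Dom C e') (Cod C d)" by (rule zer_cancel) (use d' e e' k l' g in auto)
    finally have "d \<odot> f = Zer C (Dom C f) (Cod C d)" using e' e by simp
    then obtain d1 where d1: "d1 \<in> Arr C" "Dom C d1 = Cod C c" "Cod C d1 = Cod C d" "d1 \<odot> c = d"
      using coker_desc[OF assms(1), of d] d' k c l' g e by auto
    have "d \<odot> k = d1 \<odot> (c \<odot> k)" using d1 c k assoc[of k c d1] by auto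
    then have dk: "d \<odot> k = Zer C (Dom C k) (Cod C d)" using d1 k by simp
    obtain s where s: "s \<in> Arr C" "Dom C s = Dom C k" "Cod C s = Dom C (k \<odot> l)" "(k \<odot> l) \<odot> s = k"
      by (rule ker_lift[OF kl_ker, of k]) (use k dk d' l' g e in auto)
    have "l \<odot> s = Idn C (Dom C k)"
      by (rule monicD[OF ker_monic[OF assms(2)]]) (use s k l' g e in auto)
    then have "g = g \<odot> (l \<odot> s)" using g e by simp
    also have "\<dots> = Zer C (Dom C s) (Cod C g)" by (rule zer_cancel) (use l' s k e g in auto)
    finally show "g = Zer C (Cod C e) A" using s e g by simp
  qed (use e in simp)
  then show thesis using that e by blast
qed

text \<open>The kernel of the difference \<open>s\<close> of the two composites out of the
  biproduct; vanishing of the difference is commutativity of the square.\<close>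

lemma pullback_exists:
  assumes "f \<in> Arr C" "g \<in> Arr C" "Cod C f = Cod C g"
  obtains p q where "is_pullback C p q f g"
proof -
  obtain i j p q where "is_biprod C i j p q" and ij: "Dom C i = Dom C f" "Dom C j = Dom C g"
    by (rule biprod_exists[of "Dom C f" "Dom C g"]) (use assms in simp_all)
  note b = is_biprodD[OF this(1)]
  define s where "s = sub C (f \<odot> p) (g \<odot> q)"
  have s: "s \<in> Arr C" "Dom C s = Dom C q" "Cod C s = Cod C g"
    using assms b(1-9) ij unfolding s_def by simp_all
  obtain k where k: "is_ker C k s" using has_ker s by blast
  note k' = is_kerD[OF k]
  have "is_pullback C (p \<odot> k) (q \<odot> k) f g"
    unfolding is_pullback_def
  proof (intro conjI allI impI)
    have "sub C (f \<odot> (p \<odot> k)) (g \<odot> (q \<odot> k)) = s \<odot> k" unfolding s_def using assms b(1-9) ij k' s by simp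
    also have "\<dots> = Zer C (Dom C k) (Cod C g)" using k' s by simp
    finally show "f \<odot> (p \<odot> k) = g \<odot> (q \<odot> k)"
      by (subst (asm) sub_zer_iff) (use assms b(1-9) ij k' s in simp_all)
    fix u v assume uv: "u \<in> Arr C" "v \<in> Arr C" "Dom C u = Dom C v" "Cod C u = Dom C f" "Cod C v = Dom C g"
      "f \<odot> u = g \<odot> v"
    define w where "w = Add C (i \<odot> u) (j \<odot> v)"
    have w: "w \<in> Arr C" "Dom C w = Dom C v" "Cod C w = Dom C q" using uv b(1-9) ij unfolding w_def by simp_all
    have "p \<odot> (i \<odot> u) = u" "q \<odot> (j \<odot> v) = v"
      by (rule cmp_cancel, use uv b ij in simp_all)+
    moreover have "q \<odot> (i \<odot> u) = Zer C (Dom C v) (Dom C g)" "p \<odot> (j \<odot> v) = Zer C (Dom C v) (Dom C f)"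
      by (subst zer_cancel, use uv b ij in simp_all)+
    ultimately have pw: "p \<odot> w = u" "q \<odot> w = v" unfolding w_def using uv b(1-9) ij by simp_all
    have "s \<odot> w = sub C (f \<odot> (p \<odot> w)) (g \<odot> (q \<odot> w))" unfolding s_def using assms b(1-9) ij w by simp
    also have "\<dots> = Zer C (Dom C w) (Cod C s)" using pw uv assms w s by simp
    finally obtain h where h: "h \<in> Arr C" "Dom C h = Dom C w" "Cod C h = Dom C k" "k \<odot> h = w"
      using ker_lift[OF k, of w] w s by auto
    show "\<exists>!h. h \<in> Hom C (Dom C u) (Dom C (p \<odot> k)) \<and> (p \<odot> k) \<odot> h = u \<and> (q \<odot> k) \<odot> h = v"
    proof (rule ex1I[of _ h])
      show "h \<in> Hom C (Dom C u) (Dom C (p \<odot> k)) \<and> (p \<odot> k) \<odot> h = u \<and> (q \<odot> k) \<odot> h = v"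
        using h w uv pw k' s b(1-9) by (simp add: Hom_def)
      fix h' assume "h' \<in> Hom C (Dom C u) (Dom C (p \<odot> k)) \<and> (p \<odot> k) \<odot> h' = u \<and> (q \<odot> k) \<odot> h' = v"
      then have h': "h' \<in> Arr C" "Dom C h' = Dom C u" "Cod C h' = Dom C k" "p \<odot> (k \<odot> h') = u" "q \<odot> (k \<odot> h') = v"
        using k' s b(1-9) by (auto simp: Hom_def)
      have "k \<odot> h' = Add C (i \<odot> p) (j \<odot> q) \<odot> (k \<odot> h')" using h' k' s b by simp
      also have "\<dots> = Add C (i \<odot> (p \<odot> (k \<odot> h'))) (j \<odot> (q \<odot> (k \<odot> h')))"
        using h'(1-3) k' s b(1-9) by simp
      also have "\<dots> = w" unfolding w_def by (simp only: h')
      finally show "h' = h" by - (rule monicD[OF ker_monic[OF k]], use h h' uv w in simp_all)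
    qed
  qed (use k' s b(1-9) ij assms in simp_all)
  then show thesis using that by blast
qed

text \<open>The pullback is the kernel \<open>k\<close> of the difference \<open>s\<close>, which is
  epic because its restriction to the first summand is \<open>f\<close>; so \<open>s\<close> is a
  cokernel of \<open>k\<close>. If \<open>u \<odot> q\<close> is zero, \<open>u \<odot> y\<close>
  factors as \<open>v \<odot> s\<close>; restricting to the first summand gives
  \<open>v \<odot> f\<close> zero, hence \<open>v\<close> zero, and restricting to the second gives
  \<open>u\<close> zero.\<close>

lemma pullback_epic:
  assumes pb: "is_pullback C p q f g" and "epic C f" shows "epic C q"
proof -
  note P = is_pullbackD[OF pb]
  obtain i j x y where "is_biprod C i j x y" and ij: "Dom C i = Dom C f" "Dom C j = Dom C g"
    by (rule biprod_exists[of "Dom C f" "Dom C g"]) (use P in simp_all)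
  note b = is_biprodD[OF this(1)]
  define s where "s = sub C (f \<odot> x) (g \<odot> y)"
  define k where "k = Add C (i \<odot> p) (j \<odot> q)"
  have s: "s \<in> Arr C" "Dom C s = Dom C y" "Cod C s = Cod C g"
    using P(1-8) b(1-9) ij unfolding s_def by simp_all
  have k: "k \<in> Arr C" "Dom C k = Dom C q" "Cod C k = Dom C y"
    using P(1-8) b(1-9) ij unfolding k_def by simp_all
  have xk: "x \<odot> k = p"
  proof -
    have "x \<odot> (i \<odot> p) = p" by (rule cmp_cancel) (use P b ij in simp_all)
    moreover have "x \<odot> (j \<odot> q) = Zer C (Dom C q) (Dom C f)" by (subst zer_cancel) (use P b ij in simp_all)
    ultimately show ?thesis unfolding k_def using P(1-8) b(1-9) ij by simp
  qed
  have yk: "y \<odot> k = q"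
  proof -
    have "y \<odot> (j \<odot> q) = q" by (rule cmp_cancel) (use P b ij in simp_all)
    moreover have "y \<odot> (i \<odot> p) = Zer C (Dom C q) (Dom C g)" by (subst zer_cancel) (use P b ij in simp_all)
    ultimately show ?thesis unfolding k_def using P(1-8) b(1-9) ij by simp
  qed
  have si: "s \<odot> i = f"
  proof -
    have "s \<odot> i = sub C (f \<odot> (x \<odot> i)) (g \<odot> (y \<odot> i))" unfolding s_def using P(1-8) b(1-9) ij by simp
    also have "\<dots> = f" using P b ij by simp
    finally show ?thesis .
  qed
  have "epic C s" using epic_cancel[of s i] assms(2) si b s by simp
  have "is_ker C k s"
  proof (rule is_kerI)
    show "monic C k"
    proof (rule monicI)
      fix t A assume t: "t \<in> Arr C" "Dom C t = A" "Cod C t = Dom C k" "k \<odot> t = Zer C A (Cod C k)"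
      have A: "A \<in> Ob C" using t by auto
      have "p \<odot> t = x \<odot> (k \<odot> t)" using xk k t b P by (subst assoc[symmetric]) simp_all
      then have pt: "p \<odot> t = Zer C A (Cod C p)" using A t b k P ij by simp
      have "q \<odot> t = y \<odot> (k \<odot> t)" using yk k t b P by (subst assoc[symmetric]) simp_all
      then have qt: "q \<odot> t = Zer C A (Cod C q)" using A t b k P ij by simp
      show "t = Zer C A (Dom C k)"
        by - (rule pullback_unique[OF pb], use pt qt t k P A in simp_all)
    qed (use k in simp)
    have "s \<odot> k = sub C (f \<odot> (x \<odot> k)) (g \<odot> (y \<odot> k))" unfolding s_def using P(1-8) b(1-9) ij k by simp
    then show "s \<odot> k = Zer C (Dom C k) (Cod C s)" using xk yk P k s by simp
    fix t assume t: "t \<in> Arr C" "Cod C t = Dom C s" "s \<odot> t = Zer C (Dom C t) (Cod C s)"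
    have "sub C (f \<odot> (x \<odot> t)) (g \<odot> (y \<odot> t)) = s \<odot> t" unfolding s_def using P(1-8) b(1-9) ij t s by simp
    then have "sub C (f \<odot> (x \<odot> t)) (g \<odot> (y \<odot> t)) = Zer C (Dom C t) (Cod C g)" using t s by simp
    then have fx: "f \<odot> (x \<odot> t) = g \<odot> (y \<odot> t)"
      by (subst (asm) sub_zer_iff) (use P(1-8) b(1-9) ij t s in simp_all)
    obtain h where h: "h \<in> Arr C" "Dom C h = Dom C (y \<odot> t)" "Cod C h = Dom C q" "p \<odot> h = x \<odot> t" "q \<odot> h = y \<odot> t"
      by (rule pullback_lift[OF pb _ _ _ _ _ fx]) (use P(1-8) b(1-9) ij t s in simp_all)
    have "k \<odot> h = Add C (i \<odot> (p \<odot> h)) (j \<odot> (q \<odot> h))" unfolding k_def using P(1-8) b(1-9) ij h(1-3) by simp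
    also have "\<dots> = Add C (i \<odot> x) (j \<odot> y) \<odot> t" using h P(1-8) b(1-9) ij t s by simp
    also have "\<dots> = t" using t s b by simp
    finally show "\<exists>h. h \<in> Arr C \<and> Dom C h = Dom C t \<and> Cod C h = Dom C k \<and> k \<odot> h = t"
      using h k t b s by auto
  qed (use k s in simp_all)
  then have ck: "is_coker C s k" using coker_ker[OF \<open>epic C s\<close>] by blast
  show ?thesis
  proof (rule epicI)
    fix u A assume u: "u \<in> Arr C" "Cod C u = A" "Dom C u = Cod C q" "u \<odot> q = Zer C (Dom C q) A"
    have "(u \<odot> y) \<odot> k = u \<odot> q" using u k b P ij yk by simp
    then have uy: "(u \<odot> y) \<odot> k = Zer C (Dom C k) (Cod C (u \<odot> y))" using u k b P ij by simp
    obtain v where v: "v \<in> Arr C" "Dom C v = Cod C s" "Cod C v = Cod C (u \<odot> y)" "v \<odot> s = u \<odot> y"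
      by (rule coker_desc[OF ck _ _ uy]) (use u k b P ij in simp_all)
    have "v \<odot> f = v \<odot> (s \<odot> i)" by (simp only: si)
    also have "\<dots> = (u \<odot> y) \<odot> i" using assoc_eq[of v s u y i] u v s b P ij by simp
    also have "\<dots> = Zer C (Dom C f) A" using u b P ij by simp
    finally have "v = Zer C (Cod C f) A"
      by - (rule epic_zer[OF assms(2)], use u v b P ij s in simp_all)
    then have "u \<odot> y = Zer C (Cod C f) A \<odot> s" using v by simp
    then have "u \<odot> y = Zer C (Dom C y) A" using s u P ob(2)[OF u(1)] by simp
    then have "(u \<odot> y) \<odot> j = Zer C (Dom C j) A" using u b P ij ob(2)[OF u(1)] by simp
    then show "u = Zer C (Cod C q) A" using u b P ij by simp
  qed (use P in simp)
qed

text \<open>Replaces the choice of a preimage: arrows into \<open>Cod C g\<close> play the role of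
  elements, and \<open>t\<close> has a preimage under \<open>g\<close> after passing to the
  epimorphism \<open>e\<close>, a projection of the pullback.\<close>

lemma cover:
  assumes "epic C g" "t \<in> Arr C" "Cod C t = Cod C g"
  obtains e s where "epic C e" "s \<in> Arr C" "Dom C s = Dom C e" "Cod C e = Dom C t" "Cod C s = Dom C g" "t \<odot> e = g \<odot> s"
proof -
  obtain p q where pb: "is_pullback C p q g t" using pullback_exists[of g t] assms epic_arr by metis
  show thesis using that[of q p] pullback_epic[OF pb assms(1)] is_pullbackD[OF pb] by auto
qed

lemma exact_arr: "exact C f g \<Longrightarrow> f \<in> Arr C" "exact C f g \<Longrightarrow> g \<in> Arr C" "exact C f g \<Longrightarrow> Cod C f = Dom C g"
  by (auto simp: exact_def)

lemma exact_cover: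
  assumes "exact C f g" "t \<in> Arr C" "Cod C t = Dom C g" "g \<odot> t = Zer C (Dom C t) (Cod C g)"
  obtains e s where "epic C e" "s \<in> Arr C" "Dom C s = Dom C e" "Cod C e = Dom C t" "Cod C s = Dom C f" "t \<odot> e = f \<odot> s"
proof -
  obtain c k where ck: "is_coker C c f" "is_ker C k c" "is_ker C k g" using assms(1) by (auto simp: exact_def)
  note k = is_kerD[OF ck(3)]
  obtain e where e: "epic C e" "Dom C e = Dom C f" "Cod C e = Dom C k" "k \<odot> e = f"
    using image_factor[OF ck(1,2)] .
  obtain h where h: "h \<in> Arr C" "Dom C h = Dom C t" "Cod C h = Dom C k" "k \<odot> h = t"
    using ker_lift[OF ck(3) assms(2-4)] .
  obtain d s where d: "epic C d" "s \<in> Arr C" "Dom C s = Dom C d" "Cod C d = Dom C h" "Cod C s = Dom C e" "h \<odot> d = e \<odot> s"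
    using cover[OF e(1) h(1)] h e by auto
  have "t \<odot> d = k \<odot> (h \<odot> d)" using h k d epic_arr[OF d(1)] by auto
  also have "\<dots> = f \<odot> s" using d e k epic_arr[OF e(1)] assoc[of s e k] by auto
  finally show thesis using that[of d s] d h e by auto
qed

lemma exact_zer:
  assumes "exact C f g" shows "g \<odot> f = Zer C (Dom C f) (Cod C g)"
proof -
  obtain c k where ck: "is_coker C c f" "is_ker C k c" "is_ker C k g" using assms(1) by (auto simp: exact_def)
  note k = is_kerD[OF ck(3)]
  obtain e where e: "epic C e" "Dom C e = Dom C f" "Cod C e = Dom C k" "k \<odot> e = f"
    using image_factor[OF ck(1,2)] .
  have "g \<odot> f = g \<odot> (k \<odot> e)" using e by simp
  also have "\<dots> = Zer C (Dom C f) (Cod C g)" by (subst zer_cancel) (use e k epic_arr[OF e(1)] in auto)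
  finally show ?thesis .
qed

text \<open>Exactness by elements: a cycle \<open>t\<close> need only come from \<open>f\<close>
  after an epimorphic cover. The cover cancels once \<open>t\<close> is composed with the cokernel
  \<open>c\<close> of \<open>f\<close>, and then \<open>t\<close> lifts to the kernel of
  \<open>c\<close>.\<close>

lemma exactI:
  assumes "f \<in> Arr C" "g \<in> Arr C" "Cod C f = Dom C g" "g \<odot> f = Zer C (Dom C f) (Cod C g)"
    "\<And>t. t \<in> Arr C \<Longrightarrow> Cod C t = Dom C g \<Longrightarrow> g \<odot> t = Zer C (Dom C t) (Cod C g) \<Longrightarrow>
      \<exists>e s. epic C e \<and> s \<in> Arr C \<and> Dom C s = Dom C e \<and> Cod C e = Dom C t \<and> Cod C s = Dom C f \<and> t \<odot> e = f \<odot> s"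
  shows "exact C f g"
proof -
  obtain c where c: "is_coker C c f" using has_coker assms(1) by blast
  note c' = is_cokerD[OF c]
  obtain k where k: "is_ker C k c" using has_ker c' by blast
  note k' = is_kerD[OF k]
  obtain e where e: "epic C e" "Dom C e = Dom C f" "Cod C e = Dom C k" "k \<odot> e = f"
    using image_factor[OF c k] .
  note e' = epic_arr[OF e(1)]
  have "is_ker C k g"
  proof (rule is_kerI)
    have "(g \<odot> k) \<odot> e = Zer C (Dom C e) (Cod C g)" using e e' k' assms c' by simp
    then show "g \<odot> k = Zer C (Dom C k) (Cod C g)"
      by - (rule epic_zer[OF e(1)], use k' assms c' e in simp_all)
    fix t assume t: "t \<in> Arr C" "Cod C t = Dom C g" "g \<odot> t = Zer C (Dom C t) (Cod C g)"
    then obtain d s where d: "epic C d" "s \<in> Arr C" "Dom C s = Dom C d" "Cod C d = Dom C t" "Cod C s = Dom C f" "t \<odot> d = f \<odot> s"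
      using assms(5) by blast
    have "(c \<odot> t) \<odot> d = c \<odot> (f \<odot> s)" using d t c' assms epic_arr[OF d(1)] by simp
    also have "\<dots> = Zer C (Dom C s) (Cod C c)" by (rule zer_cancel) (use c' d assms in auto)
    finally have "c \<odot> t = Zer C (Dom C t) (Cod C c)"
      by - (rule epic_zer[OF d(1)], use d t c' assms in simp_all)
    then show "\<exists>h. h \<in> Arr C \<and> Dom C h = Dom C t \<and> Cod C h = Dom C k \<and> k \<odot> h = t"
      using ker_lift[OF k t(1)] t c' assms by auto
  qed (use ker_monic[OF k] assms k' c' in auto)
  then show ?thesis unfolding exact_def using assms c k by blast
qed

lemma exact_op1: assumes "exact C f g" shows "exact (op_cat C) g f"
proof -
  obtain c k where ck: "is_coker C c f" "is_ker C k c" "is_ker C k g" using assms(1) by (auto simp: exact_def)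
  then have "is_coker C c k" using coker_ker coker_epic by blast
  then show ?thesis unfolding exact_def using assms ck exact_arr[OF assms] by auto
qed

lemma exact_op [simp]: "exact (op_cat C) g f \<longleftrightarrow> exact C f g"
proof
  interpret op: abelian_category "op_cat C" by (rule op_abelian)
  show "exact C f g" if "exact (op_cat C) g f" using op.exact_op1[OF that] by simp
qed (rule exact_op1)

lemma short_exact_op [simp]: "short_exact (op_cat C) g f \<longleftrightarrow> short_exact C f g"
  unfolding short_exact_def by auto

section \<open>Short exact sequences, their pullbacks and pushouts\<close>

lemma short_exact_iff: "short_exact C i p \<longleftrightarrow> is_ker C i p \<and> is_coker C p i"
proof
  assume se: "short_exact C i p"
  then have m: "monic C i" "exact C i p" "epic C p" by (auto simp: short_exact_def)
  obtain c k where ck: "is_coker C c i" "is_ker C k c" "is_ker C k p" using m(2) by (auto simp: exact_def)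
  note k = is_kerD[OF ck(3)] and c = is_cokerD[OF ck(1)]
  have "is_ker C i c" using ker_coker[OF m(1) ck(1)] .
  have "is_ker C i p"
  proof (rule is_kerI[OF m(1)])
    show "p \<odot> i = Zer C (Dom C i) (Cod C p)" using exact_zer[OF m(2)] .
    fix t assume t: "t \<in> Arr C" "Cod C t = Dom C p" "p \<odot> t = Zer C (Dom C t) (Cod C p)"
    obtain h where h: "h \<in> Arr C" "Dom C h = Dom C t" "Cod C h = Dom C k" "k \<odot> h = t"
      using ker_lift[OF ck(3) t] .
    have "c \<odot> t = c \<odot> (k \<odot> h)" using h by simp
    also have "\<dots> = Zer C (Dom C h) (Cod C c)" by (rule zer_cancel) (use is_kerD[OF ck(2)] h in auto)
    finally have "c \<odot> t = Zer C (Dom C t) (Cod C c)" using h by simp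
    then show "\<exists>h. h \<in> Arr C \<and> Dom C h = Dom C t \<and> Cod C h = Dom C i \<and> i \<odot> h = t"
      using ker_lift[OF \<open>is_ker C i c\<close> t(1)] t exact_arr[OF m(2)] c by auto
  qed (use exact_arr[OF m(2)] in auto)
  then show "is_ker C i p \<and> is_coker C p i" using coker_ker[OF m(3)] by blast
next
  assume ip: "is_ker C i p \<and> is_coker C p i"
  then show "short_exact C i p"
    unfolding short_exact_def exact_def using ker_monic coker_epic is_kerD[of i p] by blast
qed

lemma short_exactD:
  assumes "short_exact C i p"
  shows "i \<in> Arr C" "p \<in> Arr C" "Cod C i = Dom C p" "p \<odot> i = Zer C (Dom C i) (Cod C p)"
    "monic C i" "epic C p" "is_ker C i p" "is_coker C p i"
  using assms short_exact_iff is_kerD[of i p] ker_monic coker_epic by blast+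

lemma short_exactI_ker: "is_ker C i p \<Longrightarrow> epic C p \<Longrightarrow> short_exact C i p"
  using short_exact_iff coker_ker by blast

lemma short_exactI_coker: "is_coker C p i \<Longrightarrow> monic C i \<Longrightarrow> short_exact C i p"
  using short_exact_iff ker_coker by blast

lemma monic_coker_short_exact:
  assumes "monic C i" obtains p where "short_exact C i p"
  using has_coker[OF monic_arr[OF assms]] short_exactI_coker assms by blast

text \<open>Parallel sides of a pullback square have the same kernel: the zero arrow and
  \<open>k\<close> together induce the kernel of \<open>p\<close>.\<close>

lemma pullback_ker:
  assumes pb: "is_pullback C p q f g" and k: "is_ker C k g"
  obtains k' where "is_ker C k' p" "q \<odot> k' = k" "Dom C k' = Dom C k"
proof -
  note P = is_pullbackD[OF pb] and K = is_kerD[OF k]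
  have eq: "f \<odot> Zer C (Dom C k) (Dom C f) = g \<odot> k" using K P by simp
  obtain h where h: "h \<in> Arr C" "Dom C h = Dom C k" "Cod C h = Dom C q" "p \<odot> h = Zer C (Dom C k) (Dom C f)" "q \<odot> h = k"
    by (rule pullback_lift[OF pb _ _ _ _ _ eq]) (use P K in simp_all)
  have "is_ker C h p"
  proof (rule is_kerI)
    show "monic C h" using monic_cancel[of q h] ker_monic[OF k] h P by simp
    fix t assume t: "t \<in> Arr C" "Cod C t = Dom C p" "p \<odot> t = Zer C (Dom C t) (Cod C p)"
    have "g \<odot> (q \<odot> t) = f \<odot> (p \<odot> t)" by (rule assoc_eq) (use P t in simp_all)
    also have "\<dots> = Zer C (Dom C t) (Cod C g)" using t P by simp
    finally have "g \<odot> (q \<odot> t) = Zer C (Dom C (q \<odot> t)) (Cod C g)" using t P by simp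
    then obtain s where s: "s \<in> Arr C" "Dom C s = Dom C t" "Cod C s = Dom C k" "k \<odot> s = q \<odot> t"
      using ker_lift[OF k, of "q \<odot> t"] t P by auto
    have ps: "p \<odot> (h \<odot> s) = p \<odot> t"
      using t P h s K by (subst zer_cancel) simp_all
    have qs: "q \<odot> (h \<odot> s) = q \<odot> t" using reassoc[OF h(5)] h s P by simp
    have "h \<odot> s = t" by (rule pullback_unique[OF pb _ _ _ _ _ ps qs]) (use t h s P in simp_all)
    then show "\<exists>x. x \<in> Arr C \<and> Dom C x = Dom C t \<and> Cod C x = Dom C h \<and> h \<odot> x = t" using h s by auto
  qed (use h P in simp_all)
  then show thesis using that h by blast
qed

lemma pullback_se:
  assumes pb: "is_pullback C p u f g" and se: "short_exact C i g"
  obtains i' where "short_exact C i' p" "u \<odot> i' = i" "Dom C i' = Dom C i"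
proof -
  obtain k' where k': "is_ker C k' p" "u \<odot> k' = i" "Dom C k' = Dom C i"
    using pullback_ker[OF pb short_exactD(7)[OF se]] .
  have "epic C p" using pullback_epic[OF is_pullback_sym[OF pb] short_exactD(6)[OF se]] .
  then show thesis using that k' short_exactI_ker by blast
qed

lemma pull_se:
  assumes "short_exact C i g" "f \<in> Arr C" "Cod C f = Cod C g"
  obtains i' p u where "short_exact C i' p" "is_pullback C p u f g" "u \<odot> i' = i" "Dom C i' = Dom C i" "Cod C p = Dom C f"
proof -
  obtain p u where pb: "is_pullback C p u f g"
    using pullback_exists[of f g] assms short_exactD[OF assms(1)] by metis
  show thesis using pullback_se[OF pb assms(1)] that pb is_pullbackD[OF pb] by metis
qed

lemma push_se:
  assumes "short_exact C g p" "f \<in> Arr C" "Dom C f = Dom C g"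
  obtains i' p' u where "short_exact C i' p'" "is_pullback (op_cat C) i' u f g" "p' \<odot> u = p" "Cod C p' = Cod C p" "Dom C i' = Cod C f"
proof -
  interpret op: abelian_category "op_cat C" by (rule op_abelian)
  show thesis by (rule op.pull_se[simplified, OF assms]) (use that in blast)
qed

text \<open>\<open>u\<close> maps one extension to another over the same quotient, so its kernel is
  that of \<open>p\<close>, sitting inside the subobject, and it is epic because \<open>p\<close>
  is. The lemma is applied to pushout squares.\<close>

lemma corner_se:
  assumes "short_exact C j q" "short_exact C j' q'" "short_exact C i p" "u \<in> Arr C" "Dom C u = Dom C q"
    "u \<odot> j = j' \<odot> p" "q' \<odot> u = q" "Dom C j' = Cod C p" "Dom C j = Dom C p" "Cod C u = Dom C q'"
  shows "short_exact C (j \<odot> i) u"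
proof (rule short_exactI_ker)
  note j = short_exactD[OF assms(1)] and j' = short_exactD[OF assms(2)] and i = short_exactD[OF assms(3)]
  have cq: "Cod C q' = Cod C q" by (rule cmp_cod[OF assms(7)]) (use assms j' in simp_all)
  show "is_ker C (j \<odot> i) u"
  proof (rule is_kerI)
    show "monic C (j \<odot> i)" by (rule monic_cmp) (use i j assms in simp_all)
    have "u \<odot> (j \<odot> i) = j' \<odot> (p \<odot> i)" by (rule assoc_eq) (use i j j' assms in simp_all)
    then show "u \<odot> (j \<odot> i) = Zer C (Dom C (j \<odot> i)) (Cod C u)" using i j j' assms by simp
    fix t assume t: "t \<in> Arr C" "Cod C t = Dom C u" "u \<odot> t = Zer C (Dom C t) (Cod C u)"
    have "q \<odot> t = q' \<odot> (u \<odot> t)" using assms t j' assoc[of t u q'] by auto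
    then have "q \<odot> t = Zer C (Dom C t) (Cod C q)" using t assms j' cq by simp
    then obtain a where a: "a \<in> Arr C" "Dom C a = Dom C t" "Cod C a = Dom C j" "j \<odot> a = t"
      using ker_lift[OF j(7) t(1)] t assms by auto
    have "j' \<odot> (p \<odot> a) = u \<odot> (j \<odot> a)" by (rule assoc_eq[symmetric]) (use i j j' assms a in simp_all)
    also have "\<dots> = Zer C (Dom C t) (Cod C j')" using a t assms j' by simp
    finally have "p \<odot> a = Zer C (Dom C t) (Cod C p)"
      by - (rule monic_zer[OF j'(5)], use i j j' assms a in simp_all)
    then obtain b where b: "b \<in> Arr C" "Dom C b = Dom C a" "Cod C b = Dom C i" "i \<odot> b = a"
      using ker_lift[OF i(7) a(1)] a assms by auto
    then show "\<exists>h. h \<in> Arr C \<and> Dom C h = Dom C t \<and> Cod C h = Dom C (j \<odot> i) \<and> (j \<odot> i) \<odot> h = t"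
      using a i j assms by (intro exI[of _ b]) simp
  qed (use i j assms in simp_all)
  obtain e s where e: "epic C e" "s \<in> Arr C" "Dom C s = Dom C e" "Cod C e = Dom C q'" "Cod C s = Dom C q" "q' \<odot> e = q \<odot> s"
    using cover[OF j(6) j'(2)] cq by auto
  note ea = epic_arr[OF e(1)]
  \<comment> \<open>\<open>s\<close> is a preimage of \<open>e\<close> only modulo
    \<open>j'\<close>. The error \<open>d\<close> is killed by \<open>q'\<close>, so it lies in the
    image of \<open>j'\<close> and, after another cover, in that of \<open>j' \<odot> p\<close>,
    which equals \<open>u \<odot> j\<close>.\<close>
  define d where "d = sub C e (u \<odot> s)"
  have d: "d \<in> Arr C" "Dom C d = Dom C e" "Cod C d = Dom C q'" unfolding d_def using e ea assms j' by simp_all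
  have "q' \<odot> d = sub C (q' \<odot> e) ((q' \<odot> u) \<odot> s)" unfolding d_def using e(2-5) ea assms(4,5,10) j' by simp
  also have "\<dots> = Zer C (Dom C d) (Cod C q')" using e assms d j cq by simp
  finally obtain b where b: "b \<in> Arr C" "Dom C b = Dom C d" "Cod C b = Dom C j'" "j' \<odot> b = d"
    using ker_lift[OF j'(7) d(1)] d j' by auto
  obtain e' a where e': "epic C e'" "a \<in> Arr C" "Dom C a = Dom C e'" "Cod C e' = Dom C b" "Cod C a = Dom C p" "b \<odot> e' = p \<odot> a"
    using cover[OF i(6) b(1)] b assms by auto
  note ea' = epic_arr[OF e'(1)]
  have eq: "Add C d (u \<odot> s) = e" unfolding d_def using e ea assms j' by simp
  have "d \<odot> e' = j' \<odot> (p \<odot> a)" using b e' ea' j' assoc[of e' b j'] by auto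
  also have "\<dots> = u \<odot> (j \<odot> a)" by (rule assoc_eq) (use i j j' assms e' in simp_all)
  finally have de: "d \<odot> e' = u \<odot> (j \<odot> a)" .
  have "e \<odot> e' = Add C d (u \<odot> s) \<odot> e'" by (simp only: eq)
  also have "\<dots> = Add C (d \<odot> e') (u \<odot> (s \<odot> e'))"
    using d e(2-5) ea assms(4,5,9,10) j e'(2-5) ea' b(1-3) i by simp
  also have "\<dots> = u \<odot> Add C (j \<odot> a) (s \<odot> e')"
    unfolding de using d e(2-5) ea assms(4,5,9,10) j e'(2-5) ea' b(1-3) i by simp
  finally have "e \<odot> e' = u \<odot> Add C (j \<odot> a) (s \<odot> e')" .
  moreover have "epic C (e \<odot> e')" by (rule epic_cmp) (use e e' b d in simp_all)
  ultimately show "epic C u"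
    by - (rule epic_cancel[of u "Add C (j \<odot> a) (s \<odot> e')"],
      use d e(2-5) ea assms(4,5,9,10) j e'(2-5) ea' b(1-3) i in simp_all)
qed

text \<open>Let \<open>L\<close> be the middle object of \<open>i\<close>, \<open>q\<close>. In
  elements: an element of \<open>L\<close> killed by \<open>c \<odot> q\<close> has its image under
  \<open>q\<close> in the image of \<open>b\<close>, so it agrees with an element coming from
  \<open>v\<close> modulo the image of \<open>i\<close>, and that image is itself contained in the
  image of \<open>v\<close>.\<close>

lemma two_ext:
  assumes "monic C a" "exact C a b" "exact C b c" "epic C c" "short_exact C i q"
    "v \<in> Arr C" "Dom C v = Dom C b" "Cod C v = Dom C q" "v \<odot> a = i" "q \<odot> v = b"
  shows "short_exact C v (c \<odot> q)"
proof (rule short_exactI_ker)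
  note i = short_exactD[OF assms(5)] and a = exact_arr[OF assms(2)] and b = exact_arr[OF assms(3)]
  have cq: "Cod C q = Cod C b" by (rule cmp_cod[OF assms(10)]) (use assms i in simp_all)
  have di: "Dom C i = Dom C a" by (rule cmp_dom[OF assms(9), symmetric]) (use assms i a b in simp_all)
  show "epic C (c \<odot> q)" by (rule epic_cmp) (use assms i a b cq in simp_all)
  have vm: "monic C v"
  proof (rule monicI)
    fix x A assume x: "x \<in> Arr C" "Dom C x = A" "Cod C x = Dom C v" "v \<odot> x = Zer C A (Cod C v)"
    have "b \<odot> x = q \<odot> (v \<odot> x)" by (rule reassoc[OF assms(10), symmetric]) (use assms i x in simp_all)
    then have "b \<odot> x = q \<odot> Zer C A (Cod C v)" by (simp only: x(4))
    then have bx: "b \<odot> x = Zer C (Dom C x) (Cod C b)"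
      using x(1,2) ob(1)[OF x(1)] i(2) assms(8) cq by simp
    obtain e s where e: "epic C e" "s \<in> Arr C" "Dom C s = Dom C e" "Cod C e = Dom C x" "Cod C s = Dom C a" "x \<odot> e = a \<odot> s"
      by (rule exact_cover[OF assms(2) x(1) _ bx]) (use x assms in auto)
    note ea = epic_arr[OF e(1)]
    have "i \<odot> s = v \<odot> (a \<odot> s)"
      by (rule reassoc[OF assms(9), symmetric]) (use e a assms in simp_all)
    also have "\<dots> = v \<odot> (x \<odot> e)" using e by simp
    also have "\<dots> = (v \<odot> x) \<odot> e" by (rule assoc[symmetric]) (use e ea x assms in simp_all)
    also have "\<dots> = Zer C (Dom C e) (Cod C i)" using x e ea i assms by auto
    finally have "s = Zer C (Dom C e) (Dom C a)"
      by - (rule monic_zer[OF i(5)], use e di in simp_all)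
    then have "x \<odot> e = Zer C (Dom C e) (Dom C v)" using e a ea assms by auto
    then show "x = Zer C A (Dom C v)" by - (rule epic_zer[OF e(1)], use e x in simp_all)
  qed (use assms in simp)
  show "is_ker C v (c \<odot> q)"
  proof (rule is_kerI[OF vm])
    show "(c \<odot> q) \<odot> v = Zer C (Dom C v) (Cod C (c \<odot> q))" 
      using assms i a b cq exact_zer[OF assms(3)] by simp
    fix t assume t: "t \<in> Arr C" "Cod C t = Dom C (c \<odot> q)" "(c \<odot> q) \<odot> t = Zer C (Dom C t) (Cod C (c \<odot> q))"
    have t2: "c \<odot> (q \<odot> t) = Zer C (Dom C (q \<odot> t)) (Cod C c)" using t i a b cq by simp
    obtain e s where e: "epic C e" "s \<in> Arr C" "Dom C s = Dom C e" "Cod C e = Dom C (q \<odot> t)" "Cod C s = Dom C b" "(q \<odot> t) \<odot> e = b \<odot> s"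
      by (rule exact_cover[OF assms(3) _ _ t2]) (use t i a b cq in auto)
    note ea = epic_arr[OF e(1)]
    have t': "Cod C t = Dom C q" "Cod C e = Dom C t" using t e i b cq by simp_all
    define d where "d = sub C (t \<odot> e) (v \<odot> s)"
    have d: "d \<in> Arr C" "Dom C d = Dom C e" "Cod C d = Dom C q" unfolding d_def using e ea assms t t' by simp_all
    have "q \<odot> d = sub C ((q \<odot> t) \<odot> e) ((q \<odot> v) \<odot> s)" unfolding d_def using e(2,3,5) ea assms(6-8) i(2) t(1) t' b(1) by simp
    also have "\<dots> = Zer C (Dom C d) (Cod C q)" unfolding e(6) assms(10) using e(2,3,5) d b(1) cq by simp
    finally obtain y where y: "y \<in> Arr C" "Dom C y = Dom C d" "Cod C y = Dom C i" "i \<odot> y = d"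
      using ker_lift[OF i(7) d(1)] d by auto
    have "t \<odot> e = Add C d (v \<odot> s)" unfolding d_def using e ea assms t t' by simp
    also have "d = v \<odot> (a \<odot> y)"
      unfolding y(4)[symmetric] by (rule reassoc[OF assms(9), symmetric]) (use y a assms di in simp_all)
    finally have te: "t \<odot> e = v \<odot> Add C (a \<odot> y) s" using y a b d di assms(6-8) e(2-5) by simp
    \<comment> \<open>So far only \<open>t \<odot> e\<close> factors through \<open>v\<close>. As
      \<open>v\<close> is the kernel of its cokernel \<open>w\<close>, it is enough that
      \<open>w\<close> kills \<open>t\<close>, and there the epimorphism \<open>e\<close>
      cancels.\<close>
    obtain w where w: "is_coker C w v" using has_coker assms by blast
    note w' = is_cokerD[OF w]
    have "(w \<odot> t) \<odot> e = w \<odot> (v \<odot> Add C (a \<odot> y) s)" using te ea t t' w' assms by simp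
    also have "\<dots> = Zer C (Dom C e) (Cod C w)" by (subst zer_cancel) (use w' y a b d di assms(6-8) e(2-5) in simp_all)
    finally have "w \<odot> t = Zer C (Dom C t) (Cod C w)"
      by - (rule epic_zer[OF e(1)], use w' t t' assms(8) in simp_all)
    then show "\<exists>h. h \<in> Arr C \<and> Dom C h = Dom C t \<and> Cod C h = Dom C v \<and> v \<odot> h = t"
      using ker_lift[OF ker_coker[OF vm w] t(1)] t' w' assms(8) by auto
  qed (use assms i a b cq in simp_all)
qed

section \<open>Split short exact sequences\<close>

lemma splits_retract:
  assumes "short_exact C i p" "splits C p"
  obtains r where "r \<in> Arr C" "Dom C r = Cod C i" "Cod C r = Dom C i" "r \<odot> i = Idn C (Dom C i)"
proof -
  note i = short_exactD[OF assms(1)]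
  obtain s where s: "s \<in> Arr C" "Dom C s = Cod C p" "Cod C s = Dom C p" "p \<odot> s = Idn C (Cod C p)"
    using assms(2) by (auto simp: splits_def)
  define d where "d = sub C (Idn C (Dom C p)) (s \<odot> p)"
  have d: "d \<in> Arr C" "Dom C d = Dom C p" "Cod C d = Dom C p" unfolding d_def using s i by simp_all
  have "p \<odot> d = sub C p ((p \<odot> s) \<odot> p)" unfolding d_def using s(1-3) i by simp
  also have "\<dots> = Zer C (Dom C d) (Cod C p)" using s i d by simp
  finally obtain r where r: "r \<in> Arr C" "Dom C r = Dom C d" "Cod C r = Dom C i" "i \<odot> r = d"
    using ker_lift[OF i(7) d(1)] d by auto
  have "i \<odot> (r \<odot> i) = d \<odot> i" by (rule reassoc[OF r(4)]) (use i d r in simp_all)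
  also have "\<dots> = i \<odot> Idn C (Dom C i)" unfolding d_def using s i by simp
  finally have "r \<odot> i = Idn C (Dom C i)" by - (rule monicD[OF i(5)], use i r d in simp_all)
  then show thesis using that r d i by auto
qed

lemma splits_op [simp]: assumes "short_exact C i p" shows "splits (op_cat C) i \<longleftrightarrow> splits C p"
proof
  show "splits C p \<Longrightarrow> splits (op_cat C) i"
    using splits_retract[OF assms] unfolding splits_def by auto
  interpret op: abelian_category "op_cat C" by (rule op_abelian)
  show "splits (op_cat C) i \<Longrightarrow> splits C p"
    using op.splits_retract[of p i] assms unfolding splits_def by auto
qed

lemma splitsI_retract:
  assumes "short_exact C i p" "r \<in> Arr C" "Dom C r = Cod C i" "Cod C r = Dom C i" "r \<odot> i = Idn C (Dom C i)"
  shows "splits C p"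
  using splits_op[OF assms(1)] assms(2-) unfolding splits_def by auto

lemma biprod_se: assumes "is_biprod C i j p q" shows "short_exact C i q"
proof (rule short_exactI_ker)
  note b = is_biprodD[OF assms]
  show "epic C q" by (rule epic_cancel[of q j]) (use b epic_idn in simp_all)
  show "is_ker C i q"
  proof (rule is_kerI)
    show "monic C i" by (rule monic_cancel[of p i]) (use b monic_idn in simp_all)
    fix t assume t: "t \<in> Arr C" "Cod C t = Dom C q" "q \<odot> t = Zer C (Dom C t) (Cod C q)"
    have "t = Add C (i \<odot> p) (j \<odot> q) \<odot> t" using b t by simp
    also have "\<dots> = i \<odot> (p \<odot> t)" using b(1-9) t by simp
    finally show "\<exists>h. h \<in> Arr C \<and> Dom C h = Dom C t \<and> Cod C h = Dom C i \<and> i \<odot> h = t"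
      using b t by (intro exI[of _ "p \<odot> t"]) simp
  qed (use b in simp_all)
qed

end

section \<open>Vanishing of Ext\<close>

text \<open>Yoneda classes are zigzags of morphisms of extensions, so a property is constant on a
  class as soon as every single morphism preserves and reflects it.\<close>

lemma equivclp_invariant:
  assumes "equivclp r x y" "\<And>x y. r x y \<Longrightarrow> P x \<longleftrightarrow> P y"
  shows "P x \<longleftrightarrow> P y"
  using assms(1) by (induct rule: equivclp_induct) (use assms(2) in blast)+

lemma Ext_vanishes_related:
  assumes "Ext_vanishes C n X Y" "es \<in> yoneda_seq C n X Y" "es' \<in> yoneda_seq C n X Y"
  shows "equivclp (yoneda_mor C n X Y) es es'"
proof -
  obtain z where z: "yoneda_seq C n X Y // yoneda_rel C n X Y = {z}"
    using assms(1) by (auto simp: Ext_vanishes_def yoneda_Ext_def)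
  have "yoneda_rel C n X Y `` {es} = z" "yoneda_rel C n X Y `` {es'} = z"
    using quotientI[OF assms(2), of "yoneda_rel C n X Y"] quotientI[OF assms(3), of "yoneda_rel C n X Y"] z by auto
  moreover have "es' \<in> yoneda_rel C n X Y `` {es'}" using assms(3) by (simp add: yoneda_rel_def)
  ultimately have "es' \<in> yoneda_rel C n X Y `` {es}" by simp
  then show ?thesis by (simp add: yoneda_rel_def)
qed

text \<open>A two-fold extension \<open>0 \<rightarrow> Y \<rightarrow> E\<^sub>2 \<rightarrow> E\<^sub>1 \<rightarrow> X \<rightarrow> 0\<close> with arrows \<open>a\<close>, \<open>b\<close>, \<open>c\<close> is zero in \<open>Ext\<^sup>2\<close> iff there is an
  extension \<open>L\<close> of \<open>E\<^sub>1\<close> by \<open>Y\<close> with \<open>E\<^sub>2 \<subseteq> L\<close>. Equivalently \<open>L\<close> is an extension of \<open>X\<close> by \<open>E\<^sub>2\<close>, which makes the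
  condition self-dual. It is pulled back along morphisms of extensions, hence by duality also pushed
  forward, hence invariant.\<close>

definition lifts_two_ext :: "('o, 'm) add_cat \<Rightarrow> 'm \<Rightarrow> 'm \<Rightarrow> bool" where
  "lifts_two_ext C a b \<longleftrightarrow> (\<exists>q v. short_exact C (Cmp C v a) q \<and> v \<in> Arr C \<and> Dom C v = Dom C b \<and>
     Cod C v = Dom C q \<and> Cmp C q v = b)"

context abelian_category begin

lemma yoneda_seq_1: "[i, p] \<in> yoneda_seq C 1 X Y \<longleftrightarrow> short_exact C i p \<and> Dom C i = Y \<and> Cod C p = X"
  by (auto simp: yoneda_seq_def short_exact_def)

lemma yoneda_seq_2: "[a, b, c] \<in> yoneda_seq C 2 X Y \<longleftrightarrow>
    Dom C a = Y \<and> Cod C c = X \<and> monic C a \<and> exact C a b \<and> exact C b c \<and> epic C c"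
  by (auto simp: yoneda_seq_def less_Suc_eq numeral_2_eq_2)

lemma yoneda_seq_1E:
  assumes "es \<in> yoneda_seq C 1 X Y"
  obtains i p where "es = [i, p]" "short_exact C i p" "Dom C i = Y" "Cod C p = X"
proof -
  obtain i p where "es = [i, p]" using assms
    by (auto simp: yoneda_seq_def length_Suc_conv)
  then show thesis using that assms yoneda_seq_1 by blast
qed

lemma yoneda_seq_2E:
  assumes "es \<in> yoneda_seq C 2 X Y"
  obtains a b c where "es = [a, b, c]" "Dom C a = Y" "Cod C c = X" "monic C a" "exact C a b" "exact C b c" "epic C c"
proof -
  obtain a b c where "es = [a, b, c]" using assms
    by (auto simp: yoneda_seq_def length_Suc_conv numeral_2_eq_2)
  then show thesis using that assms yoneda_seq_2 by blast
qed

text \<open>A section of the source composes with the middle component to a section of the target; a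
  retraction of the target composes with it to a retraction of the source.\<close>

lemma splits_invariant:
  assumes "yoneda_mor C 1 X Y es es'" shows "splits C (es ! 1) \<longleftrightarrow> splits C (es' ! 1)"
proof -
  obtain \<phi> where es: "es \<in> yoneda_seq C 1 X Y" "es' \<in> yoneda_seq C 1 X Y"
    and p0: "\<phi> 0 = Idn C Y" "\<phi> 2 = Idn C X"
    and p: "\<And>i. i \<le> 1 \<Longrightarrow> \<phi> i \<in> Hom C (Dom C (es ! i)) (Dom C (es' ! i)) \<and> \<phi> (Suc i) \<odot> (es ! i) = (es' ! i) \<odot> \<phi> i"
    using assms unfolding yoneda_mor_def by (auto simp: numeral_2_eq_2)
  obtain i q where i: "es = [i, q]" "short_exact C i q" "Dom C i = Y" "Cod C q = X" using yoneda_seq_1E[OF es(1)] .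
  obtain i' q' where i': "es' = [i', q']" "short_exact C i' q'" "Dom C i' = Y" "Cod C q' = X" using yoneda_seq_1E[OF es(2)] .
  note I = short_exactD[OF i(2)] and I' = short_exactD[OF i'(2)]
  have f: "\<phi> 1 \<in> Arr C" "Dom C (\<phi> 1) = Dom C q" "Cod C (\<phi> 1) = Dom C q'" "\<phi> 1 \<odot> i = i'" "q' \<odot> \<phi> 1 = q"
  proof -
    have 0: "\<phi> 1 \<odot> i = i' \<odot> \<phi> 0" using p[of 0] i(1) i'(1) by simp
    have 1: "\<phi> 2 \<odot> q = q' \<odot> \<phi> 1" using p[of 1] i(1) i'(1) by (simp add: numeral_2_eq_2)
    have 2: "\<phi> 1 \<in> Hom C (Dom C q) (Dom C q')" using p[of 1] i(1) i'(1) by simp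
    show "\<phi> 1 \<in> Arr C" "Dom C (\<phi> 1) = Dom C q" "Cod C (\<phi> 1) = Dom C q'" using 2 by (simp_all add: Hom_def)
    show "\<phi> 1 \<odot> i = i'" using 0 p0 i' I' by simp
    show "q' \<odot> \<phi> 1 = q" using 1 p0 i I by simp
  qed
  show ?thesis
  proof
    assume "splits C (es ! 1)"
    then obtain s where s: "s \<in> Arr C" "Dom C s = X" "Cod C s = Dom C q" "q \<odot> s = Idn C X"
      using i by (auto simp: splits_def)
    have "q' \<odot> (\<phi> 1 \<odot> s) = q \<odot> s" by (rule reassoc[OF f(5)]) (use f s I' in simp_all)
    then show "splits C (es' ! 1)" unfolding splits_def
      by (intro bexI[of _ "\<phi> 1 \<odot> s"]) (use f(1-3) s i' in simp_all)
  next
    assume "splits C (es' ! 1)"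
    then have "splits C q'" using i' by simp
    then obtain r where r: "r \<in> Arr C" "Dom C r = Cod C i'" "Cod C r = Dom C i'" "r \<odot> i' = Idn C (Dom C i')"
      using splits_retract[OF i'(2)] by blast
    have "splits C q"
      by (rule splitsI_retract[OF i(2), of "r \<odot> \<phi> 1"]) (use r f i i' I I' in simp_all)
    then show "splits C (es ! 1)" using i by simp
  qed
qed

text \<open>The biproduct extension splits, and vanishing puts every extension into its
  class.\<close>

lemma Ext1_splits:
  assumes "Ext_vanishes C 1 (Cod C p) (Dom C i)" "short_exact C i p"
  shows "splits C p"
proof -
  note I = short_exactD[OF assms(2)]
  obtain a b x y where b: "is_biprod C a b x y" "Dom C a = Dom C i" "Dom C b = Cod C p"
    by (rule biprod_exists[of "Dom C i" "Cod C p"]) (use I in simp_all)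
  note B = is_biprodD[OF b(1)]
  have "[a, y] \<in> yoneda_seq C 1 (Cod C p) (Dom C i)" "[i, p] \<in> yoneda_seq C 1 (Cod C p) (Dom C i)"
    using biprod_se[OF b(1)] b B assms(2) by (simp_all add: yoneda_seq_1[simplified])
  from equivclp_invariant[OF Ext_vanishes_related[OF assms(1) this], of "\<lambda>es. splits C (es ! 1)"]
  have "splits C y \<longleftrightarrow> splits C p" using splits_invariant by simp
  moreover have "splits C y" unfolding splits_def by (intro bexI[of _ b]) (use B in simp_all)
  ultimately show ?thesis by blast
qed

lemma splits_Ext1:
  assumes "X \<in> Ob C" "Y \<in> Ob C"
    and sp: "\<And>i p. short_exact C i p \<Longrightarrow> Dom C i = Y \<Longrightarrow> Cod C p = X \<Longrightarrow> splits C p"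
  shows "Ext_vanishes C 1 X Y"
proof -
  have mor: "yoneda_mor C 1 X Y es es'" if es: "es \<in> yoneda_seq C 1 X Y" "es' \<in> yoneda_seq C 1 X Y" for es es'
  proof -
    obtain i p where i: "es = [i, p]" "short_exact C i p" "Dom C i = Y" "Cod C p = X" using yoneda_seq_1E[OF es(1)] .
    obtain i' p' where i': "es' = [i', p']" "short_exact C i' p'" "Dom C i' = Y" "Cod C p' = X" using yoneda_seq_1E[OF es(2)] .
    note I = short_exactD[OF i(2)] and I' = short_exactD[OF i'(2)]
    obtain r where r: "r \<in> Arr C" "Dom C r = Cod C i" "Cod C r = Dom C i" "r \<odot> i = Idn C (Dom C i)"
      using splits_retract[OF i(2) sp] i by blast
    obtain s where s: "s \<in> Arr C" "Dom C s = Cod C p'" "Cod C s = Dom C p'" "p' \<odot> s = Idn C (Cod C p')"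
      using sp[OF i'(2-4)] by (auto simp: splits_def)
    \<comment> \<open>\<open>r\<close> and \<open>p\<close> are the two coordinates of the split
      source; the first is sent to the target by \<open>i'\<close>, the second by the section
      \<open>s\<close> of \<open>p'\<close>.\<close>
    define f where "f = Add C (i' \<odot> r) (s \<odot> p)"
    have f: "f \<in> Arr C" "Dom C f = Dom C p" "Cod C f = Dom C p'"
      unfolding f_def using r s I I' i i' by simp_all
    have "f \<odot> i = i'" unfolding f_def using r s I I' i i' assms(1,2) by simp
    moreover have "p' \<odot> f = p"
    proof -
      have "p' \<odot> (i' \<odot> r) = Zer C (Dom C r) (Cod C p')" by (rule zer_cancel) (use I' r i i' in simp_all)
      moreover have "p' \<odot> (s \<odot> p) = p" by (subst reassoc[OF s(4)]) (use I' I s i i' in simp_all)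
      ultimately show ?thesis unfolding f_def using r s I I' i i' assms(1,2) by simp
    qed
    ultimately show ?thesis unfolding yoneda_mor_def
      using es f i i' I I' assms
      by (intro conjI exI[of _ "\<lambda>n. if n = 0 then Idn C Y else if n = 1 then f else Idn C X"])
        (auto simp: le_Suc_eq Hom_def)
  qed
  obtain a b x y where b: "is_biprod C a b x y" "Dom C a = Y" "Dom C b = X"
    using biprod_exists[OF assms(2,1)] by blast
  define e where "e = [a, y]"
  have e: "e \<in> yoneda_seq C 1 X Y"
    using biprod_se[OF b(1)] b is_biprodD[OF b(1)] by (simp add: e_def yoneda_seq_1[simplified])
  have rel: "yoneda_rel C 1 X Y `` {es} = yoneda_seq C 1 X Y" if "es \<in> yoneda_seq C 1 X Y" for es
    using mor[OF that] that r_into_equivclp[of "yoneda_mor C 1 X Y" es] unfolding yoneda_rel_def by auto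
  have "yoneda_Ext C 1 X Y = {yoneda_seq C 1 X Y}"
    unfolding yoneda_Ext_def quotient_def using rel e by auto
  then show ?thesis by (auto simp: Ext_vanishes_def)
qed

text \<open>The witness is the pullback of \<open>q'\<close> along \<open>g\<close>; the pair of
  \<open>b\<close> and \<open>v' \<odot> f\<close> is compatible over \<open>Cod C b'\<close> and
  induces \<open>v\<close>.\<close>

lemma lifts_two_ext_back:
  assumes "exact C a b" "exact C a' b'" "f \<in> Arr C" "g \<in> Arr C" "Dom C f = Dom C b" "Cod C f = Dom C b'"
    "Dom C g = Cod C b" "Cod C g = Cod C b'" "f \<odot> a = a'" "g \<odot> b = b' \<odot> f" "lifts_two_ext C a' b'"
  shows "lifts_two_ext C a b"
proof -
  obtain q' v' where v': "short_exact C (v' \<odot> a') q'" "v' \<in> Arr C" "Dom C v' = Dom C b'" "Cod C v' = Dom C q'" "q' \<odot> v' = b'"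
    using assms(11) unfolding lifts_two_ext_def by blast
  note A = exact_arr[OF assms(1)] and A' = exact_arr[OF assms(2)] and S = short_exactD[OF v'(1)]
  have cq': "Cod C q' = Cod C b'" by (rule cmp_cod[OF v'(5)]) (use v' S in simp_all)
  have da': "Dom C a' = Dom C a" by (rule cmp_dom[OF assms(9), symmetric]) (use A assms in simp_all)
  obtain i q u where q: "short_exact C i q" "is_pullback C q u g q'" "u \<odot> i = v' \<odot> a'" "Dom C i = Dom C (v' \<odot> a')" "Cod C q = Dom C g"
    by (rule pull_se[OF v'(1) assms(4)]) (use cq' assms in simp_all)
  note P = is_pullbackD[OF q(2)] and I = short_exactD[OF q(1)]
  have eq: "g \<odot> b = q' \<odot> (v' \<odot> f)" unfolding assms(10)
    by (rule reassoc[OF v'(5), symmetric]) (use v' S assms in simp_all)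
  obtain v where v: "v \<in> Arr C" "Dom C v = Dom C (v' \<odot> f)" "Cod C v = Dom C u" "q \<odot> v = b" "u \<odot> v = v' \<odot> f"
    by (rule pullback_lift[OF q(2) _ _ _ _ _ eq]) (use v' S A assms in simp_all)
  have dv: "Dom C v = Dom C b" using v v' assms by simp
  have "v \<odot> a = i"
  proof (rule pullback_unique[OF q(2)])
    have "q \<odot> (v \<odot> a) = b \<odot> a" by (rule reassoc[OF v(4)]) (use v(1-3) dv P A in simp_all)
    also have "\<dots> = q \<odot> i" using exact_zer[OF assms(1)] I q v' A A' assms P da' by simp
    finally show "q \<odot> (v \<odot> a) = q \<odot> i" .
    have "u \<odot> (v \<odot> a) = (v' \<odot> f) \<odot> a" by (rule reassoc[OF v(5)]) (use v(1-3) dv P A in simp_all)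
    also have "\<dots> = v' \<odot> a'" unfolding assms(9)[symmetric] by (rule assoc) (use v' assms A in simp_all)
    finally show "u \<odot> (v \<odot> a) = u \<odot> i" using q by simp
  qed (use v dv A A' P I q v' assms da' in simp_all)
  then show ?thesis unfolding lifts_two_ext_def
    using q v dv P by (intro exI[of _ q] exI[of _ v]) simp
qed

lemma lifts_two_ext_op:
  assumes "monic C a" "exact C a b" "exact C b c" "epic C c" "lifts_two_ext C a b"
  shows "lifts_two_ext (op_cat C) c b"
proof -
  obtain q v where v: "short_exact C (v \<odot> a) q" "v \<in> Arr C" "Dom C v = Dom C b" "Cod C v = Dom C q" "q \<odot> v = b"
    using assms(5) unfolding lifts_two_ext_def by blast
  have "short_exact C v (c \<odot> q)" by (rule two_ext[OF assms(1-4) v(1-4) refl v(5)])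
  moreover have "Cod C q = Cod C b" by (rule cmp_cod[OF v(5)]) (use v short_exactD[OF v(1)] in simp_all)
  ultimately show ?thesis unfolding lifts_two_ext_def
    using v short_exactD[OF v(1)] by (intro exI[of _ v] exI[of _ q]) simp
qed

lemma lifts_two_ext_invariant:
  assumes "yoneda_mor C 2 X Y es es'"
  shows "lifts_two_ext C (es ! 0) (es ! 1) \<longleftrightarrow> lifts_two_ext C (es' ! 0) (es' ! 1)"
proof -
  obtain \<phi> where es: "es \<in> yoneda_seq C 2 X Y" "es' \<in> yoneda_seq C 2 X Y"
    and p0: "\<phi> 0 = Idn C Y" "\<phi> 3 = Idn C X"
    and p: "\<And>i. i \<le> 2 \<Longrightarrow> \<phi> i \<in> Hom C (Dom C (es ! i)) (Dom C (es' ! i)) \<and> \<phi> (Suc i) \<odot> (es ! i) = (es' ! i) \<odot> \<phi> i"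
    using assms unfolding yoneda_mor_def by (auto simp: numeral_3_eq_3 numeral_2_eq_2)
  obtain a b c where a: "es = [a, b, c]" "Dom C a = Y" "Cod C c = X" "monic C a" "exact C a b" "exact C b c" "epic C c"
    using yoneda_seq_2E[OF es(1)] .
  obtain a' b' c' where a': "es' = [a', b', c']" "Dom C a' = Y" "Cod C c' = X" "monic C a'" "exact C a' b'" "exact C b' c'" "epic C c'"
    using yoneda_seq_2E[OF es(2)] .
  note A = exact_arr[OF a(5)] exact_arr[OF a(6)] and A' = exact_arr[OF a'(5)] exact_arr[OF a'(6)]
  have 0: "\<phi> 1 \<odot> a = a' \<odot> \<phi> 0" using p[of 0] a(1) a'(1) by simp
  have 1: "\<phi> 2 \<odot> b = b' \<odot> \<phi> 1" using p[of 1] a(1) a'(1) by (simp add: numeral_2_eq_2)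
  have 2: "\<phi> 3 \<odot> c = c' \<odot> \<phi> 2" using p[of 2] a(1) a'(1) by (simp add: numeral_2_eq_2 numeral_3_eq_3)
  have h1: "\<phi> 1 \<in> Hom C (Dom C b) (Dom C b')" using p[of 1] a(1) a'(1) by simp
  have h2: "\<phi> 2 \<in> Hom C (Dom C c) (Dom C c')" using p[of 2] a(1) a'(1) by (simp add: numeral_2_eq_2)
  have f: "\<phi> 1 \<in> Arr C" "Dom C (\<phi> 1) = Dom C b" "Cod C (\<phi> 1) = Dom C b'" "\<phi> 1 \<odot> a = a'"
    using 0 p0 a' A' h1 by (simp_all add: Hom_def)
  have g: "\<phi> 2 \<in> Arr C" "Dom C (\<phi> 2) = Dom C c" "Cod C (\<phi> 2) = Dom C c'" "\<phi> 2 \<odot> b = b' \<odot> \<phi> 1" "c' \<odot> \<phi> 2 = c"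
    using 1 2 p0 a A h2 by (simp_all add: Hom_def)
  interpret op: abelian_category "op_cat C" by (rule op_abelian)
  have "lifts_two_ext C a b" if "lifts_two_ext C a' b'"
    by (rule lifts_two_ext_back[OF a(5) a'(5) f(1) g(1)]) (use f g A A' that in simp_all)
  moreover have "lifts_two_ext C a' b'" if "lifts_two_ext C a b"
  proof -
    have 1: "lifts_two_ext (op_cat C) c b" using lifts_two_ext_op[OF a(4-7) that] .
    have 2: "lifts_two_ext (op_cat C) c' b'"
      by (rule op.lifts_two_ext_back[of c' b' c b "\<phi> 2" "\<phi> 1"]) (use f g A A' 1 a a' in simp_all)
    then show ?thesis using op.lifts_two_ext_op[of c' b' a'] a' by simp
  qed
  ultimately show ?thesis using a a' by auto
qed

text \<open>The zero class is represented by the two-fold extension with identities at the ends and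
  a zero arrow in the middle, for which the biproduct of \<open>Y\<close> and \<open>X\<close> is a
  witness.\<close>

lemma Ext2_lifts:
  assumes "Ext_vanishes C 2 X Y" "[a, b, c] \<in> yoneda_seq C 2 X Y"
  shows "lifts_two_ext C a b"
proof -
  have a: "Dom C a = Y" "Cod C c = X" "a \<in> Arr C" "c \<in> Arr C" using assms(2) unfolding yoneda_seq_2 by (auto simp: monic_def epic_def)
  then have o: "X \<in> Ob C" "Y \<in> Ob C" by auto
  have "exact C (Idn C Y) (Zer C Y X)"
  proof (rule exactI)
    fix t assume t: "t \<in> Arr C" "Cod C t = Dom C (Zer C Y X)"
    show "\<exists>e s. epic C e \<and> s \<in> Arr C \<and> Dom C s = Dom C e \<and> Cod C e = Dom C t \<and> Cod C s = Dom C (Idn C Y) \<and> t \<odot> e = Idn C Y \<odot> s"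
      by (rule exI[of _ "Idn C (Dom C t)"], rule exI[of _ t]) (use t o epic_idn in simp_all)
  qed (use o in simp_all)
  moreover have "exact C (Zer C Y X) (Idn C X)"
  proof (rule exactI)
    fix t assume t: "t \<in> Arr C" "Cod C t = Dom C (Idn C X)" "Idn C X \<odot> t = Zer C (Dom C t) (Cod C (Idn C X))"
    then have t0: "t = Zer C (Dom C t) X" using o by simp
    have "t \<odot> Idn C (Dom C t) = Zer C Y X \<odot> Zer C (Dom C t) Y" using o t(1) t0 by simp
    then show "\<exists>e s. epic C e \<and> s \<in> Arr C \<and> Dom C s = Dom C e \<and> Cod C e = Dom C t \<and> Cod C s = Dom C (Zer C Y X) \<and> t \<odot> e = Zer C Y X \<odot> s"
      by - (rule exI[of _ "Idn C (Dom C t)"], rule exI[of _ "Zer C (Dom C t) Y"], use t(1) o epic_idn in simp_all)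
  qed (use o in simp_all)
  ultimately have z: "[Idn C Y, Zer C Y X, Idn C X] \<in> yoneda_seq C 2 X Y"
    unfolding yoneda_seq_2 using o epic_idn monic_idn by simp
  obtain i j x y where b: "is_biprod C i j x y" "Dom C i = Y" "Dom C j = X"
    using biprod_exists[OF o(2,1)] by blast
  note B = is_biprodD[OF b(1)]
  have "lifts_two_ext C (Idn C Y) (Zer C Y X)" unfolding lifts_two_ext_def
    using biprod_se[OF b(1)] B b o by (intro exI[of _ y] exI[of _ i]) simp
  with equivclp_invariant[OF Ext_vanishes_related[OF assms(1) z assms(2)], of "\<lambda>es. lifts_two_ext C (es ! 0) (es ! 1)"]
    lifts_two_ext_invariant show ?thesis by simp
qed

text \<open>The Yoneda product of two extensions: \<open>j \<odot> p\<close> has the kernel of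
  \<open>p\<close> because \<open>j\<close> is monic, and the image of \<open>j\<close> because
  \<open>p\<close> is epic.\<close>

lemma splice:
  assumes "short_exact C i p" "short_exact C j q" "Dom C j = Cod C p"
  shows "[i, j \<odot> p, q] \<in> yoneda_seq C 2 (Cod C q) (Dom C i)"
proof -
  note I = short_exactD[OF assms(1)] and J = short_exactD[OF assms(2)]
  have "exact C i (j \<odot> p)"
  proof (rule exactI)
    show "(j \<odot> p) \<odot> i = Zer C (Dom C i) (Cod C (j \<odot> p))" using I J assms by simp
    fix t assume t: "t \<in> Arr C" "Cod C t = Dom C (j \<odot> p)" "(j \<odot> p) \<odot> t = Zer C (Dom C t) (Cod C (j \<odot> p))"
    have "p \<odot> t = Zer C (Dom C t) (Cod C p)" by (rule monic_zer[OF J(5)]) (use t I J assms in simp_all)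
    then obtain s where s: "s \<in> Arr C" "Dom C s = Dom C t" "Cod C s = Dom C i" "i \<odot> s = t"
      using ker_lift[OF I(7), of t] t I J assms by auto
    show "\<exists>e s. epic C e \<and> s \<in> Arr C \<and> Dom C s = Dom C e \<and> Cod C e = Dom C t \<and> Cod C s = Dom C i \<and> t \<odot> e = i \<odot> s"
      by (rule exI[of _ "Idn C (Dom C t)"], rule exI[of _ s]) (use t(1) s epic_idn in simp_all)
  qed (use I J assms in simp_all)
  moreover have "exact C (j \<odot> p) q"
  proof (rule exactI)
    show "q \<odot> (j \<odot> p) = Zer C (Dom C (j \<odot> p)) (Cod C q)" using I J assms by (subst zer_cancel) simp_all
    fix t assume t: "t \<in> Arr C" "Cod C t = Dom C q" "q \<odot> t = Zer C (Dom C t) (Cod C q)"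
    obtain s where s: "s \<in> Arr C" "Dom C s = Dom C t" "Cod C s = Dom C j" "j \<odot> s = t"
      using ker_lift[OF J(7) t] .
    obtain e x where e: "epic C e" "x \<in> Arr C" "Dom C x = Dom C e" "Cod C e = Dom C s" "Cod C x = Dom C p" "s \<odot> e = p \<odot> x"
      by (rule cover[OF I(6) s(1)]) (use s assms in simp_all)
    have "t \<odot> e = j \<odot> (s \<odot> e)" by (rule reassoc[OF s(4), symmetric]) (use s J e epic_arr in simp_all)
    then have "t \<odot> e = (j \<odot> p) \<odot> x" using e J I assms by simp
    then show "\<exists>e x. epic C e \<and> x \<in> Arr C \<and> Dom C x = Dom C e \<and> Cod C e = Dom C t \<and> Cod C x = Dom C (j \<odot> p) \<and> t \<odot> e = (j \<odot> p) \<odot> x"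
      by - (rule exI[of _ e], rule exI[of _ x], use e s I J assms in simp_all)
  qed (use I J assms in simp_all)
  ultimately show ?thesis unfolding yoneda_seq_2 using I J assms by simp
qed

end

section \<open>Hereditary model structures\<close>

text \<open>The model structure with Ext eliminated: orthogonality is stated as splitting
  (\<open>Q_split\<close>, \<open>R_split\<close>), maximality of the orthogonal classes as
  \<open>Q_I\<close>, \<open>R_I\<close>, and the hereditary condition as \<open>Q_ker\<close>,
  \<open>R_coker\<close>. The list is self-dual with \<open>Q\<close> and \<open>R\<close>
  exchanged, see \<open>hmod_op\<close>.\<close>

locale hmod = abelian_category +
  fixes Q W R :: "'a set"
  assumes Q_ob: "Q \<subseteq> Ob C" and W_ob: "W \<subseteq> Ob C" and R_ob: "R \<subseteq> Ob C"
    and Q_split: "\<lbrakk>short_exact C i p; Dom C i \<in> W; Dom C i \<in> R; Cod C p \<in> Q\<rbrakk> \<Longrightarrow> splits C p"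
    and R_split: "\<lbrakk>short_exact C i p; Dom C i \<in> R; Cod C p \<in> Q; Cod C p \<in> W\<rbrakk> \<Longrightarrow> splits C p"
    and Q_I: "\<lbrakk>X \<in> Ob C; \<And>i p. \<lbrakk>short_exact C i p; Dom C i \<in> W; Dom C i \<in> R; Cod C p = X\<rbrakk> \<Longrightarrow> splits C p\<rbrakk> \<Longrightarrow> X \<in> Q"
    and R_I: "\<lbrakk>X \<in> Ob C; \<And>i p. \<lbrakk>short_exact C i p; Cod C p \<in> Q; Cod C p \<in> W; Dom C i = X\<rbrakk> \<Longrightarrow> splits C p\<rbrakk> \<Longrightarrow> X \<in> R"
    and cof_repl: "A \<in> Ob C \<Longrightarrow> \<exists>i p. short_exact C i p \<and> Dom C i \<in> W \<and> Dom C i \<in> R \<and> Dom C p \<in> Q \<and> Cod C p = A"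
    and fib_repl: "A \<in> Ob C \<Longrightarrow> \<exists>j q. short_exact C j q \<and> Cod C q \<in> Q \<and> Cod C q \<in> W \<and> Cod C j \<in> R \<and> Dom C j = A"
    and Q_ker: "\<lbrakk>short_exact C i p; Dom C p \<in> Q; Cod C p \<in> Q\<rbrakk> \<Longrightarrow> Dom C i \<in> Q"
    and R_coker: "\<lbrakk>short_exact C i p; Dom C i \<in> R; Cod C i \<in> R\<rbrakk> \<Longrightarrow> Cod C p \<in> R"
    and W_coker: "\<lbrakk>short_exact C i p; Dom C i \<in> W; Cod C i \<in> W\<rbrakk> \<Longrightarrow> Cod C p \<in> W"
    and W_ker: "\<lbrakk>short_exact C i p; Dom C p \<in> W; Cod C p \<in> W\<rbrakk> \<Longrightarrow> Dom C i \<in> W"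
    and W_ext: "\<lbrakk>short_exact C i p; Dom C i \<in> W; Cod C p \<in> W\<rbrakk> \<Longrightarrow> Dom C p \<in> W"

lemma hereditary_model_hmod:
  fixes C :: "('o, 'm) add_cat" (structure)
  assumes "abelian_category C" "hereditary_model C M"
  shows "hmod C (Cofib M) (Triv M) (Fib M)"
proof -
  interpret abelian_category C by fact
  note h = assms(2)[unfolded hereditary_model_def]
  have ct: "cotorsion_pair C (Cofib M) (Triv M \<inter> Fib M)" "cotorsion_pair C (Cofib M \<inter> Triv M) (Fib M)"
    and cp: "complete_pair C (Cofib M) (Triv M \<inter> Fib M)" "complete_pair C (Cofib M \<inter> Triv M) (Fib M)"
    and hp: "hereditary_pair C (Cofib M) (Triv M \<inter> Fib M)" "hereditary_pair C (Cofib M \<inter> Triv M) (Fib M)"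
    and obs': "Cofib M \<subseteq> Ob C" "Fib M \<subseteq> Ob C" and th: "thick C (Triv M)"
    using h by simp_all
  have obs: "Cofib M \<subseteq> Ob C" "Fib M \<subseteq> Ob C" "Triv M \<subseteq> Ob C"
    using obs' th by (simp_all add: thick_def)
  have v: "Ext_vanishes C n X Y" if "n \<ge> 1" "X \<in> Cofib M \<and> Y \<in> Triv M \<inter> Fib M \<or> X \<in> Cofib M \<inter> Triv M \<and> Y \<in> Fib M" for n X Y
    using hp that unfolding hereditary_pair_def by blast
  have Qsp: "splits C p" if "short_exact C i p" "Dom C i \<in> Triv M" "Dom C i \<in> Fib M" "Cod C p \<in> Cofib M" for i p
    by (rule Ext1_splits[OF v that(1)]) (use that in auto)
  have Rsp: "splits C p" if "short_exact C i p" "Dom C i \<in> Fib M" "Cod C p \<in> Cofib M" "Cod C p \<in> Triv M" for i p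
    by (rule Ext1_splits[OF v that(1)]) (use that in auto)
  have QI: "X \<in> Cofib M" if X: "X \<in> Ob C" and sp: "\<And>i p. \<lbrakk>short_exact C i p; Dom C i \<in> Triv M; Dom C i \<in> Fib M; Cod C p = X\<rbrakk> \<Longrightarrow> splits C p" for X
  proof -
    have "Ext_vanishes C 1 X Y" if "Y \<in> Triv M \<inter> Fib M" for Y
      by (rule splits_Ext1) (use that obs X sp in auto)
    then show ?thesis using ct(1) X unfolding cotorsion_pair_def by blast
  qed
  have RI: "X \<in> Fib M" if X: "X \<in> Ob C" and sp: "\<And>i p. \<lbrakk>short_exact C i p; Cod C p \<in> Cofib M; Cod C p \<in> Triv M; Dom C i = X\<rbrakk> \<Longrightarrow> splits C p" for X
  proof -
    have "Ext_vanishes C 1 Y X" if "Y \<in> Cofib M \<inter> Triv M" for Y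
      by (rule splits_Ext1) (use that obs X sp in auto)
    then show ?thesis using ct(2) X unfolding cotorsion_pair_def by blast
  qed
  have Wc: "Cod C p \<in> Triv M" if "short_exact C i p" "Dom C i \<in> Triv M" "Cod C i \<in> Triv M" for i p
    using th that unfolding thick_def by blast
  have Wk: "Dom C i \<in> Triv M" if "short_exact C i p" "Dom C p \<in> Triv M" "Cod C p \<in> Triv M" for i p
    using th that short_exactD(3)[OF that(1)] unfolding thick_def by metis
  have We: "Dom C p \<in> Triv M" if "short_exact C i p" "Dom C i \<in> Triv M" "Cod C p \<in> Triv M" for i p
    using th that short_exactD(3)[OF that(1)] unfolding thick_def by metis
  show ?thesis
  proof
    fix k e assume k: "short_exact C k e" "Dom C e \<in> Cofib M" "Cod C e \<in> Cofib M"
    note K = short_exactD[OF k(1)]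
    show "Dom C k \<in> Cofib M"
    proof (rule QI)
      fix i p assume i: "short_exact C i p" "Dom C i \<in> Triv M" "Dom C i \<in> Fib M" "Cod C p = Dom C k"
      note I = short_exactD[OF i(1)]
      \<comment> \<open>Splicing \<open>i\<close>, \<open>p\<close> with \<open>k\<close>,
        \<open>e\<close> gives a class in degree 2 over the cofibrant object \<open>Cod C e\<close>,
        which vanishes. The resulting extension of \<open>Dom C e\<close> splits because
        \<open>Dom C e\<close> is cofibrant, and its retraction restricts along \<open>w\<close> to
        a retraction of \<open>i\<close>.\<close>
      have "lifts_two_ext C i (k \<odot> p)"
        using Ext2_lifts[OF v splice[OF i(1) k(1)]] i k by auto
      then obtain q w where w: "short_exact C (w \<odot> i) q" "w \<in> Arr C" "Dom C w = Dom C p" "Cod C w = Dom C q" "q \<odot> w = k \<odot> p"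
        unfolding lifts_two_ext_def using I K i by auto
      note V = short_exactD[OF w(1)]
      have "Cod C q = Cod C (k \<odot> p)" by (rule cmp_cod[OF w(5)]) (use w V in simp_all)
      then have "splits C q" using Qsp[OF w(1)] i k I K w by simp
      then obtain r where r: "r \<in> Arr C" "Dom C r = Cod C (w \<odot> i)" "Cod C r = Dom C (w \<odot> i)" "r \<odot> (w \<odot> i) = Idn C (Dom C (w \<odot> i))"
        using splits_retract[OF w(1)] by blast
      show "splits C p" by (rule splitsI_retract[OF i(1), of "r \<odot> w"]) (use r w I in simp_all)
    qed (use K in simp)
  next
    fix k e assume k: "short_exact C k e" "Dom C k \<in> Fib M" "Cod C k \<in> Fib M"
    note K = short_exactD[OF k(1)]
    show "Cod C e \<in> Fib M"
    proof (rule RI)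
      fix i p assume i: "short_exact C i p" "Cod C p \<in> Cofib M" "Cod C p \<in> Triv M" "Dom C i = Cod C e"
      note I = short_exactD[OF i(1)]
      note sp = splice[OF k(1) i(1,4)]
      note sp' = sp[unfolded yoneda_seq_2]
      \<comment> \<open>Dually, \<open>two_ext\<close> reads the witness as an extension of the
        trivially cofibrant \<open>Cod C p\<close> by the fibrant \<open>Cod C k\<close>; a section
        of it composed with \<open>q\<close> is a section of \<open>p\<close>.\<close>
      have "lifts_two_ext C k (i \<odot> e)"
        using Ext2_lifts[OF v sp] i k by auto
      then obtain q w where w: "short_exact C (w \<odot> k) q" "w \<in> Arr C" "Dom C w = Dom C e" "Cod C w = Dom C q" "q \<odot> w = i \<odot> e"
        unfolding lifts_two_ext_def using I K i by auto
      note V = short_exactD[OF w(1)]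
      have cq: "Cod C q = Cod C (i \<odot> e)" by (rule cmp_cod[OF w(5)]) (use w V in simp_all)
      have "short_exact C w (p \<odot> q)"
        using two_ext[of k "i \<odot> e" p "w \<odot> k" q w] sp' w K I i by simp
      then have "splits C (p \<odot> q)" using Rsp w k K i I cq V by simp
      then obtain s where s: "s \<in> Arr C" "Dom C s = Cod C p" "Cod C s = Dom C q" "p \<odot> (q \<odot> s) = Idn C (Cod C p)"
        unfolding splits_def using w V cq I K i by auto
      then show "splits C p" unfolding splits_def
        by (intro bexI[of _ "q \<odot> s"]) (use w V cq I K i in simp_all)
    qed (use K in simp)
  next
    show "\<exists>i p. short_exact C i p \<and> Dom C i \<in> Triv M \<and> Dom C i \<in> Fib M \<and> Dom C p \<in> Cofib M \<and> Cod C p = A"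
      if "A \<in> Ob C" for A using cp(1) that unfolding complete_pair_def by blast
    show "\<exists>j q. short_exact C j q \<and> Cod C q \<in> Cofib M \<and> Cod C q \<in> Triv M \<and> Cod C j \<in> Fib M \<and> Dom C j = A"
      if "A \<in> Ob C" for A using cp(2) that unfolding complete_pair_def by blast
  qed (fact obs Qsp Rsp QI RI Wc Wk We)+
qed

lemma hmod_op: assumes "hmod C Q W R" shows "hmod (op_cat C) R W Q"
proof -
  interpret hmod C Q W R by fact
  show ?thesis
  proof (rule hmod.intro[OF op_abelian], rule hmod_axioms.intro)
    show "\<exists>i p. short_exact (op_cat C) i p \<and> Dom (op_cat C) i \<in> W \<and> Dom (op_cat C) i \<in> Q \<and> Dom (op_cat C) p \<in> R \<and> Cod (op_cat C) p = A"
      if A: "A \<in> Ob (op_cat C)" for A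
    proof -
      obtain j q where "short_exact C j q" "Cod C q \<in> Q" "Cod C q \<in> W" "Cod C j \<in> R" "Dom C j = A"
        using fib_repl[of A] A by auto
      then show ?thesis by (intro exI[of _ q] exI[of _ j]) simp
    qed
    show "\<exists>j q. short_exact (op_cat C) j q \<and> Cod (op_cat C) q \<in> R \<and> Cod (op_cat C) q \<in> W \<and> Cod (op_cat C) j \<in> Q \<and> Dom (op_cat C) j = A"
      if A: "A \<in> Ob (op_cat C)" for A
    proof -
      obtain i p where "short_exact C i p" "Dom C i \<in> W" "Dom C i \<in> R" "Dom C p \<in> Q" "Cod C p = A"
        using cof_repl[of A] A by auto
      then show ?thesis by (intro exI[of _ p] exI[of _ i]) simp
    qed
    fix i p assume se: "short_exact (op_cat C) i p"
    then have se': "short_exact C p i" by simp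
    note s = short_exactD(3)[OF se'] splits_op[OF se']
    show "splits (op_cat C) p" if "Dom (op_cat C) i \<in> W" "Dom (op_cat C) i \<in> Q" "Cod (op_cat C) p \<in> R"
      using R_split[OF se'] s that by simp
    show "splits (op_cat C) p" if "Dom (op_cat C) i \<in> Q" "Cod (op_cat C) p \<in> R" "Cod (op_cat C) p \<in> W"
      using Q_split[OF se'] s that by simp
    show "Dom (op_cat C) i \<in> R" if "Dom (op_cat C) p \<in> R" "Cod (op_cat C) p \<in> R"
      using R_coker[OF se'] that by simp
    show "Cod (op_cat C) p \<in> Q" if "Dom (op_cat C) i \<in> Q" "Cod (op_cat C) i \<in> Q"
      using Q_ker[OF se'] that by simp
    show "Cod (op_cat C) p \<in> W" if "Dom (op_cat C) i \<in> W" "Cod (op_cat C) i \<in> W"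
      using W_ker[OF se'] that by simp
    show "Dom (op_cat C) i \<in> W" if "Dom (op_cat C) p \<in> W" "Cod (op_cat C) p \<in> W"
      using W_coker[OF se'] that by simp
    show "Dom (op_cat C) p \<in> W" if "Dom (op_cat C) i \<in> W" "Cod (op_cat C) p \<in> W"
      using W_ext[OF se'] s that by simp
  next
    fix X assume X: "X \<in> Ob (op_cat C)"
    show "X \<in> R" if sp: "\<And>i p. \<lbrakk>short_exact (op_cat C) i p; Dom (op_cat C) i \<in> W; Dom (op_cat C) i \<in> Q; Cod (op_cat C) p = X\<rbrakk> \<Longrightarrow> splits (op_cat C) p"
    proof (rule R_I)
      show "splits C p" if "short_exact C i p" "Cod C p \<in> Q" "Cod C p \<in> W" "Dom C i = X" for i p
        using sp[of p i] that splits_op[OF that(1)] by simp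
    qed (use X in simp)
    show "X \<in> Q" if sp: "\<And>i p. \<lbrakk>short_exact (op_cat C) i p; Cod (op_cat C) p \<in> R; Cod (op_cat C) p \<in> W; Dom (op_cat C) i = X\<rbrakk> \<Longrightarrow> splits (op_cat C) p"
    proof (rule Q_I)
      show "splits C p" if "short_exact C i p" "Dom C i \<in> W" "Dom C i \<in> R" "Cod C p = X" for i p
        using sp[of p i] that splits_op[OF that(1)] by simp
    qed (use X in simp)
  qed (use Q_ob R_ob W_ob in simp_all)
qed

section \<open>Lifting and extension\<close>

context abelian_category begin

text \<open>A section of the pullback of \<open>p\<close> along \<open>t\<close>, followed by the
  projection \<open>u\<close>, is a lift of \<open>t\<close>; so lifting reduces to the splitting of
  extensions with the same kernel.\<close>

lemma split_lift:
  assumes "short_exact C i p" "t \<in> Arr C" "Cod C t = Cod C p"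
    "\<And>i' p'. short_exact C i' p' \<Longrightarrow> Dom C i' = Dom C i \<Longrightarrow> Cod C p' = Dom C t \<Longrightarrow> splits C p'"
  shows "\<exists>h \<in> Hom C (Dom C t) (Dom C p). p \<odot> h = t"
proof -
  note I = short_exactD[OF assms(1)]
  obtain i' q u where q: "short_exact C i' q" "is_pullback C q u t p" "u \<odot> i' = i" "Dom C i' = Dom C i" "Cod C q = Dom C t"
    using pull_se[OF assms(1-3)] .
  note P = is_pullbackD[OF q(2)]
  obtain s where s: "s \<in> Arr C" "Dom C s = Dom C t" "Cod C s = Dom C q" "q \<odot> s = Idn C (Dom C t)"
    using assms(4)[OF q(1,4,5)] q(5) by (auto simp: splits_def)
  have "p \<odot> (u \<odot> s) = t \<odot> (q \<odot> s)" by (rule assoc_eq) (use P s in simp_all)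
  then have "p \<odot> (u \<odot> s) = t" using s assms by simp
  then show ?thesis using P s by (intro bexI[of _ "u \<odot> s"]) (simp_all add: Hom_def)
qed

section \<open>Cokernels along exact sequences\<close>

lemma coker_image:
  assumes "exact C f g" "is_coker C c f"
  obtains m where "monic C m" "Dom C m = Cod C c" "Cod C m = Cod C g" "m \<odot> c = g"
proof -
  note F = exact_arr[OF assms(1)] and c = is_cokerD[OF assms(2)]
  obtain m where m: "m \<in> Arr C" "Dom C m = Cod C c" "Cod C m = Cod C g" "m \<odot> c = g"
    by (rule coker_desc[OF assms(2) F(2) _ exact_zer[OF assms(1)]]) (use F in simp_all)
  have "monic C m"
  proof (rule monicI[OF m(1)])
    fix x A assume x: "x \<in> Arr C" "Dom C x = A" "Cod C x = Dom C m" "m \<odot> x = Zer C A (Cod C m)"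
    obtain e y where e: "epic C e" "y \<in> Arr C" "Dom C y = Dom C e" "Cod C e = Dom C x" "Cod C y = Dom C c" "x \<odot> e = c \<odot> y"
      by (rule cover[OF coker_epic[OF assms(2)] x(1)]) (use x m in simp_all)
    note ea = epic_arr[OF e(1)]
    have "g \<odot> y = m \<odot> (c \<odot> y)" by (rule reassoc[OF m(4), symmetric]) (use e c m in simp_all)
    also have "\<dots> = m \<odot> (x \<odot> e)" by (simp only: e)
    also have "\<dots> = Zer C A (Cod C m) \<odot> e" by (rule reassoc[OF x(4)]) (use e ea x m in simp_all)
    finally have gy: "g \<odot> y = Zer C (Dom C y) (Cod C g)" using m e ea x F by simp
    obtain e' s where e': "epic C e'" "s \<in> Arr C" "Dom C s = Dom C e'" "Cod C e' = Dom C y" "Cod C s = Dom C f" "y \<odot> e' = f \<odot> s"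
      by (rule exact_cover[OF assms(1) e(2) _ gy]) (use e c F in simp_all)
    note ea' = epic_arr[OF e'(1)]
    have "x \<odot> (e \<odot> e') = c \<odot> (y \<odot> e')" by (rule assoc_eq[OF e(6)]) (use e ea e' ea' x c m in simp_all)
    also have "\<dots> = c \<odot> (f \<odot> s)" by (simp only: e')
    also have "\<dots> = Zer C (Dom C s) (Cod C c)" by (rule zer_cancel) (use c e' in simp_all)
    finally show "x = Zer C A (Dom C m)"
      by - (rule epic_zer[OF epic_cmp[OF e'(1) e(1)]], use e ea e' ea' x m in simp_all)
  qed
  then show thesis using that m by blast
qed

lemma exact_epic_coker: assumes "exact C f g" "epic C g" shows "is_coker C g f"
proof -
  obtain c k where ck: "is_coker C c f" "is_ker C k c" "is_ker C k g" using assms(1) by (auto simp: exact_def)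
  note F = exact_arr[OF assms(1)] and K = is_kerD[OF ck(3)]
  obtain e where e: "epic C e" "Dom C e = Dom C f" "Cod C e = Dom C k" "k \<odot> e = f"
    using image_factor[OF ck(1,2)] .
  note ea = epic_arr[OF e(1)]
  have gk: "is_coker C g k" using coker_ker[OF assms(2) ck(3)] .
  show ?thesis
  proof (rule is_cokerI[OF assms(2) F(1)])
    fix t assume t: "t \<in> Arr C" "Dom C t = Cod C f" "t \<odot> f = Zer C (Dom C f) (Cod C t)"
    have "(t \<odot> k) \<odot> e = t \<odot> (k \<odot> e)" by (rule assoc) (use t K e ea F in simp_all)
    then have "t \<odot> k = Zer C (Dom C k) (Cod C t)"
      by - (rule epic_zer[OF e(1)], use t e K F in simp_all)
    then show "\<exists>h. h \<in> Arr C \<and> Dom C h = Cod C g \<and> Cod C h = Cod C t \<and> h \<odot> g = t"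
      using coker_desc[OF gk t(1)] t K F by auto
  qed (use F exact_zer[OF assms(1)] in simp_all)
qed

lemma coker_cmp_epic:
  assumes "is_coker C c m" "epic C e" "Cod C e = Dom C m" shows "is_coker C c (m \<odot> e)"
proof (rule is_cokerI[OF coker_epic[OF assms(1)]])
  note c = is_cokerD[OF assms(1)] and ea = epic_arr[OF assms(2)]
  show "c \<odot> (m \<odot> e) = Zer C (Dom C (m \<odot> e)) (Cod C c)" by (subst zer_cancel) (use c ea assms in simp_all)
  fix t assume t: "t \<in> Arr C" "Dom C t = Cod C (m \<odot> e)" "t \<odot> (m \<odot> e) = Zer C (Dom C (m \<odot> e)) (Cod C t)"
  have "(t \<odot> m) \<odot> e = t \<odot> (m \<odot> e)" by (rule assoc) (use t c ea assms in simp_all)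
  then have "t \<odot> m = Zer C (Dom C m) (Cod C t)"
    by - (rule epic_zer[OF assms(2)], use t c ea assms in simp_all)
  then show "\<exists>h. h \<in> Arr C \<and> Dom C h = Cod C c \<and> Cod C h = Cod C t \<and> h \<odot> c = t"
    using coker_desc[OF assms(1) t(1)] t c ea assms by auto
qed (use is_cokerD[OF assms(1)] epic_arr[OF assms(2)] assms in simp_all)

lemma coker_epic_cancel:
  assumes "is_coker C c (m \<odot> e)" "epic C e" "m \<in> Arr C" "Cod C e = Dom C m" shows "is_coker C c m"
proof (rule is_cokerI[OF coker_epic[OF assms(1)]])
  note c = is_cokerD[OF assms(1)] and ea = epic_arr[OF assms(2)]
  have "(c \<odot> m) \<odot> e = c \<odot> (m \<odot> e)" by (rule assoc) (use c ea assms in simp_all)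
  then show "c \<odot> m = Zer C (Dom C m) (Cod C c)"
    by - (rule epic_zer[OF assms(2)], use c ea assms in simp_all)
  fix t assume t: "t \<in> Arr C" "Dom C t = Cod C m" "t \<odot> m = Zer C (Dom C m) (Cod C t)"
  have "t \<odot> (m \<odot> e) = Zer C (Dom C m) (Cod C t) \<odot> e" by (rule reassoc[OF t(3)]) (use t ea assms in simp_all)
  then show "\<exists>h. h \<in> Arr C \<and> Dom C h = Cod C c \<and> Cod C h = Cod C t \<and> h \<odot> c = t"
    using coker_desc[OF assms(1) t(1)] t c ea assms by auto
qed (use is_cokerD[OF assms(1)] epic_arr[OF assms(2)] assms in simp_all)

text \<open>Cuts an exact complex into short exact sequences of consecutive cokernels, along which
  cofibrancy is passed from one degree to the next.\<close>

lemma syzygy: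
  assumes "exact C f g" "is_coker C c f" "is_coker C d g"
  obtains m where "short_exact C m d" "Dom C m = Cod C c" "m \<odot> c = g"
proof -
  obtain m where m: "monic C m" "Dom C m = Cod C c" "Cod C m = Cod C g" "m \<odot> c = g"
    using coker_image[OF assms(1,2)] .
  have "is_coker C d m"
    by (rule coker_epic_cancel[of d m c]) (use m assms(3) coker_epic[OF assms(2)] monic_arr[OF m(1)] in simp_all)
  then show thesis using that[OF short_exactI_coker] m by blast
qed

end

section \<open>Lifting and extension in a model structure, closure under extensions\<close>

context hmod begin

lemma op_hmod: "hmod (op_cat C) R W Q"
  by (rule hmod_op[OF hmod_axioms])

lemma lift_QW:
  assumes "short_exact C i p" "t \<in> Arr C" "Cod C t = Cod C p" "Dom C t \<in> Q" "Dom C t \<in> W" "Dom C i \<in> R"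
  shows "\<exists>h \<in> Hom C (Dom C t) (Dom C p). p \<odot> h = t"
  by (rule split_lift[OF assms(1-3)]) (use R_split assms in auto)

lemma lift_RW:
  assumes "short_exact C i p" "t \<in> Arr C" "Cod C t = Cod C p" "Dom C t \<in> Q" "Dom C i \<in> W" "Dom C i \<in> R"
  shows "\<exists>h \<in> Hom C (Dom C t) (Dom C p). p \<odot> h = t"
  by (rule split_lift[OF assms(1-3)]) (use Q_split assms in auto)

lemma extend_RW:
  assumes "short_exact C i p" "t \<in> Arr C" "Dom C t = Dom C i" "Cod C p \<in> Q" "Cod C t \<in> W" "Cod C t \<in> R"
  shows "\<exists>h \<in> Hom C (Cod C i) (Cod C t). h \<odot> i = t"
proof -
  interpret op: hmod "op_cat C" R W Q by (rule op_hmod)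
  show ?thesis using op.lift_QW[of p i t] assms by simp
qed

lemma extend_QW:
  assumes "short_exact C i p" "t \<in> Arr C" "Dom C t = Dom C i" "Cod C p \<in> Q" "Cod C p \<in> W" "Cod C t \<in> R"
  shows "\<exists>h \<in> Hom C (Cod C i) (Cod C t). h \<odot> i = t"
proof -
  interpret op: hmod "op_cat C" R W Q by (rule op_hmod)
  show ?thesis using op.lift_RW[of p i t] assms by simp
qed

text \<open>Given an extension of the middle object by a trivially fibrant one, its restriction to
  the cofibrant subobject splits. The retraction so obtained on the pullback extends along
  \<open>u\<close>, whose cokernel \<open>Cod C e\<close> is cofibrant, and the extended arrow
  retracts \<open>i\<close>.\<close>

lemma Q_ext:
  assumes "short_exact C m e" "Dom C m \<in> Q" "Cod C e \<in> Q"
  shows "Dom C e \<in> Q"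
proof (rule Q_I)
  note M = short_exactD[OF assms(1)]
  show "Dom C e \<in> Ob C" using M by simp
  fix i p assume i: "short_exact C i p" "Dom C i \<in> W" "Dom C i \<in> R" "Cod C p = Dom C e"
  note I = short_exactD[OF i(1)]
  obtain i' q u where q: "short_exact C i' q" "is_pullback C q u m p" "u \<odot> i' = i" "Dom C i' = Dom C i" "Cod C q = Dom C m"
    by (rule pull_se[OF i(1) M(1)]) (use M i in simp_all)
  note P = is_pullbackD[OF q(2)] and J = short_exactD[OF q(1)]
  have "splits C q" using Q_split[OF q(1)] q i assms by simp
  then obtain r where r: "r \<in> Arr C" "Dom C r = Cod C i'" "Cod C r = Dom C i'" "r \<odot> i' = Idn C (Dom C i')"
    using splits_retract[OF q(1)] by blast
  have "short_exact C u (e \<odot> p)"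
  proof (rule short_exactI_ker)
    show "epic C (e \<odot> p)" by (rule epic_cmp) (use M I i in simp_all)
    show "is_ker C u (e \<odot> p)"
    proof (rule is_kerI)
      show "monic C u"
      proof (rule monicI)
        fix x A assume x: "x \<in> Arr C" "Dom C x = A" "Cod C x = Dom C u" "u \<odot> x = Zer C A (Cod C u)"
        have A: "A \<in> Ob C" using x by auto
        have "m \<odot> (q \<odot> x) = p \<odot> (u \<odot> x)" by (rule assoc_eq) (use P x in simp_all)
        then have "m \<odot> (q \<odot> x) = Zer C A (Cod C m)" using x A P by simp
        then have "q \<odot> x = Zer C A (Dom C m)" by - (rule monic_zer[OF M(5)], use x P in simp_all)
        then show "x = Zer C A (Dom C u)"
          by - (rule pullback_unique[OF q(2)], use x P A in simp_all)
      qed (use P in simp)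
      have "(e \<odot> p) \<odot> u = e \<odot> (m \<odot> q)" using P M i I by simp
      also have "\<dots> = Zer C (Dom C u) (Cod C (e \<odot> p))" by (subst zer_cancel) (use P M i I in simp_all)
      finally show "(e \<odot> p) \<odot> u = Zer C (Dom C u) (Cod C (e \<odot> p))" .
      fix t assume t: "t \<in> Arr C" "Cod C t = Dom C (e \<odot> p)" "(e \<odot> p) \<odot> t = Zer C (Dom C t) (Cod C (e \<odot> p))"
      have t': "Cod C t = Dom C p" using t M I i by simp
      have "e \<odot> (p \<odot> t) = Zer C (Dom C (p \<odot> t)) (Cod C e)" using t M I i by simp
      then obtain a where a: "a \<in> Arr C" "Dom C a = Dom C (p \<odot> t)" "Cod C a = Dom C m" "m \<odot> a = p \<odot> t"
        using ker_lift[OF M(7), of "p \<odot> t"] t(1) t' I i by auto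
      obtain h where h: "h \<in> Arr C" "Dom C h = Dom C t" "Cod C h = Dom C u" "q \<odot> h = a" "u \<odot> h = t"
        by (rule pullback_lift[OF q(2) _ _ _ _ _ a(4)]) (use a t(1) t' I P in simp_all)
      then show "\<exists>h. h \<in> Arr C \<and> Dom C h = Dom C t \<and> Cod C h = Dom C u \<and> u \<odot> h = t" by blast
    qed (use P M I i in simp_all)
  qed
  then obtain r' where r': "r' \<in> Hom C (Cod C u) (Cod C r)" "r' \<odot> u = r"
    using extend_RW[of u "e \<odot> p" r] r q P M I J i assms by auto
  then have r'': "r' \<in> Arr C" "Dom C r' = Cod C u" "Cod C r' = Dom C i" using r q by (auto simp: Hom_def)
  have "r' \<odot> (u \<odot> i') = r \<odot> i'" by (rule reassoc[OF r'(2)]) (use r'' P J in simp_all)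
  then show "splits C p"
    by - (rule splitsI_retract[OF i(1), of r'], use r'' r q I P in simp_all)
qed

lemma R_ext:
  assumes "short_exact C m e" "Dom C m \<in> R" "Cod C e \<in> R"
  shows "Dom C e \<in> R"
proof -
  interpret op: hmod "op_cat C" R W Q by (rule op_hmod)
  show ?thesis using op.Q_ext[of e m] assms short_exactD(3)[OF assms(1)] by simp
qed

end

section \<open>Complexes\<close>

definition is_complex :: "('o, 'm) add_cat \<Rightarrow> ('o, 'm) resol \<Rightarrow> bool" where
  "is_complex C V \<longleftrightarrow> (\<forall>n. diff V n \<in> Hom C (obj V n) (obj V (n - 1)) \<and>
     Cmp C (diff V n) (diff V (n + 1)) = Zer C (obj V (n + 1)) (obj V (n - 1)))"

text \<open>What is left of a resolution of a cofibrant object when its augmentation is forgotten: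
  the objects are trivially cofibrant in all degrees, negative ones included. In the opposite
  category the same notion describes coresolutions of fibrant objects.\<close>

definition cofib_complex :: "('o, 'm) add_cat \<Rightarrow> 'o set \<Rightarrow> 'o set \<Rightarrow> ('o, 'm) resol \<Rightarrow> bool" where
  "cofib_complex C Q W V \<longleftrightarrow> (\<forall>n. diff V n \<in> Hom C (obj V n) (obj V (n - 1)) \<and>
     obj V n \<in> Q \<and> obj V n \<in> W \<and> exact C (diff V (n + 1)) (diff V n) \<and>
     (\<exists>c. is_coker C c (diff V n) \<and> Cod C c \<in> Q))"

definition augmented :: "('o, 'm) add_cat \<Rightarrow> 'o \<Rightarrow> ('o, 'm) resol \<Rightarrow> bool" where
  "augmented C P V \<longleftrightarrow> eps V \<in> Hom C (obj V 0) P \<and> eta V \<in> Hom C P (obj V (-1)) \<and>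
     diff V 0 = Cmp C (eta V) (eps V) \<and> epic C (eps V) \<and> monic C (eta V)"

text \<open>A coresolution is a resolution in the opposite category; the shift turns \<open>co_obj\<close> into \<open>obj\<close>.\<close>

definition dual_resol :: "('o, 'm) resol \<Rightarrow> ('o, 'm) resol" where
  "dual_resol V = \<lparr>obj = \<lambda>n. obj V (- n - 1), diff = \<lambda>n. diff V (- n), eps = eta V, eta = eps V\<rparr>"

definition dual_triple :: "'o triple \<Rightarrow> 'o triple" where
  "dual_triple M = \<lparr>Cofib = Fib M, Triv = Triv M, Fib = Cofib M\<rparr>"

lemma dual_resol_simps [simp]:
  "obj (dual_resol V) n = obj V (- n - 1)" "diff (dual_resol V) n = diff V (- n)"
  "eps (dual_resol V) = eta V" "eta (dual_resol V) = eps V"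
  by (simp_all add: dual_resol_def)

lemma dual_triple_simps [simp]:
  "Cofib (dual_triple M) = Fib M" "Triv (dual_triple M) = Triv M" "Fib (dual_triple M) = Cofib M"
  by (simp_all add: dual_triple_def)

text \<open>The index conventions match exactly, so this is an equality and not merely an
  isomorphism; results on \<open>lH\<close> thereby become results on \<open>rH\<close>.\<close>

lemma rH_op: "rH C A V = lH (op_cat C) (dual_resol V) A"
  unfolding rH_def lH_def co_obj_def co_diff_def by (simp add: fun_eq_iff algebra_simps)

lemma rH_map_op: "rH_map C A V = lH_map (op_cat C) (dual_resol V) A"
  unfolding rH_map_def lH_map_def co_obj_def co_diff_def by (simp add: fun_eq_iff algebra_simps)

context abelian_category begin

lemma cofib_complex_is_complex:
  assumes "cofib_complex C Q W V" shows "is_complex C V"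
  unfolding is_complex_def
proof (intro allI conjI)
  fix n
  show h: "diff V n \<in> Hom C (obj V n) (obj V (n - 1))" for n using assms unfolding cofib_complex_def by blast
  have "exact C (diff V (n + 1)) (diff V n)" using assms unfolding cofib_complex_def by blast
  from exact_zer[OF this] show "diff V n \<odot> diff V (n + 1) = Zer C (obj V (n + 1)) (obj V (n - 1))"
    using h[of n] h[of "n + 1"] by (simp add: Hom_def)
qed

lemma M_resolution_op:
  assumes "M_resolution C M P V" shows "M_resolution (op_cat C) (dual_triple M) P (dual_resol V)"
proof -
  note m = assms[unfolded M_resolution_def]
  have 1: "diff V n \<in> Hom C (obj V n) (obj V (n - 1))" "exact C (diff V (n + 1)) (diff V n)"
    "n \<ge> 0 \<Longrightarrow> obj V n \<in> Cofib M \<inter> Triv M" "n < 0 \<Longrightarrow> obj V n \<in> Triv M \<inter> Fib M"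
    "n \<ge> 1 \<Longrightarrow> is_ker C k (diff V n) \<Longrightarrow> Dom C k \<in> Fib M"
    "n \<le> -1 \<Longrightarrow> is_coker C c (diff V n) \<Longrightarrow> Cod C c \<in> Cofib M" for n k c using m by blast+
  have "\<forall>n. exact C (diff V (- n)) (diff V (- n - 1))" using 1(2)[of "- n - 1" for n] by simp
  moreover have "\<forall>n\<ge>0. obj V (- n - 1) \<in> Fib M \<inter> Triv M" "\<forall>n<0. obj V (- n - 1) \<in> Triv M \<inter> Cofib M"
    using 1(3,4) by auto
  moreover have "\<forall>n\<ge>1. \<forall>k. is_coker C k (diff V (- n)) \<longrightarrow> Cod C k \<in> Cofib M"
    by (intro allI impI, erule 1(6)[rotated], simp)
  moreover have "\<forall>n\<le>-1. \<forall>k. is_ker C k (diff V (- n)) \<longrightarrow> Dom C k \<in> Fib M"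
    by (intro allI impI, erule 1(5)[rotated], simp)
  ultimately show ?thesis
    unfolding M_resolution_def using m by simp
qed

end

text \<open>In positive degrees, cofibrancy of cokernels starts at \<open>P\<close>, the cokernel of
  \<open>diff V 1\<close>, and climbs by \<open>Q_ker\<close>; in degree 0 the cokernel is that of
  \<open>eta V\<close>; below, it is part of the definition. An object in negative degree is
  cofibrant as an extension of two such cokernels.\<close>

lemma (in hmod) M_resolution_cofib_complex:
  assumes "M_resolution C M P V" "Cofib M = Q" "Triv M = W" "P \<in> Q"
  shows "cofib_complex C Q W V"
proof -
  note m = assms(1)[unfolded M_resolution_def]
  have d: "diff V n \<in> Hom C (obj V n) (obj V (n - 1))" and ex: "exact C (diff V (n + 1)) (diff V n)" for n using m by blast+
  note d' = d[unfolded Hom_def, simplified]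
  have e: "eps V \<in> Hom C (obj V 0) P" "eta V \<in> Hom C P (obj V (-1))" "diff V 0 = eta V \<odot> eps V"
    "epic C (eps V)" "exact C (diff V 1) (eps V)" using m by blast+
  have up: "\<exists>c. is_coker C c (diff V (1 + int k)) \<and> Cod C c \<in> Q" for k
  proof (induct k)
    case 0
    show ?case using exact_epic_coker[OF e(5,4)] assms(4) e(1) by (auto simp: Hom_def)
  next
    case (Suc k)
    then obtain c where c: "is_coker C c (diff V (1 + int k))" "Cod C c \<in> Q" by blast
    obtain b where b: "is_coker C b (diff V (1 + int k + 1))" using has_coker d' by blast
    obtain s where s: "short_exact C s c" "Dom C s = Cod C b" using syzygy[OF ex b c(1)] by blast
    have "Dom C c = obj V (int k)" using is_cokerD(3)[OF c(1)] d'[of "1 + int k"] by simp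
    moreover have "obj V (int k) \<in> Q" using m assms by simp
    ultimately have "Cod C b \<in> Q" using Q_ker[OF s(1)] c s by simp
    then show ?case using b by (auto simp: algebra_simps)
  qed
  have ck: "\<exists>c. is_coker C c (diff V n) \<and> Cod C c \<in> Q" for n
  proof -
    consider "n \<le> -1" | "n = 0" | k where "n = 1 + int k"
      by (metis nonneg_int_cases add.commute diff_add_cancel diff_ge_0_iff_ge int_one_le_iff_zero_less not_less zero_less_imp_eq_int linorder_neqE_linordered_idom zle_diff1_eq diff_0)
    then show ?thesis
    proof cases
      case 1
      obtain c where "is_coker C c (diff V n)" using has_coker d' by blast
      then show ?thesis using m 1 assms by blast
    next
      case 2
      obtain c where c: "is_coker C c (eta V)" using has_coker e(2) by (auto simp: Hom_def)
      then have "Cod C c \<in> Q" using m assms by blast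
      moreover have "is_coker C c (diff V 0)" unfolding e(3)
        by (rule coker_cmp_epic[OF c e(4)]) (use e(1,2) in \<open>simp add: Hom_def\<close>)
      ultimately show ?thesis using 2 by blast
    next
      case 3
      then show ?thesis using up by blast
    qed
  qed
  have "obj V n \<in> Q \<and> obj V n \<in> W" for n
  proof (cases "n \<ge> 0")
    case True
    then show ?thesis using m assms by blast
  next
    case False
    then have "obj V n \<in> W" using m assms by auto
    obtain c where c: "is_coker C c (diff V (n + 1))" "Cod C c \<in> Q" using ck by blast
    obtain b where b: "is_coker C b (diff V (n + 1 + 1))" "Cod C b \<in> Q" using ck by blast
    obtain s where s: "short_exact C s c" "Dom C s = Cod C b" using syzygy[OF ex b(1) c(1)] by blast
    have "Dom C c = obj V n" using is_cokerD(3)[OF c(1)] d'[of "n + 1"] by simp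
    then have "obj V n \<in> Q" using Q_ext[OF s(1)] c b s by simp
    with \<open>obj V n \<in> W\<close> show ?thesis by blast
  qed
  then show ?thesis unfolding cofib_complex_def using d ex ck by blast
qed

lemma M_resolution_augmented: "M_resolution C M P V \<Longrightarrow> augmented C P V"
  unfolding M_resolution_def augmented_def by blast

text \<open>A cocycle factors through the cokernel of \<open>diff V (n + 1)\<close>, which embeds
  into \<open>obj V (n - 1)\<close> with cofibrant cokernel; the factor extends because
  \<open>N\<close> is trivially fibrant.\<close>

lemma (in hmod) extend_cocycle:
  assumes V: "cofib_complex C Q W V" and N: "N \<in> W" "N \<in> R"
    and h: "h \<in> Hom C (obj V n) N" "h \<odot> diff V (n + 1) = Zer C (obj V (n + 1)) N"
  shows "\<exists>s \<in> Hom C (obj V (n - 1)) N. s \<odot> diff V n = h"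
proof -
  have d: "diff V n \<in> Hom C (obj V n) (obj V (n - 1))" and ex: "exact C (diff V (n + 1)) (diff V n)" for n
    using V unfolding cofib_complex_def by blast+
  note d' = d[unfolded Hom_def, simplified]
  have h': "h \<in> Arr C" "Dom C h = obj V n" "Cod C h = N" using h by (auto simp: Hom_def)
  obtain c where c: "is_coker C c (diff V n)" "Cod C c \<in> Q" using V unfolding cofib_complex_def by blast
  obtain b where b: "is_coker C b (diff V (n + 1))" using V unfolding cofib_complex_def by blast
  obtain m where m: "short_exact C m c" "Dom C m = Cod C b" "m \<odot> b = diff V n" using syzygy[OF ex b(1) c(1)] by blast
  note B = is_cokerD[OF b] and M = short_exactD[OF m(1)]
  obtain h1 where h1: "h1 \<in> Arr C" "Dom C h1 = Cod C b" "Cod C h1 = N" "h1 \<odot> b = h"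
    using coker_desc[OF b h'(1)] h h' d'[of "n + 1"] by auto
  obtain s where s: "s \<in> Hom C (Cod C m) N" "s \<odot> m = h1"
    using extend_RW[OF m(1) h1(1)] h1 m c N by auto
  have cm: "Cod C m = obj V (n - 1)" using M is_cokerD[OF c(1)] d'[of n] by simp
  have "s \<odot> (m \<odot> b) = h1 \<odot> b" by (rule reassoc[OF s(2)]) (use s B M m in \<open>simp_all add: Hom_def\<close>)
  then show ?thesis using s h1 m cm by auto
qed

section \<open>Cohomology\<close>

locale cochain =
  fixes G :: "int \<Rightarrow> 'g monoid" and \<delta> :: "int \<Rightarrow> 'g \<Rightarrow> 'g"
  assumes G_comm: "comm_group (G n)"
    and \<delta>_hom: "\<delta> n \<in> hom (G n) (G (n + 1))"
    and \<delta>_\<delta>: "x \<in> carrier (G n) \<Longrightarrow> \<delta> (n + 1) (\<delta> n x) = \<one>\<^bsub>G (n + 1 + 1)\<^esub>"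
begin

definition cocycles :: "int \<Rightarrow> 'g set" where
  "cocycles n = kernel (G n) (G (n + 1)) (\<delta> n)"

definition cls :: "int \<Rightarrow> 'g \<Rightarrow> 'g set" where
  "cls n x = boundaries G \<delta> n #>\<^bsub>G n\<^esub> x"

lemma G_group: "group (G n)"
  using G_comm comm_group.axioms(2) by blast

lemma group_hom_\<delta>: "group_hom (G n) (G (n + 1)) (\<delta> n)"
  using G_group \<delta>_hom by (intro group_hom.intro group_hom_axioms.intro)

lemma cocycles_subgroup: "subgroup (cocycles n) (G n)"
  unfolding cocycles_def by (rule group_hom.subgroup_kernel[OF group_hom_\<delta>])

lemma boundaries_subgroup: "subgroup (boundaries G \<delta> n) (G n)"
  using group_hom.img_is_subgroup[OF group_hom_\<delta>[of "n - 1"]] unfolding boundaries_def by simp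

lemma boundaries_cocycles: "boundaries G \<delta> n \<subseteq> cocycles n"
proof
  fix y assume "y \<in> boundaries G \<delta> n"
  then obtain x where x: "x \<in> carrier (G (n - 1))" "y = \<delta> (n - 1) x" by (auto simp: boundaries_def)
  then have "y \<in> carrier (G n)" using hom_in_carrier[OF \<delta>_hom[of "n - 1"]] by simp
  then show "y \<in> cocycles n" using \<delta>_\<delta>[OF x(1)] x(2) by (simp add: cocycles_def kernel_def)
qed

lemma cohomology_eq: "cohomology G \<delta> n = (G n)\<lparr>carrier := cocycles n\<rparr> Mod boundaries G \<delta> n"
  unfolding cohomology_def cocycles_def ..

lemma cocycles_comm_group: "comm_group ((G n)\<lparr>carrier := cocycles n\<rparr>)"
proof (rule group.group_comm_groupI)
  interpret comm_group "G n" by (rule G_comm)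
  show "group ((G n)\<lparr>carrier := cocycles n\<rparr>)" by (rule subgroup_imp_group[OF cocycles_subgroup])
  fix x y assume "x \<in> carrier ((G n)\<lparr>carrier := cocycles n\<rparr>)" "y \<in> carrier ((G n)\<lparr>carrier := cocycles n\<rparr>)"
  then show "x \<otimes>\<^bsub>(G n)\<lparr>carrier := cocycles n\<rparr>\<^esub> y = y \<otimes>\<^bsub>(G n)\<lparr>carrier := cocycles n\<rparr>\<^esub> x"
    using subgroup.subset[OF cocycles_subgroup[of n]] m_comm by auto
qed

lemma boundaries_subgroup': "subgroup (boundaries G \<delta> n) ((G n)\<lparr>carrier := cocycles n\<rparr>)"
  using group.subgroup_incl[OF G_group boundaries_subgroup cocycles_subgroup boundaries_cocycles] .

lemma cohomology_comm_group: "comm_group (cohomology G \<delta> n)"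
  unfolding cohomology_eq by (rule comm_group.abelian_FactGroup[OF cocycles_comm_group boundaries_subgroup'])

lemma carrier_cohomology: "carrier (cohomology G \<delta> n) = cls n ` cocycles n"
  unfolding cohomology_eq FactGroup_def RCOSETS_def cls_def by (auto simp: r_coset_def)

lemma cls_mult:
  assumes "x \<in> cocycles n" "y \<in> cocycles n"
  shows "cls n x \<otimes>\<^bsub>cohomology G \<delta> n\<^esub> cls n y = cls n (x \<otimes>\<^bsub>G n\<^esub> y)"
proof -
  let ?Z = "(G n)\<lparr>carrier := cocycles n\<rparr>"
  have "normal (boundaries G \<delta> n) ?Z"
    using comm_group.subgroup_imp_normal[OF cocycles_comm_group boundaries_subgroup'] .
  from normal.rcos_sum[OF this, of x y] show ?thesis
    using assms unfolding cohomology_eq FactGroup_def cls_def by (simp add: r_coset_def set_mult_def)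
qed

lemma cls_eq_iff:
  assumes "x \<in> carrier (G n)" "y \<in> carrier (G n)"
  shows "cls n x = cls n y \<longleftrightarrow> (\<exists>b \<in> boundaries G \<delta> n. x = b \<otimes>\<^bsub>G n\<^esub> y)"
proof -
  interpret group "G n" by (rule G_group)
  show ?thesis
  proof
    assume "cls n x = cls n y"
    then have "x \<in> cls n y" unfolding cls_def using rcos_self[OF assms(1) boundaries_subgroup] by simp
    then show "\<exists>b \<in> boundaries G \<delta> n. x = b \<otimes>\<^bsub>G n\<^esub> y" unfolding cls_def r_coset_def by auto
  next
    assume "\<exists>b \<in> boundaries G \<delta> n. x = b \<otimes>\<^bsub>G n\<^esub> y"
    then have "x \<in> boundaries G \<delta> n #>\<^bsub>G n\<^esub> y" unfolding r_coset_def by auto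
    then show "cls n x = cls n y" unfolding cls_def
      using repr_independence[OF _ assms(2) boundaries_subgroup] by simp
  qed
qed

lemma one_cohomology: "\<one>\<^bsub>cohomology G \<delta> n\<^esub> = cls n \<one>\<^bsub>G n\<^esub>"
proof -
  interpret group "G n" by (rule G_group)
  show ?thesis unfolding cohomology_eq FactGroup_def cls_def
    using coset_mult_one[OF subgroup.subset[OF boundaries_subgroup]] by simp
qed

end

section \<open>Classes in the cohomology of Hom complexes\<close>

definition cocycle :: "('o, 'm) add_cat \<Rightarrow> ('o, 'm) resol \<Rightarrow> 'o \<Rightarrow> int \<Rightarrow> 'm \<Rightarrow> bool" where
  "cocycle C V B n h \<longleftrightarrow> h \<in> Hom C (obj V n) B \<and> Cmp C h (diff V (n + 1)) = Zer C (obj V (n + 1)) B"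

definition coh_class :: "('o, 'm) add_cat \<Rightarrow> ('o, 'm) resol \<Rightarrow> 'o \<Rightarrow> int \<Rightarrow> 'm \<Rightarrow> 'm set" where
  "coh_class C V B n h = boundaries (\<lambda>n. hom_group C (obj V n) B) (\<lambda>n h. Cmp C h (diff V (n + 1))) n
     #>\<^bsub>hom_group C (obj V n) B\<^esub> h"

lemma hom_group_simps [simp]:
  "carrier (hom_group C A B) = Hom C A B" "f \<otimes>\<^bsub>hom_group C A B\<^esub> g = Add C f g" "\<one>\<^bsub>hom_group C A B\<^esub> = Zer C A B"
  by (simp_all add: hom_group_def)

lemma is_complexD:
  assumes "is_complex C V"
  shows "diff V n \<in> Arr C" "Dom C (diff V n) = obj V n" "Cod C (diff V n) = obj V (n - 1)"
    "Cmp C (diff V n) (diff V (n + 1)) = Zer C (obj V (n + 1)) (obj V (n - 1))"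
  using assms unfolding is_complex_def Hom_def by auto

context preadditive_category begin

lemma complex_ob [simp]: "is_complex C V \<Longrightarrow> obj V n \<in> Ob C"
  using is_complexD[of C V n] ob(1)[of "diff V n"] by simp

lemma complex_zer:
  assumes "is_complex C V"
  shows "diff V (n + 1) \<odot> diff V (n + 1 + 1) = Zer C (obj V (n + 1 + 1)) (obj V n)"
  using is_complexD(4)[OF assms, of "n + 1"] by simp

lemma hom_cochain:
  assumes V: "is_complex C V" and B: "B \<in> Ob C"
  shows "cochain (\<lambda>n. hom_group C (obj V n) B) (\<lambda>n h. h \<odot> diff V (n + 1))"
proof (rule cochain.intro)
  fix n
  show "comm_group (hom_group C (obj V n) B)" using hom_comm_group V B by simp
  show "(\<lambda>h. h \<odot> diff V (n + 1)) \<in> hom (hom_group C (obj V n) B) (hom_group C (obj V (n + 1)) B)"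
    using is_complexD[OF V, of "n + 1"] by (auto simp: hom_def Hom_def)
  fix x assume "x \<in> carrier (hom_group C (obj V n) B)"
  then show "(x \<odot> diff V (n + 1)) \<odot> diff V (n + 1 + 1) = \<one>\<^bsub>hom_group C (obj V (n + 1 + 1)) B\<^esub>"
    using complex_zer[OF V, of n] is_complexD(1-3)[OF V, of "n + 1"] is_complexD(1-3)[OF V, of "n + 1 + 1"] V B
    by (simp add: Hom_def add.commute)
qed

context
  fixes V :: "('a, 'b) resol" and B :: 'a
  assumes V: "is_complex C V" and B: "B \<in> Ob C"
begin

interpretation cc: cochain "\<lambda>n. hom_group C (obj V n) B" "\<lambda>n h. h \<odot> diff V (n + 1)"
  by (rule hom_cochain[OF V B])

lemma coh_class_cls: "coh_class C V B n h = cc.cls n h"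
  by (simp add: coh_class_def cc.cls_def)

lemma cocycle_iff: "cocycle C V B n h \<longleftrightarrow> h \<in> cc.cocycles n"
  by (auto simp: cocycle_def cc.cocycles_def kernel_def)

lemma lH_comm_group: "comm_group (lH C V B n)"
  unfolding lH_def by (rule cc.cohomology_comm_group)

lemma carrier_lH: "carrier (lH C V B n) = {coh_class C V B n h | h. cocycle C V B n h}"
  unfolding lH_def cc.carrier_cohomology coh_class_cls cocycle_iff by auto

lemma coh_class_add:
  "cocycle C V B n h \<Longrightarrow> cocycle C V B n h' \<Longrightarrow>
    coh_class C V B n h \<otimes>\<^bsub>lH C V B n\<^esub> coh_class C V B n h' = coh_class C V B n (Add C h h')"
  using cc.cls_mult[of h n h'] unfolding lH_def coh_class_cls cocycle_iff by simp

lemma boundaries_hom: "b \<in> boundaries (\<lambda>n. hom_group C (obj V n) B) (\<lambda>n h. h \<odot> diff V (n + 1)) n \<longleftrightarrow>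
    (\<exists>s \<in> Hom C (obj V (n - 1)) B. b = s \<odot> diff V n)"
  by (auto simp: boundaries_def)

lemma coh_class_eq_iff:
  assumes "h \<in> Hom C (obj V n) B" "h' \<in> Hom C (obj V n) B"
  shows "coh_class C V B n h = coh_class C V B n h' \<longleftrightarrow> (\<exists>s \<in> Hom C (obj V (n - 1)) B. sub C h h' = s \<odot> diff V n)"
proof -
  note d = is_complexD(1-3)[OF V, of n]
  have "sub C h h' = s \<odot> diff V n \<longleftrightarrow> h = Add C (s \<odot> diff V n) h'" if "s \<in> Hom C (obj V (n - 1)) B" for s
  proof
    assume "sub C h h' = s \<odot> diff V n"
    then have "Add C (sub C h h') h' = Add C (s \<odot> diff V n) h'" by simp
    then show "h = Add C (s \<odot> diff V n) h'" using assms by (simp add: Hom_def)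
  qed (use assms d that in \<open>simp add: Hom_def\<close>)
  then show ?thesis
    using cc.cls_eq_iff[of h n h'] assms boundaries_hom[of _ n] unfolding coh_class_cls by auto
qed

lemma one_lH: "\<one>\<^bsub>lH C V B n\<^esub> = coh_class C V B n (Zer C (obj V n) B)"
  using cc.one_cohomology[of n] unfolding lH_def coh_class_cls by simp

lemma cocycle_add: "cocycle C V B n h \<Longrightarrow> cocycle C V B n h' \<Longrightarrow> cocycle C V B n (Add C h h')"
  unfolding cocycle_def using V B is_complexD[OF V, of "n + 1"] by (simp add: Hom_def)

lemma cocycle_sub: "cocycle C V B n h \<Longrightarrow> cocycle C V B n h' \<Longrightarrow> cocycle C V B n (sub C h h')"
  unfolding cocycle_def using V B is_complexD[OF V, of "n + 1"] by (simp add: Hom_def)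

lemma coh_class_one_iff:
  assumes "h \<in> Hom C (obj V n) B"
  shows "coh_class C V B n h = \<one>\<^bsub>lH C V B n\<^esub> \<longleftrightarrow> (\<exists>s \<in> Hom C (obj V (n - 1)) B. h = s \<odot> diff V n)"
  unfolding one_lH using coh_class_eq_iff[OF assms, of "Zer C (obj V n) B"] V B assms
  by (simp add: Hom_def)

lemma coh_class_sub:
  assumes "cocycle C V B n h" "cocycle C V B n h'"
  shows "coh_class C V B n (sub C h h') = coh_class C V B n h \<otimes>\<^bsub>lH C V B n\<^esub> inv\<^bsub>lH C V B n\<^esub> coh_class C V B n h'"
proof -
  interpret comm_group "lH C V B n" by (rule lH_comm_group)
  have c: "coh_class C V B n x \<in> carrier (lH C V B n)" if "cocycle C V B n x" for x
    using that carrier_lH by blast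
  have "coh_class C V B n (sub C h h') \<otimes>\<^bsub>lH C V B n\<^esub> coh_class C V B n h' = coh_class C V B n h"
    using coh_class_add[OF cocycle_sub[OF assms] assms(2)] assms by (simp add: cocycle_def Hom_def)
  then show ?thesis using inv_solve_right[of "coh_class C V B n (sub C h h')" "coh_class C V B n h" "coh_class C V B n h'"]
    c[OF assms(1)] c[OF assms(2)] c[OF cocycle_sub[OF assms]] by simp
qed

lemma coh_class_add_boundary:
  assumes "h \<in> Hom C (obj V n) B" "s \<in> Hom C (obj V (n - 1)) B"
  shows "coh_class C V B n (Add C (s \<odot> diff V n) h) = coh_class C V B n h"
  by (subst coh_class_eq_iff) (use assms is_complexD(1-3)[OF V, of n] in \<open>auto simp: Hom_def intro!: bexI[of _ s]\<close>)

end

text \<open>\<open>cohomology_map\<close> takes a union over all representatives; it collapses to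
  one class because \<open>\<phi>\<close> is additive and carries boundaries to boundaries.\<close>

lemma lH_map_coh_class:
  assumes V: "is_complex C V" "B \<in> Ob C" and V': "is_complex C V'" "B' \<in> Ob C"
    and hom: "\<And>h. h \<in> Hom C (obj V n) B \<Longrightarrow> \<phi> h \<in> Hom C (obj V' n) B'"
    and add: "\<And>h h'. h \<in> Hom C (obj V n) B \<Longrightarrow> h' \<in> Hom C (obj V n) B \<Longrightarrow> \<phi> (Add C h h') = Add C (\<phi> h) (\<phi> h')"
    and bd: "\<And>s. s \<in> Hom C (obj V (n - 1)) B \<Longrightarrow> \<exists>s' \<in> Hom C (obj V' (n - 1)) B'. \<phi> (s \<odot> diff V n) = s' \<odot> diff V' n"
    and h: "h \<in> Hom C (obj V n) B"
  shows "lH_map C V' B' n \<phi> (coh_class C V B n h) = coh_class C V' B' n (\<phi> h)"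
proof -
  note d = is_complexD(1-3)[OF V(1), of n]
  have "coh_class C V' B' n (\<phi> x) = coh_class C V' B' n (\<phi> h)" if x: "x \<in> coh_class C V B n h" for x
  proof -
    obtain s where s: "s \<in> Hom C (obj V (n - 1)) B" "x = Add C (s \<odot> diff V n) h"
      using x unfolding coh_class_def r_coset_def by (auto simp: boundaries_hom[OF V])
    obtain s' where s': "s' \<in> Hom C (obj V' (n - 1)) B'" "\<phi> (s \<odot> diff V n) = s' \<odot> diff V' n" using bd[OF s(1)] by blast
    have "\<phi> x = Add C (s' \<odot> diff V' n) (\<phi> h)"
      unfolding s(2) s'(2)[symmetric] using s(1) d h by (intro add) (auto simp: Hom_def)
    then show ?thesis using coh_class_add_boundary[OF V' hom[OF h] s'(1)] by simp
  qed
  moreover have "h \<in> coh_class C V B n h"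
  proof -
    have "Add C (Zer C (obj V (n - 1)) B \<odot> diff V n) h = h" "Zer C (obj V (n - 1)) B \<in> Hom C (obj V (n - 1)) B"
      using V d h by (auto simp: Hom_def)
    then have "Zer C (obj V (n - 1)) B \<odot> diff V n \<in> boundaries (\<lambda>n. hom_group C (obj V n) B) (\<lambda>n h. h \<odot> diff V (n + 1)) n"
      "h = Add C (Zer C (obj V (n - 1)) B \<odot> diff V n) h"
      by (auto simp: boundaries_hom[OF V])
    then show ?thesis unfolding coh_class_def r_coset_def by auto
  qed
  ultimately show ?thesis unfolding lH_map_def cohomology_map_def coh_class_def[symmetric] by blast
qed

end

section \<open>Chain maps\<close>

text \<open>Two sequences indexed by natural numbers, one chosen upwards and one downwards from
  \<open>k\<close>, are glued at their common value \<open>x\<close>.\<close>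

lemma int_dependent_choice:
  fixes P :: "int \<Rightarrow> 'x \<Rightarrow> bool"
  assumes "P k x" and up: "\<And>m x. P m x \<Longrightarrow> \<exists>y. P (m + 1) y \<and> S m x y"
    and down: "\<And>m y. P (m + 1) y \<Longrightarrow> \<exists>x. P m x \<and> S m x y"
  shows "\<exists>f. f k = x \<and> (\<forall>m. P m (f m) \<and> S m (f m) (f (m + 1)))"
proof -
  have "\<exists>u. \<forall>n. (P (k + int n) (u n) \<and> (n = 0 \<longrightarrow> u n = x)) \<and> S (k + int n) (u n) (u (Suc n))"
  proof (rule dependent_nat_choice)
    fix y n assume "P (k + int n) y \<and> (n = 0 \<longrightarrow> y = x)"
    then obtain z where "P (k + int n + 1) z" "S (k + int n) y z" using up by blast
    moreover have "k + int n + 1 = k + int (Suc n)" by simp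
    ultimately show "\<exists>z. (P (k + int (Suc n)) z \<and> (Suc n = 0 \<longrightarrow> z = x)) \<and> S (k + int n) y z" by auto
  qed (use assms(1) in auto)
  then obtain u where u: "\<And>n. P (k + int n) (u n)" "u 0 = x" "\<And>n. S (k + int n) (u n) (u (Suc n))" by blast
  have "\<exists>v. \<forall>n. (P (k - int n) (v n) \<and> (n = 0 \<longrightarrow> v n = x)) \<and> S (k - int (Suc n)) (v (Suc n)) (v n)"
  proof (rule dependent_nat_choice)
    fix y n assume "P (k - int n) y \<and> (n = 0 \<longrightarrow> y = x)"
    then have "P (k - int (Suc n) + 1) y" by simp
    then show "\<exists>z. (P (k - int (Suc n)) z \<and> (Suc n = 0 \<longrightarrow> z = x)) \<and> S (k - int (Suc n)) z y" using down by blast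
  qed (use assms(1) in auto)
  then obtain v where v: "\<And>n. P (k - int n) (v n)" "v 0 = x" "\<And>n. S (k - int (Suc n)) (v (Suc n)) (v n)" by blast
  define f where "f m = (if m \<ge> k then u (nat (m - k)) else v (nat (k - m)))" for m
  have "P m (f m)" for m
    using u(1)[of "nat (m - k)"] v(1)[of "nat (k - m)"] by (cases "k \<le> m") (simp_all add: f_def)
  moreover have "S m (f m) (f (m + 1))" for m
  proof (cases "m \<ge> k")
    case True
    then have "nat (m + 1 - k) = Suc (nat (m - k))" by linarith
    then show ?thesis using u(3)[of "nat (m - k)"] True by (simp add: f_def)
  next
    case False
    \<comment> \<open>\<open>m\<close> lies \<open>n + 1\<close> steps below \<open>k\<close>. For
      \<open>n = 0\<close> the next value is taken from the upward sequence, which agrees with the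
      downward one at the seam.\<close>
    define n where "n = nat (k - m - 1)"
    have n: "m = k - int (Suc n)" "nat (k - m) = Suc n" using False by (auto simp: n_def)
    have "f (m + 1) = v n"
    proof (cases n)
      case 0
      then show ?thesis using n u(2) v(2) by (simp add: f_def)
    next
      case (Suc l)
      then have "nat (k - (m + 1)) = n" "\<not> k \<le> m + 1" using n by auto
      then show ?thesis by (simp add: f_def)
    qed
    then show ?thesis using v(3)[of n] n False by (simp add: f_def)
  qed
  ultimately show ?thesis using u(2) by (intro exI[of _ f]) (simp add: f_def)
qed

lemma int_up_down:
  fixes P :: "int \<Rightarrow> bool"
  assumes "P k" "\<And>m. P m \<Longrightarrow> P (m + 1)" "\<And>m. P (m + 1) \<Longrightarrow> P m"
  shows "P m"
  using int_induct[of P k m] assms by (metis diff_add_cancel)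

text \<open>The two exactness assumptions say that \<open>Hom(X\<^sub>m, Y)\<close> and \<open>Hom(X, Y\<^sub>m)\<close> are exact.\<close>

locale hom_exact = preadditive_category +
  fixes X Y :: "int \<Rightarrow> 'a" and dx dy :: "int \<Rightarrow> 'b"
  assumes dx: "dx m \<in> Hom C (X m) (X (m - 1))" and dy: "dy m \<in> Hom C (Y m) (Y (m - 1))"
    and dx_dx: "dx m \<odot> dx (m + 1) = Zer C (X (m + 1)) (X (m - 1))"
    and dy_dy: "dy m \<odot> dy (m + 1) = Zer C (Y (m + 1)) (Y (m - 1))"
    and lift: "\<lbrakk>t \<in> Hom C (X m) (Y l); dy l \<odot> t = Zer C (X m) (Y (l - 1))\<rbrakk>
        \<Longrightarrow> \<exists>s \<in> Hom C (X m) (Y (l + 1)). dy (l + 1) \<odot> s = t"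
    and ext: "\<lbrakk>t \<in> Hom C (X m) (Y l); t \<odot> dx (m + 1) = Zer C (X (m + 1)) (Y l)\<rbrakk>
        \<Longrightarrow> \<exists>s \<in> Hom C (X (m - 1)) (Y l). s \<odot> dx m = t"
begin

lemma dx' [simp]: "dx m \<in> Arr C" "Dom C (dx m) = X m" "Cod C (dx m) = X (m - 1)"
  using dx[of m] by (auto simp: Hom_def)

lemma dy' [simp]: "dy m \<in> Arr C" "Dom C (dy m) = Y m" "Cod C (dy m) = Y (m - 1)"
  using dy[of m] by (auto simp: Hom_def)

lemma obs [simp]: "X m \<in> Ob C" "Y m \<in> Ob C"
  using ob(1)[OF dx'(1)[of m]] ob(1)[OF dy'(1)[of m]] by simp_all

definition chain_map :: "(int \<Rightarrow> 'b) \<Rightarrow> bool" where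
  "chain_map \<xi> \<longleftrightarrow> (\<forall>m. \<xi> m \<in> Hom C (X m) (Y m) \<and> dy m \<odot> \<xi> m = \<xi> (m - 1) \<odot> dx m)"

lemma dx_zer: assumes "t \<in> Arr C" "Dom C t = X (m - 1)"
  shows "t \<odot> (dx m \<odot> dx (m + 1)) = Zer C (X (m + 1)) (Cod C t)"
  unfolding dx_dx using assms by simp

lemma dy_zer: assumes "t \<in> Arr C" "Cod C t = Y (m + 1)"
  shows "dy m \<odot> (dy (m + 1) \<odot> t) = Zer C (Dom C t) (Y (m - 1))"
  by (subst zer_cancel) (use assms dy_dy in simp_all)

text \<open>The vanishing of \<open>dy k \<odot> (s \<odot> dx (k + 1))\<close> is the invariant: it
  makes \<open>s \<odot> dx (k + 1)\<close> a cycle that lifts to the next higher degree and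
  \<open>dy k \<odot> s\<close> a cocycle that extends to the next lower one, and both steps
  reproduce it.\<close>

lemma chain_map_exists:
  assumes s: "s \<in> Hom C (X k) (Y k)" "dy k \<odot> (s \<odot> dx (k + 1)) = Zer C (X (k + 1)) (Y (k - 1))"
  obtains \<xi> where "chain_map \<xi>" "\<xi> k = s"
proof -
  let ?P = "\<lambda>m s. s \<in> Hom C (X m) (Y m) \<and> dy m \<odot> (s \<odot> dx (m + 1)) = Zer C (X (m + 1)) (Y (m - 1))"
  have "\<exists>f. f k = s \<and> (\<forall>m. ?P m (f m) \<and> dy (m + 1) \<odot> f (m + 1) = f m \<odot> dx (m + 1))"
  proof (rule int_dependent_choice)
    show "?P k s" using s by blast
    fix m x assume x: "?P m x"
    have t: "x \<odot> dx (m + 1) \<in> Hom C (X (m + 1)) (Y m)" using x by (simp add: Hom_def)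
    obtain y where y: "y \<in> Hom C (X (m + 1)) (Y (m + 1))" "dy (m + 1) \<odot> y = x \<odot> dx (m + 1)"
      using lift[OF t] x by blast
    have "dy (m + 1) \<odot> (y \<odot> dx (m + 1 + 1)) = (x \<odot> dx (m + 1)) \<odot> dx (m + 1 + 1)"
      by (rule reassoc[OF y(2)]) (use y in \<open>simp_all add: Hom_def add.commute\<close>)
    also have "\<dots> = Zer C (X (m + 1 + 1)) (Y (m + 1 - 1))"
      using x dx_zer[of x "m + 1"] by (simp add: Hom_def add.commute)
    finally show "\<exists>y. ?P (m + 1) y \<and> dy (m + 1) \<odot> y = x \<odot> dx (m + 1)" using y by blast
  next
    fix m y assume y: "?P (m + 1) y"
    have t: "dy (m + 1) \<odot> y \<in> Hom C (X (m + 1)) (Y m)" using y by (simp add: Hom_def)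
    have "(dy (m + 1) \<odot> y) \<odot> dx (m + 1 + 1) = Zer C (X (m + 1 + 1)) (Y m)"
      using y by (simp add: Hom_def add.commute)
    then obtain x where x: "x \<in> Hom C (X m) (Y m)" "x \<odot> dx (m + 1) = dy (m + 1) \<odot> y"
      using ext[OF t] by auto
    have "dy m \<odot> (x \<odot> dx (m + 1)) = Zer C (X (m + 1)) (Y (m - 1))"
      unfolding x(2) using y by (subst dy_zer) (simp_all add: Hom_def)
    then show "\<exists>x. ?P m x \<and> dy (m + 1) \<odot> y = x \<odot> dx (m + 1)" using x by metis
  qed
  then obtain f where f: "f k = s" "\<And>m. ?P m (f m)" "\<And>m. dy (m + 1) \<odot> f (m + 1) = f m \<odot> dx (m + 1)" by blast
  have "chain_map f" unfolding chain_map_def using f(2) f(3)[of "m - 1" for m] by simp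
  then show thesis using that f(1) by blast
qed

text \<open>Weaker than a null-homotopy: \<open>h\<close> and \<open>h'\<close> concern degree
  \<open>m\<close> alone and need not fit together with those of other degrees. For chain maps the
  condition nevertheless spreads to all degrees.\<close>

definition null_at :: "(int \<Rightarrow> 'b) \<Rightarrow> int \<Rightarrow> bool" where
  "null_at \<xi> m \<longleftrightarrow> (\<exists>h \<in> Hom C (X m) (Y (m + 1)). \<exists>h' \<in> Hom C (X (m - 1)) (Y m).
     \<xi> m = Add C (dy (m + 1) \<odot> h) (h' \<odot> dx m))"

lemma null_up:
  assumes \<xi>: "chain_map \<xi>" and n: "null_at \<xi> m" shows "null_at \<xi> (m + 1)"
proof -
  have x: "\<xi> m \<in> Hom C (X m) (Y m)" "\<xi> (m + 1) \<in> Hom C (X (m + 1)) (Y (m + 1))"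
    "dy (m + 1) \<odot> \<xi> (m + 1) = \<xi> m \<odot> dx (m + 1)" for m
    using \<xi> unfolding chain_map_def by (metis add_diff_cancel_right')+
  obtain h h' where h: "h \<in> Hom C (X m) (Y (m + 1))" "h' \<in> Hom C (X (m - 1)) (Y m)"
    "\<xi> m = Add C (dy (m + 1) \<odot> h) (h' \<odot> dx m)" using n unfolding null_at_def by blast
  \<comment> \<open>\<open>h\<close> is kept and becomes the second half of the homotopy in degree
    \<open>m + 1\<close>; what remains of the chain map is a cycle and lifts.\<close>
  define t where "t = sub C (\<xi> (m + 1)) (h \<odot> dx (m + 1))"
  have t: "t \<in> Hom C (X (m + 1)) (Y (m + 1))" unfolding t_def using x(2)[of m] h(1) by (simp add: Hom_def)
  have "\<xi> m \<odot> dx (m + 1) = Add C (dy (m + 1) \<odot> (h \<odot> dx (m + 1))) (h' \<odot> (dx m \<odot> dx (m + 1)))"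
    unfolding h(3) using h(1,2) by (simp add: Hom_def)
  also have "\<dots> = dy (m + 1) \<odot> (h \<odot> dx (m + 1))"
    using h(1,2) by (subst dx_zer) (simp_all add: Hom_def)
  finally have e: "\<xi> m \<odot> dx (m + 1) = dy (m + 1) \<odot> (h \<odot> dx (m + 1))" .
  have "dy (m + 1) \<odot> t = sub C (dy (m + 1) \<odot> \<xi> (m + 1)) (dy (m + 1) \<odot> (h \<odot> dx (m + 1)))"
    unfolding t_def using x(2)[of m] h(1) by (simp add: Hom_def)
  also have "\<dots> = Zer C (X (m + 1)) (Y (m + 1 - 1))" unfolding x(3) e using h(1) by (simp add: Hom_def)
  finally obtain g where g: "g \<in> Hom C (X (m + 1)) (Y (m + 1 + 1))" "dy (m + 1 + 1) \<odot> g = t"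
    using lift[OF t] by blast
  have "\<xi> (m + 1) = Add C (dy (m + 1 + 1) \<odot> g) (h \<odot> dx (m + 1))"
    unfolding g(2) t_def using x(2)[of m] h(1) by (simp add: Hom_def)
  then show ?thesis unfolding null_at_def using g h by auto
qed

lemma null_down:
  assumes \<xi>: "chain_map \<xi>" and n: "null_at \<xi> (m + 1)" shows "null_at \<xi> m"
proof -
  have x: "\<xi> m \<in> Hom C (X m) (Y m)" "\<xi> (m + 1) \<in> Hom C (X (m + 1)) (Y (m + 1))"
    "dy (m + 1) \<odot> \<xi> (m + 1) = \<xi> m \<odot> dx (m + 1)"
    using \<xi> unfolding chain_map_def by (metis add_diff_cancel_right')+
  obtain h h' where h: "h \<in> Hom C (X (m + 1)) (Y (m + 1 + 1))" "h' \<in> Hom C (X m) (Y (m + 1))"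
    "\<xi> (m + 1) = Add C (dy (m + 1 + 1) \<odot> h) (h' \<odot> dx (m + 1))" using n unfolding null_at_def by auto
  define t where "t = sub C (\<xi> m) (dy (m + 1) \<odot> h')"
  have t: "t \<in> Hom C (X m) (Y m)" unfolding t_def using x(1) h(2) by (simp add: Hom_def)
  have "dy (m + 1) \<odot> \<xi> (m + 1) = Add C (dy (m + 1) \<odot> (dy (m + 1 + 1) \<odot> h)) (dy (m + 1) \<odot> (h' \<odot> dx (m + 1)))"
    unfolding h(3) using h(1,2) by (simp add: Hom_def add.commute)
  also have "\<dots> = dy (m + 1) \<odot> (h' \<odot> dx (m + 1))"
    using h(1,2) by (subst dy_zer) (simp_all add: Hom_def)
  finally have e: "dy (m + 1) \<odot> \<xi> (m + 1) = dy (m + 1) \<odot> (h' \<odot> dx (m + 1))" .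
  have "t \<odot> dx (m + 1) = sub C (\<xi> m \<odot> dx (m + 1)) (dy (m + 1) \<odot> (h' \<odot> dx (m + 1)))"
    unfolding t_def using x(1) h(2) by (simp add: Hom_def)
  also have "\<dots> = Zer C (X (m + 1)) (Y m)" unfolding x(3)[symmetric] e using h(2) by (simp add: Hom_def)
  finally obtain g where g: "g \<in> Hom C (X (m - 1)) (Y m)" "g \<odot> dx m = t"
    using ext[OF t] by blast
  have "\<xi> m = Add C (dy (m + 1) \<odot> h') (g \<odot> dx m)"
    unfolding g(2) t_def using x(1) h(2) by (simp add: Hom_def)
  then show ?thesis unfolding null_at_def using g h by blast
qed

lemma null_all:
  assumes "chain_map \<xi>" "null_at \<xi> k" shows "null_at \<xi> m"
  by (rule int_up_down[of "null_at \<xi>" k]) (use assms null_up null_down in blast)+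

lemma chain_map_sub:
  assumes "chain_map \<xi>" "chain_map \<xi>'" shows "chain_map (\<lambda>m. sub C (\<xi> m) (\<xi>' m))"
  unfolding chain_map_def
proof (intro allI conjI)
  fix m
  have x: "\<xi> m \<in> Hom C (X m) (Y m)" "\<xi>' m \<in> Hom C (X m) (Y m)" "\<xi> (m - 1) \<in> Hom C (X (m - 1)) (Y (m - 1))"
    "\<xi>' (m - 1) \<in> Hom C (X (m - 1)) (Y (m - 1))"
    "dy m \<odot> \<xi> m = \<xi> (m - 1) \<odot> dx m" "dy m \<odot> \<xi>' m = \<xi>' (m - 1) \<odot> dx m"
    using assms unfolding chain_map_def by auto
  show "sub C (\<xi> m) (\<xi>' m) \<in> Hom C (X m) (Y m)" using x by (simp add: sub_hom)
  show "dy m \<odot> sub C (\<xi> m) (\<xi>' m) = sub C (\<xi> (m - 1)) (\<xi>' (m - 1)) \<odot> dx m" using x by (simp add: Hom_def)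
qed

end

section \<open>Comparison of resolutions and coresolutions\<close>

text \<open>A total relation closed under division is a subgroup of the product; if it relates the
  unit only to the unit, it is the graph of a homomorphism. Maps on cohomology are built this way so
  that no representatives have to be chosen.\<close>

lemma functional_relation_hom:
  assumes G: "group G" and H: "group H"
    and carr: "\<And>x y. Rel x y \<Longrightarrow> x \<in> carrier G \<and> y \<in> carrier H"
    and total: "\<And>x. x \<in> carrier G \<Longrightarrow> \<exists>y. Rel x y"
    and div: "\<And>x y x' y'. Rel x y \<Longrightarrow> Rel x' y' \<Longrightarrow> Rel (x \<otimes>\<^bsub>G\<^esub> inv\<^bsub>G\<^esub> x') (y \<otimes>\<^bsub>H\<^esub> inv\<^bsub>H\<^esub> y')"
    and one: "\<And>y. Rel \<one>\<^bsub>G\<^esub> y \<Longrightarrow> y = \<one>\<^bsub>H\<^esub>"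
  obtains f where "f \<in> hom G H" "\<And>x. x \<in> carrier G \<Longrightarrow> Rel x (f x)" "\<And>x y. Rel x y \<Longrightarrow> f x = y"
proof -
  interpret G: group G by fact
  interpret H: group H by fact
  have uniq: "y = y'" if "Rel x y" "Rel x y'" for x y y'
  proof -
    have "y \<otimes>\<^bsub>H\<^esub> inv\<^bsub>H\<^esub> y' = \<one>\<^bsub>H\<^esub>" using one div[OF that] carr[OF that(1)] by simp
    then show ?thesis using carr[OF that(1)] carr[OF that(2)]
      by (metis H.inv_closed H.inv_equality H.inv_inv)
  qed
  define f where "f x = (THE y. Rel x y)" for x
  have f: "f x = y" if "Rel x y" for x y
    unfolding f_def
  proof (rule the_equality)
    show "Rel x y" by fact
    show "z = y" if "Rel x z" for z using uniq that \<open>Rel x y\<close> by blast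
  qed
  have Rf: "Rel x (f x)" if "x \<in> carrier G" for x using total[OF that] f by auto
  have one': "Rel \<one>\<^bsub>G\<^esub> \<one>\<^bsub>H\<^esub>"
    using Rf[OF G.one_closed] one by fastforce
  have inv': "Rel (inv\<^bsub>G\<^esub> x) (inv\<^bsub>H\<^esub> y)" if "Rel x y" for x y
    using div[OF one' that] carr[OF that] by simp
  have mult: "Rel (x \<otimes>\<^bsub>G\<^esub> x') (y \<otimes>\<^bsub>H\<^esub> y')" if "Rel x y" "Rel x' y'" for x x' y y'
    using div[OF that(1) inv'[OF that(2)]] carr[OF that(2)] by simp
  have "f \<in> hom G H"
  proof (rule homI)
    show "f x \<in> carrier H" if "x \<in> carrier G" for x using Rf[OF that] carr by blast
    show "f (x \<otimes>\<^bsub>G\<^esub> x') = f x \<otimes>\<^bsub>H\<^esub> f x'" if "x \<in> carrier G" "x' \<in> carrier G" for x x'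
      by (rule f[OF mult[OF Rf[OF that(1)] Rf[OF that(2)]]])
  qed
  then show thesis using that Rf f by blast
qed

lemma bijective_relation_iso:
  assumes G: "group G" and H: "group H"
    and carr: "\<And>x y. Rel x y \<Longrightarrow> x \<in> carrier G \<and> y \<in> carrier H"
    and total: "\<And>x. x \<in> carrier G \<Longrightarrow> \<exists>y. Rel x y"
    and onto: "\<And>y. y \<in> carrier H \<Longrightarrow> \<exists>x. Rel x y"
    and div: "\<And>x y x' y'. Rel x y \<Longrightarrow> Rel x' y' \<Longrightarrow> Rel (x \<otimes>\<^bsub>G\<^esub> inv\<^bsub>G\<^esub> x') (y \<otimes>\<^bsub>H\<^esub> inv\<^bsub>H\<^esub> y')"
    and one: "\<And>x y. Rel x y \<Longrightarrow> x = \<one>\<^bsub>G\<^esub> \<longleftrightarrow> y = \<one>\<^bsub>H\<^esub>"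
  obtains f where "f \<in> iso G H" "\<And>x. x \<in> carrier G \<Longrightarrow> Rel x (f x)" "\<And>x y. Rel x y \<Longrightarrow> f x = y"
proof -
  interpret G: group G by fact
  interpret H: group H by fact
  obtain f where f: "f \<in> hom G H" "\<And>x. x \<in> carrier G \<Longrightarrow> Rel x (f x)" "\<And>x y. Rel x y \<Longrightarrow> f x = y"
  proof (rule functional_relation_hom[of G H Rel])
    show "y = \<one>\<^bsub>H\<^esub>" if "Rel \<one>\<^bsub>G\<^esub> y" for y using one[OF that] by simp
  qed (use G H carr total div that in auto)
  interpret group_hom G H f by unfold_locales fact
  have "inj_on f (carrier G)"
    using inj_on_one_iff f(2) one by blast
  moreover have "f ` carrier G = carrier H"
  proof
    show "carrier H \<subseteq> f ` carrier G" using onto f(3) carr by (metis image_eqI subsetI)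
  qed (use f(2) carr in blast)
  ultimately have "f \<in> iso G H" using f(1) by (simp add: iso_def bij_betw_def)
  then show thesis using that f by blast
qed

section \<open>Chain maps from a resolution to a coresolution\<close>

lemma is_complex_op [simp]: "is_complex (op_cat C) (dual_resol V) \<longleftrightarrow> is_complex C V"
proof
  assume V: "is_complex C V"
  have 1: "diff V (- n) \<in> Hom C (obj V (- n)) (obj V (- n - 1))" for n
    using V unfolding is_complex_def by blast
  have 2: "Cmp C (diff V (- (n + 1))) (diff V (- (n + 1) + 1)) = Zer C (obj V (- (n + 1) + 1)) (obj V (- (n + 1) - 1))" for n
    using V unfolding is_complex_def by blast
  show "is_complex (op_cat C) (dual_resol V)" unfolding is_complex_def
    using 1 2 by (simp add: algebra_simps)
next
  assume V: "is_complex (op_cat C) (dual_resol V)"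
  have 1: "diff V n \<in> Hom C (obj V n) (obj V (n - 1))" for n
    using is_complexD(1-3)[OF V, of "- n"] by (simp add: Hom_def)
  have 2: "Cmp C (diff V n) (diff V (n + 1)) = Zer C (obj V (n + 1)) (obj V (n - 1))" for n
    using is_complexD(4)[OF V, of "- n - 1"] by (simp add: algebra_simps)
  show "is_complex C V" unfolding is_complex_def using 1 2 by blast
qed

abbreviation fib_complex :: "('o, 'm) add_cat \<Rightarrow> 'o set \<Rightarrow> 'o set \<Rightarrow> ('o, 'm) resol \<Rightarrow> bool" where
  "fib_complex C R W U \<equiv> cofib_complex (op_cat C) R W (dual_resol U)"

text \<open>\<open>x\<close> and \<open>y\<close> are the two ends of a chain map \<open>V \<rightarrow> U\<close> of degree \<open>-n\<close>.\<close>

definition linked :: "('o, 'm) add_cat \<Rightarrow> ('o, 'm) resol \<Rightarrow> ('o, 'm) resol \<Rightarrow> 'o \<Rightarrow> 'o \<Rightarrow> int \<Rightarrow> 'm set \<Rightarrow> 'm set \<Rightarrow> bool" where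
  "linked C V U P N n x y \<longleftrightarrow> (\<exists>\<xi>. (\<forall>m. \<xi> m \<in> Hom C (obj V m) (obj U (m - n)) \<and>
       Cmp C (diff U (m - n)) (\<xi> m) = Cmp C (\<xi> (m - 1)) (diff V m)) \<and>
     x = coh_class C V N n (Cmp C (eps U) (\<xi> n)) \<and>
     y = coh_class (op_cat C) (dual_resol U) P n (Cmp C (\<xi> (-1)) (eta V)))"

context preadditive_category begin

lemma augmentedD:
  assumes "is_complex C V" "augmented C P V"
  shows "eps V \<in> Arr C" "Dom C (eps V) = obj V 0" "Cod C (eps V) = P"
    "eta V \<in> Arr C" "Dom C (eta V) = P" "Cod C (eta V) = obj V (-1)"
    "eta V \<odot> eps V = diff V 0" "epic C (eps V)" "monic C (eta V)"
    "eps V \<odot> diff V 1 = Zer C (obj V 1) P" "diff V (-1) \<odot> eta V = Zer C P (obj V (-2))"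
proof -
  show a: "eps V \<in> Arr C" "Dom C (eps V) = obj V 0" "Cod C (eps V) = P"
    "eta V \<in> Arr C" "Dom C (eta V) = P" "Cod C (eta V) = obj V (-1)"
    "eta V \<odot> eps V = diff V 0" "epic C (eps V)" "monic C (eta V)"
    using assms(2) unfolding augmented_def Hom_def by auto
  note d = is_complexD[OF assms(1), of 0] is_complexD[OF assms(1), of 1] is_complexD[OF assms(1), of "-1"]
  have "eta V \<odot> (eps V \<odot> diff V 1) = diff V 0 \<odot> diff V 1"
    by (rule reassoc[OF a(7)]) (use a d in simp_all)
  then show "eps V \<odot> diff V 1 = Zer C (obj V 1) P"
    by - (rule monic_zer[OF a(9)], use a d in simp_all)
  have "(diff V (-1) \<odot> eta V) \<odot> eps V = diff V (-1) \<odot> diff V 0"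
    using a d by simp
  then show "diff V (-1) \<odot> eta V = Zer C P (obj V (-2))"
    by - (rule epic_zer[OF a(8)], use a d in simp_all)
qed

end

context hmod begin

lemma fib_complexD:
  assumes "fib_complex C R W U" shows "is_complex C U" "obj U m \<in> R" "obj U m \<in> W"
proof -
  interpret op: hmod "op_cat C" R W Q by (rule op_hmod)
  show "is_complex C U" using op.cofib_complex_is_complex[OF assms] by simp
  have "obj (dual_resol U) (- m - 1) \<in> R \<and> obj (dual_resol U) (- m - 1) \<in> W"
    using assms unfolding cofib_complex_def by blast
  then show "obj U m \<in> R" "obj U m \<in> W" by simp_all
qed

lemma cofib_complexD:
  assumes "cofib_complex C Q W V" shows "is_complex C V" "obj V m \<in> Q" "obj V m \<in> W"
  using cofib_complex_is_complex[OF assms] assms unfolding cofib_complex_def by auto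

lemma resolutions_hom_exact:
  assumes V: "cofib_complex C Q W V" and U: "fib_complex C R W U"
  shows "hom_exact C (obj V) (\<lambda>m. obj U (m - n)) (diff V) (\<lambda>m. diff U (m - n))"
proof -
  interpret op: hmod "op_cat C" R W Q by (rule op_hmod)
  note v = cofib_complexD[OF V] and u = fib_complexD[OF U]
  show ?thesis
  proof (rule hom_exact.intro[OF preadditive_category_axioms], rule hom_exact_axioms.intro)
    fix m l t
    show "diff V m \<in> Hom C (obj V m) (obj V (m - 1))" "diff V m \<odot> diff V (m + 1) = Zer C (obj V (m + 1)) (obj V (m - 1))"
      using v(1) unfolding is_complex_def by blast+
    have "m - n - 1 = m - 1 - n" "m - n + 1 = m + 1 - n" by simp_all
    then show "diff U (m - n) \<in> Hom C (obj U (m - n)) (obj U (m - 1 - n))"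
      "diff U (m - n) \<odot> diff U (m + 1 - n) = Zer C (obj U (m + 1 - n)) (obj U (m - 1 - n))"
      using u(1) unfolding is_complex_def by metis+
    show "\<exists>s\<in>Hom C (obj V (m - 1)) (obj U (l - n)). s \<odot> diff V m = t"
      if "t \<in> Hom C (obj V m) (obj U (l - n))" "t \<odot> diff V (m + 1) = Zer C (obj V (m + 1)) (obj U (l - n))"
      by (rule extend_cocycle[OF V u(3,2) that])
    show "\<exists>s\<in>Hom C (obj V m) (obj U (l + 1 - n)). diff U (l + 1 - n) \<odot> s = t"
      if "t \<in> Hom C (obj V m) (obj U (l - n))" "diff U (l - n) \<odot> t = Zer C (obj V m) (obj U (l - 1 - n))"
    proof -
      \<comment> \<open>The degree in which \<open>dual_resol U\<close> has the object
        \<open>obj U (l - n)\<close>; lifting along \<open>diff U\<close> is extension of a cocycle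
        in the opposite category.\<close>
      define k where "k = - (l - n) - 1"
      have "- k - 1 = l - n" "- (k + 1) = l - n" "- (k + 1) - 1 = l - 1 - n" "- (k - 1) - 1 = l + 1 - n" "- k = l + 1 - n"
        by (simp_all add: k_def)
      then have k: "obj U (- k - 1) = obj U (l - n)" "diff U (- (k + 1)) = diff U (l - n)"
        "obj U (- (k + 1) - 1) = obj U (l - 1 - n)" "obj U (- (k - 1) - 1) = obj U (l + 1 - n)"
        "diff U (- k) = diff U (l + 1 - n)" by (simp_all only:)
      show ?thesis
        using op.extend_cocycle[OF U v(3,2), of t k m] that by (simp only: k dual_resol_simps op_cat_simps Hom_op)
    qed
  qed
qed

text \<open>In degree \<open>n\<close> a chain map lands in \<open>obj U 0\<close>, which maps onto
  \<open>N\<close>, and in degree -1 it starts from \<open>obj V (-1)\<close>, which contains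
  \<open>P\<close>; this gives the two ends. The class of either end is trivial exactly if the chain
  map is \<open>null_at\<close> the corresponding degree, a condition that does not depend on the
  degree. Hence \<open>linked\<close> is a bijective relation.\<close>

lemma comparison:
  assumes V: "cofib_complex C Q W V" "augmented C P V" and U: "fib_complex C R W U" "augmented C N U"
  obtains \<Phi> where "\<Phi> \<in> iso (lH C V N n) (rH C P U n)"
    "\<And>x. x \<in> carrier (lH C V N n) \<Longrightarrow> linked C V U P N n x (\<Phi> x)"
    "\<And>x y. linked C V U P N n x y \<Longrightarrow> \<Phi> x = y"
proof -
  interpret op: hmod "op_cat C" R W Q by (rule op_hmod)
  interpret K: hom_exact C "obj V" "\<lambda>m. obj U (m - n)" "diff V" "\<lambda>m. diff U (m - n)"
    by (rule resolutions_hom_exact[OF V(1) U(1)])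
  let ?U = "dual_resol U"
  note v = cofib_complexD[OF V(1)] and u = fib_complexD[OF U(1)]
  have u': "is_complex (op_cat C) ?U" using u by simp
  note av = augmentedD[OF v(1) V(2)] and au = augmentedD[OF u(1) U(2)]
  note dv = is_complexD(1-3)[OF v(1)] and du = is_complexD(1-3)[OF u(1)]
  have obs': "P \<in> Ob C" "N \<in> Ob C" using ob(1)[OF av(4)] ob(1)[OF au(4)] av au by simp_all
  have P': "P \<in> Ob (op_cat C)" using obs' by simp
  have idx: "- 1 - n = - n - 1" "0 - n = - n" "- 2 - n = - n - 2" by simp_all
  define a b where "a \<xi> = eps U \<odot> \<xi> n" and "b \<xi> = \<xi> (-1) \<odot> eta V" for \<xi>
  have cm: "\<xi> m \<in> Arr C" "Dom C (\<xi> m) = obj V m" "Cod C (\<xi> m) = obj U (m - n)"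
    "diff U (m - n) \<odot> \<xi> m = \<xi> (m - 1) \<odot> diff V m" if "K.chain_map \<xi>" for \<xi> m
    using that unfolding K.chain_map_def Hom_def by auto
  have link: "linked C V U P N n x y \<longleftrightarrow> (\<exists>\<xi>. K.chain_map \<xi> \<and> x = coh_class C V N n (a \<xi>) \<and> y = coh_class (op_cat C) ?U P n (b \<xi>))" for x y
    unfolding linked_def K.chain_map_def a_def b_def by blast
  have ah: "a \<xi> \<in> Hom C (obj V n) N" if "K.chain_map \<xi>" for \<xi>
    using cm[OF that, of n] au unfolding a_def by (simp add: Hom_def)
  have bh: "b \<xi> \<in> Hom C P (obj U (- n - 1))" if "K.chain_map \<xi>" for \<xi>
    using cm[OF that, of "-1"] av unfolding b_def idx by (simp add: Hom_def)
  have ac: "cocycle C V N n (a \<xi>)" if "K.chain_map \<xi>" for \<xi>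
  proof -
    note x = cm[OF that]
    have "a \<xi> \<odot> diff V (n + 1) = eps U \<odot> (\<xi> n \<odot> diff V (n + 1))"
      unfolding a_def by (rule assoc) (use x au dv in simp_all)
    also have "\<xi> n \<odot> diff V (n + 1) = diff U 1 \<odot> \<xi> (n + 1)" using x(4)[of "n + 1"] by simp
    also have "eps U \<odot> (diff U 1 \<odot> \<xi> (n + 1)) = Zer C (obj V (n + 1)) N"
      by (subst zer_cancel) (use x[of "n + 1"] au du[of 1] in simp_all)
    finally show ?thesis unfolding cocycle_def using ah[OF that] by blast
  qed
  have bc: "cocycle (op_cat C) ?U P n (b \<xi>)" if "K.chain_map \<xi>" for \<xi>
  proof -
    note x = cm[OF that]
    have "diff U (- n - 1) \<odot> b \<xi> = (diff U (- 1 - n) \<odot> \<xi> (-1)) \<odot> eta V"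
      unfolding b_def idx by (rule assoc[symmetric]) (use x(1-3)[of "-1"] av du[of "- n - 1"] idx in simp_all)
    also have "\<dots> = \<xi> (-2) \<odot> (diff V (-1) \<odot> eta V)"
      unfolding x(4) using x(1-3)[of "-2"] av dv[of "-1"] by simp
    also have "\<dots> = Zer C P (obj U (- n - 2))"
      unfolding av(11) using x(1-3)[of "-2"] obs' idx by simp
    finally show ?thesis unfolding cocycle_def using bh[OF that] by (simp add: algebra_simps idx)
  qed
  have a_null: "coh_class C V N n (a \<xi>) = \<one>\<^bsub>lH C V N n\<^esub> \<longleftrightarrow> K.null_at \<xi> n" if "K.chain_map \<xi>" for \<xi>
  proof -
    note x = cm[OF that]
    have "(\<exists>s \<in> Hom C (obj V (n - 1)) N. a \<xi> = s \<odot> diff V n) \<longleftrightarrow> K.null_at \<xi> n"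
    proof
      assume "\<exists>s \<in> Hom C (obj V (n - 1)) N. a \<xi> = s \<odot> diff V n"
      then obtain z where z: "z \<in> Arr C" "Dom C z = obj V (n - 1)" "Cod C z = N" "a \<xi> = z \<odot> diff V n" by (auto simp: Hom_def)
      \<comment> \<open>Lifting \<open>eta U \<odot> z\<close> along \<open>diff U 0\<close> lifts
        \<open>z\<close> itself along \<open>eps U\<close>, since \<open>eta U\<close> is
        monic.\<close>
      have "diff U (-1) \<odot> (eta U \<odot> z) = Zer C (obj V (n - 1)) (obj U (-2))"
        by (subst zer_cancel) (use au z du[of "-1"] in simp_all)
      then obtain h where h: "h \<in> Hom C (obj V (n - 1)) (obj U 0)" "diff U 0 \<odot> h = eta U \<odot> z"
        using K.lift[of "eta U \<odot> z" "n - 1" "n - 1"] au z by (auto simp: Hom_def)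
      have "eta U \<odot> (eps U \<odot> h) = diff U 0 \<odot> h" by (rule reassoc[OF au(7)]) (use h au in \<open>simp_all add: Hom_def\<close>)
      then have eh: "eps U \<odot> h = z" using h z au by - (rule monicD[OF au(9)], simp_all add: Hom_def)
      \<comment> \<open>Removing the coboundary leaves an arrow killed by \<open>eps U\<close>,
        hence by \<open>diff U 0\<close>; so it lifts along \<open>diff U 1\<close>.\<close>
      define t where "t = sub C (\<xi> n) (h \<odot> diff V n)"
      have t: "t \<in> Hom C (obj V n) (obj U 0)" unfolding t_def using x(1-3)[of n] h dv by (simp add: Hom_def)
      have "eps U \<odot> t = sub C (a \<xi>) (z \<odot> diff V n)"
        unfolding t_def a_def eh[symmetric] using x(1-3)[of n] h au dv by (simp add: Hom_def)
      also have "\<dots> = Zer C (obj V n) N" unfolding z(4) using z dv v by simp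
      finally have et: "eps U \<odot> t = Zer C (obj V n) N" .
      have "diff U 0 \<odot> t = eta U \<odot> (eps U \<odot> t)" by (rule reassoc[OF au(7), symmetric]) (use t au in \<open>simp_all add: Hom_def\<close>)
      also have "\<dots> = Zer C (obj V n) (obj U (-1))" unfolding et using au v by simp
      finally obtain g where g: "g \<in> Hom C (obj V n) (obj U (n + 1 - n))" "diff U (n + 1 - n) \<odot> g = t"
        using K.lift[of t n n] t by auto
      have "\<xi> n = Add C t (h \<odot> diff V n)" unfolding t_def using x(1-3)[of n] h dv by (simp add: Hom_def)
      then show "K.null_at \<xi> n" unfolding K.null_at_def using g h by (intro bexI[of _ g] bexI[of _ h]) simp_all
    next
      assume "K.null_at \<xi> n"
      then obtain h h' where h: "h \<in> Hom C (obj V n) (obj U (n + 1 - n))" "h' \<in> Hom C (obj V (n - 1)) (obj U (n - n))"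
        "\<xi> n = Add C (diff U (n + 1 - n) \<odot> h) (h' \<odot> diff V n)" unfolding K.null_at_def by blast
      have "a \<xi> = Add C (eps U \<odot> (diff U 1 \<odot> h)) ((eps U \<odot> h') \<odot> diff V n)"
        unfolding a_def h(3) using h(1,2) au(1-3) du[of 1] dv[of n] by (simp add: Hom_def)
      also have "eps U \<odot> (diff U 1 \<odot> h) = Zer C (obj V n) N"
        by (subst zer_cancel) (use h(1,2) au du[of 1] in \<open>simp_all add: Hom_def\<close>)
      finally have "a \<xi> = (eps U \<odot> h') \<odot> diff V n" using h(1,2) au(1-3) dv[of n] by (simp add: Hom_def)
      then show "\<exists>s \<in> Hom C (obj V (n - 1)) N. a \<xi> = s \<odot> diff V n"
        using h(2) au(1-3) by (intro bexI[of _ "eps U \<odot> h'"]) (simp_all add: Hom_def)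
    qed
    then show ?thesis using coh_class_one_iff[OF v(1) obs'(2) ah[OF that]] by simp
  qed
  have b_null: "coh_class (op_cat C) ?U P n (b \<xi>) = \<one>\<^bsub>lH (op_cat C) ?U P n\<^esub> \<longleftrightarrow> K.null_at \<xi> (-1)" if "K.chain_map \<xi>" for \<xi>
  proof -
    note x = cm[OF that]
    have "(\<exists>s \<in> Hom C P (obj U (- n)). b \<xi> = diff U (- n) \<odot> s) \<longleftrightarrow> K.null_at \<xi> (-1)"
    proof
      assume "\<exists>s \<in> Hom C P (obj U (- n)). b \<xi> = diff U (- n) \<odot> s"
      then obtain z where z: "z \<in> Arr C" "Dom C z = P" "Cod C z = obj U (- n)" "b \<xi> = diff U (- n) \<odot> z" by (auto simp: Hom_def)
      \<comment> \<open>Dually, extending \<open>z \<odot> eps V\<close> along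
        \<open>diff V 0\<close> extends \<open>z\<close> along \<open>eta V\<close>, since
        \<open>eps V\<close> is epic.\<close>
      have "(z \<odot> eps V) \<odot> diff V 1 = Zer C (obj V 1) (obj U (- n))"
        using av z dv[of 1] v u by simp
      then obtain h where h: "h \<in> Hom C (obj V (-1)) (obj U (- n))" "h \<odot> diff V 0 = z \<odot> eps V"
        using K.ext[of "z \<odot> eps V" 0 0] av z by (auto simp: Hom_def)
      have "(h \<odot> eta V) \<odot> eps V = z \<odot> eps V" using h av by (simp add: Hom_def)
      then have eh: "h \<odot> eta V = z" using h z av by - (rule epicD[OF av(8)], simp_all add: Hom_def)
      define t where "t = sub C (\<xi> (-1)) (diff U (- n) \<odot> h)"
      have t: "t \<in> Hom C (obj V (-1)) (obj U (- n - 1))" unfolding t_def using x(1-3)[of "-1"] h du[of "- n"] idx by (simp add: Hom_def)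
      have "t \<odot> eta V = sub C (b \<xi>) (diff U (- n) \<odot> z)"
        unfolding t_def b_def eh[symmetric] using x(1-3)[of "-1"] h av du[of "- n"] idx by (simp add: Hom_def)
      also have "\<dots> = Zer C P (obj U (- n - 1))" unfolding z(4) using z du[of "- n"] by simp
      finally have et: "t \<odot> eta V = Zer C P (obj U (- n - 1))" .
      have "t \<odot> diff V 0 = (t \<odot> eta V) \<odot> eps V" unfolding av(7)[symmetric] by (rule assoc[symmetric]) (use t av in \<open>simp_all add: Hom_def\<close>)
      also have "\<dots> = Zer C (obj V 0) (obj U (- n - 1))" unfolding et using av u by simp
      finally obtain g where g: "g \<in> Hom C (obj V (-1 - 1)) (obj U (-1 - n))" "g \<odot> diff V (-1) = t"
        using K.ext[of t "-1" "-1"] t idx by auto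
      have "\<xi> (-1) = Add C (diff U (- n) \<odot> h) t" unfolding t_def using x(1-3)[of "-1"] h du[of "- n"] idx by (simp add: Hom_def)
      then show "K.null_at \<xi> (-1)" unfolding K.null_at_def using g h by (intro bexI[of _ h] bexI[of _ g]) simp_all
    next
      assume "K.null_at \<xi> (-1)"
      then obtain h h' where h: "h \<in> Hom C (obj V (-1)) (obj U (- n))" "h' \<in> Hom C (obj V (-2)) (obj U (- n - 1))"
        "\<xi> (-1) = Add C (diff U (- n) \<odot> h) (h' \<odot> diff V (-1))" unfolding K.null_at_def using idx by auto
      have "b \<xi> = Add C (diff U (- n) \<odot> (h \<odot> eta V)) (h' \<odot> (diff V (-1) \<odot> eta V))"
        unfolding b_def h(3) using h(1,2) av(1-6) du[of "- n"] dv[of "-1"] by (simp add: Hom_def)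
      also have "\<dots> = diff U (- n) \<odot> (h \<odot> eta V)"
        unfolding av(11) using h(1,2) av(1-6) du[of "- n"] obs' by (simp add: Hom_def)
      finally show "\<exists>s \<in> Hom C P (obj U (- n)). b \<xi> = diff U (- n) \<odot> s"
        using h(1) av(4-6) by (intro bexI[of _ "h \<odot> eta V"]) (simp_all add: Hom_def)
    qed
    moreover have "- (n - 1) - 1 = - n" by simp
    ultimately show ?thesis using op.coh_class_one_iff[OF u' P', of "b \<xi>" n] bh[OF that] by simp
  qed
  have nulls: "K.null_at \<xi> n \<longleftrightarrow> K.null_at \<xi> (-1)" if "K.chain_map \<xi>" for \<xi>
    using K.null_all[OF that] by blast
  have ca: "carrier (lH C V N n) = {coh_class C V N n h | h. cocycle C V N n h}"
    by (rule carrier_lH[OF v(1) obs'(2)])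
  have cb: "carrier (lH (op_cat C) ?U P n) = {coh_class (op_cat C) ?U P n h | h. cocycle (op_cat C) ?U P n h}"
    by (rule op.carrier_lH[OF u' P'])
  obtain \<Phi> where "\<Phi> \<in> iso (lH C V N n) (lH (op_cat C) ?U P n)"
    "\<And>x. x \<in> carrier (lH C V N n) \<Longrightarrow> linked C V U P N n x (\<Phi> x)"
    "\<And>x y. linked C V U P N n x y \<Longrightarrow> \<Phi> x = y"
  proof (rule bijective_relation_iso[of "lH C V N n" "lH (op_cat C) ?U P n" "linked C V U P N n"])
    show "group (lH C V N n)" using lH_comm_group[OF v(1) obs'(2)] comm_group.axioms(2) by blast
    show "group (lH (op_cat C) ?U P n)" using op.lH_comm_group[OF u' P'] comm_group.axioms(2) by blast
    fix x y
    show "x \<in> carrier (lH C V N n) \<and> y \<in> carrier (lH (op_cat C) ?U P n)" if "linked C V U P N n x y"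
      using that ac bc unfolding link ca cb by blast
    show "x = \<one>\<^bsub>lH C V N n\<^esub> \<longleftrightarrow> y = \<one>\<^bsub>lH (op_cat C) ?U P n\<^esub>" if "linked C V U P N n x y"
      using that a_null b_null nulls unfolding link by metis
    show "\<exists>y. linked C V U P N n x y" if x: "x \<in> carrier (lH C V N n)"
    proof -
      obtain h where h: "h \<in> Arr C" "Dom C h = obj V n" "Cod C h = N" "h \<odot> diff V (n + 1) = Zer C (obj V (n + 1)) N"
        and xh: "x = coh_class C V N n h" using x unfolding ca cocycle_def Hom_def by auto
      \<comment> \<open>The cocycle \<open>h\<close> is lifted to \<open>obj U 0\<close>; its
        cocycle condition is what allows the lift to start a chain map in degree
        \<open>n\<close>.\<close>
      have "diff U (-1) \<odot> (eta U \<odot> h) = Zer C (obj V n) (obj U (-2))"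
        by (subst zer_cancel) (use au h du[of "-1"] in simp_all)
      then obtain s where s: "s \<in> Hom C (obj V n) (obj U 0)" "diff U 0 \<odot> s = eta U \<odot> h"
        using K.lift[of "eta U \<odot> h" n "n - 1"] au h by (auto simp: Hom_def)
      have "eta U \<odot> (eps U \<odot> s) = diff U 0 \<odot> s" by (rule reassoc[OF au(7)]) (use s au in \<open>simp_all add: Hom_def\<close>)
      then have es: "eps U \<odot> s = h" using s h au by - (rule monicD[OF au(9)], simp_all add: Hom_def)
      have "diff U 0 \<odot> (s \<odot> diff V (n + 1)) = (eta U \<odot> h) \<odot> diff V (n + 1)"
        by (rule reassoc[OF s(2)]) (use s du[of 0] dv[of "n + 1"] in \<open>simp_all add: Hom_def\<close>)
      also have "\<dots> = Zer C (obj V (n + 1)) (obj U (-1))" using h au dv[of "n + 1"] v by simp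
      finally obtain \<xi> where "K.chain_map \<xi>" "\<xi> n = s"
        using K.chain_map_exists[of s n] s by auto
      then show ?thesis unfolding link using es xh by (auto simp: a_def)
    qed
    show "\<exists>x. linked C V U P N n x y" if y: "y \<in> carrier (lH (op_cat C) ?U P n)"
    proof -
      obtain h where h: "h \<in> Arr C" "Dom C h = P" "Cod C h = obj U (- n - 1)" "diff U (- n - 1) \<odot> h = Zer C P (obj U (- n - 2))"
        and yh: "y = coh_class (op_cat C) ?U P n h" using y unfolding cb cocycle_def Hom_def by (auto simp: algebra_simps idx)
      have "(h \<odot> eps V) \<odot> diff V 1 = Zer C (obj V 1) (obj U (- n - 1))" using av h dv[of 1] v u by simp
      then obtain s where s: "s \<in> Hom C (obj V (-1)) (obj U (- n - 1))" "s \<odot> diff V 0 = h \<odot> eps V"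
        using K.ext[of "h \<odot> eps V" 0 "-1"] av h idx by (auto simp: Hom_def)
      have "(s \<odot> eta V) \<odot> eps V = h \<odot> eps V" using s av by (simp add: Hom_def)
      then have es: "s \<odot> eta V = h" using s h av by - (rule epicD[OF av(8)], simp_all add: Hom_def)
      have "diff U (- n - 1) \<odot> (s \<odot> diff V 0) = (diff U (- n - 1) \<odot> h) \<odot> eps V"
        unfolding s(2) by (rule assoc[symmetric]) (use h av du[of "- n - 1"] in simp_all)
      also have "\<dots> = Zer C (obj V 0) (obj U (- n - 2))" unfolding h(4) using av u by simp
      finally have "diff U (- 1 - n) \<odot> (s \<odot> diff V (-1 + 1)) = Zer C (obj V (-1 + 1)) (obj U (-1 - 1 - n))"
        by (simp add: idx)
      moreover have "s \<in> Hom C (obj V (-1)) (obj U (- 1 - n))" using s by (simp add: idx)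
      ultimately obtain \<xi> where "K.chain_map \<xi>" "\<xi> (-1) = s"
        using K.chain_map_exists[of s "-1"] by blast
      then show ?thesis unfolding link using es yh by (auto simp: b_def)
    qed
    fix x' y' assume "linked C V U P N n x y" "linked C V U P N n x' y'"
    then obtain \<xi> \<xi>' where x: "K.chain_map \<xi>" "x = coh_class C V N n (a \<xi>)" "y = coh_class (op_cat C) ?U P n (b \<xi>)"
      "K.chain_map \<xi>'" "x' = coh_class C V N n (a \<xi>')" "y' = coh_class (op_cat C) ?U P n (b \<xi>')"
      unfolding link by blast
    let ?\<xi> = "\<lambda>m. sub C (\<xi> m) (\<xi>' m)"
    have "a ?\<xi> = sub C (a \<xi>) (a \<xi>')" unfolding a_def
      using cm(1-3)[OF x(1), of n] cm(1-3)[OF x(4), of n] au by simp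
    moreover have "b ?\<xi> = sub C (b \<xi>) (b \<xi>')" unfolding b_def
      using cm(1-3)[OF x(1), of "-1"] cm(1-3)[OF x(4), of "-1"] av by simp
    ultimately show "linked C V U P N n (x \<otimes>\<^bsub>lH C V N n\<^esub> inv\<^bsub>lH C V N n\<^esub> x')
        (y \<otimes>\<^bsub>lH (op_cat C) ?U P n\<^esub> inv\<^bsub>lH (op_cat C) ?U P n\<^esub> y')"
      unfolding link x using K.chain_map_sub[OF x(1,4)]
        coh_class_sub[OF v(1) obs'(2) ac[OF x(1)] ac[OF x(4)]]
        op.coh_class_sub[OF u' P' bc[OF x(1)] bc[OF x(4)]]
      by (intro exI[of _ ?\<xi>]) simp
  qed (use that in blast)
  then show thesis using that unfolding rH_op by blast
qed

end

section \<open>Induced maps in cohomology\<close>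

definition post :: "('o, 'm) add_cat \<Rightarrow> ('o, 'm) resol \<Rightarrow> 'm \<Rightarrow> int \<Rightarrow> 'm set \<Rightarrow> 'm set" where
  "post C V t n = lH_map C V (Cod C t) n (\<lambda>h. Cmp C t h)"

definition pre :: "('o, 'm) add_cat \<Rightarrow> ('o, 'm) resol \<Rightarrow> 'o \<Rightarrow> int \<Rightarrow> 'm \<Rightarrow> 'm set \<Rightarrow> 'm set" where
  "pre C V B n f = lH_map C V B n (\<lambda>h. Cmp C h f)"

context preadditive_category begin

lemma post_class:
  assumes "is_complex C V" "t \<in> Arr C" "h \<in> Hom C (obj V n) (Dom C t)"
  shows "post C V t n (coh_class C V (Dom C t) n h) = coh_class C V (Cod C t) n (t \<odot> h)"
  unfolding post_def
proof (rule lH_map_coh_class)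
  fix s assume "s \<in> Hom C (obj V (n - 1)) (Dom C t)"
  then show "\<exists>s'\<in>Hom C (obj V (n - 1)) (Cod C t). t \<odot> (s \<odot> diff V n) = s' \<odot> diff V n"
    using is_complexD(1-3)[OF assms(1), of n] assms(2) by (intro bexI[of _ "t \<odot> s"]) (simp_all add: Hom_def)
qed (use assms in \<open>simp_all add: Hom_def\<close>)

lemma cocycle_post:
  assumes "is_complex C V" "t \<in> Arr C" "cocycle C V (Dom C t) n h"
  shows "cocycle C V (Cod C t) n (t \<odot> h)"
  using assms is_complexD(1-3)[OF assms(1), of "n + 1"] unfolding cocycle_def by (simp add: Hom_def)

lemma lH_cases:
  assumes "is_complex C V" "B \<in> Ob C" "x \<in> carrier (lH C V B n)"
  obtains h where "cocycle C V B n h" "x = coh_class C V B n h"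
  using assms carrier_lH by blast

lemma coh_class_closed:
  assumes "is_complex C V" "B \<in> Ob C" "cocycle C V B n h"
  shows "coh_class C V B n h \<in> carrier (lH C V B n)"
  using assms carrier_lH by blast

lemma cocycle_hom: "cocycle C V B n h \<Longrightarrow> h \<in> Hom C (obj V n) B"
  by (simp add: cocycle_def)

lemma lH_group: assumes "is_complex C V" "B \<in> Ob C" shows "group (lH C V B n)"
  using lH_comm_group[OF assms] comm_group.axioms(2) by blast

lemma post_hom:
  assumes V: "is_complex C V" and t: "t \<in> Arr C"
  shows "post C V t n \<in> hom (lH C V (Dom C t) n) (lH C V (Cod C t) n)"
proof (rule homI)
  have o: "Dom C t \<in> Ob C" "Cod C t \<in> Ob C" using t by simp_all
  fix x assume x: "x \<in> carrier (lH C V (Dom C t) n)"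
  obtain h where h: "cocycle C V (Dom C t) n h" "x = coh_class C V (Dom C t) n h" using lH_cases[OF V o(1) x] .
  show "post C V t n x \<in> carrier (lH C V (Cod C t) n)"
    unfolding h(2) post_class[OF V t cocycle_hom[OF h(1)]]
    by (rule coh_class_closed[OF V o(2) cocycle_post[OF V t h(1)]])
  fix y assume y: "y \<in> carrier (lH C V (Dom C t) n)"
  obtain k where k: "cocycle C V (Dom C t) n k" "y = coh_class C V (Dom C t) n k" using lH_cases[OF V o(1) y] .
  have "t \<odot> Add C h k = Add C (t \<odot> h) (t \<odot> k)" using t cocycle_hom[OF h(1)] cocycle_hom[OF k(1)] by (simp add: Hom_def)
  then show "post C V t n (x \<otimes>\<^bsub>lH C V (Dom C t) n\<^esub> y) = post C V t n x \<otimes>\<^bsub>lH C V (Cod C t) n\<^esub> post C V t n y"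
    unfolding h(2) k(2) coh_class_add[OF V o(1) h(1) k(1)] post_class[OF V t cocycle_hom[OF h(1)]]
      post_class[OF V t cocycle_hom[OF k(1)]] post_class[OF V t cocycle_hom[OF cocycle_add[OF V o(1) h(1) k(1)]]]
    using coh_class_add[OF V o(2) cocycle_post[OF V t h(1)] cocycle_post[OF V t k(1)]] by simp
qed

lemma post_closed:
  assumes "is_complex C V" "t \<in> Arr C" "x \<in> carrier (lH C V (Dom C t) n)"
  shows "post C V t n x \<in> carrier (lH C V (Cod C t) n)"
  using hom_in_carrier[OF post_hom[OF assms(1,2)] assms(3)] .

lemma post_idn:
  assumes V: "is_complex C V" and A: "A \<in> Ob C" and x: "x \<in> carrier (lH C V A n)"
  shows "post C V (Idn C A) n x = x"
proof -
  obtain h where h: "cocycle C V A n h" "x = coh_class C V A n h" using lH_cases[OF V A x] .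
  show ?thesis using post_class[OF V, of "Idn C A" h n] A h cocycle_hom[OF h(1)] by (simp add: Hom_def)
qed

lemma post_cmp:
  assumes V: "is_complex C V" and t: "t \<in> Arr C" "s \<in> Arr C" "Cod C t = Dom C s" and x: "x \<in> carrier (lH C V (Dom C t) n)"
  shows "post C V (s \<odot> t) n x = post C V s n (post C V t n x)"
proof -
  have o: "Dom C t \<in> Ob C" using t by simp
  obtain h where h: "cocycle C V (Dom C t) n h" "x = coh_class C V (Dom C t) n h" using lH_cases[OF V o x] .
  have th: "t \<odot> h \<in> Hom C (obj V n) (Dom C s)" using cocycle_hom[OF h(1)] t by (simp add: Hom_def)
  show ?thesis
    using post_class[OF V t(1) cocycle_hom[OF h(1)]] post_class[OF V t(2) th] post_class[OF V, of "s \<odot> t" h n] h t cocycle_hom[OF h(1)]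
    by (simp add: Hom_def)
qed

lemma post_add:
  assumes V: "is_complex C V" and t: "t \<in> Arr C" "s \<in> Arr C" "Dom C t = Dom C s" "Cod C t = Cod C s"
    and x: "x \<in> carrier (lH C V (Dom C s) n)"
  shows "post C V (Add C t s) n x = post C V t n x \<otimes>\<^bsub>lH C V (Cod C s) n\<^esub> post C V s n x"
proof -
  have o: "Dom C s \<in> Ob C" "Cod C s \<in> Ob C" using t by simp_all
  obtain h where h: "cocycle C V (Dom C s) n h" "x = coh_class C V (Dom C s) n h" using lH_cases[OF V o(1) x] .
  have 1: "post C V t n x = coh_class C V (Cod C s) n (t \<odot> h)" and 2: "post C V s n x = coh_class C V (Cod C s) n (s \<odot> h)"
    and 3: "post C V (Add C t s) n x = coh_class C V (Cod C s) n (Add C (t \<odot> h) (s \<odot> h))"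
    using post_class[OF V t(1), of h n] post_class[OF V t(2), of h n] post_class[OF V, of "Add C t s" h n] h t cocycle_hom[OF h(1)]
    by (simp_all add: Hom_def)
  have "cocycle C V (Cod C s) n (t \<odot> h)" "cocycle C V (Cod C s) n (s \<odot> h)"
    using cocycle_post[OF V t(1), of n h] cocycle_post[OF V t(2), of n h] h t by simp_all
  then show ?thesis unfolding 1 2 3 using coh_class_add[OF V o(2)] by simp
qed

lemma pre_class:
  assumes "is_complex C V" "is_complex C V'" "B \<in> Ob C"
    "f \<in> Hom C (obj V n) (obj V' n)" "f' \<in> Hom C (obj V (n - 1)) (obj V' (n - 1))" "diff V' n \<odot> f = f' \<odot> diff V n"
    "h \<in> Hom C (obj V' n) B"
  shows "pre C V B n f (coh_class C V' B n h) = coh_class C V B n (h \<odot> f)"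
  unfolding pre_def
proof (rule lH_map_coh_class)
  fix s assume s: "s \<in> Hom C (obj V' (n - 1)) B"
  note d = is_complexD(1-3)[OF assms(1), of n] is_complexD(1-3)[OF assms(2), of n]
  have "(s \<odot> diff V' n) \<odot> f = s \<odot> (diff V' n \<odot> f)" by (rule assoc) (use s d assms(4) in \<open>simp_all add: Hom_def\<close>)
  also have "\<dots> = (s \<odot> f') \<odot> diff V n" unfolding assms(6)
    by (rule assoc[symmetric]) (use s d assms(5) in \<open>simp_all add: Hom_def\<close>)
  finally show "\<exists>s'\<in>Hom C (obj V (n - 1)) B. (s \<odot> diff V' n) \<odot> f = s' \<odot> diff V n"
    using s assms(5) by (intro bexI[of _ "s \<odot> f'"]) (simp_all add: Hom_def)
qed (use assms in \<open>simp_all add: Hom_def\<close>)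

text \<open>Compose the chain map with the lift \<open>\<phi>\<close>. At the end of degree -1 the
  lifting condition replaces \<open>\<phi> (-1) \<odot> eta V\<close> by
  \<open>eta V' \<odot> f\<close>, so on that side only \<open>f\<close> acts, and the choice of the
  lift has disappeared.\<close>

lemma linked_pre:
  assumes V: "is_complex C V" "augmented C P V" and V': "is_complex C V'" "augmented C P' V'"
    and U: "is_complex C U" "augmented C N U"
    and f: "f \<in> Hom C P P'" and l: "resol_lift C V V' f \<phi>" and x: "linked C V' U P' N n x y"
  shows "linked C V U P N n (pre C V N n (\<phi> n) x) (post (op_cat C) (dual_resol U) f n y)"
proof -
  interpret op: preadditive_category "op_cat C" by (rule preadditive_op[OF preadditive_category_axioms])
  note av = augmentedD[OF V] and av' = augmentedD[OF V'] and au = augmentedD[OF U]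
  note dv = is_complexD(1-3)[OF V(1)] and dv' = is_complexD(1-3)[OF V'(1)] and du = is_complexD(1-3)[OF U(1)]
  have N: "N \<in> Ob C" using ob(1)[OF au(4)] au by simp
  have p: "\<phi> m \<in> Arr C" "Dom C (\<phi> m) = obj V m" "Cod C (\<phi> m) = obj V' m" "diff V' m \<odot> \<phi> m = \<phi> (m - 1) \<odot> diff V m"
    "\<phi> (-1) \<odot> eta V = eta V' \<odot> f" for m
    using l unfolding resol_lift_def Hom_def by auto
  have f': "f \<in> Arr C" "Dom C f = P" "Cod C f = P'" using f by (auto simp: Hom_def)
  obtain \<xi> where xi: "\<And>m. \<xi> m \<in> Hom C (obj V' m) (obj U (m - n)) \<and> diff U (m - n) \<odot> \<xi> m = \<xi> (m - 1) \<odot> diff V' m"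
    and xx: "x = coh_class C V' N n (eps U \<odot> \<xi> n)"
    and yy: "y = coh_class (op_cat C) (dual_resol U) P' n (\<xi> (-1) \<odot> eta V')"
    using x unfolding linked_def by blast
  have k: "\<xi> m \<in> Arr C" "Dom C (\<xi> m) = obj V' m" "Cod C (\<xi> m) = obj U (m - n)"
    "diff U (m - n) \<odot> \<xi> m = \<xi> (m - 1) \<odot> diff V' m" for m using xi[of m] unfolding Hom_def by auto
  have idx: "- 1 - n = - n - 1" by simp
  have "pre C V N n (\<phi> n) x = coh_class C V N n ((eps U \<odot> \<xi> n) \<odot> \<phi> n)"
    unfolding xx by (rule pre_class[OF V(1) V'(1) N, of _ _ "\<phi> (n - 1)"]) (use p k[of n] au in \<open>simp_all add: Hom_def\<close>)
  then have 1: "pre C V N n (\<phi> n) x = coh_class C V N n (eps U \<odot> (\<xi> n \<odot> \<phi> n))"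
    using p k[of n] au by simp
  have "post (op_cat C) (dual_resol U) f n y = coh_class (op_cat C) (dual_resol U) P n ((\<xi> (-1) \<odot> eta V') \<odot> f)"
    unfolding yy using op.post_class[of "dual_resol U" f "\<xi> (-1) \<odot> eta V'" n] U f' k(1-3)[of "-1"] av' idx
    by (simp add: Hom_def)
  also have "(\<xi> (-1) \<odot> eta V') \<odot> f = \<xi> (-1) \<odot> (\<phi> (-1) \<odot> eta V)"
    unfolding p(5) by (rule assoc) (use f' k(1-3)[of "-1"] av' in simp_all)
  also have "\<dots> = (\<xi> (-1) \<odot> \<phi> (-1)) \<odot> eta V"
    by (rule assoc[symmetric]) (use p(1-3)[of "-1"] k(1-3)[of "-1"] av in simp_all)
  finally have 2: "post (op_cat C) (dual_resol U) f n y = coh_class (op_cat C) (dual_resol U) P n ((\<xi> (-1) \<odot> \<phi> (-1)) \<odot> eta V)" .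
  have "\<xi> m \<odot> \<phi> m \<in> Hom C (obj V m) (obj U (m - n)) \<and>
      diff U (m - n) \<odot> (\<xi> m \<odot> \<phi> m) = (\<xi> (m - 1) \<odot> \<phi> (m - 1)) \<odot> diff V m" for m
  proof
    show "\<xi> m \<odot> \<phi> m \<in> Hom C (obj V m) (obj U (m - n))" using k(1-3)[of m] p(1-3)[of m] by (simp add: Hom_def)
    have "diff U (m - n) \<odot> (\<xi> m \<odot> \<phi> m) = \<xi> (m - 1) \<odot> (diff V' m \<odot> \<phi> m)"
      by (rule assoc_eq[OF k(4)]) (use k(1-3)[of m] k(1-3)[of "m - 1"] p(1-3)[of m] du dv' in simp_all)
    also have "\<dots> = (\<xi> (m - 1) \<odot> \<phi> (m - 1)) \<odot> diff V m"
      unfolding p(4) by (rule assoc[symmetric]) (use k(1-3)[of "m - 1"] p(1-3)[of "m - 1"] dv in simp_all)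
    finally show "diff U (m - n) \<odot> (\<xi> m \<odot> \<phi> m) = (\<xi> (m - 1) \<odot> \<phi> (m - 1)) \<odot> diff V m" .
  qed
  then show ?thesis unfolding linked_def 1 2 by (intro exI[of _ "\<lambda>m. \<xi> m \<odot> \<phi> m"]) blast
qed

text \<open>The mirror image: after composition with \<open>\<psi>\<close> only \<open>g\<close> is
  left at the end of degree \<open>n\<close>. The index \<open>- n - 1\<close> is the chain degree
  belonging to cohomological degree \<open>n\<close>.\<close>

lemma linked_post:
  assumes V: "is_complex C V" "augmented C P V" 
    and U: "is_complex C U" "augmented C N U" and U': "is_complex C U'" "augmented C N' U'"
    and g: "g \<in> Hom C N N'" and l: "resol_lift C U U' g \<psi>" and x: "linked C V U P N n x y"
  shows "linked C V U' P N' n (post C V g n x) (pre (op_cat C) (dual_resol U') P n (\<psi> (- n - 1)) y)"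
proof -
  interpret op: preadditive_category "op_cat C" by (rule preadditive_op[OF preadditive_category_axioms])
  note av = augmentedD[OF V] and au' = augmentedD[OF U'] and au = augmentedD[OF U]
  note dv = is_complexD(1-3)[OF V(1)] and du' = is_complexD(1-3)[OF U'(1)] and du = is_complexD(1-3)[OF U(1)]
  have P: "P \<in> Ob C" using ob(1)[OF av(4)] av by simp
  have p: "\<psi> m \<in> Arr C" "Dom C (\<psi> m) = obj U m" "Cod C (\<psi> m) = obj U' m" "diff U' m \<odot> \<psi> m = \<psi> (m - 1) \<odot> diff U m"
    "eps U' \<odot> \<psi> 0 = g \<odot> eps U" for m
    using l unfolding resol_lift_def Hom_def by auto
  have g': "g \<in> Arr C" "Dom C g = N" "Cod C g = N'" using g by (auto simp: Hom_def)
  obtain \<xi> where xi: "\<And>m. \<xi> m \<in> Hom C (obj V m) (obj U (m - n)) \<and> diff U (m - n) \<odot> \<xi> m = \<xi> (m - 1) \<odot> diff V m"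
    and xx: "x = coh_class C V N n (eps U \<odot> \<xi> n)"
    and yy: "y = coh_class (op_cat C) (dual_resol U) P n (\<xi> (-1) \<odot> eta V)"
    using x unfolding linked_def by blast
  have k: "\<xi> m \<in> Arr C" "Dom C (\<xi> m) = obj V m" "Cod C (\<xi> m) = obj U (m - n)"
    "diff U (m - n) \<odot> \<xi> m = \<xi> (m - 1) \<odot> diff V m" for m using xi[of m] unfolding Hom_def by auto
  have idx: "- 1 - n = - n - 1" by simp
  have "post C V g n x = coh_class C V N' n (g \<odot> (eps U \<odot> \<xi> n))"
    unfolding xx using post_class[OF V(1) g'(1), of "eps U \<odot> \<xi> n" n] g' au k[of n] by (simp add: Hom_def)
  also have "g \<odot> (eps U \<odot> \<xi> n) = eps U' \<odot> (\<psi> 0 \<odot> \<xi> n)"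
    by (rule assoc_eq[OF p(5)[symmetric]]) (use g' au au' p(1-3)[of 0] k(1-3)[of n] in simp_all)
  finally have 1: "post C V g n x = coh_class C V N' n (eps U' \<odot> (\<psi> (n - n) \<odot> \<xi> n))" by simp
  have pd: "\<psi> (- n - 1) \<odot> diff U (- n) = diff U' (- n) \<odot> \<psi> (- n)" using p(4)[of "- n"] by simp
  have "pre (op_cat C) (dual_resol U') P n (\<psi> (- n - 1)) y
      = coh_class (op_cat C) (dual_resol U') P n (\<psi> (- n - 1) \<odot> (\<xi> (-1) \<odot> eta V))"
    unfolding yy using op.pre_class[of "dual_resol U'" "dual_resol U" P "\<psi> (- n - 1)" n "\<psi> (- n)" "\<xi> (-1) \<odot> eta V"]
      U U' P p(1-3)[of "- n - 1"] p(1-3)[of "- n"] pd k(1-3)[of "-1"] av idx by (simp add: Hom_def)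
  also have "\<psi> (- n - 1) \<odot> (\<xi> (-1) \<odot> eta V) = (\<psi> (-1 - n) \<odot> \<xi> (-1)) \<odot> eta V"
    unfolding idx by (rule assoc[symmetric]) (use p(1-3)[of "- n - 1"] k(1-3)[of "-1"] av idx in simp_all)
  finally have 2: "pre (op_cat C) (dual_resol U') P n (\<psi> (- n - 1)) y
      = coh_class (op_cat C) (dual_resol U') P n ((\<psi> (-1 - n) \<odot> \<xi> (-1)) \<odot> eta V)" .
  have "\<psi> (m - n) \<odot> \<xi> m \<in> Hom C (obj V m) (obj U' (m - n)) \<and>
      diff U' (m - n) \<odot> (\<psi> (m - n) \<odot> \<xi> m) = (\<psi> (m - 1 - n) \<odot> \<xi> (m - 1)) \<odot> diff V m" for m
  proof
    have i: "m - n - 1 = m - 1 - n" by simp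
    show "\<psi> (m - n) \<odot> \<xi> m \<in> Hom C (obj V m) (obj U' (m - n))" using k(1-3)[of m] p(1-3)[of "m - n"] by (simp add: Hom_def)
    have "diff U' (m - n) \<odot> (\<psi> (m - n) \<odot> \<xi> m) = \<psi> (m - n - 1) \<odot> (diff U (m - n) \<odot> \<xi> m)"
      by (rule assoc_eq[OF p(4)]) (use k(1-3)[of m] p(1-3)[of "m - n"] p(1-3)[of "m - n - 1"] du[of "m - n"] du'[of "m - n"] in simp_all)
    also have "\<dots> = (\<psi> (m - 1 - n) \<odot> \<xi> (m - 1)) \<odot> diff V m"
      unfolding k(4) i by (rule assoc[symmetric]) (use k(1-3)[of "m - 1"] p(1-3)[of "m - 1 - n"] dv in simp_all)
    finally show "diff U' (m - n) \<odot> (\<psi> (m - n) \<odot> \<xi> m) = (\<psi> (m - 1 - n) \<odot> \<xi> (m - 1)) \<odot> diff V m" .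
  qed
  then show ?thesis unfolding linked_def 1 2 by (intro exI[of _ "\<lambda>m. \<psi> (m - n) \<odot> \<xi> m"]) blast
qed

end

section \<open>Long exact sequences\<close>

text \<open>Each \<open>obj V m\<close> is trivially cofibrant and the kernel \<open>Dom C i\<close>
  is fibrant, so Hom out of \<open>obj V m\<close> keeps the sequence exact; what follows is the
  connecting homomorphism of a short exact sequence of complexes.\<close>

lemma (in hmod) long_exact_sequence:
  assumes V: "cofib_complex C Q W V" and se: "short_exact C i p" and X: "Dom C i \<in> R"
  shows "\<exists>\<delta>. \<forall>n. ab_exact (lH C V (Dom C i) n) (post C V i n) (lH C V (Cod C i) n) (post C V p n) (lH C V (Cod C p) n) \<and>
    ab_exact (lH C V (Cod C i) n) (post C V p n) (lH C V (Cod C p) n) (\<delta> n) (lH C V (Dom C i) (n + 1)) \<and>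
    ab_exact (lH C V (Cod C p) n) (\<delta> n) (lH C V (Dom C i) (n + 1)) (post C V i (n + 1)) (lH C V (Cod C i) (n + 1))"
proof -
  note I = short_exactD[OF se] and v = cofib_complexD[OF V]
  note d = is_complexD(1-3)[OF v(1)]
  define A B D where "A = Dom C i" and "B = Dom C p" and "D = Cod C p"
  have I': "Dom C i = A" "Cod C i = B" "Dom C p = B" "Cod C p = D" "A \<in> Ob C" "B \<in> Ob C" "D \<in> Ob C"
    using I by (simp_all add: A_def B_def D_def)
  have V1: "is_complex C V" by (rule v(1))
  have pi: "p \<odot> i = Zer C A D" using I I' by simp
  have piz: "p \<odot> (i \<odot> t) = Zer C (Dom C t) D" if "t \<in> Arr C" "Cod C t = A" for t
    using zer_cancel[of p i t] I I' that by simp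
  have lift: "\<exists>y \<in> Hom C (obj V m) B. p \<odot> y = t" if "t \<in> Hom C (obj V m) D" for t m
    using lift_QW[OF se, of t] that v X I' by (auto simp: Hom_def)
  have ker: "\<exists>x \<in> Hom C (obj V m) A. i \<odot> x = t" if "t \<in> Hom C (obj V m) B" "p \<odot> t = Zer C (obj V m) D" for t m
    using ker_lift[OF I(7), of t] that I' by (auto simp: Hom_def)
  have pi_i: "post C V i n (coh_class C V A n h) = coh_class C V B n (i \<odot> h)" if "h \<in> Hom C (obj V n) A" for h n
    using post_class[OF V1 I(1), of h n] that I' by simp
  have pi_p: "post C V p n (coh_class C V B n h) = coh_class C V D n (p \<odot> h)" if "h \<in> Hom C (obj V n) B" for h n
    using post_class[OF V1 I(2), of h n] that I' by simp
  \<comment> \<open>The snake relation: \<open>y\<close> lifts a cocycle along \<open>p\<close>, and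
    the coboundary of \<open>y\<close> comes from \<open>x\<close> along \<open>i\<close>.\<close>
  define Rel where "Rel n c c' \<longleftrightarrow> (\<exists>y \<in> Hom C (obj V n) B. \<exists>x \<in> Hom C (obj V (n + 1)) A. i \<odot> x = y \<odot> diff V (n + 1) \<and>
    c = coh_class C V D n (p \<odot> y) \<and> c' = coh_class C V A (n + 1) x)" for n c c'
  have cz: "cocycle C V D n (p \<odot> y)" and cx: "cocycle C V A (n + 1) x"
    if y: "y \<in> Hom C (obj V n) B" "x \<in> Hom C (obj V (n + 1)) A" "i \<odot> x = y \<odot> diff V (n + 1)" for n y x
  proof -
    have "p \<odot> (y \<odot> diff V (n + 1)) = Zer C (obj V (n + 1)) D"
      unfolding y(3)[symmetric] using piz[of x] y(2) by (simp add: Hom_def)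
    then show "cocycle C V D n (p \<odot> y)" unfolding cocycle_def using y(1) I I' d[of "n + 1"] by (simp add: Hom_def)
    have "i \<odot> (x \<odot> diff V (n + 1 + 1)) = (y \<odot> diff V (n + 1)) \<odot> diff V (n + 1 + 1)"
      by (rule reassoc[OF y(3)]) (use y d[of "n + 1 + 1"] I I' in \<open>simp_all add: Hom_def add.commute\<close>)
    also have "\<dots> = y \<odot> (diff V (n + 1) \<odot> diff V (n + 1 + 1))"
      by (rule assoc) (use y d[of "n + 1"] d[of "n + 1 + 1"] in \<open>simp_all add: Hom_def add.commute\<close>)
    also have "\<dots> = Zer C (obj V (n + 1 + 1)) B"
      unfolding complex_zer[OF V1] using y V1 by (simp add: Hom_def)
    finally have "x \<odot> diff V (n + 1 + 1) = Zer C (obj V (n + 1 + 1)) A"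
      by - (rule monic_zer[OF I(5)], use y d[of "n + 1 + 1"] I I' in \<open>simp_all add: Hom_def add.commute\<close>)
    then show "cocycle C V A (n + 1) x" unfolding cocycle_def using y(2) by blast
  qed
  have total: "\<exists>c'. Rel n c c'" if c: "c \<in> carrier (lH C V D n)" for n c
  proof -
    obtain z where z: "cocycle C V D n z" "c = coh_class C V D n z" using lH_cases[OF V1 I'(7) c] .
    obtain y where y: "y \<in> Hom C (obj V n) B" "p \<odot> y = z" using lift[OF cocycle_hom[OF z(1)]] by blast
    have "p \<odot> (y \<odot> diff V (n + 1)) = Zer C (obj V (n + 1)) D"
      using reassoc[OF y(2), of "diff V (n + 1)"] y(1) d[of "n + 1"] I I' z(1) by (simp add: Hom_def cocycle_def)
    then obtain x where "x \<in> Hom C (obj V (n + 1)) A" "i \<odot> x = y \<odot> diff V (n + 1)"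
      using ker[of "y \<odot> diff V (n + 1)" "n + 1"] y(1) d[of "n + 1"] by (auto simp: Hom_def)
    then show ?thesis unfolding Rel_def using y z by blast
  qed
  have one: "\<exists>w \<in> Hom C (obj V n) A. x = w \<odot> diff V (n + 1)"
    if y: "y \<in> Hom C (obj V n) B" "x \<in> Hom C (obj V (n + 1)) A" "i \<odot> x = y \<odot> diff V (n + 1)"
      and s: "s \<in> Hom C (obj V (n - 1)) D" "p \<odot> y = s \<odot> diff V n" for n y x s
  proof -
    obtain s' where s': "s' \<in> Hom C (obj V (n - 1)) B" "p \<odot> s' = s" using lift[OF s(1)] by blast
    \<comment> \<open>If \<open>p \<odot> y\<close> is the coboundary of \<open>s\<close>,
      subtracting the coboundary of a lift \<open>s'\<close> moves \<open>y\<close> into the kernel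
      of \<open>p\<close> without changing its own coboundary.\<close>
    define t where "t = sub C y (s' \<odot> diff V n)"
    have t: "t \<in> Hom C (obj V n) B" unfolding t_def using y s' d[of n] by (simp add: Hom_def)
    have "p \<odot> (s' \<odot> diff V n) = s \<odot> diff V n" by (rule reassoc[OF s'(2)]) (use s' d[of n] I I' in \<open>simp_all add: Hom_def\<close>)
    then have "p \<odot> t = Zer C (obj V n) D" unfolding t_def using y s' s d[of n] I I' by (simp add: Hom_def)
    then obtain w where w: "w \<in> Hom C (obj V n) A" "i \<odot> w = t" using ker[OF t] by blast
    have dd: "s' \<odot> (diff V n \<odot> diff V (n + 1)) = Zer C (obj V (n + 1)) B"
      unfolding is_complexD(4)[OF V1] using s' V1 by (simp add: Hom_def)
    have "i \<odot> (w \<odot> diff V (n + 1)) = t \<odot> diff V (n + 1)"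
      by (rule reassoc[OF w(2)]) (use w d[of "n + 1"] I I' in \<open>simp_all add: Hom_def\<close>)
    also have "\<dots> = y \<odot> diff V (n + 1)"
      unfolding t_def using y(1) s'(1) d[of n] d[of "n + 1"] dd by (simp add: Hom_def)
    finally have "i \<odot> (w \<odot> diff V (n + 1)) = i \<odot> x" using y(3) by simp
    then have "x = w \<odot> diff V (n + 1)"
      by - (rule monicD[OF I(5)], use w y(2) d[of "n + 1"] I I' in \<open>simp_all add: Hom_def\<close>)
    then show ?thesis using w by blast
  qed
  have "\<exists>f. f \<in> hom (lH C V D n) (lH C V A (n + 1)) \<and> (\<forall>c \<in> carrier (lH C V D n). Rel n c (f c)) \<and> (\<forall>c c'. Rel n c c' \<longrightarrow> f c = c')" for n
  proof (rule functional_relation_hom[of "lH C V D n" "lH C V A (n + 1)" "Rel n"])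
    fix c c'
    show "c \<in> carrier (lH C V D n) \<and> c' \<in> carrier (lH C V A (n + 1))" if "Rel n c c'"
      using that cz cx coh_class_closed[OF V1 I'(7)] coh_class_closed[OF V1 I'(5)] unfolding Rel_def by blast
    show "c' = \<one>\<^bsub>lH C V A (n + 1)\<^esub>" if r: "Rel n \<one>\<^bsub>lH C V D n\<^esub> c'"
    proof -
      obtain y x where y: "y \<in> Hom C (obj V n) B" "x \<in> Hom C (obj V (n + 1)) A" "i \<odot> x = y \<odot> diff V (n + 1)"
        "\<one>\<^bsub>lH C V D n\<^esub> = coh_class C V D n (p \<odot> y)" "c' = coh_class C V A (n + 1) x" using r unfolding Rel_def by blast
      obtain s where "s \<in> Hom C (obj V (n - 1)) D" "p \<odot> y = s \<odot> diff V n"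
        using y(4)[symmetric] coh_class_one_iff[OF V1 I'(7) cocycle_hom[OF cz[OF y(1-3)]]] by blast
      then obtain w where "w \<in> Hom C (obj V n) A" "x = w \<odot> diff V (n + 1)" using one[OF y(1-3)] by blast
      then show ?thesis unfolding y(5) using coh_class_one_iff[OF V1 I'(5) y(2)] by auto
    qed
    fix e e' assume "Rel n c c'" "Rel n e e'"
    then obtain y x y' x' where y: "y \<in> Hom C (obj V n) B" "x \<in> Hom C (obj V (n + 1)) A" "i \<odot> x = y \<odot> diff V (n + 1)"
        "c = coh_class C V D n (p \<odot> y)" "c' = coh_class C V A (n + 1) x"
      and y': "y' \<in> Hom C (obj V n) B" "x' \<in> Hom C (obj V (n + 1)) A" "i \<odot> x' = y' \<odot> diff V (n + 1)"
        "e = coh_class C V D n (p \<odot> y')" "e' = coh_class C V A (n + 1) x'" unfolding Rel_def by blast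
    have 1: "sub C y y' \<in> Hom C (obj V n) B" "sub C x x' \<in> Hom C (obj V (n + 1)) A" using y y' sub_hom by blast+
    have 2: "i \<odot> sub C x x' = sub C y y' \<odot> diff V (n + 1)"
      using y(1-3) y'(1-3) I I' d[of "n + 1"] by (simp add: Hom_def)
    have 3: "p \<odot> sub C y y' = sub C (p \<odot> y) (p \<odot> y')" using y(1) y'(1) I I' by (simp add: Hom_def)
    show "Rel n (c \<otimes>\<^bsub>lH C V D n\<^esub> inv\<^bsub>lH C V D n\<^esub> e) (c' \<otimes>\<^bsub>lH C V A (n + 1)\<^esub> inv\<^bsub>lH C V A (n + 1)\<^esub> e')"
      unfolding Rel_def y(4,5) y'(4,5)
      using 1 2 3 coh_class_sub[OF V1 I'(7) cz[OF y(1-3)] cz[OF y'(1-3)]] coh_class_sub[OF V1 I'(5) cx[OF y(1-3)] cx[OF y'(1-3)]]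
      by (intro bexI[of _ "sub C y y'"] bexI[of _ "sub C x x'"]) simp_all
  qed (use lH_group[OF V1] I' total in blast)+
  then obtain \<delta> where \<delta>: "\<And>n. \<delta> n \<in> hom (lH C V D n) (lH C V A (n + 1))"
    "\<And>n c. c \<in> carrier (lH C V D n) \<Longrightarrow> Rel n c (\<delta> n c)" "\<And>n c c'. Rel n c c' \<Longrightarrow> \<delta> n c = c'" by metis
  have e1: "ab_exact (lH C V A n) (post C V i n) (lH C V B n) (post C V p n) (lH C V D n)" for n
    unfolding ab_exact_def
  proof (intro conjI)
    show "post C V i n \<in> hom (lH C V A n) (lH C V B n)" "post C V p n \<in> hom (lH C V B n) (lH C V D n)"
      using post_hom[OF V1 I(1), of n] post_hom[OF V1 I(2), of n] I' by simp_all
    show "post C V i n ` carrier (lH C V A n) = kernel (lH C V B n) (lH C V D n) (post C V p n)"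
    proof (intro equalityI subsetI)
      fix c assume "c \<in> post C V i n ` carrier (lH C V A n)"
      then obtain b where b: "b \<in> carrier (lH C V A n)" "c = post C V i n b" by blast
      obtain x where x': "cocycle C V A n x" "b = coh_class C V A n x" using lH_cases[OF V1 I'(5) b(1)] .
      have x: "cocycle C V A n x" "c = coh_class C V B n (i \<odot> x)"
        using b(2) x' pi_i[OF cocycle_hom[OF x'(1)]] by simp_all
      have ix: "cocycle C V B n (i \<odot> x)" using cocycle_post[OF V1 I(1), of n x] x I' by simp
      have "post C V p n c = coh_class C V D n (Zer C (obj V n) D)"
        unfolding x(2) pi_p[OF cocycle_hom[OF ix]] using piz[of x] cocycle_hom[OF x(1)] by (simp add: Hom_def)
      then show "c \<in> kernel (lH C V B n) (lH C V D n) (post C V p n)"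
        unfolding kernel_def using one_lH[OF V1 I'(7)] coh_class_closed[OF V1 I'(6) ix] x(2) by simp
    next
      fix c assume "c \<in> kernel (lH C V B n) (lH C V D n) (post C V p n)"
      then have c: "c \<in> carrier (lH C V B n)" "post C V p n c = \<one>\<^bsub>lH C V D n\<^esub>" unfolding kernel_def by auto
      obtain y where y: "cocycle C V B n y" "c = coh_class C V B n y" using lH_cases[OF V1 I'(6) c(1)] .
      note yh = cocycle_hom[OF y(1)]
      have "p \<odot> y \<in> Hom C (obj V n) D" using yh I I' by (simp add: Hom_def)
      then obtain s where s: "s \<in> Hom C (obj V (n - 1)) D" "p \<odot> y = s \<odot> diff V n"
        using c(2) unfolding y(2) pi_p[OF yh] using coh_class_one_iff[OF V1 I'(7)] by blast
      obtain s' where s': "s' \<in> Hom C (obj V (n - 1)) B" "p \<odot> s' = s" using lift[OF s(1)] by blast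
      define t where "t = sub C y (s' \<odot> diff V n)"
      have t: "t \<in> Hom C (obj V n) B" unfolding t_def using yh s' d[of n] by (simp add: Hom_def)
      have "p \<odot> (s' \<odot> diff V n) = s \<odot> diff V n" by (rule reassoc[OF s'(2)]) (use s' d[of n] I I' in \<open>simp_all add: Hom_def\<close>)
      then have "p \<odot> t = Zer C (obj V n) D" unfolding t_def using yh s' s d[of n] I I' by (simp add: Hom_def)
      then obtain w where w: "w \<in> Hom C (obj V n) A" "i \<odot> w = t" using ker[OF t] by blast
      have dd: "s' \<odot> (diff V n \<odot> diff V (n + 1)) = Zer C (obj V (n + 1)) B"
        unfolding is_complexD(4)[OF V1] using s' V1 by (simp add: Hom_def)
      have "i \<odot> (w \<odot> diff V (n + 1)) = t \<odot> diff V (n + 1)"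
        by (rule reassoc[OF w(2)]) (use w d[of "n + 1"] I I' in \<open>simp_all add: Hom_def\<close>)
      also have "\<dots> = Zer C (obj V (n + 1)) B"
        unfolding t_def using y(1) s'(1) d[of n] d[of "n + 1"] dd V1 I' by (simp add: Hom_def cocycle_def)
      finally have "w \<odot> diff V (n + 1) = Zer C (obj V (n + 1)) A"
        by - (rule monic_zer[OF I(5)], use w d[of "n + 1"] I I' in \<open>simp_all add: Hom_def\<close>)
      then have wc: "cocycle C V A n w" unfolding cocycle_def using w by blast
      have "coh_class C V B n t = c" unfolding y(2)
      proof (subst coh_class_eq_iff[OF V1 I'(6) t yh])
        have "sub C t y = neg C s' \<odot> diff V n"
          unfolding t_def sub_def using yh s'(1) d[of n] add_comm[of y "neg C (s' \<odot> diff V n)"]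
          by (simp add: Hom_def add_assoc)
        then show "\<exists>s\<in>Hom C (obj V (n - 1)) B. sub C t y = s \<odot> diff V n" using neg_hom[OF s'(1)] by blast
      qed
      then have "c = post C V i n (coh_class C V A n w)" using pi_i[OF w(1)] w(2) by simp
      then show "c \<in> post C V i n ` carrier (lH C V A n)" using coh_class_closed[OF V1 I'(5) wc] by blast
    qed
  qed
  have e2: "ab_exact (lH C V B n) (post C V p n) (lH C V D n) (\<delta> n) (lH C V A (n + 1))" for n
    unfolding ab_exact_def
  proof (intro conjI)
    show "post C V p n \<in> hom (lH C V B n) (lH C V D n)" "\<delta> n \<in> hom (lH C V D n) (lH C V A (n + 1))"
      using post_hom[OF V1 I(2), of n] I' \<delta>(1) by simp_all
    show "post C V p n ` carrier (lH C V B n) = kernel (lH C V D n) (lH C V A (n + 1)) (\<delta> n)"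
    proof (intro equalityI subsetI)
      fix c assume "c \<in> post C V p n ` carrier (lH C V B n)"
      then obtain b where b: "b \<in> carrier (lH C V B n)" "c = post C V p n b" by blast
      obtain y where y': "cocycle C V B n y" "b = coh_class C V B n y" using lH_cases[OF V1 I'(6) b(1)] .
      have y: "cocycle C V B n y" "c = coh_class C V D n (p \<odot> y)"
        using b(2) y' pi_p[OF cocycle_hom[OF y'(1)]] by simp_all
      have pc: "cocycle C V D n (p \<odot> y)" using cocycle_post[OF V1 I(2), of n y] y I' by simp
      have "Rel n c (coh_class C V A (n + 1) (Zer C (obj V (n + 1)) A))"
        unfolding Rel_def y(2) using y(1) I I' V1
        by (intro bexI[of _ y] bexI[of _ "Zer C (obj V (n + 1)) A"]) (auto simp: cocycle_def Hom_def)
      then have "\<delta> n c = \<one>\<^bsub>lH C V A (n + 1)\<^esub>" using \<delta>(3) one_lH[OF V1 I'(5)] by simp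
      then show "c \<in> kernel (lH C V D n) (lH C V A (n + 1)) (\<delta> n)"
        unfolding kernel_def using coh_class_closed[OF V1 I'(7) pc] y(2) by simp
    next
      fix c assume "c \<in> kernel (lH C V D n) (lH C V A (n + 1)) (\<delta> n)"
      then have "Rel n c \<one>\<^bsub>lH C V A (n + 1)\<^esub>" using \<delta>(2)[of c n] unfolding kernel_def by auto
      then obtain y x where y: "y \<in> Hom C (obj V n) B" "x \<in> Hom C (obj V (n + 1)) A" "i \<odot> x = y \<odot> diff V (n + 1)"
        "c = coh_class C V D n (p \<odot> y)" "coh_class C V A (n + 1) x = \<one>\<^bsub>lH C V A (n + 1)\<^esub>" unfolding Rel_def by metis
      obtain w where w: "w \<in> Hom C (obj V n) A" "x = w \<odot> diff V (n + 1)"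
        using y(5) coh_class_one_iff[OF V1 I'(5) y(2)] by auto
      \<comment> \<open>Since \<open>x\<close> is the coboundary of \<open>w\<close>, this
        correction turns \<open>y\<close> into a cocycle with the same image under
        \<open>p\<close>.\<close>
      define t where "t = sub C y (i \<odot> w)"
      have t: "t \<in> Hom C (obj V n) B" unfolding t_def using y(1) w I I' by (simp add: Hom_def)
      have "t \<odot> diff V (n + 1) = sub C (y \<odot> diff V (n + 1)) (i \<odot> x)"
        unfolding t_def w(2) using y(1) w(1) I I' d[of "n + 1"] by (simp add: Hom_def)
      also have "\<dots> = Zer C (obj V (n + 1)) B" unfolding y(3) using y(1) d[of "n + 1"] by (simp add: Hom_def)
      finally have tc: "cocycle C V B n t" unfolding cocycle_def using t by blast
      have "p \<odot> t = p \<odot> y" unfolding t_def using y(1) w(1) I(1,2) I' piz[of w] by (simp add: Hom_def)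
      then have "c = post C V p n (coh_class C V B n t)" unfolding y(4) using pi_p[OF t] by simp
      then show "c \<in> post C V p n ` carrier (lH C V B n)" using coh_class_closed[OF V1 I'(6) tc] by blast
    qed
  qed
  have e3: "ab_exact (lH C V D n) (\<delta> n) (lH C V A (n + 1)) (post C V i (n + 1)) (lH C V B (n + 1))" for n
    unfolding ab_exact_def
  proof (intro conjI)
    show "\<delta> n \<in> hom (lH C V D n) (lH C V A (n + 1))" "post C V i (n + 1) \<in> hom (lH C V A (n + 1)) (lH C V B (n + 1))"
      using post_hom[OF V1 I(1), of "n + 1"] I' \<delta>(1) by simp_all
    show "\<delta> n ` carrier (lH C V D n) = kernel (lH C V A (n + 1)) (lH C V B (n + 1)) (post C V i (n + 1))"
    proof (intro equalityI subsetI)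
      fix c' assume "c' \<in> \<delta> n ` carrier (lH C V D n)"
      then obtain c where "c \<in> carrier (lH C V D n)" "Rel n c c'" using \<delta>(2) by blast
      then obtain y x where y: "y \<in> Hom C (obj V n) B" "x \<in> Hom C (obj V (n + 1)) A" "i \<odot> x = y \<odot> diff V (n + 1)"
        "c' = coh_class C V A (n + 1) x" unfolding Rel_def by blast
      have "i \<odot> x \<in> Hom C (obj V (n + 1)) B" using y(2) I I' by (simp add: Hom_def)
      then have "coh_class C V B (n + 1) (i \<odot> x) = \<one>\<^bsub>lH C V B (n + 1)\<^esub>"
        using coh_class_one_iff[OF V1 I'(6), of "i \<odot> x" "n + 1"] y(1,3) by auto
      then show "c' \<in> kernel (lH C V A (n + 1)) (lH C V B (n + 1)) (post C V i (n + 1))"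
        unfolding kernel_def y(4) using pi_i[OF y(2)] coh_class_closed[OF V1 I'(5) cx[OF y(1-3)]] by simp
    next
      fix c' assume "c' \<in> kernel (lH C V A (n + 1)) (lH C V B (n + 1)) (post C V i (n + 1))"
      then have c: "c' \<in> carrier (lH C V A (n + 1))" "post C V i (n + 1) c' = \<one>\<^bsub>lH C V B (n + 1)\<^esub>" unfolding kernel_def by auto
      obtain x where x: "cocycle C V A (n + 1) x" "c' = coh_class C V A (n + 1) x" using lH_cases[OF V1 I'(5) c(1)] .
      note xh = cocycle_hom[OF x(1)]
      have "i \<odot> x \<in> Hom C (obj V (n + 1)) B" using xh I I' by (simp add: Hom_def)
      then obtain y where y: "y \<in> Hom C (obj V n) B" "i \<odot> x = y \<odot> diff V (n + 1)"
        using c(2) unfolding x(2) pi_i[OF xh] using coh_class_one_iff[OF V1 I'(6), of "i \<odot> x" "n + 1"] by auto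
      have "Rel n (coh_class C V D n (p \<odot> y)) c'" unfolding Rel_def x(2) using y xh by blast
      then show "c' \<in> \<delta> n ` carrier (lH C V D n)"
        using \<delta>(3) coh_class_closed[OF V1 I'(7) cz[OF y(1) xh y(2)]] by (metis imageI)
    qed
  qed
  show ?thesis unfolding I' using e1 e2 e3 by blast
qed

section \<open>Negligible morphisms\<close>

text \<open>For \<open>K\<close> the core this is \<open>factors_through_core\<close>; with the
  class as a parameter it is visibly self-dual.\<close>

definition negligible :: "('o, 'm) add_cat \<Rightarrow> 'o set \<Rightarrow> 'm \<Rightarrow> bool" where
  "negligible C K t \<longleftrightarrow> (\<exists>u \<in> Arr C. \<exists>v \<in> Arr C. Cod C u \<in> K \<and> Dom C v = Cod C u \<and> t = Cmp C v u)"

lemma negligible_op [simp]: "negligible (op_cat C) K t \<longleftrightarrow> negligible C K t"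
  unfolding negligible_def by (auto, metis+)

context category begin

lemma negligible_arr: "negligible C K t \<Longrightarrow> t \<in> Arr C"
  unfolding negligible_def by auto

lemma negligible_left:
  assumes "negligible C K t" "s \<in> Arr C" "Dom C s = Cod C t" shows "negligible C K (s \<odot> t)"
proof -
  obtain u v where u: "u \<in> Arr C" "v \<in> Arr C" "Cod C u \<in> K" "Dom C v = Cod C u" "t = v \<odot> u"
    using assms(1) unfolding negligible_def by blast
  then show ?thesis unfolding negligible_def using assms by (intro bexI[of _ u] bexI[of _ "s \<odot> v"]) auto
qed

lemma negligible_right:
  assumes "negligible C K t" "s \<in> Arr C" "Cod C s = Dom C t" shows "negligible C K (t \<odot> s)"
proof -
  obtain u v where u: "u \<in> Arr C" "v \<in> Arr C" "Cod C u \<in> K" "Dom C v = Cod C u" "t = v \<odot> u"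
    using assms(1) unfolding negligible_def by blast
  then show ?thesis unfolding negligible_def using assms by (intro bexI[of _ "u \<odot> s"] bexI[of _ v]) auto
qed

end

lemma (in preadditive_category) negligible_neg:
  assumes "negligible C K t" shows "negligible C K (neg C t)"
proof -
  obtain u v where u: "u \<in> Arr C" "v \<in> Arr C" "Cod C u \<in> K" "Dom C v = Cod C u" "t = v \<odot> u"
    using assms(1) unfolding negligible_def by blast
  then show ?thesis unfolding negligible_def by (intro bexI[of _ u] bexI[of _ "neg C v"]) auto
qed

text \<open>A fibrant replacement recorded by its arrow alone, whose domain is the object replaced;
  \<open>cof_rep\<close> is then literally the same notion in the opposite category.\<close>

definition fib_rep :: "('o, 'm) add_cat \<Rightarrow> 'o set \<Rightarrow> 'o set \<Rightarrow> 'o set \<Rightarrow> 'm \<Rightarrow> bool" where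
  "fib_rep C Q W R j \<longleftrightarrow> Cod C j \<in> R \<and> (\<exists>q. short_exact C j q \<and> Cod C q \<in> Q \<and> Cod C q \<in> W)"

abbreviation cof_rep :: "('o, 'm) add_cat \<Rightarrow> 'o set \<Rightarrow> 'o set \<Rightarrow> 'o set \<Rightarrow> 'm \<Rightarrow> bool" where
  "cof_rep C Q W R p \<equiv> fib_rep (op_cat C) R W Q p"

lemma iso_cmp:
  assumes "f \<in> iso G H" "g \<in> iso H K" "\<And>x. x \<in> carrier G \<Longrightarrow> h x = g (f x)" "group G"
  shows "h \<in> iso G K"
proof -
  interpret group G by fact
  have f: "f \<in> hom G H" "bij_betw f (carrier G) (carrier H)" and g: "g \<in> hom H K" "bij_betw g (carrier H) (carrier K)"
    using assms by (auto simp: iso_def)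
  have "h \<in> hom G K"
    by (rule homI) (use assms(3) hom_in_carrier[OF f(1)] hom_in_carrier[OF g(1)] hom_mult[OF f(1)] hom_mult[OF g(1)] in simp_all)
  moreover have "bij_betw h (carrier G) (carrier K)"
    using bij_betw_trans[OF f(2) g(2)] bij_betw_cong[of "carrier G" h "g \<circ> f"] assms(3) by simp
  ultimately show ?thesis by (simp add: iso_def)
qed

section \<open>Arithmetic of negligible morphisms\<close>

context hmod begin

lemma core_biprod:
  assumes "is_biprod C i j p q" "Dom C i \<in> Q \<inter> W \<inter> R" "Dom C j \<in> Q \<inter> W \<inter> R"
  shows "Dom C q \<in> Q \<inter> W \<inter> R"
proof -
  note b = is_biprodD[OF assms(1)] and s = biprod_se[OF assms(1)]
  show ?thesis using Q_ext[OF s] R_ext[OF s] W_ext[OF s] assms b by simp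
qed

text \<open>The sum factors through the biproduct of the two core objects, which stays in the core
  because each of the three classes is closed under extensions.\<close>

lemma negligible_add:
  assumes "negligible C (Q \<inter> W \<inter> R) s" "negligible C (Q \<inter> W \<inter> R) t" "Dom C s = Dom C t" "Cod C s = Cod C t"
  shows "negligible C (Q \<inter> W \<inter> R) (Add C s t)"
proof -
  obtain u v where u: "u \<in> Arr C" "v \<in> Arr C" "Cod C u \<in> Q \<inter> W \<inter> R" "Dom C v = Cod C u" "s = v \<odot> u"
    using assms(1) unfolding negligible_def by blast
  obtain u' v' where u': "u' \<in> Arr C" "v' \<in> Arr C" "Cod C u' \<in> Q \<inter> W \<inter> R" "Dom C v' = Cod C u'" "t = v' \<odot> u'"
    using assms(2) unfolding negligible_def by blast
  have d: "Dom C u = Dom C u'" "Cod C v = Cod C v'" using assms(3,4) u u' by simp_all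
  obtain i j p q where "is_biprod C i j p q" and ij: "Dom C i = Cod C u" "Dom C j = Cod C u'"
    by (rule biprod_exists[of "Cod C u" "Cod C u'"]) (use u u' in simp_all)
  note bp = this(1) and b = is_biprodD[OF this(1)]
  define x y where "x = Add C (i \<odot> u) (j \<odot> u')" and "y = Add C (v \<odot> p) (v' \<odot> q)"
  have x: "x \<in> Arr C" "Cod C x = Dom C q" and y: "y \<in> Arr C" "Dom C y = Dom C q"
    unfolding x_def y_def using u u' d b(1-9) ij by simp_all
  have "p \<odot> (i \<odot> u) = u" "q \<odot> (j \<odot> u') = u'"
    by (rule cmp_cancel, use u(1) u'(1) b ij in simp_all)+
  moreover have "p \<odot> (j \<odot> u') = Zer C (Dom C u') (Cod C u)" "q \<odot> (i \<odot> u) = Zer C (Dom C u) (Cod C u')"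
    by (subst zer_cancel, use u(1) u'(1) b ij in simp_all)+
  ultimately have "y \<odot> x = Add C s t"
    unfolding x_def y_def u(5) u'(5) using u(1,2,4) u'(1,2,4) d b(1-9) ij by simp
  then show ?thesis unfolding negligible_def
    using x y core_biprod[OF bp] u(3) u'(3) ij by (intro bexI[of _ x] bexI[of _ y]) auto
qed

text \<open>Some core object has to exist: the kernel of a cofibrant replacement is trivially
  fibrant, and a cofibrant replacement of that kernel is in the core by closure under
  extensions.\<close>

lemma negligible_zer:
  assumes "A \<in> Ob C" "B \<in> Ob C" shows "negligible C (Q \<inter> W \<inter> R) (Zer C A B)"
proof -
  obtain i p where 1: "short_exact C i p" "Dom C i \<in> W" "Dom C i \<in> R" "Dom C p \<in> Q" "Cod C p = A" using cof_repl[OF assms(1)] by blast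
  have "Dom C i \<in> Ob C" using short_exactD(1)[OF 1(1)] by simp
  then obtain j q where 2: "short_exact C j q" "Dom C j \<in> W" "Dom C j \<in> R" "Dom C q \<in> Q" "Cod C q = Dom C i"
    using cof_repl by blast
  have K: "Dom C q \<in> Q \<inter> W \<inter> R" using W_ext[OF 2(1)] R_ext[OF 2(1)] 1 2 by simp
  have "Dom C q \<in> Ob C" using short_exactD(2)[OF 2(1)] by simp
  then show ?thesis unfolding negligible_def using K assms
    by (intro bexI[of _ "Zer C A (Dom C q)"] bexI[of _ "Zer C (Dom C q) B"]) simp_all
qed

text \<open>\<open>v\<close> extends over a fibrant replacement of its trivially cofibrant domain,
  and that replacement lies in the core.\<close>

lemma negligible_QW:
  assumes "u \<in> Arr C" "v \<in> Arr C" "Cod C u = Dom C v" "Dom C v \<in> Q" "Dom C v \<in> W" "Cod C v \<in> R"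
  shows "negligible C (Q \<inter> W \<inter> R) (v \<odot> u)"
proof -
  obtain j q where j: "short_exact C j q" "Cod C q \<in> Q" "Cod C q \<in> W" "Cod C j \<in> R" "Dom C j = Dom C v"
    using fib_repl[of "Dom C v"] assms by auto
  note J = short_exactD[OF j(1)]
  obtain r where r: "r \<in> Hom C (Cod C j) (Cod C v)" "r \<odot> j = v"
    using extend_QW[OF j(1) assms(2)] j assms by auto
  have K: "Cod C j \<in> Q \<inter> W \<inter> R" using Q_ext[OF j(1)] W_ext[OF j(1)] j J assms by simp
  have "v \<odot> u = r \<odot> (j \<odot> u)" by (rule reassoc[OF r(2), symmetric]) (use r J j assms in \<open>simp_all add: Hom_def\<close>)
  then show ?thesis unfolding negligible_def using K r J j assms
    by (intro bexI[of _ "j \<odot> u"] bexI[of _ r]) (simp_all add: Hom_def)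
qed

section \<open>Replacements\<close>

lemma fib_repD:
  assumes "fib_rep C Q W R j" shows "j \<in> Arr C" "Cod C j \<in> R"
  using assms short_exactD(1) unfolding fib_rep_def by auto

lemma fib_extend:
  assumes "fib_rep C Q W R j" "t \<in> Hom C (Dom C j) N" "N \<in> R"
  obtains r where "r \<in> Hom C (Cod C j) N" "r \<odot> j = t"
proof -
  obtain q where q: "short_exact C j q" "Cod C q \<in> Q" "Cod C q \<in> W" using assms(1) unfolding fib_rep_def by blast
  show thesis using extend_QW[OF q(1), of t] assms q that by (auto simp: Hom_def)
qed

text \<open>The difference kills \<open>j\<close>, so it factors through the trivially cofibrant
  cokernel of \<open>j\<close>; as \<open>N\<close> is fibrant, \<open>negligible_QW\<close>
  applies.\<close>

lemma fib_unique:
  assumes j: "fib_rep C Q W R j" and r: "r \<in> Hom C (Cod C j) N" "r' \<in> Hom C (Cod C j) N" "r \<odot> j = r' \<odot> j" and N: "N \<in> R"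
  shows "negligible C (Q \<inter> W \<inter> R) (sub C r r')"
proof -
  obtain q where q: "short_exact C j q" "Cod C q \<in> Q" "Cod C q \<in> W" using j unfolding fib_rep_def by blast
  note J = short_exactD[OF q(1)]
  define d where "d = sub C r r'"
  have d: "d \<in> Arr C" "Dom C d = Cod C j" "Cod C d = N" unfolding d_def using r by (simp_all add: Hom_def)
  have "d \<odot> j = Zer C (Dom C j) (Cod C d)" unfolding d_def using r J by (simp add: Hom_def)
  then obtain h where h: "h \<in> Arr C" "Dom C h = Cod C q" "Cod C h = Cod C d" "h \<odot> q = d"
    using coker_desc[OF J(8) d(1)] d by auto
  then show ?thesis using negligible_QW[of q h] J q N d unfolding d_def by simp
qed

section \<open>Action of morphisms on the cohomology of Hom out of a fixed complex\<close>

context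
  fixes V assumes V: "cofib_complex C Q W V"
begin

text \<open>Composing a cocycle with \<open>u\<close> gives a cocycle with values in a trivially
  fibrant object, hence a coboundary.\<close>

lemma post_negligible:
  assumes t: "negligible C (Q \<inter> W \<inter> R) t" and x: "x \<in> carrier (lH C V (Dom C t) n)"
  shows "post C V t n x = \<one>\<^bsub>lH C V (Cod C t) n\<^esub>"
proof -
  note v = cofib_complexD(1)[OF V]
  note d = is_complexD(1-3)[OF v]
  have ta: "t \<in> Arr C" using negligible_arr[OF t] .
  obtain u w where u: "u \<in> Arr C" "w \<in> Arr C" "Cod C u \<in> Q \<inter> W \<inter> R" "Dom C w = Cod C u" "t = w \<odot> u"
    using t unfolding negligible_def by blast
  have dt: "Dom C t = Dom C u" "Cod C t = Cod C w" using u by simp_all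
  have o: "Dom C t \<in> Ob C" "Cod C t \<in> Ob C" using ta by simp_all
  obtain h where h: "cocycle C V (Dom C t) n h" "x = coh_class C V (Dom C t) n h" using lH_cases[OF v o(1) x] .
  have "cocycle C V (Cod C u) n (u \<odot> h)" using cocycle_post[OF v u(1)] h dt by simp
  then obtain s where s: "s \<in> Hom C (obj V (n - 1)) (Cod C u)" "s \<odot> diff V n = u \<odot> h"
    using extend_cocycle[OF V, of "Cod C u" "u \<odot> h" n] u unfolding cocycle_def by blast
  have "t \<odot> h = w \<odot> (u \<odot> h)" unfolding u(5) by (rule assoc) (use u h dt in \<open>simp_all add: cocycle_def Hom_def\<close>)
  also have "\<dots> = (w \<odot> s) \<odot> diff V n" unfolding s(2)[symmetric] by (rule assoc[symmetric]) (use u s d[of n] in \<open>simp_all add: Hom_def\<close>)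
  finally have th: "t \<odot> h = (w \<odot> s) \<odot> diff V n" .
  have "t \<odot> h \<in> Hom C (obj V n) (Cod C t)" using cocycle_hom[OF cocycle_post[OF v ta h(1)]] .
  moreover have "w \<odot> s \<in> Hom C (obj V (n - 1)) (Cod C t)" using s u by (simp add: Hom_def)
  ultimately show ?thesis unfolding h(2) post_class[OF v ta cocycle_hom[OF h(1)]]
    using coh_class_one_iff[OF v o(2)] th by blast
qed

lemma post_cong:
  assumes t: "t \<in> Hom C A B" "t' \<in> Hom C A B" and n: "negligible C (Q \<inter> W \<inter> R) (sub C t t')" and x: "x \<in> carrier (lH C V A n)"
  shows "post C V t n x = post C V t' n x"
proof -
  note v = cofib_complexD(1)[OF V]
  have t': "t \<in> Arr C" "t' \<in> Arr C" "Dom C t = A" "Dom C t' = A" "Cod C t = B" "Cod C t' = B" using t by (auto simp: Hom_def)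
  have B: "B \<in> Ob C" using ob(2)[OF t'(1)] t' by simp
  interpret group "lH C V B n" by (rule lH_group[OF v B])
  have "t = Add C (sub C t t') t'" using t' by simp
  then have "post C V t n x = post C V (sub C t t') n x \<otimes>\<^bsub>lH C V B n\<^esub> post C V t' n x"
    using post_add[OF v, of "sub C t t'" t' x n] t' x by simp
  also have "post C V (sub C t t') n x = \<one>\<^bsub>lH C V B n\<^esub>"
    using post_negligible[OF n, of x n] t' x by simp
  finally show ?thesis using post_closed[OF v t'(2), of x n] t' x by simp
qed

text \<open>Cohomology with values in the trivially fibrant kernel vanishes, and the long exact
  sequence does the rest.\<close>

lemma post_iso_epic:
  assumes se: "short_exact C i p" and i: "Dom C i \<in> W" "Dom C i \<in> R"
  shows "post C V p n \<in> iso (lH C V (Dom C p) n) (lH C V (Cod C p) n)"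
proof -
  note v = cofib_complexD(1)[OF V] and I = short_exactD[OF se]
  have o: "Dom C i \<in> Ob C" "Dom C p \<in> Ob C" "Cod C p \<in> Ob C" using I by simp_all
  have triv: "c = \<one>\<^bsub>lH C V (Dom C i) m\<^esub>" if c: "c \<in> carrier (lH C V (Dom C i) m)" for c m
  proof -
    obtain h where h: "cocycle C V (Dom C i) m h" "c = coh_class C V (Dom C i) m h" using lH_cases[OF v o(1) c] .
    then obtain s where "s \<in> Hom C (obj V (m - 1)) (Dom C i)" "s \<odot> diff V m = h"
      using extend_cocycle[OF V i, of h m] unfolding cocycle_def by blast
    then show ?thesis using h coh_class_one_iff[OF v o(1) cocycle_hom[OF h(1)]] by auto
  qed
  obtain \<delta> where d: "ab_exact (lH C V (Dom C i) n) (post C V i n) (lH C V (Dom C p) n) (post C V p n) (lH C V (Cod C p) n)"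
    "ab_exact (lH C V (Dom C p) n) (post C V p n) (lH C V (Cod C p) n) (\<delta> n) (lH C V (Dom C i) (n + 1))"
    using long_exact_sequence[OF V se i(2)] I(3) by metis
  interpret H: group_hom "lH C V (Dom C p) n" "lH C V (Cod C p) n" "post C V p n"
    by (intro group_hom.intro group_hom_axioms.intro lH_group[OF v] o) (use d(1) in \<open>simp add: ab_exact_def\<close>)
  have "post C V i n \<in> hom (lH C V (Dom C i) n) (lH C V (Dom C p) n)" using d(1) unfolding ab_exact_def by blast
  then have "post C V i n \<one>\<^bsub>lH C V (Dom C i) n\<^esub> = \<one>\<^bsub>lH C V (Dom C p) n\<^esub>"
    using hom_one lH_group[OF v] o by blast
  then have "post C V i n ` carrier (lH C V (Dom C i) n) \<subseteq> {\<one>\<^bsub>lH C V (Dom C p) n\<^esub>}" using triv by auto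
  then have "kernel (lH C V (Dom C p) n) (lH C V (Cod C p) n) (post C V p n) \<subseteq> {\<one>\<^bsub>lH C V (Dom C p) n\<^esub>}"
    using d(1) unfolding ab_exact_def by simp
  then have "inj_on (post C V p n) (carrier (lH C V (Dom C p) n))"
    unfolding H.inj_on_one_iff kernel_def by blast
  moreover have "post C V p n ` carrier (lH C V (Dom C p) n) = carrier (lH C V (Cod C p) n)"
  proof -
    have "\<delta> n \<in> hom (lH C V (Cod C p) n) (lH C V (Dom C i) (n + 1))" using d(2) unfolding ab_exact_def by blast
    then have "kernel (lH C V (Cod C p) n) (lH C V (Dom C i) (n + 1)) (\<delta> n) = carrier (lH C V (Cod C p) n)"
      unfolding kernel_def by (auto intro!: triv intro: hom_in_carrier)
    then show ?thesis using d(2) unfolding ab_exact_def by simp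
  qed
  ultimately show ?thesis using H.homh by (simp add: iso_def bij_betw_def)
qed

lemma post_iso_inverse:
  assumes c: "c \<in> Hom C A B" "c' \<in> Hom C B A"
    and n: "negligible C (Q \<inter> W \<inter> R) (sub C (c' \<odot> c) (Idn C A))" "negligible C (Q \<inter> W \<inter> R) (sub C (c \<odot> c') (Idn C B))"
  shows "post C V c n \<in> iso (lH C V A n) (lH C V B n)"
proof -
  note v = cofib_complexD(1)[OF V]
  have c': "c \<in> Arr C" "c' \<in> Arr C" "Dom C c = A" "Dom C c' = B" "Cod C c = B" "Cod C c' = A" using c by (auto simp: Hom_def)
  have o: "A \<in> Ob C" "B \<in> Ob C" using hom_ob[OF c(1)] by simp_all
  have h: "post C V c n \<in> hom (lH C V A n) (lH C V B n)" "post C V c' n \<in> hom (lH C V B n) (lH C V A n)"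
    using post_hom[OF v c'(1), of n] post_hom[OF v c'(2), of n] c' by simp_all
  have 1: "post C V c' n (post C V c n x) = x" if x: "x \<in> carrier (lH C V A n)" for x
    using post_cmp[OF v c'(1,2), of x n] post_cong[OF cmp[OF c] idn[OF o(1)] n(1) x] post_idn[OF v o(1) x] x c' by simp
  have 2: "post C V c n (post C V c' n x) = x" if x: "x \<in> carrier (lH C V B n)" for x
    using post_cmp[OF v c'(2,1), of x n] post_cong[OF cmp[OF c(2,1)] idn[OF o(2)] n(2) x] post_idn[OF v o(2) x] x c' by simp
  have "bij_betw (post C V c n) (carrier (lH C V A n)) (carrier (lH C V B n))"
    by (rule bij_betw_byWitness[of _ "post C V c' n"]) (use 1 2 hom_in_carrier[OF h(1)] hom_in_carrier[OF h(2)] in auto)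
  then show ?thesis using h by (simp add: iso_def)
qed

text \<open>\<open>c\<close> is invertible up to negligible morphisms: its composites with a filler
  \<open>c'\<close> in the other direction agree with identities on the replaced object.\<close>

lemma post_iso_comparison:
  assumes j: "fib_rep C Q W R j" "fib_rep C Q W R j'" "Dom C j = Dom C j'"
    and c: "c \<in> Hom C (Cod C j) (Cod C j')" "c \<odot> j = j'"
  shows "post C V c n \<in> iso (lH C V (Cod C j) n) (lH C V (Cod C j') n)"
proof -
  note J = fib_repD[OF j(1)] fib_repD[OF j(2)]
  obtain c' where c': "c' \<in> Hom C (Cod C j') (Cod C j)" "c' \<odot> j' = j"
    by (rule fib_extend[OF j(2), of j "Cod C j"]) (use J j in \<open>auto simp: Hom_def\<close>)
  have o: "Cod C j \<in> Ob C" "Cod C j' \<in> Ob C" using J by simp_all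
  have "(c' \<odot> c) \<odot> j = Idn C (Cod C j) \<odot> j" "(c \<odot> c') \<odot> j' = Idn C (Cod C j') \<odot> j'"
    using c c' J by (simp_all add: Hom_def)
  then show ?thesis
    using fib_unique[OF j(1) cmp[OF c(1) c'(1)] idn[OF o(1)]] fib_unique[OF j(2) cmp[OF c'(1) c(1)] idn[OF o(2)]] J
    by (intro post_iso_inverse[OF c(1) c'(1)]) simp_all
qed

end

text \<open>Push the replacement \<open>k\<close> out along \<open>p\<close> to \<open>j'\<close>.
  The other leg \<open>u\<close> is epic with the same trivially fibrant kernel as \<open>p\<close>,
  so its target is fibrant by \<open>R_coker\<close>. Thus \<open>j'\<close> is a fibrant
  replacement of \<open>Cod C p\<close> and can be compared with \<open>j\<close>.\<close>

lemma bifibrant_comparison: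
  assumes p: "cof_rep C Q W R p" and k: "fib_rep C Q W R k" "Dom C k = Dom C p" and j: "fib_rep C Q W R j" "Dom C j = Cod C p"
  obtains t where "t \<in> Hom C (Cod C k) (Cod C j)" "t \<odot> k = j \<odot> p"
    "\<And>V n. cofib_complex C Q W V \<Longrightarrow> post C V t n \<in> iso (lH C V (Cod C k) n) (lH C V (Cod C j) n)"
proof -
  obtain i where i: "short_exact C i p" "Dom C i \<in> W" "Dom C i \<in> R" "Dom C p \<in> Q" using p unfolding fib_rep_def by auto
  obtain q where q: "short_exact C k q" "Cod C q \<in> Q" "Cod C q \<in> W" "Cod C k \<in> R" using k unfolding fib_rep_def by blast
  note I = short_exactD[OF i(1)] and K = short_exactD[OF q(1)]
  obtain j' q' u where u: "short_exact C j' q'" "is_pullback (op_cat C) j' u p k" "q' \<odot> u = q" "Cod C q' = Cod C q" "Dom C j' = Cod C p"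
    by (rule push_se[OF q(1) I(2)]) (use k in simp_all)
  note P = is_pullbackD[OF u(2), simplified] and J = short_exactD[OF u(1)]
  have se: "short_exact C (k \<odot> i) u"
    by (rule corner_se[OF q(1) u(1) i(1)]) (use P J K I u k in simp_all)
  have "Cod C u \<in> R" using R_coker[OF se] i q I K k by simp
  then have j': "fib_rep C Q W R j'" unfolding fib_rep_def using u q P by auto
  obtain c where c: "c \<in> Hom C (Cod C j') (Cod C j)" "c \<odot> j' = j"
    by (rule fib_extend[OF j', of j "Cod C j"]) (use fib_repD[OF j(1)] j u in \<open>auto simp: Hom_def\<close>)
  have c': "c \<in> Arr C" "Dom C c = Cod C u" "Cod C c = Cod C j" using c P by (auto simp: Hom_def)
  have u': "u \<in> Arr C" "Dom C u = Cod C k" "Cod C u = Cod C j'" using P K by auto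
  show thesis
  proof (rule that[of "c \<odot> u"])
    show "c \<odot> u \<in> Hom C (Cod C k) (Cod C j)" using c' u' by (simp add: Hom_def)
    have "c \<odot> (u \<odot> k) = c \<odot> (j' \<odot> p)" using P by simp
    also have "\<dots> = j \<odot> p" by (rule reassoc[OF c(2)]) (use c' u' J I u in simp_all)
    finally show "(c \<odot> u) \<odot> k = j \<odot> p" using c' u' K by simp
    fix V n assume V: "cofib_complex C Q W V"
    note v = cofib_complexD(1)[OF V]
    have 1: "post C V u n \<in> iso (lH C V (Cod C k) n) (lH C V (Cod C j') n)"
      using post_iso_epic[OF V se, of n] i u' I K k by simp
    have 2: "post C V c n \<in> iso (lH C V (Cod C j') n) (lH C V (Cod C j) n)"
      by (rule post_iso_comparison[OF V j' j(1) _ c]) (use u j in simp)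
    show "post C V (c \<odot> u) n \<in> iso (lH C V (Cod C k) n) (lH C V (Cod C j) n)"
      by (rule iso_cmp[OF 1 2]) (use post_cmp[OF v u'(1) c'(1)] c' u' lH_group[OF v, of "Cod C k" n] K in simp_all)
  qed
qed

text \<open>Push the sequence out along \<open>j\<close>, then replace only the new middle object,
  along \<open>k\<close>. The quotient is then fibrant by \<open>R_coker\<close>, and the induced
  arrow \<open>z\<close> is monic with the same cokernel as \<open>k\<close>.\<close>

lemma fib_rep_se:
  assumes j: "fib_rep C Q W R j" and se: "short_exact C f g" and dj: "Dom C j = Dom C f"
  obtains f' g' y z where "short_exact C f' g'" "fib_rep C Q W R y" "fib_rep C Q W R z"
    "Dom C y = Cod C f" "Dom C z = Cod C g" "Dom C f' = Cod C j" "Cod C f' = Cod C y" "Cod C g' = Cod C z"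
    "f' \<odot> j = y \<odot> f" "g' \<odot> y = z \<odot> g"
proof -
  interpret op: hmod "op_cat C" R W Q by (rule op_hmod)
  obtain q where q: "short_exact C j q" "Cod C q \<in> Q" "Cod C q \<in> W" "Cod C j \<in> R" using j unfolding fib_rep_def by blast
  note J = short_exactD[OF q(1)] and F = short_exactD[OF se]
  obtain f1 g1 u where u: "short_exact C f1 g1" "is_pullback (op_cat C) f1 u j f" "g1 \<odot> u = g" "Cod C g1 = Cod C g" "Dom C f1 = Cod C j"
    by (rule push_se[OF se J(1) dj])
  note P = is_pullbackD[OF u(2), simplified] and G = short_exactD[OF u(1)]
  obtain q1 where q1: "short_exact C u q1" "Cod C q1 = Cod C q"
    by (rule op.pullback_se[OF is_pullback_sym[OF u(2)], of q]) (use q in simp_all)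
  note U = short_exactD[OF q1(1)]
  obtain k qk where k: "short_exact C k qk" "Cod C qk \<in> Q" "Cod C qk \<in> W" "Cod C k \<in> R" "Dom C k = Cod C u"
    using fib_repl[of "Cod C u"] P by auto
  note K = short_exactD[OF k(1)]
  \<comment> \<open>Exhibits the cokernel of \<open>k \<odot> u\<close> as an extension of the
    cokernel of \<open>k\<close> by that of \<open>u\<close>, both trivially cofibrant.\<close>
  obtain i' p' u1 where e: "short_exact C i' p'" "is_pullback (op_cat C) i' u1 q1 k" "p' \<odot> u1 = qk" "Cod C p' = Cod C qk" "Dom C i' = Cod C q1"
    by (rule push_se[OF k(1) U(2)]) (use U k in simp_all)
  note PE = is_pullbackD[OF e(2), simplified] and E = short_exactD[OF e(1)]
  have ku: "short_exact C (k \<odot> u) u1"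
    by (rule corner_se[OF k(1) e(1) q1(1)]) (use PE E K U k e in simp_all)
  have "Cod C u1 \<in> Q" "Cod C u1 \<in> W"
    using Q_ext[OF e(1)] W_ext[OF e(1)] e q1 q k PE E by simp_all
  then have y: "fib_rep C Q W R (k \<odot> u)" unfolding fib_rep_def using ku k K U by auto
  have "monic C (k \<odot> f1)" by (rule monic_cmp) (use K G k P in simp_all)
  then obtain g' where g': "short_exact C (k \<odot> f1) g'" using monic_coker_short_exact by blast
  note G' = short_exactD[OF g']
  have cg: "Dom C g' = Cod C k" "Dom C g1 = Cod C u" "Cod C f1 = Cod C u" "Cod C f1 = Dom C k" using G' G K P k by auto
  have "g' \<odot> (k \<odot> f1) = Zer C (Dom C f1) (Cod C g')" using G' K G cg by simp
  then have "(g' \<odot> k) \<odot> f1 = Zer C (Dom C f1) (Cod C (g' \<odot> k))" using G' K G cg by simp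
  then obtain z where z: "z \<in> Arr C" "Dom C z = Cod C g1" "Cod C z = Cod C g'" "z \<odot> g1 = g' \<odot> k"
    using coker_desc[OF G(8), of "g' \<odot> k"] G' K G cg k by auto
  have "qk \<odot> (k \<odot> f1) = Zer C (Dom C (k \<odot> f1)) (Cod C qk)" by (subst zer_cancel) (use K G cg in simp_all)
  then obtain c where c: "c \<in> Arr C" "Dom C c = Cod C g'" "Cod C c = Cod C qk" "c \<odot> g' = qk"
    using coker_desc[OF G'(8) K(2)] K G' G cg by auto
  have "is_coker C c z"
  proof (rule is_cokerI)
    show "epic C c" by (rule epic_cancel[of c g']) (use c K G' in simp_all)
    have "(c \<odot> z) \<odot> g1 = c \<odot> (z \<odot> g1)" by (rule assoc) (use c z G in simp_all)
    also have "\<dots> = qk \<odot> k" unfolding z(4) by (rule reassoc[OF c(4)]) (use c G' K cg in simp_all)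
    finally show "c \<odot> z = Zer C (Dom C z) (Cod C c)"
      by - (rule epic_zer[OF G(6)], use c z K k cg in simp_all)
    fix t assume t: "t \<in> Arr C" "Dom C t = Cod C z" "t \<odot> z = Zer C (Dom C z) (Cod C t)"
    have "(t \<odot> g') \<odot> k = t \<odot> (z \<odot> g1)" unfolding z(4) by (rule assoc) (use t z G' K cg in simp_all)
    also have "\<dots> = Zer C (Dom C z) (Cod C t) \<odot> g1" by (rule reassoc[OF t(3)]) (use t z G in simp_all)
    also have "\<dots> = Zer C (Dom C k) (Cod C (t \<odot> g'))" using t z G G' cg k by simp
    finally obtain h where h: "h \<in> Arr C" "Dom C h = Cod C qk" "Cod C h = Cod C (t \<odot> g')" "h \<odot> qk = t \<odot> g'"
      using coker_desc[OF K(8), of "t \<odot> g'"] t z G' cg by auto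
    have "(h \<odot> c) \<odot> g' = h \<odot> qk" using h c G' by simp
    then have "h \<odot> c = t" unfolding h(4) by - (rule epicD[OF G'(6)], use h c t z G' in simp_all)
    then show "\<exists>h. h \<in> Arr C \<and> Dom C h = Cod C c \<and> Cod C h = Cod C t \<and> h \<odot> c = t"
      using h c t z G' by auto
  qed (use c z in simp_all)
  moreover have "monic C z"
  proof (rule monicI[OF z(1)])
    fix x A assume x: "x \<in> Arr C" "Dom C x = A" "Cod C x = Dom C z" "z \<odot> x = Zer C A (Cod C z)"
    obtain e s where e: "epic C e" "s \<in> Arr C" "Dom C s = Dom C e" "Cod C e = Dom C x" "Cod C s = Dom C g1" "x \<odot> e = g1 \<odot> s"
      by (rule cover[OF G(6) x(1)]) (use x z in simp_all)
    note ea = epic_arr[OF e(1)]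
    have "g' \<odot> (k \<odot> s) = z \<odot> (g1 \<odot> s)" by (rule assoc_eq[OF z(4)[symmetric]]) (use G' K cg z G e k in simp_all)
    also have "\<dots> = z \<odot> (x \<odot> e)" by (simp only: e)
    also have "\<dots> = Zer C A (Cod C z) \<odot> e" by (rule reassoc[OF x(4)]) (use x e ea z in simp_all)
    finally have "g' \<odot> (k \<odot> s) = Zer C (Dom C (k \<odot> s)) (Cod C g')" using x e ea z K cg k ob(2)[OF z(1)] by simp
    then obtain w where w: "w \<in> Arr C" "Dom C w = Dom C (k \<odot> s)" "Cod C w = Dom C (k \<odot> f1)" "(k \<odot> f1) \<odot> w = k \<odot> s"
      using ker_lift[OF G'(7), of "k \<odot> s"] e K cg k by auto
    have "f1 \<odot> w = s" by (rule monicD[OF K(5)]) (use w G K cg e k in simp_all)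
    then have "g1 \<odot> s = g1 \<odot> (f1 \<odot> w)" by simp
    also have "\<dots> = Zer C (Dom C w) (Cod C g1)" by (rule zer_cancel) (use G w K cg in simp_all)
    finally have "x \<odot> e = Zer C (Dom C e) (Dom C z)" using e w z K cg k by simp
    then show "x = Zer C A (Dom C z)" by - (rule epic_zer[OF e(1)], use x e z in simp_all)
  qed
  ultimately have "short_exact C z c" by (rule short_exactI_coker)
  moreover have "Cod C g' \<in> R" using R_coker[OF g'] k q u K G cg by simp
  ultimately have z': "fib_rep C Q W R z" unfolding fib_rep_def using c k z by auto
  show thesis
  proof (rule that[OF g' y z'])
    show "(k \<odot> f1) \<odot> j = (k \<odot> u) \<odot> f" using P K J F cg k by simp
    have "g' \<odot> (k \<odot> u) = z \<odot> (g1 \<odot> u)" by (rule assoc_eq[OF z(4)[symmetric]]) (use G' K cg z G U k in simp_all)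
    then show "g' \<odot> (k \<odot> u) = z \<odot> g" unfolding u(3) .
  qed (use P K J F cg k u z G U in simp_all)
qed

end

section \<open>Transport along natural isomorphisms\<close>

lemma isoD:
  assumes "f \<in> iso G H"
  shows "f \<in> hom G H" "inj_on f (carrier G)" "f ` carrier G = carrier H" "x \<in> carrier G \<Longrightarrow> f x \<in> carrier H"
  using assms by (auto simp: iso_def bij_betw_def)

lemma iso_eqI:
  assumes "f \<in> iso G H" "x \<in> carrier G" "y \<in> carrier G" "f x = f y" shows "x = y"
  using inj_onD[OF isoD(2)[OF assms(1)]] assms(2-4) by blast

text \<open>The injective homomorphism \<open>c\<close> reflects the equation to be shown.\<close>

lemma hom_transport:
  assumes c: "c \<in> iso K' K" and a: "a \<in> hom G' G" and g: "g \<in> hom G K" and G': "group G'" and K': "group K'"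
    and f: "\<And>x. x \<in> carrier G' \<Longrightarrow> f x \<in> carrier K' \<and> c (f x) = g (a x)"
  shows "f \<in> hom G' K'"
proof (rule homI)
  interpret G': group G' by fact
  interpret K': group K' by fact
  show "f x \<in> carrier K'" if "x \<in> carrier G'" for x using f[OF that] by blast
  fix x y assume xy: "x \<in> carrier G'" "y \<in> carrier G'"
  have "c (f (x \<otimes>\<^bsub>G'\<^esub> y)) = g (a x \<otimes>\<^bsub>G\<^esub> a y)" using f[of "x \<otimes>\<^bsub>G'\<^esub> y"] xy hom_mult[OF a] by simp
  also have "\<dots> = c (f x) \<otimes>\<^bsub>K\<^esub> c (f y)" using hom_mult[OF g] hom_in_carrier[OF a] f xy by simp
  also have "\<dots> = c (f x \<otimes>\<^bsub>K'\<^esub> f y)" using hom_mult[OF isoD(1)[OF c]] f xy by simp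
  finally show "f (x \<otimes>\<^bsub>G'\<^esub> y) = f x \<otimes>\<^bsub>K'\<^esub> f y"
    by (rule iso_eqI[OF c, rotated 2]) (use f xy in simp_all)
qed

lemma ab_exact_transport:
  assumes ex: "ab_exact G f H g K" and a: "a \<in> iso G' G" and b: "b \<in> iso H' H" and c: "c \<in> iso K' K"
    and grp: "group G'" "group H'" "group K'" "group K"
    and f: "\<And>x. x \<in> carrier G' \<Longrightarrow> f' x \<in> carrier H' \<and> b (f' x) = f (a x)"
    and g: "\<And>x. x \<in> carrier H' \<Longrightarrow> g' x \<in> carrier K' \<and> c (g' x) = g (b x)"
  shows "ab_exact G' f' H' g' K'"
proof -
  have e: "f \<in> hom G H" "g \<in> hom H K" "f ` carrier G = kernel H K g" using ex by (auto simp: ab_exact_def)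
  have one: "c \<one>\<^bsub>K'\<^esub> = \<one>\<^bsub>K\<^esub>" using hom_one[OF isoD(1)[OF c] grp(3,4)] .
  have "f' ` carrier G' = kernel H' K' g'"
  proof (intro equalityI subsetI)
    fix y assume "y \<in> f' ` carrier G'"
    then obtain x where x: "x \<in> carrier G'" "y = f' x" by blast
    have "f (a x) \<in> kernel H K g" using e(3) isoD(4)[OF a x(1)] by blast
    then have "c (g' y) = c \<one>\<^bsub>K'\<^esub>" using f[OF x(1)] g[of y] x one by (simp add: kernel_def)
    then have "g' y = \<one>\<^bsub>K'\<^esub>"
      by (rule iso_eqI[OF c, rotated 2]) (use f[OF x(1)] g[of y] x group.is_monoid[OF grp(3)] monoid.one_closed in auto)
    then show "y \<in> kernel H' K' g'" using f[OF x(1)] x by (simp add: kernel_def)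
  next
    fix y assume "y \<in> kernel H' K' g'"
    then have y: "y \<in> carrier H'" "g' y = \<one>\<^bsub>K'\<^esub>" by (auto simp: kernel_def)
    have "b y \<in> kernel H K g" using g[OF y(1)] y one isoD(4)[OF b y(1)] by (simp add: kernel_def)
    then obtain u where u: "u \<in> carrier G" "b y = f u" using e(3) by blast
    obtain x where x: "x \<in> carrier G'" "u = a x" using isoD(3)[OF a] u(1) by blast
    have "y = f' x" by (rule iso_eqI[OF b y(1)]) (use f[OF x(1)] x u in simp_all)
    then show "y \<in> f' ` carrier G'" using x by blast
  qed
  then show ?thesis unfolding ab_exact_def
    using hom_transport[OF b isoD(1)[OF a] e(1) grp(1,2) f] hom_transport[OF c isoD(1)[OF b] e(2) grp(2,3) g] by blast
qed

lemma long_exact_transport: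
  fixes FX FY FZ :: "int \<Rightarrow> 'g monoid" and GX GY GZ :: "int \<Rightarrow> 'h monoid"
  assumes ex: "\<exists>\<delta>. \<forall>n. ab_exact (GX n) (f n) (GY n) (g n) (GZ n) \<and> ab_exact (GY n) (g n) (GZ n) (\<delta> n) (GX (n + 1)) \<and>
      ab_exact (GZ n) (\<delta> n) (GX (n + 1)) (f (n + 1)) (GY (n + 1))"
    and x: "\<And>n. x n \<in> iso (FX n) (GX n)" and y: "\<And>n. y n \<in> iso (FY n) (GY n)" and z: "\<And>n. z n \<in> iso (FZ n) (GZ n)"
    and F: "\<And>n. group (FX n)" "\<And>n. group (FY n)" "\<And>n. group (FZ n)"
    and G: "\<And>n. group (GX n)" "\<And>n. group (GY n)" "\<And>n. group (GZ n)"
    and f: "\<And>n c. c \<in> carrier (FX n) \<Longrightarrow> f' n c \<in> carrier (FY n) \<and> y n (f' n c) = f n (x n c)"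
    and g: "\<And>n c. c \<in> carrier (FY n) \<Longrightarrow> g' n c \<in> carrier (FZ n) \<and> z n (g' n c) = g n (y n c)"
  shows "\<exists>\<delta>. \<forall>n. ab_exact (FX n) (f' n) (FY n) (g' n) (FZ n) \<and> ab_exact (FY n) (g' n) (FZ n) (\<delta> n) (FX (n + 1)) \<and>
      ab_exact (FZ n) (\<delta> n) (FX (n + 1)) (f' (n + 1)) (FY (n + 1))"
proof -
  obtain \<delta> where d: "\<And>n. ab_exact (GX n) (f n) (GY n) (g n) (GZ n)" "\<And>n. ab_exact (GY n) (g n) (GZ n) (\<delta> n) (GX (n + 1))"
    "\<And>n. ab_exact (GZ n) (\<delta> n) (GX (n + 1)) (f (n + 1)) (GY (n + 1))" using ex by metis
  \<comment> \<open>The connecting map conjugated with the isomorphisms at its two ends.\<close>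
  define \<delta>' where "\<delta>' n c = inv_into (carrier (FX (n + 1))) (x (n + 1)) (\<delta> n (z n c))" for n c
  have dh: "\<delta> n \<in> hom (GZ n) (GX (n + 1))" for n using d(2) by (auto simp: ab_exact_def)
  have d': "\<delta>' n c \<in> carrier (FX (n + 1)) \<and> x (n + 1) (\<delta>' n c) = \<delta> n (z n c)" if c: "c \<in> carrier (FZ n)" for n c
  proof -
    have "\<delta> n (z n c) \<in> x (n + 1) ` carrier (FX (n + 1))"
      using hom_in_carrier[OF dh isoD(4)[OF z c]] isoD(3)[OF x[of "n + 1"]] by simp
    then show ?thesis unfolding \<delta>'_def using inv_into_into f_inv_into_f by metis
  qed
  have 1: "ab_exact (FX n) (f' n) (FY n) (g' n) (FZ n)" for n
    by (rule ab_exact_transport[OF d(1) x y z F(1) F(2) F(3) G(3) f g])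
  have 2: "ab_exact (FY n) (g' n) (FZ n) (\<delta>' n) (FX (n + 1))" for n
    by (rule ab_exact_transport[OF d(2) y z x F(2) F(3) F(1) G(1) g d'])
  have 3: "ab_exact (FZ n) (\<delta>' n) (FX (n + 1)) (f' (n + 1)) (FY (n + 1))" for n
    by (rule ab_exact_transport[OF d(3) z x y F(3) F(1) F(2) G(2) d' f])
  show ?thesis using 1 2 3 by blast
qed

lemma ab_functor_transport:
  assumes G: "ab_functor D G Gm"
    and hom: "\<And>A B f. f \<in> Hom D A B \<Longrightarrow> A \<in> Ob D \<and> B \<in> Ob D"
    and cmp: "\<And>A B E f g. f \<in> Hom D A B \<Longrightarrow> g \<in> Hom D B E \<Longrightarrow> Cmp D g f \<in> Hom D A E"
    and idn: "\<And>A. A \<in> Ob D \<Longrightarrow> Idn D A \<in> Hom D A A"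
    and t: "\<And>A. A \<in> Ob D \<Longrightarrow> t A \<in> iso (F A) (G A)" and F: "\<And>A. A \<in> Ob D \<Longrightarrow> comm_group (F A)"
    and m: "\<And>A B f x. f \<in> Hom D A B \<Longrightarrow> x \<in> carrier (F A) \<Longrightarrow> Fm f x \<in> carrier (F B) \<and> t B (Fm f x) = Gm f (t A x)"
  shows "ab_functor D F Fm"
  unfolding ab_functor_def
proof (intro conjI allI ballI)
  note g = G[unfolded ab_functor_def]
  show "comm_group (F A)" if "A \<in> Ob D" for A using F that .
  fix A
  show "Fm (Idn D A) x = x" if A: "A \<in> Ob D" "x \<in> carrier (F A)" for x
    by (rule iso_eqI[OF t[OF A(1)]]) (use m[OF idn[OF A(1)] A(2)] g A isoD(4)[OF t[OF A(1)]] in auto)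
  fix B f assume f: "f \<in> Hom D A B"
  have o: "A \<in> Ob D" "B \<in> Ob D" using hom[OF f] by auto
  show "Fm f \<in> hom (F A) (F B)"
  proof (rule hom_transport[of "t B" "F B" "G B" "t A" "F A" "G A" "Gm f"])
    show "t B \<in> iso (F B) (G B)" by (rule t[OF o(2)])
    show "t A \<in> hom (F A) (G A)" by (rule isoD(1)[OF t[OF o(1)]])
    show "Gm f \<in> hom (G A) (G B)" using g f by blast
    show "group (F A)" "group (F B)" using F o comm_group.axioms(2) by blast+
  qed (rule m[OF f])
  fix E k x assume k: "k \<in> Hom D B E" and x: "x \<in> carrier (F A)"
  have oE: "E \<in> Ob D" using hom[OF k] by blast
  note m1 = m[OF f x] and m2 = m[OF k conjunct1[OF m[OF f x]]] and m3 = m[OF cmp[OF f k] x]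
  have "Gm (Cmp D k f) (t A x) = Gm k (Gm f (t A x))" using g f k isoD(4)[OF t[OF o(1)] x] by blast
  then show "Fm (Cmp D k f) x = Fm k (Fm f x)"
    by - (rule iso_eqI[OF t[OF oE]], use m1 m2 m3 in simp_all)
qed

lemma additive_ab_functor_transport:
  assumes D: "preadditive_category D" and G: "additive_ab_functor D G Gm"
    and t: "\<And>A. A \<in> Ob D \<Longrightarrow> t A \<in> iso (F A) (G A)" and F: "\<And>A. A \<in> Ob D \<Longrightarrow> comm_group (F A)"
    and m: "\<And>A B f x. f \<in> Hom D A B \<Longrightarrow> x \<in> carrier (F A) \<Longrightarrow> Fm f x \<in> carrier (F B) \<and> t B (Fm f x) = Gm f (t A x)"
  shows "additive_ab_functor D F Fm"
  unfolding additive_ab_functor_def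
proof (intro conjI allI ballI)
  interpret D: preadditive_category D by fact
  show "ab_functor D F Fm"
  proof (rule ab_functor_transport[of D G Gm t F Fm])
    show "ab_functor D G Gm" using G by (simp add: additive_ab_functor_def)
  qed (fact D.hom_ob D.cmp D.idn t F m)+
  fix A B f g x assume f: "f \<in> Hom D A B" "g \<in> Hom D A B" and x: "x \<in> carrier (F A)"
  have o: "A \<in> Ob D" "B \<in> Ob D" using D.hom_ob[OF f(1)] by auto
  note m1 = m[OF f(1) x] and m2 = m[OF f(2) x] and m3 = m[OF D.add_hom[OF f] x]
  have "Gm (Add D f g) (t A x) = Gm f (t A x) \<otimes>\<^bsub>G B\<^esub> Gm g (t A x)"
    using G f isoD(4)[OF t[OF o(1)] x] unfolding additive_ab_functor_def by blast
  then have "t B (Fm (Add D f g) x) = t B (Fm f x \<otimes>\<^bsub>F B\<^esub> Fm g x)"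
    using m1 m2 m3 hom_mult[OF isoD(1)[OF t[OF o(2)]]] by simp
  moreover have "Fm f x \<otimes>\<^bsub>F B\<^esub> Fm g x \<in> carrier (F B)"
    using m1 m2 monoid.m_closed[OF group.is_monoid[OF comm_group.axioms(2)[OF F[OF o(2)]]]] by simp
  ultimately show "Fm (Add D f g) x = Fm f x \<otimes>\<^bsub>F B\<^esub> Fm g x"
    by - (rule iso_eqI[OF t[OF o(2)]], use m3 in simp_all)
qed

lemma long_exact_sequences_transport:
  assumes D: "category D" and G: "long_exact_sequences D G Gm"
    and t: "\<And>n A. A \<in> Ob D \<Longrightarrow> t n A \<in> iso (F n A) (G n A)"
    and grp: "\<And>n A. A \<in> Ob D \<Longrightarrow> group (F n A)" "\<And>n A. A \<in> Ob D \<Longrightarrow> group (G n A)"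
    and m: "\<And>n A B f x. f \<in> Hom D A B \<Longrightarrow> x \<in> carrier (F n A) \<Longrightarrow> Fm n f x \<in> carrier (F n B) \<and> t n B (Fm n f x) = Gm n f (t n A x)"
  shows "long_exact_sequences D F Fm"
  unfolding long_exact_sequences_def
proof (intro allI impI)
  interpret D: category D by fact
  fix X Y Z f g assume a: "f \<in> Hom D X Y \<and> g \<in> Hom D Y Z \<and> short_exact D f g"
  then have o: "X \<in> Ob D" "Y \<in> Ob D" "Z \<in> Ob D" using D.hom_ob by blast+
  show "\<exists>\<delta>. \<forall>n. ab_exact (F n X) (Fm n f) (F n Y) (Fm n g) (F n Z) \<and> ab_exact (F n Y) (Fm n g) (F n Z) (\<delta> n) (F (n + 1) X) \<and>
      ab_exact (F n Z) (\<delta> n) (F (n + 1) X) (Fm (n + 1) f) (F (n + 1) Y)"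
    by (rule long_exact_transport[of "\<lambda>n. G n X" "\<lambda>n. Gm n f" "\<lambda>n. G n Y" "\<lambda>n. Gm n g" "\<lambda>n. G n Z" "\<lambda>n. t n X" _ "\<lambda>n. t n Y" _ "\<lambda>n. t n Z"])
      (use a G t grp o m in \<open>auto simp: long_exact_sequences_def\<close>)
qed

text \<open>Two functors isomorphic to a common third are compared by \<open>s\<close> followed by
  the inverse of \<open>t\<close>; naturality is checked after applying the injective
  \<open>t\<close>.\<close>

lemma naturally_isomorphic_trans_sym:
  assumes F: "\<And>A B. A \<in> Ob C \<Longrightarrow> B \<in> Ob C \<Longrightarrow> s A B \<in> iso (F A B) (G A B)"
    "\<And>A' A f B x. f \<in> Hom C A' A \<Longrightarrow> B \<in> Ob C \<Longrightarrow> x \<in> carrier (F A B) \<Longrightarrow> s A' B (F1 f B x) = G1 f B (s A B x)"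
    "\<And>A B B' g x. A \<in> Ob C \<Longrightarrow> g \<in> Hom C B B' \<Longrightarrow> x \<in> carrier (F A B) \<Longrightarrow> s A B' (F2 A g x) = G2 A g (s A B x)"
    and H: "\<And>A B. A \<in> Ob C \<Longrightarrow> B \<in> Ob C \<Longrightarrow> t A B \<in> iso (H A B) (G A B)"
    "\<And>A' A f B x. f \<in> Hom C A' A \<Longrightarrow> B \<in> Ob C \<Longrightarrow> x \<in> carrier (H A B) \<Longrightarrow> H1 f B x \<in> carrier (H A' B) \<and> t A' B (H1 f B x) = G1 f B (t A B x)"
    "\<And>A B B' g x. A \<in> Ob C \<Longrightarrow> g \<in> Hom C B B' \<Longrightarrow> x \<in> carrier (H A B) \<Longrightarrow> H2 A g x \<in> carrier (H A B') \<and> t A B' (H2 A g x) = G2 A g (t A B x)"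
    and grp: "\<And>A B. A \<in> Ob C \<Longrightarrow> B \<in> Ob C \<Longrightarrow> group (H A B)" and C: "category C"
  shows "naturally_isomorphic C F F1 F2 H H1 H2"
proof -
  interpret category C by fact
  define u where "u A B x = inv_into (carrier (H A B)) (t A B) (s A B x)" for A B x
  have u: "u A B x \<in> carrier (H A B)" "t A B (u A B x) = s A B x" if "A \<in> Ob C" "B \<in> Ob C" "x \<in> carrier (F A B)" for A B x
  proof -
    have "s A B x \<in> t A B ` carrier (H A B)" using isoD(4)[OF F(1)] isoD(3)[OF H(1)] that by blast
    then show "u A B x \<in> carrier (H A B)" "t A B (u A B x) = s A B x"
      unfolding u_def using inv_into_into f_inv_into_f by metis+
  qed
  have ui: "u A B x = y" if "A \<in> Ob C" "B \<in> Ob C" "y \<in> carrier (H A B)" "t A B y = s A B x" for A B x y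
    unfolding u_def using that inv_into_f_f[OF isoD(2)[OF H(1)]] by metis
  have "u A B \<in> iso (F A B) (H A B)" if "A \<in> Ob C" "B \<in> Ob C" for A B
    using iso_set_trans[OF F(1)[OF that] group.iso_set_sym[OF grp[OF that] H(1)[OF that]]]
    unfolding u_def comp_def .
  moreover have "u A' B (F1 f B x) = H1 f B (u A B x)" if f: "f \<in> Hom C A' A" "B \<in> Ob C" "x \<in> carrier (F A B)" for A' A f B x
  proof -
    have o: "A' \<in> Ob C" "A \<in> Ob C" using hom_ob[OF f(1)] by auto
    note h = H(2)[OF f(1,2) u(1)[OF o(2) f(2,3)]]
    show ?thesis by (rule ui[OF o(1) f(2)]) (use h u(2)[OF o(2) f(2,3)] F(2)[OF f] in simp_all)
  qed
  moreover have "u A B' (F2 A g x) = H2 A g (u A B x)" if g: "A \<in> Ob C" "g \<in> Hom C B B'" "x \<in> carrier (F A B)" for A B B' g x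
  proof -
    have o: "B \<in> Ob C" "B' \<in> Ob C" using hom_ob[OF g(2)] by auto
    note h = H(3)[OF g(1,2) u(1)[OF g(1) o(1) g(3)]]
    show ?thesis by (rule ui[OF g(1) o(2)]) (use h u(2)[OF g(1) o(1) g(3)] F(3)[OF g] in simp_all)
  qed
  ultimately show ?thesis unfolding naturally_isomorphic_def by (intro exI[of _ u]) blast
qed

section \<open>Cohomology of fibrant replacements\<close>

lemma (in preadditive_category) post_pre:
  assumes V: "is_complex C V" "is_complex C V'" and t: "t \<in> Arr C"
    and f: "f \<in> Hom C (obj V n) (obj V' n)" "f' \<in> Hom C (obj V (n - 1)) (obj V' (n - 1))" "diff V' n \<odot> f = f' \<odot> diff V n"
    and x: "x \<in> carrier (lH C V' (Dom C t) n)"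
  shows "post C V t n (pre C V (Dom C t) n f x) = pre C V (Cod C t) n f (post C V' t n x)"
proof -
  have o: "Dom C t \<in> Ob C" "Cod C t \<in> Ob C" using t by simp_all
  obtain h where h: "cocycle C V' (Dom C t) n h" "x = coh_class C V' (Dom C t) n h" using lH_cases[OF V(2) o(1) x] .
  note hh = cocycle_hom[OF h(1)]
  have hf: "h \<odot> f \<in> Hom C (obj V n) (Dom C t)" "t \<odot> h \<in> Hom C (obj V' n) (Cod C t)" using hh f t by (simp_all add: Hom_def)
  show ?thesis unfolding h(2) pre_class[OF V o(1) f hh] post_class[OF V(2) t hh] post_class[OF V(1) t hf(1)] pre_class[OF V o(2) f hf(2)]
    using hh f(1) t by (simp add: Hom_def)
qed

text \<open>Three neighbouring components of a chain map are involved: \<open>f2\<close> makes the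
  image of a cocycle a cocycle, and \<open>f'\<close> makes its class independent of the
  representative.\<close>

lemma (in preadditive_category) pre_closed:
  assumes V: "is_complex C V" "is_complex C V'" and B: "B \<in> Ob C"
    and f: "f \<in> Hom C (obj V n) (obj V' n)" "f' \<in> Hom C (obj V (n - 1)) (obj V' (n - 1))" "diff V' n \<odot> f = f' \<odot> diff V n"
    and f2: "f2 \<in> Hom C (obj V (n + 1)) (obj V' (n + 1))" "diff V' (n + 1) \<odot> f2 = f \<odot> diff V (n + 1)"
    and x: "x \<in> carrier (lH C V' B n)"
  shows "pre C V B n f x \<in> carrier (lH C V B n)"
proof -
  obtain h where h: "cocycle C V' B n h" "x = coh_class C V' B n h" using lH_cases[OF V(2) B x] .
  note hh = cocycle_hom[OF h(1)]
  have "(h \<odot> f) \<odot> diff V (n + 1) = h \<odot> (f \<odot> diff V (n + 1))"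
    by (rule assoc) (use hh f is_complexD(1-3)[OF V(1), of "n + 1"] in \<open>simp_all add: Hom_def\<close>)
  also have "\<dots> = Zer C (obj V' (n + 1)) B \<odot> f2"
    unfolding f2(2)[symmetric] using h(1) f2(1) is_complexD(1-3)[OF V(2), of "n + 1"]
    by (intro reassoc) (simp_all add: cocycle_def Hom_def)
  finally have "cocycle C V B n (h \<odot> f)" unfolding cocycle_def using f2(1) hh f(1) B by (simp add: Hom_def)
  then show ?thesis unfolding h(2) pre_class[OF V B f hh] using coh_class_closed[OF V(1) B] by blast
qed

context hmod begin

text \<open>Makes arbitrary fillers harmless: two arrows out of a fibrant replacement that agree on
  the replaced object act alike.\<close>

lemma post_square:
  assumes V: "cofib_complex C Q W V" and j: "fib_rep C Q W R j"
    and r: "r \<in> Hom C (Cod C j) N" "r' \<in> Hom C (Cod C j) N" "r \<odot> j = r' \<odot> j" "N \<in> R"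
    and x: "x \<in> carrier (lH C V (Cod C j) n)"
  shows "post C V r n x = post C V r' n x"
  by (rule post_cong[OF V r(1,2) fib_unique[OF j r] x])

lemma fib_rep_homD:
  assumes "i \<in> Hom C A B \<and> fib_rep C Q W R i"
  shows "i \<in> Arr C" "Dom C i = A" "Cod C i = B" "fib_rep C Q W R i" "B \<in> R" "B \<in> Ob C"
  using assms fib_repD(2)[of i] ob(2)[of i] by (auto simp: Hom_def)

lemma square_homD:
  assumes "r \<in> Hom C A B \<and> r \<odot> i = j"
  shows "r \<in> Arr C" "Dom C r = A" "Cod C r = B" "r \<odot> i = j"
  using assms by (auto simp: Hom_def)

context
  fixes V :: "('a, 'b) resol" and RO :: "'a \<Rightarrow> 'a" and inc :: "'a \<Rightarrow> 'b" and RM :: "'b \<Rightarrow> 'b" and n :: int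
  assumes V: "cofib_complex C Q W V"
    and inc: "\<And>A. A \<in> Ob C \<Longrightarrow> inc A \<in> Hom C A (RO A) \<and> fib_rep C Q W R (inc A)"
    and RM: "\<And>A B f. f \<in> Hom C A B \<Longrightarrow> RM f \<in> Hom C (RO A) (RO B) \<and> RM f \<odot> inc A = inc B \<odot> f"
begin

lemmas inc' = fib_rep_homD[OF inc] and RM' = square_homD[OF RM]

text \<open>\<open>RM\<close> itself need not preserve identities, composites or sums; each equation
  holds because both sides fill the same square, so that \<open>post_square\<close> applies.\<close>

lemma fibrant_replacement_functor:
  "additive_ab_functor C (\<lambda>A. lH C V (RO A) n) (\<lambda>f. post C V (RM f) n)"
  unfolding additive_ab_functor_def ab_functor_def
proof (intro conjI allI ballI)
  note v = cofib_complexD(1)[OF V]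
  show "comm_group (lH C V (RO A) n)" if "A \<in> Ob C" for A using lH_comm_group[OF v inc'(6)[OF that]] .
  show "post C V (RM (Idn C A)) n x = x" if A: "A \<in> Ob C" "x \<in> carrier (lH C V (RO A) n)" for A x
  proof -
    note i = inc'[OF A(1)] and r = RM'[OF idn[OF A(1)]]
    have "post C V (RM (Idn C A)) n x = post C V (Idn C (RO A)) n x"
      by (rule post_square[OF V i(4), where N = "RO A"]) (use i r A in \<open>simp_all add: Hom_def\<close>)
    then show ?thesis using post_idn[OF v i(6) A(2)] by simp
  qed
  fix A B f assume f: "f \<in> Hom C A B"
  have o: "A \<in> Ob C" "B \<in> Ob C" using hom_ob[OF f] by auto
  note rf = RM'[OF f] and iA = inc'[OF o(1)] and iB = inc'[OF o(2)]
  have f': "f \<in> Arr C" "Dom C f = A" "Cod C f = B" using f by (auto simp: Hom_def)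
  show "post C V (RM f) n \<in> hom (lH C V (RO A) n) (lH C V (RO B) n)" using post_hom[OF v rf(1), of n] rf by simp
  fix x assume x: "x \<in> carrier (lH C V (RO A) n)"
  show "post C V (RM (g \<odot> f)) n x = post C V (RM g) n (post C V (RM f) n x)" if g: "g \<in> Hom C B E" for E g
  proof -
    note rg = RM'[OF g] and rgf = RM'[OF cmp[OF f g]] and iE = inc'[OF conjunct2[OF hom_ob[OF g]]]
    have g': "g \<in> Arr C" "Dom C g = B" "Cod C g = E" using g by (auto simp: Hom_def)
    have "(RM g \<odot> RM f) \<odot> inc A = RM g \<odot> (inc B \<odot> f)" using rg rf iA by simp
    also have "\<dots> = inc E \<odot> (g \<odot> f)" by (rule assoc_eq[OF rg(4)]) (use rg iB iE f' g' in simp_all)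
    finally have "post C V (RM (g \<odot> f)) n x = post C V (RM g \<odot> RM f) n x"
      by - (rule post_square[OF V iA(4), where N = "RO E"], use rg rf rgf iA iE x in \<open>simp_all add: Hom_def\<close>)
    then show ?thesis using post_cmp[OF v rf(1) rg(1), of x n] rf rg x by simp
  qed
  show "post C V (RM (Add C f g)) n x = post C V (RM f) n x \<otimes>\<^bsub>lH C V (RO B) n\<^esub> post C V (RM g) n x" if g: "g \<in> Hom C A B" for g
  proof -
    note rg = RM'[OF g] and ra = RM'[OF add_hom[OF f g]]
    have g': "g \<in> Arr C" "Dom C g = A" "Cod C g = B" using g by (auto simp: Hom_def)
    have "Add C (RM f) (RM g) \<odot> inc A = inc B \<odot> Add C f g" using rf rg iA iB f' g' by simp
    then have "post C V (RM (Add C f g)) n x = post C V (Add C (RM f) (RM g)) n x"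
      by - (rule post_square[OF V iA(4), where N = "RO B"], use rg rf ra iA iB x in \<open>simp_all add: Hom_def\<close>)
    then show ?thesis using post_add[OF v rf(1) rg(1), of x n] rf rg x by simp
  qed
qed

end

text \<open>The chosen replacements of \<open>X\<close>, \<open>Y\<close>, \<open>Z\<close> need not
  form a short exact sequence. \<open>fib_rep_se\<close> extends the one of \<open>X\<close> to such
  a sequence, and \<open>cy\<close>, \<open>cz\<close> compare its other two terms with the chosen
  ones.\<close>

lemma fibrant_replacement_long_exact:
  fixes RO :: "'a \<Rightarrow> 'a" and inc :: "'a \<Rightarrow> 'b" and RM :: "'b \<Rightarrow> 'b"
  assumes V: "cofib_complex C Q W V"
    and inc: "\<And>A. A \<in> Ob C \<Longrightarrow> inc A \<in> Hom C A (RO A) \<and> fib_rep C Q W R (inc A)"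
    and RM: "\<And>A B f. f \<in> Hom C A B \<Longrightarrow> RM f \<in> Hom C (RO A) (RO B) \<and> RM f \<odot> inc A = inc B \<odot> f"
  shows "long_exact_sequences C (\<lambda>n A. lH C V (RO A) n) (\<lambda>n f. post C V (RM f) n)"
  unfolding long_exact_sequences_def
proof (intro allI impI)
  note v = cofib_complexD(1)[OF V]
  note inc' = fib_rep_homD[OF inc] and RM' = square_homD[OF RM]
  fix X Y Z f g assume a: "f \<in> Hom C X Y \<and> g \<in> Hom C Y Z \<and> short_exact C f g"
  then have f: "f \<in> Hom C X Y" "g \<in> Hom C Y Z" and se: "short_exact C f g" by auto
  have o: "X \<in> Ob C" "Y \<in> Ob C" "Z \<in> Ob C" using f hom_ob by auto
  note iX = inc'[OF o(1)] and iY = inc'[OF o(2)] and iZ = inc'[OF o(3)] and rf = RM'[OF f(1)] and rg = RM'[OF f(2)]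
  have f': "f \<in> Arr C" "Dom C f = X" "Cod C f = Y" "g \<in> Arr C" "Dom C g = Y" "Cod C g = Z" using f by (auto simp: Hom_def)
  obtain a b y z where r: "short_exact C a b" "fib_rep C Q W R y" "fib_rep C Q W R z"
    "Dom C y = Cod C f" "Dom C z = Cod C g" "Dom C a = Cod C (inc X)" "Cod C a = Cod C y" "Cod C b = Cod C z"
    "a \<odot> inc X = y \<odot> f" "b \<odot> y = z \<odot> g"
    using fib_rep_se[OF iX(4) se] iX f' by metis
  note S = short_exactD[OF r(1)] and Y = fib_repD[OF r(2)] and Z = fib_repD[OF r(3)]
  obtain cy where cy: "cy \<in> Hom C (RO Y) (Cod C y)" "cy \<odot> inc Y = y"
    by (rule fib_extend[OF iY(4), of y "Cod C y"]) (use iY Y r f' in \<open>auto simp: Hom_def\<close>)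
  obtain cz where cz: "cz \<in> Hom C (RO Z) (Cod C z)" "cz \<odot> inc Z = z"
    by (rule fib_extend[OF iZ(4), of z "Cod C z"]) (use iZ Z r f' in \<open>auto simp: Hom_def\<close>)
  have cy': "cy \<in> Arr C" "Dom C cy = RO Y" "Cod C cy = Cod C y" and cz': "cz \<in> Arr C" "Dom C cz = RO Z" "Cod C cz = Cod C z"
    using cy cz by (auto simp: Hom_def)
  have isoy: "post C V cy n \<in> iso (lH C V (RO Y) n) (lH C V (Cod C y) n)" for n
    using post_iso_comparison[OF V iY(4) r(2) _ _ cy(2)] cy(1) iY r f' by simp
  have isoz: "post C V cz n \<in> iso (lH C V (RO Z) n) (lH C V (Cod C z) n)" for n
    using post_iso_comparison[OF V iZ(4) r(3) _ _ cz(2)] cz(1) iZ r f' by simp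
  have ex: "\<exists>\<delta>. \<forall>n. ab_exact (lH C V (RO X) n) (post C V a n) (lH C V (Cod C y) n) (post C V b n) (lH C V (Cod C z) n) \<and>
    ab_exact (lH C V (Cod C y) n) (post C V b n) (lH C V (Cod C z) n) (\<delta> n) (lH C V (RO X) (n + 1)) \<and>
    ab_exact (lH C V (Cod C z) n) (\<delta> n) (lH C V (RO X) (n + 1)) (post C V a (n + 1)) (lH C V (Cod C y) (n + 1))"
    using long_exact_sequence[OF V r(1)] r iX by simp
  have sq1: "post C V (RM f) n c \<in> carrier (lH C V (RO Y) n) \<and> post C V cy n (post C V (RM f) n c) = post C V a n c"
    if c: "c \<in> carrier (lH C V (RO X) n)" for n c
  proof
    show "post C V (RM f) n c \<in> carrier (lH C V (RO Y) n)" using post_closed[OF v rf(1), of c n] rf c by simp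
    have "(cy \<odot> RM f) \<odot> inc X = cy \<odot> (inc Y \<odot> f)" using rf cy' iX by simp
    also have "\<dots> = a \<odot> inc X" unfolding r(9) by (rule reassoc[OF cy(2)]) (use cy' iY f' in simp_all)
    finally have "post C V (cy \<odot> RM f) n c = post C V a n c"
      by - (rule post_square[OF V iX(4), where N = "Cod C y"], use rf cy' iX S r Y c in \<open>simp_all add: Hom_def\<close>)
    then show "post C V cy n (post C V (RM f) n c) = post C V a n c"
      using post_cmp[OF v rf(1) cy'(1), of c n] rf cy' c by simp
  qed
  have sq2: "post C V (RM g) n c \<in> carrier (lH C V (RO Z) n) \<and> post C V cz n (post C V (RM g) n c) = post C V b n (post C V cy n c)"
    if c: "c \<in> carrier (lH C V (RO Y) n)" for n c
  proof
    show "post C V (RM g) n c \<in> carrier (lH C V (RO Z) n)" using post_closed[OF v rg(1), of c n] rg c by simp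
    have "(cz \<odot> RM g) \<odot> inc Y = cz \<odot> (inc Z \<odot> g)" using rg cz' iY by simp
    also have "\<dots> = b \<odot> y" unfolding r(10) by (rule reassoc[OF cz(2)]) (use cz' iZ f' in simp_all)
    also have "\<dots> = (b \<odot> cy) \<odot> inc Y" using cy cy' S r iY by simp
    finally have "post C V (cz \<odot> RM g) n c = post C V (b \<odot> cy) n c"
      by - (rule post_square[OF V iY(4), where N = "Cod C z"], use rg cz' cy' iY S r Z c in \<open>simp_all add: Hom_def\<close>)
    then show "post C V cz n (post C V (RM g) n c) = post C V b n (post C V cy n c)"
      using post_cmp[OF v rg(1) cz'(1), of c n] post_cmp[OF v cy'(1) S(2), of c n] rg cz' cy' c S r by simp
  qed
  have oy: "Cod C y \<in> Ob C" "Cod C z \<in> Ob C" using Y Z by simp_all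
  show "\<exists>\<delta>. \<forall>n. ab_exact (lH C V (RO X) n) (post C V (RM f) n) (lH C V (RO Y) n) (post C V (RM g) n) (lH C V (RO Z) n) \<and>
    ab_exact (lH C V (RO Y) n) (post C V (RM g) n) (lH C V (RO Z) n) (\<delta> n) (lH C V (RO X) (n + 1)) \<and>
    ab_exact (lH C V (RO Z) n) (\<delta> n) (lH C V (RO X) (n + 1)) (post C V (RM f) (n + 1)) (lH C V (RO Y) (n + 1))"
    by (rule long_exact_transport[OF ex iso_set_refl isoy isoz]) (use lH_group[OF v] iX iY iZ oy sq1 sq2 in auto)
qed

text \<open>The arrows of \<open>E\<close> are classes \<open>rep k\<close> of morphisms modulo negligible ones.\<close>

lemma descended_functor:
  fixes E :: "('a, 'k) add_cat"
  assumes V: "cofib_complex C Q W V" and P: "\<And>A. A \<in> Ob E \<Longrightarrow> P A \<in> Ob C"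
    and hom: "\<And>A B k. k \<in> Hom E A B \<Longrightarrow> A \<in> Ob E \<and> B \<in> Ob E \<and> rep k \<noteq> {} \<and> rep k \<subseteq> Hom C (P A) (P B)"
    and rep: "\<And>A B k f g. k \<in> Hom E A B \<Longrightarrow> f \<in> rep k \<Longrightarrow> g \<in> rep k \<Longrightarrow> negligible C (Q \<inter> W \<inter> R) (sub C f g)"
    and idn: "\<And>A. A \<in> Ob E \<Longrightarrow> Idn E A \<in> Hom E A A \<and> Idn C (P A) \<in> rep (Idn E A)"
    and cmp: "\<And>A B D k l f g. k \<in> Hom E A B \<Longrightarrow> l \<in> Hom E B D \<Longrightarrow> f \<in> rep k \<Longrightarrow> g \<in> rep l \<Longrightarrow>
      Cmp E l k \<in> Hom E A D \<and> g \<odot> f \<in> rep (Cmp E l k)"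
  shows "ab_functor E (\<lambda>A. lH C V (P A) n) (\<lambda>k. post C V (SOME f. f \<in> rep k) n)"
    and "\<And>A B k f x. k \<in> Hom E A B \<Longrightarrow> f \<in> rep k \<Longrightarrow> x \<in> carrier (lH C V (P A) n) \<Longrightarrow>
      post C V (SOME f. f \<in> rep k) n x = post C V f n x"
proof -
  note v = cofib_complexD(1)[OF V]
  have some: "(SOME f. f \<in> rep k) \<in> rep k" if "k \<in> Hom E A B" for A B k using hom[OF that] some_in_eq by blast
  show eq: "post C V (SOME f. f \<in> rep k) n x = post C V f n x"
    if k: "k \<in> Hom E A B" "f \<in> rep k" "x \<in> carrier (lH C V (P A) n)" for A B k f x
    using post_cong[OF V _ _ rep[OF k(1) some[OF k(1)] k(2)] k(3)] hom[OF k(1)] some[OF k(1)] k(2) by blast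
  show "ab_functor E (\<lambda>A. lH C V (P A) n) (\<lambda>k. post C V (SOME f. f \<in> rep k) n)"
    unfolding ab_functor_def
  proof (intro conjI allI ballI)
    show "comm_group (lH C V (P A) n)" if "A \<in> Ob E" for A using lH_comm_group[OF v P[OF that]] .
    show "post C V (SOME f. f \<in> rep (Idn E A)) n x = x" if A: "A \<in> Ob E" "x \<in> carrier (lH C V (P A) n)" for A x
      using eq[of "Idn E A" A A "Idn C (P A)" x] idn[OF A(1)] post_idn[OF v P[OF A(1)] A(2)] A by simp
    fix A B k assume k: "k \<in> Hom E A B"
    let ?f = "SOME f. f \<in> rep k"
    have f: "?f \<in> Arr C" "Dom C ?f = P A" "Cod C ?f = P B" using hom[OF k] some[OF k] by (auto simp: Hom_def)
    show "post C V ?f n \<in> hom (lH C V (P A) n) (lH C V (P B) n)" using post_hom[OF v f(1), of n] f by simp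
    fix D l x assume l: "l \<in> Hom E B D" and x: "x \<in> carrier (lH C V (P A) n)"
    let ?g = "SOME f. f \<in> rep l"
    have g: "?g \<in> Arr C" "Dom C ?g = P B" "Cod C ?g = P D" using hom[OF l] some[OF l] by (auto simp: Hom_def)
    show "post C V (SOME f. f \<in> rep (Cmp E l k)) n x = post C V ?g n (post C V ?f n x)"
      using eq[of "Cmp E l k" A D "?g \<odot> ?f" x] cmp[OF k l some[OF k] some[OF l]] x post_cmp[OF v f(1) g(1), of x n] f g by simp
  qed
qed

end

section \<open>Ext groups of the homotopy category\<close>

text \<open>The lift reverses direction together with the complexes; \<open>- n - 1\<close> is the
  reindexing made by \<open>dual_resol\<close>.\<close>

lemma resol_lift_op:
  assumes "resol_lift C U U' g \<psi>"
  shows "resol_lift (op_cat C) (dual_resol U') (dual_resol U) g (\<lambda>n. \<psi> (- n - 1))"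
proof -
  have 1: "\<psi> n \<in> Hom C (obj U n) (obj U' n)" "Cmp C (diff U' n) (\<psi> n) = Cmp C (\<psi> (n - 1)) (diff U n)" for n
    using assms unfolding resol_lift_def by blast+
  show ?thesis unfolding resol_lift_def
    using assms 1(1) 1(2)[of "- n" for n] by (simp add: resol_lift_def)
qed

context preadditive_category begin

lemma resol_liftD:
  assumes "resol_lift C V V' f \<phi>"
  shows "\<phi> n \<in> Hom C (obj V n) (obj V' n)" "\<phi> (n - 1) \<in> Hom C (obj V (n - 1)) (obj V' (n - 1))"
    "diff V' n \<odot> \<phi> n = \<phi> (n - 1) \<odot> diff V n"
    "\<phi> (n + 1) \<in> Hom C (obj V (n + 1)) (obj V' (n + 1))" "diff V' (n + 1) \<odot> \<phi> (n + 1) = \<phi> n \<odot> diff V (n + 1)"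
proof -
  have 1: "\<phi> n \<in> Hom C (obj V n) (obj V' n)" "diff V' n \<odot> \<phi> n = \<phi> (n - 1) \<odot> diff V n" for n
    using assms unfolding resol_lift_def by blast+
  show "\<phi> n \<in> Hom C (obj V n) (obj V' n)" "\<phi> (n - 1) \<in> Hom C (obj V (n - 1)) (obj V' (n - 1))"
    "diff V' n \<odot> \<phi> n = \<phi> (n - 1) \<odot> diff V n"
    "\<phi> (n + 1) \<in> Hom C (obj V (n + 1)) (obj V' (n + 1))" "diff V' (n + 1) \<odot> \<phi> (n + 1) = \<phi> n \<odot> diff V (n + 1)"
    using 1 1(2)[of "n + 1"] by simp_all
qed

lemma pre_lift_closed:
  assumes "is_complex C V" "is_complex C V'" "B \<in> Ob C" "resol_lift C V V' f \<phi>" "x \<in> carrier (lH C V' B n)"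
  shows "pre C V B n (\<phi> n) x \<in> carrier (lH C V B n)"
  using pre_closed[OF assms(1-3) resol_liftD[OF assms(4)] assms(5)] .

lemma post_pre_lift:
  assumes "is_complex C V" "is_complex C V'" "t \<in> Hom C B B'" "resol_lift C V V' f \<phi>" "x \<in> carrier (lH C V' B n)"
  shows "post C V t n (pre C V B n (\<phi> n) x) = pre C V B' n (\<phi> n) (post C V' t n x)"
  using post_pre[OF assms(1,2) hom_arr[OF assms(3)] resol_liftD(1-3)[OF assms(4)], of x] assms(3,5)
  by (simp add: Hom_def)

end

lemma (in abelian_category) cofibrant_replacement_rep:
  assumes "cofibrant_replacement C M A QA p"
  shows "p \<in> Hom C QA A \<and> cof_rep C (Cofib M) (Triv M) (Fib M) p"
  using assms unfolding cofibrant_replacement_def fib_rep_def by (auto simp: Hom_def)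

lemma fibrant_replacement_rep:
  assumes "fibrant_replacement C M A RA j"
  shows "j \<in> Hom C A RA \<and> fib_rep C (Cofib M) (Triv M) (Fib M) j"
  using assms unfolding fibrant_replacement_def fib_rep_def by (auto simp: Hom_def)

section \<open>Fixed choices of replacements, resolutions and lifts\<close>

locale model_choices =
  fixes C :: "('o, 'm) add_cat" (structure) and M :: "'o triple" and S :: "('o, 'm) choice"
  assumes ab: "abelian_category C" and hm: "hereditary_model C M" and ch: "choices C M S"

sublocale model_choices \<subseteq> hmod C "Cofib M" "Triv M" "Fib M"
  by (rule hereditary_model_hmod[OF ab hm])

context model_choices begin

abbreviation "Q \<equiv> Cofib M"
abbreviation "W \<equiv> Triv M"
abbreviation "R \<equiv> Fib M"

lemma op_mod: "hmod (op_cat C) R W Q" by (rule op_hmod)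

lemmas choice_objects = bspec[OF conjunct1[OF ch[unfolded choices_def]]]
  and choice_morphisms = bspec[OF spec[OF spec[OF conjunct2[OF ch[unfolded choices_def]]]]]

lemma pr_rep: "A \<in> Ob C \<Longrightarrow> pr S A \<in> Hom C (QO S A) A \<and> cof_rep C Q W R (pr S A)"
  by (rule cofibrant_replacement_rep) (use choice_objects in blast)

lemma inc_rep: "A \<in> Ob C \<Longrightarrow> inc S A \<in> Hom C A (RO S A) \<and> fib_rep C Q W R (inc S A)"
  by (rule fibrant_replacement_rep) (use choice_objects in blast)

lemma QM_square: "f \<in> Hom C A B \<Longrightarrow> QM S f \<in> Hom C (QO S A) (QO S B) \<and> pr S B \<odot> QM S f = f \<odot> pr S A"
  and RM_square: "f \<in> Hom C A B \<Longrightarrow> RM S f \<in> Hom C (RO S A) (RO S B) \<and> RM S f \<odot> inc S A = inc S B \<odot> f"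
  and res_lift: "f \<in> Hom C A B \<Longrightarrow> resol_lift C (res S A) (res S B) f (res_lift S f)"
  and cores_lift: "f \<in> Hom C A B \<Longrightarrow> resol_lift C (cores S A) (cores S B) f (cores_lift S f)"
  using choice_morphisms[of f A B] by simp_all

lemma RQM_square:
  assumes "f \<in> Hom C A B"
  shows "RQM S f \<in> Hom C (RQO S A) (RQO S B) \<and> RQM S f \<odot> inc S (QO S A) = inc S (QO S B) \<odot> QM S f"
  unfolding RQM_def RQO_def using RM_square QM_square[OF assms] by blast

lemma replacement_objects:
  assumes "A \<in> Ob C"
  shows "QO S A \<in> Ob C" "QO S A \<in> Q" "RO S A \<in> Ob C" "RO S A \<in> R" "RQO S A \<in> Ob C" "RQO S A \<in> Q" "RQO S A \<in> R"
proof -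
  interpret op: hmod "op_cat C" R W Q by (rule op_mod)
  have *: "RO S A \<in> Ob C \<and> RO S A \<in> R" if "A \<in> Ob C" for A
    using fib_rep_homD[OF inc_rep[OF that]] by blast
  show q: "QO S A \<in> Ob C" "QO S A \<in> Q"
    using pr_rep[OF assms] op.fib_repD[of "pr S A"] hom_ob[of "pr S A"] by (auto simp: Hom_def)
  show "RO S A \<in> Ob C" "RO S A \<in> R" using *[OF assms] by auto
  show "RQO S A \<in> Ob C" "RQO S A \<in> R" unfolding RQO_def using *[OF q(1)] by auto
  obtain c where "short_exact C (inc S (QO S A)) c" "Cod C c \<in> Q" using inc_rep[OF q(1)] unfolding fib_rep_def by blast
  then show "RQO S A \<in> Q" unfolding RQO_def
    using Q_ext[of "inc S (QO S A)" c] short_exactD(3) inc_rep[OF q(1)] q(2) by (auto simp: Hom_def)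
qed

lemma resolution:
  assumes "P \<in> Q" shows "cofib_complex C Q W (res S P)" "augmented C P (res S P)" "is_complex C (res S P)"
proof -
  have m: "M_resolution C M P (res S P)" using choice_objects assms Q_ob by blast
  show c: "cofib_complex C Q W (res S P)" using M_resolution_cofib_complex[OF m] assms by simp
  show "augmented C P (res S P)" by (rule M_resolution_augmented[OF m])
  show "is_complex C (res S P)" by (rule cofib_complexD(1)[OF c])
qed

lemma coresolution:
  assumes "M_resolution C M N U" "N \<in> R" shows "fib_complex C R W U" "augmented C N U" "is_complex C U"
proof -
  interpret op: hmod "op_cat C" R W Q by (rule op_mod)
  show c: "fib_complex C R W U" using op.M_resolution_cofib_complex[OF M_resolution_op[OF assms(1)]] assms by simp
  show "augmented C N U" by (rule M_resolution_augmented[OF assms(1)])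
  show "is_complex C U" by (rule fib_complexD(1)[OF c])
qed

lemma chosen_coresolution:
  assumes "N \<in> R" shows "fib_complex C R W (cores S N)" "augmented C N (cores S N)" "is_complex C (cores S N)"
    "is_complex (op_cat C) (dual_resol (cores S N))"
proof -
  have m: "M_resolution C M N (cores S N)" using choice_objects assms R_ob by blast
  show "fib_complex C R W (cores S N)" "augmented C N (cores S N)" "is_complex C (cores S N)"
    "is_complex (op_cat C) (dual_resol (cores S N))"
    using coresolution[OF m assms] by simp_all
qed

lemma Ext_Ho_eq: "Ext_Ho C S n A B = lH C (res S (RQO S A)) (RQO S B) n"
  and Ext_Ho_snd_eq: "Ext_Ho_snd C S n A g = post C (res S (RQO S A)) (RQM S g) n"
  and Ext_Ho_fst_eq: "Ext_Ho_fst C S n f B = pre C (res S (Dom C (RQM S f))) (RQO S B) n (res_lift S (RQM S f) n)"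
  by (simp_all add: Ext_Ho_def lExt_def Ext_Ho_snd_def lExt_snd_def Ext_Ho_fst_def lExt_fst_def post_def pre_def)

lemma lExt_eq: "lExt C S n A B = lH C (res S A) B n"
  and lExt_snd_eq: "lExt_snd C S n A g = post C (res S A) g n"
  and lExt_fst_eq: "lExt_fst C S n f B = pre C (res S (Dom C f)) B n (res_lift S f n)"
  by (simp_all add: lExt_def lExt_snd_def lExt_fst_def post_def pre_def)

lemma rExt_eq: "rExt C S n A B = lH (op_cat C) (dual_resol (cores S B)) A n"
  and rExt_fst_eq: "rExt_fst C S n f B = post (op_cat C) (dual_resol (cores S B)) f n"
  and rExt_snd_eq: "rExt_snd C S n A g = pre (op_cat C) (dual_resol (cores S (Cod C g))) A n (cores_lift S g (- n - 1))"
  by (simp_all add: rExt_def rExt_snd_def rExt_fst_def post_def pre_def rH_op rH_map_op)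

text \<open>The comparison for the chosen resolution and coresolution. Being linked determines it on
  the carrier, so the description operator adds no real choice.\<close>

definition cmp_iso :: "int \<Rightarrow> 'o \<Rightarrow> 'o \<Rightarrow> 'm set \<Rightarrow> 'm set" where
  "cmp_iso n P N = (SOME \<Phi>. \<Phi> \<in> iso (lH C (res S P) N n) (rH C P (cores S N) n) \<and>
     (\<forall>x \<in> carrier (lH C (res S P) N n). linked C (res S P) (cores S N) P N n x (\<Phi> x)) \<and>
     (\<forall>x y. linked C (res S P) (cores S N) P N n x y \<longrightarrow> \<Phi> x = y))"

lemma cmp_iso:
  assumes "P \<in> Q" "N \<in> R"
  shows "cmp_iso n P N \<in> iso (lH C (res S P) N n) (lH (op_cat C) (dual_resol (cores S N)) P n)"
    "x \<in> carrier (lH C (res S P) N n) \<Longrightarrow> linked C (res S P) (cores S N) P N n x (cmp_iso n P N x)"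
    "linked C (res S P) (cores S N) P N n x y \<Longrightarrow> cmp_iso n P N x = y"
proof -
  let ?p = "\<lambda>\<Phi>. \<Phi> \<in> iso (lH C (res S P) N n) (rH C P (cores S N) n) \<and>
     (\<forall>x \<in> carrier (lH C (res S P) N n). linked C (res S P) (cores S N) P N n x (\<Phi> x)) \<and>
     (\<forall>x y. linked C (res S P) (cores S N) P N n x y \<longrightarrow> \<Phi> x = y)"
  obtain \<Phi> where "?p \<Phi>"
    by (rule comparison[OF resolution(1,2)[OF assms(1)] chosen_coresolution(1,2)[OF assms(2)], of n]) blast
  then have "?p (cmp_iso n P N)" unfolding cmp_iso_def by (rule someI[of ?p])
  then show "cmp_iso n P N \<in> iso (lH C (res S P) N n) (lH (op_cat C) (dual_resol (cores S N)) P n)"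
    "x \<in> carrier (lH C (res S P) N n) \<Longrightarrow> linked C (res S P) (cores S N) P N n x (cmp_iso n P N x)"
    "linked C (res S P) (cores S N) P N n x y \<Longrightarrow> cmp_iso n P N x = y"
    unfolding rH_op by blast+
qed

text \<open>Exchanges the action through a chosen lift of \<open>f\<close> for plain composition
  with \<open>f\<close> on the coresolution side.\<close>

lemma cmp_iso_pre:
  assumes "P \<in> Q" "P' \<in> Q" "N \<in> R" "f \<in> Hom C P P'" "x \<in> carrier (lH C (res S P') N n)"
  shows "cmp_iso n P N (pre C (res S P) N n (res_lift S f n) x) =
    post (op_cat C) (dual_resol (cores S N)) f n (cmp_iso n P' N x)"
  by (rule cmp_iso(3)[OF assms(1,3)], rule linked_pre[OF resolution(3,2)[OF assms(1)] resolution(3,2)[OF assms(2)]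
      chosen_coresolution(3,2)[OF assms(3)] assms(4) res_lift[OF assms(4)] cmp_iso(2)[OF assms(2,3,5)]])

lemma cmp_iso_post:
  assumes "P \<in> Q" "N \<in> R" "N' \<in> R" "g \<in> Hom C N N'" "x \<in> carrier (lH C (res S P) N n)"
  shows "cmp_iso n P N' (post C (res S P) g n x) =
    pre (op_cat C) (dual_resol (cores S N')) P n (cores_lift S g (- n - 1)) (cmp_iso n P N x)"
  by (rule cmp_iso(3)[OF assms(1,3)], rule linked_post[OF resolution(3,2)[OF assms(1)]
      chosen_coresolution(3,2)[OF assms(2)] chosen_coresolution(3,2)[OF assms(3)] assms(4) cores_lift[OF assms(4)] cmp_iso(2)[OF assms(1,2,5)]])

text \<open>The arrow from \<open>RQO S B\<close> to \<open>RO S B\<close> over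
  \<open>pr S B\<close>; by \<open>fib_unique\<close> it is determined up to negligible
  morphisms.\<close>

definition bif :: "'o \<Rightarrow> 'm" where
  "bif B = (SOME t. t \<in> Hom C (RQO S B) (RO S B) \<and> t \<odot> inc S (QO S B) = inc S B \<odot> pr S B \<and>
     (\<forall>V n. cofib_complex C Q W V \<longrightarrow> post C V t n \<in> iso (lH C V (RQO S B) n) (lH C V (RO S B) n)))"

lemma bif_exists:
  assumes p: "cof_rep C Q W R p" "p \<in> Hom C QB B" and k: "fib_rep C Q W R k" "k \<in> Hom C QB RQB"
    and j: "fib_rep C Q W R j" "j \<in> Hom C B RB"
  shows "\<exists>t. t \<in> Hom C RQB RB \<and> t \<odot> k = j \<odot> p \<and>
     (\<forall>V n. cofib_complex C Q W V \<longrightarrow> post C V t n \<in> iso (lH C V RQB n) (lH C V RB n))"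
proof -
  have d: "Dom C p = QB" "Cod C p = B" "Dom C k = QB" "Cod C k = RQB" "Dom C j = B" "Cod C j = RB"
    using assms by (auto simp: Hom_def)
  obtain t where "t \<in> Hom C (Cod C k) (Cod C j)" "t \<odot> k = j \<odot> p"
    "\<And>V n. cofib_complex C Q W V \<Longrightarrow> post C V t n \<in> iso (lH C V (Cod C k) n) (lH C V (Cod C j) n)"
    by (rule bifibrant_comparison[OF p(1) k(1) _ j(1)]) (use d in auto)
  then show ?thesis unfolding d by blast
qed

lemma bif:
  assumes "B \<in> Ob C"
  shows "bif B \<in> Hom C (RQO S B) (RO S B)" "bif B \<odot> inc S (QO S B) = inc S B \<odot> pr S B"
    "cofib_complex C Q W V \<Longrightarrow> post C V (bif B) n \<in> iso (lH C V (RQO S B) n) (lH C V (RO S B) n)"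
proof -
  have "\<exists>t. t \<in> Hom C (RQO S B) (RO S B) \<and> t \<odot> inc S (QO S B) = inc S B \<odot> pr S B \<and>
     (\<forall>V n. cofib_complex C Q W V \<longrightarrow> post C V t n \<in> iso (lH C V (RQO S B) n) (lH C V (RO S B) n))"
    by (rule bif_exists[where QB = "QO S B" and B = B]) (use pr_rep[OF assms] inc_rep[OF assms] inc_rep[OF replacement_objects(1)[OF assms]] in \<open>simp_all add: RQO_def\<close>)
  from someI_ex[OF this] show "bif B \<in> Hom C (RQO S B) (RO S B)" "bif B \<odot> inc S (QO S B) = inc S B \<odot> pr S B"
    "cofib_complex C Q W V \<Longrightarrow> post C V (bif B) n \<in> iso (lH C V (RQO S B) n) (lH C V (RO S B) n)"
    unfolding bif_def[symmetric] by blast+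
qed

text \<open>The square of \<open>bif\<close> with \<open>RQM\<close> and \<open>RM\<close> is only
  known to commute after composition with \<open>inc S (QO S B)\<close>, and
  \<open>post_square\<close> asks for no more.\<close>

lemma bif_natural:
  assumes V: "cofib_complex C Q W V" and g: "g \<in> Hom C B B'" and x: "x \<in> carrier (lH C V (RQO S B) n)"
  shows "post C V (bif B') n (post C V (RQM S g) n x) = post C V (RM S g) n (post C V (bif B) n x)"
proof -
  note v = cofib_complexD(1)[OF V]
  have o: "B \<in> Ob C" "B' \<in> Ob C" using hom_ob[OF g] by auto
  note rq = square_homD[OF RQM_square[OF g]] and rm = square_homD[OF RM_square[OF g]]
  note ob = replacement_objects[OF o(1)] and ob' = replacement_objects[OF o(2)]
  note iq = fib_rep_homD[OF inc_rep[OF ob(1)]] and i = fib_rep_homD[OF inc_rep[OF o(1)]]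
    and iq' = fib_rep_homD[OF inc_rep[OF ob'(1)]] and i' = fib_rep_homD[OF inc_rep[OF o(2)]]
  have b: "bif B \<in> Arr C" "Dom C (bif B) = RQO S B" "Cod C (bif B) = RO S B"
    and b': "bif B' \<in> Arr C" "Dom C (bif B') = RQO S B'" "Cod C (bif B') = RO S B'"
    using bif(1)[OF o(1)] bif(1)[OF o(2)] by (auto simp: Hom_def)
  have p: "pr S B \<in> Arr C" "Dom C (pr S B) = QO S B" "Cod C (pr S B) = B" "pr S B' \<in> Arr C" "Dom C (pr S B') = QO S B'" "Cod C (pr S B') = B'"
    and q: "QM S g \<in> Arr C" "Dom C (QM S g) = QO S B" "Cod C (QM S g) = QO S B'" "pr S B' \<odot> QM S g = g \<odot> pr S B"
    and g': "g \<in> Arr C" "Dom C g = B" "Cod C g = B'"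
    using pr_rep[OF o(1)] pr_rep[OF o(2)] QM_square[OF g] g by (auto simp: Hom_def)
  have e: "RO S (QO S B) = RQO S B" "RO S (QO S B') = RQO S B'" by (simp_all add: RQO_def)
  have "(bif B' \<odot> RQM S g) \<odot> inc S (QO S B) = bif B' \<odot> (inc S (QO S B') \<odot> QM S g)"
    unfolding rq(4)[symmetric] by (rule assoc) (use rq iq b' e in simp_all)
  also have "\<dots> = inc S B' \<odot> (pr S B' \<odot> QM S g)" by (rule assoc_eq[OF bif(2)[OF o(2)]]) (use iq' b' e i' p q in simp_all)
  also have "\<dots> = (inc S B' \<odot> g) \<odot> pr S B" unfolding q(4) by (rule assoc[symmetric]) (use i' g' p in simp_all)
  also have "\<dots> = RM S g \<odot> (inc S B \<odot> pr S B)" unfolding rm(4)[symmetric] by (rule assoc) (use i rm p in simp_all)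
  also have "\<dots> = (RM S g \<odot> bif B) \<odot> inc S (QO S B)" unfolding bif(2)[OF o(1), symmetric]
    by (rule assoc[symmetric]) (use rm b iq e in simp_all)
  finally have "post C V (bif B' \<odot> RQM S g) n x = post C V (RM S g \<odot> bif B) n x"
    by - (rule post_square[OF V iq(4), where N = "RO S B'"], use rq rm b b' i' iq e x in \<open>simp_all add: Hom_def\<close>)
  then show ?thesis using post_cmp[OF v rq(1) b'(1), of x n] post_cmp[OF v b(1) rm(1), of x n] rq rm b b' x by simp
qed

text \<open>\<open>Ext_Ho A B = lExt (RQA) (RQB) \<rightarrow> lExt (RQA) (RB) \<rightarrow> rExt (RQA) (RB) \<rightarrow> rExt (QA) (RB)\<close>\<close>

definition ext_iso :: "int \<Rightarrow> 'o \<Rightarrow> 'o \<Rightarrow> 'm set \<Rightarrow> 'm set" where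
  "ext_iso n A B x = post (op_cat C) (dual_resol (cores S (RO S B))) (inc S (QO S A)) n
     (cmp_iso n (RQO S A) (RO S B) (post C (res S (RQO S A)) (bif B) n x))"

text \<open>In the opposite category, \<open>inc\<close> is an epimorphism with trivially fibrant
  kernel, so \<open>post_iso_epic\<close> applies there.\<close>

lemma inc_iso:
  assumes A: "A \<in> Ob C" and U: "fib_complex C R W U"
  shows "post (op_cat C) (dual_resol U) (inc S (QO S A)) n \<in>
    iso (lH (op_cat C) (dual_resol U) (RQO S A) n) (lH (op_cat C) (dual_resol U) (QO S A) n)"
proof -
  interpret op: hmod "op_cat C" R W Q by (rule op_mod)
  note i = fib_rep_homD[OF inc_rep[OF replacement_objects(1)[OF A]]]
  obtain q where q: "short_exact C (inc S (QO S A)) q" "Cod C q \<in> Q" "Cod C q \<in> W" using i(4) unfolding fib_rep_def by blast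
  show ?thesis using op.post_iso_epic[OF U, of q "inc S (QO S A)" n] q i by (simp add: RQO_def)
qed

lemma ext_iso:
  assumes o: "A \<in> Ob C" "B \<in> Ob C"
  shows "ext_iso n A B \<in> iso (Ext_Ho C S n A B) (rExt C S n (QO S A) (RO S B))"
proof -
  note oA = replacement_objects[OF o(1)] and oB = replacement_objects[OF o(2)]
  have 1: "(\<lambda>x. cmp_iso n (RQO S A) (RO S B) (post C (res S (RQO S A)) (bif B) n x)) \<in>
    iso (Ext_Ho C S n A B) (lH (op_cat C) (dual_resol (cores S (RO S B))) (RQO S A) n)"
    using iso_set_trans[OF bif(3)[OF o(2) resolution(1)[OF oA(6)]] cmp_iso(1)[OF oA(6) oB(4)]]
    unfolding Ext_Ho_eq comp_def .
  show ?thesis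
    using iso_set_trans[OF 1 inc_iso[OF o(1) chosen_coresolution(1)[OF oB(4)]]]
    unfolding rExt_eq comp_def ext_iso_def[abs_def] .
qed

lemma Ext_Ho_group: "A \<in> Ob C \<Longrightarrow> B \<in> Ob C \<Longrightarrow> comm_group (Ext_Ho C S n A B)"
  unfolding Ext_Ho_eq by (rule lH_comm_group) (use resolution(3) replacement_objects in auto)

text \<open>\<open>bif\<close> acts on the second variable and commutes with the lift of
  \<open>RQM S f\<close>; \<open>cmp_iso\<close> trades this lift for \<open>RQM S f\<close> itself,
  and the square of \<open>inc\<close> turns that into \<open>QM S f\<close>.\<close>

lemma ext_iso_fst:
  assumes f: "f \<in> Hom C A' A" and B: "B \<in> Ob C" and x: "x \<in> carrier (Ext_Ho C S n A B)"
  shows "Ext_Ho_fst C S n f B x \<in> carrier (Ext_Ho C S n A' B)"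
    "ext_iso n A' B (Ext_Ho_fst C S n f B x) = rExt_fst C S n (QM S f) (RO S B) (ext_iso n A B x)"
proof -
  interpret op: hmod "op_cat C" R W Q by (rule op_mod)
  have o: "A' \<in> Ob C" "A \<in> Ob C" using hom_ob[OF f] by auto
  note oA = replacement_objects[OF o(2)] and oA' = replacement_objects[OF o(1)] and oB = replacement_objects[OF B]
  note rq = RQM_square[OF f] and rq' = square_homD[OF RQM_square[OF f]]
  have q: "QM S f \<in> Arr C" "Dom C (QM S f) = QO S A'" "Cod C (QM S f) = QO S A" using QM_square[OF f] by (auto simp: Hom_def)
  note i = fib_rep_homD[OF inc_rep[OF oA(1)]] and i' = fib_rep_homD[OF inc_rep[OF oA'(1)]]
  have e: "RO S (QO S A) = RQO S A" "RO S (QO S A') = RQO S A'" by (simp_all add: RQO_def)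
  note V = resolution[OF oA(6)] and V' = resolution[OF oA'(6)] and U = chosen_coresolution[OF oB(4)]
  note l = res_lift[OF conjunct1[OF rq]]
  have x: "x \<in> carrier (lH C (res S (RQO S A)) (RQO S B) n)" using x unfolding Ext_Ho_eq .
  show "Ext_Ho_fst C S n f B x \<in> carrier (Ext_Ho C S n A' B)"
    unfolding Ext_Ho_fst_eq Ext_Ho_eq rq'(2) by (rule pre_lift_closed[OF V'(3) V(3) oB(5) l x])
  have t: "bif B \<in> Arr C" "Dom C (bif B) = RQO S B" "Cod C (bif B) = RO S B" using bif(1)[OF B] by (auto simp: Hom_def)
  define y where "y = post C (res S (RQO S A)) (bif B) n x"
  have y: "y \<in> carrier (lH C (res S (RQO S A)) (RO S B) n)"
    unfolding y_def using post_closed[OF V(3) t(1), of x n] t x by simp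
  have z: "cmp_iso n (RQO S A) (RO S B) y \<in> carrier (lH (op_cat C) (dual_resol (cores S (RO S B))) (RQO S A) n)"
    by (rule isoD(4)[OF cmp_iso(1)[OF oA(6) oB(4)] y])
  have "ext_iso n A' B (Ext_Ho_fst C S n f B x) = post (op_cat C) (dual_resol (cores S (RO S B))) (inc S (QO S A')) n
     (cmp_iso n (RQO S A') (RO S B) (pre C (res S (RQO S A')) (RO S B) n (res_lift S (RQM S f) n) y))"
    unfolding ext_iso_def Ext_Ho_fst_eq rq'(2) y_def
    using post_pre_lift[OF V'(3) V(3) bif(1)[OF B] l x] by simp
  also have "\<dots> = post (op_cat C) (dual_resol (cores S (RO S B))) (inc S (QO S A')) n
     (post (op_cat C) (dual_resol (cores S (RO S B))) (RQM S f) n (cmp_iso n (RQO S A) (RO S B) y))"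
    using cmp_iso_pre[OF oA'(6) oA(6) oB(4) conjunct1[OF rq] y] by simp
  also have "\<dots> = post (op_cat C) (dual_resol (cores S (RO S B))) (RQM S f \<odot> inc S (QO S A')) n (cmp_iso n (RQO S A) (RO S B) y)"
    using op.post_cmp[OF U(4), of "RQM S f" "inc S (QO S A')" _ n] rq' i' e z by simp
  also have "\<dots> = post (op_cat C) (dual_resol (cores S (RO S B))) (inc S (QO S A) \<odot> QM S f) n (cmp_iso n (RQO S A) (RO S B) y)"
    unfolding rq'(4) ..
  also have "\<dots> = rExt_fst C S n (QM S f) (RO S B) (ext_iso n A B x)"
    unfolding rExt_fst_eq ext_iso_def y_def[symmetric]
    using op.post_cmp[OF U(4), of "inc S (QO S A)" "QM S f" _ n] i q e z by simp
  finally show "ext_iso n A' B (Ext_Ho_fst C S n f B x) = rExt_fst C S n (QM S f) (RO S B) (ext_iso n A B x)" .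
qed

lemma ext_iso_snd:
  assumes A: "A \<in> Ob C" and g: "g \<in> Hom C B B'" and x: "x \<in> carrier (Ext_Ho C S n A B)"
  shows "Ext_Ho_snd C S n A g x \<in> carrier (Ext_Ho C S n A B')"
    "ext_iso n A B' (Ext_Ho_snd C S n A g x) = rExt_snd C S n (QO S A) (RM S g) (ext_iso n A B x)"
proof -
  interpret op: hmod "op_cat C" R W Q by (rule op_mod)
  have o: "B \<in> Ob C" "B' \<in> Ob C" using hom_ob[OF g] by auto
  note oA = replacement_objects[OF A] and oB = replacement_objects[OF o(1)] and oB' = replacement_objects[OF o(2)]
  note rq = square_homD[OF RQM_square[OF g]] and rm = RM_square[OF g] and rm' = square_homD[OF RM_square[OF g]]
  note i = fib_rep_homD[OF inc_rep[OF oA(1)]]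
  have e: "RO S (QO S A) = RQO S A" by (simp add: RQO_def)
  note V = resolution[OF oA(6)] and U = chosen_coresolution[OF oB(4)] and U' = chosen_coresolution[OF oB'(4)]
  have x: "x \<in> carrier (lH C (res S (RQO S A)) (RQO S B) n)" using x unfolding Ext_Ho_eq .
  show "Ext_Ho_snd C S n A g x \<in> carrier (Ext_Ho C S n A B')"
    unfolding Ext_Ho_snd_eq Ext_Ho_eq using post_closed[OF V(3) rq(1), of x n] rq x by simp
  have t: "bif B \<in> Arr C" "Dom C (bif B) = RQO S B" "Cod C (bif B) = RO S B" using bif(1)[OF o(1)] by (auto simp: Hom_def)
  define y where "y = post C (res S (RQO S A)) (bif B) n x"
  have y: "y \<in> carrier (lH C (res S (RQO S A)) (RO S B) n)"
    unfolding y_def using post_closed[OF V(3) t(1), of x n] t x by simp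
  have z: "cmp_iso n (RQO S A) (RO S B) y \<in> carrier (lH (op_cat C) (dual_resol (cores S (RO S B))) (RQO S A) n)"
    by (rule isoD(4)[OF cmp_iso(1)[OF oA(6) oB(4)] y])
  have l: "resol_lift (op_cat C) (dual_resol (cores S (RO S B'))) (dual_resol (cores S (RO S B))) (RM S g) (\<lambda>n. cores_lift S (RM S g) (- n - 1))"
    by (rule resol_lift_op[OF cores_lift[OF conjunct1[OF rm]]])
  have "ext_iso n A B' (Ext_Ho_snd C S n A g x) = post (op_cat C) (dual_resol (cores S (RO S B'))) (inc S (QO S A)) n
     (cmp_iso n (RQO S A) (RO S B') (post C (res S (RQO S A)) (RM S g) n y))"
    unfolding ext_iso_def Ext_Ho_snd_eq y_def using bif_natural[OF V(1) g x] by simp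
  also have "\<dots> = post (op_cat C) (dual_resol (cores S (RO S B'))) (inc S (QO S A)) n
     (pre (op_cat C) (dual_resol (cores S (RO S B'))) (RQO S A) n (cores_lift S (RM S g) (- n - 1)) (cmp_iso n (RQO S A) (RO S B) y))"
    using cmp_iso_post[OF oA(6) oB(4) oB'(4) conjunct1[OF rm] y] by simp
  also have "\<dots> = rExt_snd C S n (QO S A) (RM S g) (ext_iso n A B x)"
    unfolding rExt_snd_eq rm'(3) ext_iso_def y_def[symmetric]
    using op.post_pre_lift[OF U'(4) U(4) _ l z, of "inc S (QO S A)" "QO S A"] i e by (simp add: Hom_def)
  finally show "ext_iso n A B' (Ext_Ho_snd C S n A g x) = rExt_snd C S n (QO S A) (RM S g) (ext_iso n A B x)" .
qed

section \<open>Natural isomorphisms, functoriality and computation by canonical resolutions\<close>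

lemma Ext_Ho_rExt:
  "naturally_isomorphic C (Ext_Ho C S n) (Ext_Ho_fst C S n) (Ext_Ho_snd C S n)
    (\<lambda>A B. rExt C S n (QO S A) (RO S B))
    (\<lambda>f B. rExt_fst C S n (QM S f) (RO S B)) (\<lambda>A g. rExt_snd C S n (QO S A) (RM S g))"
  unfolding naturally_isomorphic_def using ext_iso ext_iso_fst(2) ext_iso_snd(2) by (intro exI[of _ "ext_iso n"]) blast

text \<open>Both sides are compared with \<open>rExt\<close> of \<open>QO S A\<close> and
  \<open>RO S B\<close>, the one by \<open>ext_iso\<close> and the other by
  \<open>cmp_iso\<close>.\<close>

lemma Ext_Ho_lExt:
  "naturally_isomorphic C (Ext_Ho C S n) (Ext_Ho_fst C S n) (Ext_Ho_snd C S n)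
    (\<lambda>A B. lExt C S n (QO S A) (RO S B))
    (\<lambda>f B. lExt_fst C S n (QM S f) (RO S B)) (\<lambda>A g. lExt_snd C S n (QO S A) (RM S g))"
proof (rule naturally_isomorphic_trans_sym[where s = "ext_iso n" and t = "\<lambda>A B. cmp_iso n (QO S A) (RO S B)"
      and G = "\<lambda>A B. rExt C S n (QO S A) (RO S B)"
      and ?G1.0 = "\<lambda>f B. rExt_fst C S n (QM S f) (RO S B)" and ?G2.0 = "\<lambda>A g. rExt_snd C S n (QO S A) (RM S g)"])
  fix A B assume o: "A \<in> Ob C" "B \<in> Ob C"
  note oA = replacement_objects[OF o(1)] and oB = replacement_objects[OF o(2)]
  show "cmp_iso n (QO S A) (RO S B) \<in> iso (lExt C S n (QO S A) (RO S B)) (rExt C S n (QO S A) (RO S B))"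
    unfolding lExt_eq rExt_eq by (rule cmp_iso(1)[OF oA(2) oB(4)])
  show "group (lExt C S n (QO S A) (RO S B))" unfolding lExt_eq by (rule lH_group[OF resolution(3)[OF oA(2)] oB(3)])
next
  fix A' A f B x assume f: "f \<in> Hom C A' A" and B: "B \<in> Ob C" and x: "x \<in> carrier (lExt C S n (QO S A) (RO S B))"
  have o: "A' \<in> Ob C" "A \<in> Ob C" using hom_ob[OF f] by auto
  note oA = replacement_objects[OF o(2)] and oA' = replacement_objects[OF o(1)] and oB = replacement_objects[OF B]
  have q: "QM S f \<in> Hom C (QO S A') (QO S A)" using QM_square[OF f] by blast
  show "lExt_fst C S n (QM S f) (RO S B) x \<in> carrier (lExt C S n (QO S A') (RO S B)) \<and>
    cmp_iso n (QO S A') (RO S B) (lExt_fst C S n (QM S f) (RO S B) x) = rExt_fst C S n (QM S f) (RO S B) (cmp_iso n (QO S A) (RO S B) x)"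
    unfolding lExt_fst_eq lExt_eq rExt_fst_eq hom_dom[OF q]
    using pre_lift_closed[OF resolution(3)[OF oA'(2)] resolution(3)[OF oA(2)] oB(3) res_lift[OF q] x[unfolded lExt_eq]]
      cmp_iso_pre[OF oA'(2) oA(2) oB(4) q x[unfolded lExt_eq]] by blast
next
  fix A B B' g x assume A: "A \<in> Ob C" and g: "g \<in> Hom C B B'" and x: "x \<in> carrier (lExt C S n (QO S A) (RO S B))"
  have o: "B \<in> Ob C" "B' \<in> Ob C" using hom_ob[OF g] by auto
  note oA = replacement_objects[OF A] and oB = replacement_objects[OF o(1)] and oB' = replacement_objects[OF o(2)]
  have r: "RM S g \<in> Hom C (RO S B) (RO S B')" using RM_square[OF g] by blast
  have r': "RM S g \<in> Arr C" "Dom C (RM S g) = RO S B" "Cod C (RM S g) = RO S B'" using r by (auto simp: Hom_def)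
  show "lExt_snd C S n (QO S A) (RM S g) x \<in> carrier (lExt C S n (QO S A) (RO S B')) \<and>
    cmp_iso n (QO S A) (RO S B') (lExt_snd C S n (QO S A) (RM S g) x) = rExt_snd C S n (QO S A) (RM S g) (cmp_iso n (QO S A) (RO S B) x)"
    unfolding lExt_snd_eq lExt_eq rExt_snd_eq r'(3)
    using post_closed[OF resolution(3)[OF oA(2)] r'(1), of x n] x r' cmp_iso_post[OF oA(2) oB(4) oB'(4) r, of x n]
    by (simp add: lExt_eq)
qed (fact ext_iso ext_iso_fst(2) ext_iso_snd(2) category_axioms)+

text \<open>\<open>RQM\<close> fills squares over \<open>QM\<close>, not over the original
  morphisms. Passing along \<open>bif\<close> to values in \<open>RO S B\<close> leaves a single
  fibrant replacement, to which the results for \<open>RM\<close> apply.\<close>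

lemma Ext_Ho_snd_functor:
  assumes A: "A \<in> Ob C"
  shows "additive_ab_functor C (Ext_Ho C S n A) (Ext_Ho_snd C S n A)"
    "long_exact_sequences C (\<lambda>n. Ext_Ho C S n A) (\<lambda>n. Ext_Ho_snd C S n A)"
proof -
  note V = resolution[OF replacement_objects(6)[OF A]]
  let ?V = "res S (RQO S A)"
  have t: "post C ?V (bif B) n \<in> iso (Ext_Ho C S n A B) (lH C ?V (RO S B) n)" if "B \<in> Ob C" for B n
    using bif(3)[OF that V(1)] unfolding Ext_Ho_eq .
  have m: "Ext_Ho_snd C S n A g x \<in> carrier (Ext_Ho C S n A B') \<and>
      post C ?V (bif B') n (Ext_Ho_snd C S n A g x) = post C ?V (RM S g) n (post C ?V (bif B) n x)"
    if g: "g \<in> Hom C B B'" and x: "x \<in> carrier (Ext_Ho C S n A B)" for B B' g x n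
    using ext_iso_snd(1)[OF A g x] bif_natural[OF V(1) g, of x n] x unfolding Ext_Ho_snd_eq Ext_Ho_eq by blast
  show "additive_ab_functor C (Ext_Ho C S n A) (Ext_Ho_snd C S n A)"
  proof (rule additive_ab_functor_transport[OF preadditive_category_axioms])
    show "additive_ab_functor C (\<lambda>B. lH C ?V (RO S B) n) (\<lambda>g. post C ?V (RM S g) n)"
      by (rule fibrant_replacement_functor[OF V(1) inc_rep RM_square])
  qed (use t m Ext_Ho_group[OF A] in blast)+
  show "long_exact_sequences C (\<lambda>n. Ext_Ho C S n A) (\<lambda>n. Ext_Ho_snd C S n A)"
  proof (rule long_exact_sequences_transport[OF category_axioms])
    show "long_exact_sequences C (\<lambda>n B. lH C ?V (RO S B) n) (\<lambda>n g. post C ?V (RM S g) n)"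
      by (rule fibrant_replacement_long_exact[OF V(1) inc_rep RM_square])
    show "group (Ext_Ho C S n A B)" "group (lH C ?V (RO S B) n)" if "B \<in> Ob C" for B n
      using Ext_Ho_group[OF A that] comm_group.axioms(2) lH_group[OF V(3) replacement_objects(3)[OF that]] by blast+
  qed (use t m in blast)+
qed

text \<open>\<open>ext_iso\<close> moves the functor to the cohomology of Hom from
  \<open>QO S A\<close> into a coresolution; in the opposite category the cofibrant replacement
  \<open>pr\<close> is a fibrant replacement, so the covariant results apply to it.\<close>

lemma Ext_Ho_fst_functor:
  assumes B: "B \<in> Ob C"
  shows "additive_ab_functor (op_cat C) (\<lambda>A. Ext_Ho C S n A B) (\<lambda>f. Ext_Ho_fst C S n f B)"
    "long_exact_sequences (op_cat C) (\<lambda>n A. Ext_Ho C S n A B) (\<lambda>n f. Ext_Ho_fst C S n f B)"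
proof -
  interpret op: hmod "op_cat C" R W Q by (rule op_mod)
  note U = chosen_coresolution[OF replacement_objects(4)[OF B]]
  let ?U = "dual_resol (cores S (RO S B))"
  have p: "pr S A \<in> Hom (op_cat C) A (QO S A) \<and> cof_rep C Q W R (pr S A)" if "A \<in> Ob (op_cat C)" for A
    using pr_rep that by simp
  have q: "QM S f \<in> Hom (op_cat C) (QO S A) (QO S A') \<and> Cmp (op_cat C) (QM S f) (pr S A) = Cmp (op_cat C) (pr S A') f"
    if "f \<in> Hom (op_cat C) A A'" for f A A' using QM_square that by simp
  have t: "ext_iso n A B \<in> iso (Ext_Ho C S n A B) (lH (op_cat C) ?U (QO S A) n)" if "A \<in> Ob (op_cat C)" for A n
    using ext_iso[of A B n] that B unfolding rExt_eq by simp
  have m: "Ext_Ho_fst C S n f B x \<in> carrier (Ext_Ho C S n A' B) \<and>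
      ext_iso n A' B (Ext_Ho_fst C S n f B x) = post (op_cat C) ?U (QM S f) n (ext_iso n A B x)"
    if f: "f \<in> Hom (op_cat C) A A'" and x: "x \<in> carrier (Ext_Ho C S n A B)" for A A' f x n
    using ext_iso_fst[OF _ B x, of f A'] f unfolding rExt_fst_eq by simp
  have grp: "comm_group (Ext_Ho C S n A B)" if "A \<in> Ob (op_cat C)" for A n using Ext_Ho_group[of A B n] that B by simp
  show "additive_ab_functor (op_cat C) (\<lambda>A. Ext_Ho C S n A B) (\<lambda>f. Ext_Ho_fst C S n f B)"
  proof (rule additive_ab_functor_transport[OF op.preadditive_category_axioms])
    show "additive_ab_functor (op_cat C) (\<lambda>A. lH (op_cat C) ?U (QO S A) n) (\<lambda>f. post (op_cat C) ?U (QM S f) n)"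
      by (rule op.fibrant_replacement_functor[OF U(1) p q])
  qed (use t m grp in blast)+
  show "long_exact_sequences (op_cat C) (\<lambda>n A. Ext_Ho C S n A B) (\<lambda>n f. Ext_Ho_fst C S n f B)"
  proof (rule long_exact_sequences_transport[OF op.category_axioms])
    show "long_exact_sequences (op_cat C) (\<lambda>n A. lH (op_cat C) ?U (QO S A) n) (\<lambda>n f. post (op_cat C) ?U (QM S f) n)"
      by (rule op.fibrant_replacement_long_exact[OF U(1) p q])
    show "group (Ext_Ho C S n A B)" "group (lH (op_cat C) ?U (QO S A) n)" if "A \<in> Ob (op_cat C)" for A n
      using grp[OF that] comm_group.axioms(2) op.lH_group[OF U(4), of "QO S A" n] replacement_objects(1)[of A] that by auto
  qed (use t m in blast)+
qed

text \<open>Neither the replacements nor the resolutions need be the chosen ones. For a coresolution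
  the chain behind \<open>ext_iso\<close> is repeated with \<open>RB\<close> and \<open>U\<close>,
  followed by a comparison of two cofibrant replacements of \<open>A\<close>; a resolution
  \<open>V\<close> of \<open>QA\<close> is reduced to this by \<open>comparison\<close> with the
  chosen coresolution of \<open>RB\<close>.\<close>

lemma canonical_resolution:
  assumes o: "A \<in> Ob C" "B \<in> Ob C" and p: "cofibrant_replacement C M A QA p" and j: "fibrant_replacement C M B RB j"
  shows "M_resolution C M RB U \<Longrightarrow> Ext_Ho C S n A B \<cong> rH C QA U n"
    "M_resolution C M QA V \<Longrightarrow> Ext_Ho C S n A B \<cong> lH C V RB n"
proof -
  interpret op: hmod "op_cat C" R W Q by (rule op_mod)
  note oA = replacement_objects[OF o(1)] and oB = replacement_objects[OF o(2)]
  note p' = cofibrant_replacement_rep[OF p] and j' = fibrant_replacement_rep[OF j]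
  note jj = fib_rep_homD[OF j']
  have pp: "p \<in> Arr C" "Dom C p = QA" "Cod C p = A" "QA \<in> Q" "QA \<in> Ob C"
    using op.fib_rep_homD[of p A QA] p' by simp_all
  have pa: "pr S A \<in> Arr C" "Dom C (pr S A) = QO S A" "Cod C (pr S A) = A" "cof_rep C Q W R (pr S A)"
    using pr_rep[OF o(1)] by (auto simp: Hom_def)
  note iq = fib_rep_homD[OF inc_rep[OF oB(1)]]
  obtain t where t: "t \<in> Hom C (RQO S B) RB"
    "\<And>V n. cofib_complex C Q W V \<Longrightarrow> post C V t n \<in> iso (lH C V (RQO S B) n) (lH C V RB n)"
    using bif_exists[of "pr S B" "QO S B" B "inc S (QO S B)" "RQO S B" j RB] pr_rep[OF o(2)] inc_rep[OF oB(1)] j'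
    by (auto simp: RQO_def)
  have co: "Ext_Ho C S n A B \<cong> rH C QA U n" if "M_resolution C M RB U" for U
  proof -
    note U = coresolution[OF that jj(5)]
    have 1: "Ext_Ho C S n A B \<cong> lH C (res S (RQO S A)) RB n"
      unfolding Ext_Ho_eq by (rule is_isoI[OF t(2)[OF resolution(1)[OF oA(6)]]])
    obtain \<Phi> where "\<Phi> \<in> iso (lH C (res S (RQO S A)) RB n) (rH C (RQO S A) U n)"
      by (rule comparison[OF resolution(1,2)[OF oA(6)] U(1,2), of n]) blast
    then have 2: "lH C (res S (RQO S A)) RB n \<cong> lH (op_cat C) (dual_resol U) (RQO S A) n"
      unfolding rH_op by (rule is_isoI)
    have 3: "lH (op_cat C) (dual_resol U) (RQO S A) n \<cong> lH (op_cat C) (dual_resol U) (QO S A) n"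
      by (rule is_isoI[OF inc_iso[OF o(1) U(1)]])
    obtain c where c: "c \<in> Hom (op_cat C) (QO S A) QA" "Cmp (op_cat C) c (pr S A) = p"
      by (rule op.fib_extend[of "pr S A" p QA]) (use pa pp in \<open>auto simp: Hom_def\<close>)
    have 4: "lH (op_cat C) (dual_resol U) (QO S A) n \<cong> lH (op_cat C) (dual_resol U) QA n"
      using is_isoI[OF op.post_iso_comparison[OF U(1) pa(4) conjunct2[OF p'], of c n]] c pa pp by simp
    show ?thesis unfolding rH_op by (rule iso_trans[OF iso_trans[OF iso_trans[OF 1 2] 3] 4])
  qed
  then show "M_resolution C M RB U \<Longrightarrow> Ext_Ho C S n A B \<cong> rH C QA U n" .
  assume V: "M_resolution C M QA V"
  have vc: "cofib_complex C Q W V" using M_resolution_cofib_complex[OF V _ _ pp(4)] by simp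
  have m: "M_resolution C M RB (cores S RB)" using choice_objects[OF jj(6)] by blast
  note U = coresolution[OF m jj(5)]
  obtain \<Phi> where "\<Phi> \<in> iso (lH C V RB n) (rH C QA (cores S RB) n)"
    by (rule comparison[OF vc M_resolution_augmented[OF V] U(1,2), of n]) blast
  then have "lH C V RB n \<cong> rH C QA (cores S RB) n" by (rule is_isoI)
  then have "rH C QA (cores S RB) n \<cong> lH C V RB n"
    by (rule group.iso_sym[OF lH_group[OF cofib_complexD(1)[OF vc] jj(6)]])
  then show "Ext_Ho C S n A B \<cong> lH C V RB n" using iso_trans[OF co[OF m]] by blast
qed

end

section \<open>The homotopy category\<close>

context preadditive_category begin

lemma sub_trans:
  assumes "f \<in> Arr C" "g \<in> Arr C" "h \<in> Arr C" "Dom C f = Dom C h" "Cod C f = Cod C h" "Dom C g = Dom C h" "Cod C g = Cod C h"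
  shows "Add C (sub C f g) (sub C g h) = sub C f h"
proof -
  have "Add C (sub C f g) (Add C g (neg C h)) = Add C (Add C (sub C f g) g) (neg C h)"
    by (rule add_assoc[symmetric]) (use assms in simp_all)
  then show ?thesis using assms by (simp add: sub_def[of C g h] sub_def[of C f h])
qed

lemma neg_sub:
  assumes "f \<in> Arr C" "g \<in> Arr C" "Dom C f = Dom C g" "Cod C f = Cod C g"
  shows "neg C (sub C f g) = sub C g f"
  using assms neg_add[of f "neg C g"] add_comm[of g "neg C f"] by (simp add: sub_def)

end

context model_choices begin

section \<open>Congruence modulo the core\<close>

lemma core_class_iff:
  assumes "f \<in> Hom C A B"
  shows "g \<in> core_class C M f \<longleftrightarrow> g \<in> Hom C A B \<and> negligible C (Q \<inter> W \<inter> R) (sub C g f)"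
  using assms unfolding core_class_def core_equiv_def factors_through_core_def negligible_def core_def sub_def neg_def
  by (auto simp: Hom_def)

lemma core_class_self: "f \<in> Hom C A B \<Longrightarrow> f \<in> core_class C M f"
  using core_class_iff[of f A B f] negligible_zer[of A B] hom_ob[of f A B] by (auto simp: Hom_def)

lemma core_class_sym:
  assumes "f \<in> Hom C A B" "g \<in> core_class C M f" shows "f \<in> core_class C M g"
proof -
  have g: "g \<in> Hom C A B" "negligible C (Q \<inter> W \<inter> R) (sub C g f)" using assms core_class_iff by auto
  have "sub C f g = neg C (sub C g f)" using neg_sub[of g f] g(1) assms(1) by (simp add: Hom_def)
  then show ?thesis using core_class_iff[OF g(1), of f] assms(1) negligible_neg[OF g(2)] by simp
qed

lemma core_class_trans:
  assumes "f \<in> Hom C A B" "g \<in> core_class C M f" "h \<in> core_class C M g" shows "h \<in> core_class C M f"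
proof -
  have g: "g \<in> Hom C A B" "negligible C (Q \<inter> W \<inter> R) (sub C g f)" using assms core_class_iff by auto
  have h: "h \<in> Hom C A B" "negligible C (Q \<inter> W \<inter> R) (sub C h g)" using assms(3) core_class_iff[OF g(1)] by auto
  have "sub C h f = Add C (sub C h g) (sub C g f)" using sub_trans[of h g f] g(1) h(1) assms(1) by (simp add: Hom_def)
  then show ?thesis using core_class_iff[OF assms(1), of h] h(1) negligible_add[OF h(2) g(2)] g(1) assms(1)
    by (simp add: Hom_def)
qed

lemma core_class_eq:
  assumes "f \<in> Hom C A B" "g \<in> core_class C M f" shows "core_class C M g = core_class C M f"
proof -
  have g: "g \<in> Hom C A B" using assms core_class_iff by auto
  show ?thesis using core_class_trans[OF assms] core_class_trans[OF g core_class_sym[OF assms]] by blast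
qed

text \<open>The difference of the composites is
  \<open>(g' - g) \<odot> f' + g \<odot> (f' - f)\<close>, a sum of negligible arrows.\<close>

lemma core_class_cmp:
  assumes f: "f \<in> Hom C A B" "f' \<in> core_class C M f" and g: "g \<in> Hom C B D" "g' \<in> core_class C M g"
  shows "g' \<odot> f' \<in> core_class C M (g \<odot> f)"
proof -
  have f': "f' \<in> Hom C A B" "negligible C (Q \<inter> W \<inter> R) (sub C f' f)" using f core_class_iff by auto
  have g': "g' \<in> Hom C B D" "negligible C (Q \<inter> W \<inter> R) (sub C g' g)" using g core_class_iff by auto
  note h = f(1)[unfolded Hom_def] f'(1)[unfolded Hom_def] g(1)[unfolded Hom_def] g'(1)[unfolded Hom_def]
  have "negligible C (Q \<inter> W \<inter> R) (Add C (sub C g' g \<odot> f') (g \<odot> sub C f' f))"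
    by (rule negligible_add[OF negligible_right[OF g'(2)] negligible_left[OF f'(2)]]) (use h in simp_all)
  moreover have "Add C (sub C g' g \<odot> f') (g \<odot> sub C f' f) = sub C (g' \<odot> f') (g \<odot> f)"
    using sub_trans[of "g' \<odot> f'" "g \<odot> f'" "g \<odot> f"] h by simp
  ultimately show ?thesis using core_class_iff[OF cmp[OF f(1) g(1)]] cmp[OF f'(1) g'(1)] by simp
qed

text \<open>Composition in \<open>Ho\<close> is a union over representatives; each pair of them
  contributes the same class.\<close>

lemma core_class_cmp_Union:
  assumes f: "f \<in> Hom C A B" and g: "g \<in> Hom C B D"
  shows "(\<Union>g' \<in> core_class C M g. \<Union>f' \<in> core_class C M f. core_class C M (g' \<odot> f')) = core_class C M (g \<odot> f)"
proof -
  have "core_class C M (g' \<odot> f') = core_class C M (g \<odot> f)" if "g' \<in> core_class C M g" "f' \<in> core_class C M f" for g' f'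
    using core_class_eq[OF cmp[OF f g] core_class_cmp[OF f that(2) g that(1)]] .
  then show ?thesis using core_class_self[OF f] core_class_self[OF g] by blast
qed

section \<open>Arrows of the homotopy category and their representatives\<close>

lemma Ho_simps [simp]:
  "Ob (Ho C M S) = Ob C" "Idn (Ho C M S) A = (A, core_class C M (Idn C (RQO S A)), A)"
  by (simp_all add: Ho_def)

lemma Hom_Ho: "k \<in> Hom (Ho C M S) A B \<longleftrightarrow>
    A \<in> Ob C \<and> B \<in> Ob C \<and> (\<exists>f \<in> Hom C (RQO S A) (RQO S B). k = (A, core_class C M f, B))"
  by (auto simp: Ho_def Hom_def[of "Ho C M S"] core_hom_def Hom_def[of "\<lparr>Ob = _, Arr = _, Dom = _, Cod = _, Idn = _, Cmp = _, Add = _, Zer = _\<rparr>"])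

abbreviation rep :: "'o \<times> 'm set \<times> 'o \<Rightarrow> 'm set" where
  "rep k \<equiv> fst (snd k)"

lemma Ho_hom: "k \<in> Hom (Ho C M S) A B \<Longrightarrow>
    A \<in> Ob (Ho C M S) \<and> B \<in> Ob (Ho C M S) \<and> rep k \<noteq> {} \<and> rep k \<subseteq> Hom C (RQO S A) (RQO S B)"
  using core_class_self core_class_iff unfolding Hom_Ho by fastforce

lemma Ho_rep: 
  assumes "k \<in> Hom (Ho C M S) A B" "f \<in> rep k" "g \<in> rep k"
  shows "negligible C (Q \<inter> W \<inter> R) (sub C f g)"
proof -
  obtain h where h: "h \<in> Hom C (RQO S A) (RQO S B)" "k = (A, core_class C M h, B)" using assms(1) unfolding Hom_Ho by blast
  then have g: "g \<in> Hom C (RQO S A) (RQO S B)" and "f \<in> core_class C M g"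
    using assms(2,3) core_class_iff[OF h(1)] core_class_eq[OF h(1), of g] by auto
  then show ?thesis using core_class_iff[OF g] by blast
qed

lemma Ho_idn: "A \<in> Ob (Ho C M S) \<Longrightarrow>
    Idn (Ho C M S) A \<in> Hom (Ho C M S) A A \<and> Idn C (RQO S A) \<in> rep (Idn (Ho C M S) A)"
  unfolding Hom_Ho using core_class_self[OF idn] idn replacement_objects(5) by auto

lemma Ho_cmp:
  assumes "k \<in> Hom (Ho C M S) A B" "l \<in> Hom (Ho C M S) B D"
  shows "Cmp (Ho C M S) l k \<in> Hom (Ho C M S) A D"
    "f \<in> rep k \<Longrightarrow> g \<in> rep l \<Longrightarrow> g \<odot> f \<in> rep (Cmp (Ho C M S) l k)"
proof -
  obtain f0 where f: "f0 \<in> Hom C (RQO S A) (RQO S B)" "k = (A, core_class C M f0, B)" using assms(1) unfolding Hom_Ho by blast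
  obtain g0 where g: "g0 \<in> Hom C (RQO S B) (RQO S D)" "l = (B, core_class C M g0, D)" using assms(2) unfolding Hom_Ho by blast
  have c: "Cmp (Ho C M S) l k = (A, core_class C M (g0 \<odot> f0), D)"
    unfolding f g using core_class_cmp_Union[OF f(1) g(1)] by (simp add: Ho_def)
  show "Cmp (Ho C M S) l k \<in> Hom (Ho C M S) A D"
    unfolding c Hom_Ho using assms cmp[OF f(1) g(1)] unfolding Hom_Ho by blast
  show "g \<odot> f \<in> rep (Cmp (Ho C M S) l k)" if "f \<in> rep k" "g \<in> rep l"
    using core_class_cmp[OF f(1) _ g(1)] that f g unfolding c by simp
qed

lemma gamma_hom:
  assumes "f \<in> Hom C A B"
  shows "gamma C M S f \<in> Hom (Ho C M S) A B" "RQM S f \<in> rep (gamma C M S f)"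
  using RQM_square[OF assms] core_class_self[of "RQM S f"] hom_ob[OF assms] assms
  unfolding Hom_Ho gamma_def by (auto simp: hom_dom[OF assms] hom_cod[OF assms])

section \<open>Descent of Ext to the homotopy category\<close>

lemma Ext_Ho_snd_descends:
  assumes A: "A \<in> Ob C"
  shows "descends C (Ho C M S) (gamma C M S) (Ext_Ho C S n A) (Ext_Ho_snd C S n A)"
proof -
  note V = resolution[OF replacement_objects(6)[OF A]]
  note d = descended_functor[where V = "res S (RQO S A)" and E = "Ho C M S" and P = "RQO S" and rep = rep and n = n, OF V(1)]
  have P: "RQO S B \<in> Ob C" if "B \<in> Ob (Ho C M S)" for B using replacement_objects(5) that by simp
  define F where "F k = post C (res S (RQO S A)) (SOME f. f \<in> rep k) n" for k
  have "ab_functor (Ho C M S) (Ext_Ho C S n A) F"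
    unfolding F_def[abs_def] Ext_Ho_eq[abs_def] by (rule d(1)[OF P]) (use Ho_hom Ho_rep Ho_idn Ho_cmp in auto)
  moreover have "F (gamma C M S f) x = Ext_Ho_snd C S n A f x" if f: "f \<in> Arr C" and x: "x \<in> carrier (Ext_Ho C S n A (Dom C f))" for f x
    unfolding F_def Ext_Ho_snd_eq using gamma_hom[OF arr_homI[OF f]] x unfolding Ext_Ho_eq
    by (intro d(2)[OF P]) (use Ho_hom Ho_rep Ho_idn Ho_cmp in auto)
  ultimately show ?thesis unfolding descends_def by blast
qed

text \<open>A negligible change of \<open>f\<close> gives no control over its chosen lift.
  \<open>cmp_iso\<close> turns the action into composition with \<open>f\<close> on a coresolution
  of \<open>RQO S B\<close>, where \<open>descended_functor\<close> applies in the opposite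
  category, and the result is carried back.\<close>

lemma Ext_Ho_fst_descends:
  assumes B: "B \<in> Ob C"
  shows "descends (op_cat C) (op_cat (Ho C M S)) (gamma C M S) (\<lambda>A. Ext_Ho C S n A B) (\<lambda>f. Ext_Ho_fst C S n f B)"
proof -
  interpret op: hmod "op_cat C" R W Q by (rule op_mod)
  let ?E = "op_cat (Ho C M S)"
  let ?U = "dual_resol (cores S (RQO S B))"
  note oB = replacement_objects[OF B]
  note U = chosen_coresolution[OF oB(7)]
  \<comment> \<open>The core is self-dual up to the order of the intersection.\<close>
  have K: "R \<inter> W \<inter> Q = Q \<inter> W \<inter> R" by blast
  have P: "RQO S A \<in> Ob (op_cat C)" if "A \<in> Ob ?E" for A using replacement_objects(5) that by simp
  have E1: "A \<in> Ob ?E \<and> A' \<in> Ob ?E \<and> rep k \<noteq> {} \<and> rep k \<subseteq> Hom (op_cat C) (RQO S A) (RQO S A')"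
    if "k \<in> Hom ?E A A'" for A A' k using Ho_hom[of k A' A] that by simp
  have E2: "negligible (op_cat C) (R \<inter> W \<inter> Q) (sub (op_cat C) f g)"
    if "k \<in> Hom ?E A A'" "f \<in> rep k" "g \<in> rep k" for A A' k f g using Ho_rep[of k A' A f g] that by (simp add: K)
  have E3: "Idn ?E A \<in> Hom ?E A A \<and> Idn (op_cat C) (RQO S A) \<in> rep (Idn ?E A)" if "A \<in> Ob ?E" for A
    using Ho_idn[of A] that by simp
  have E4: "Cmp ?E l k \<in> Hom ?E A D \<and> Cmp (op_cat C) g f \<in> rep (Cmp ?E l k)"
    if "k \<in> Hom ?E A A'" "l \<in> Hom ?E A' D" "f \<in> rep k" "g \<in> rep l" for A A' D k l f g
    using Ho_cmp[of l D A' k A] that by simp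
  have E4': "Cmp ?E l k \<in> Hom ?E A D" if "k \<in> Hom ?E A A'" "l \<in> Hom ?E A' D" for A A' D k l
    using Ho_cmp(1)[of l D A' k A] that by simp
  have d1: "ab_functor ?E (\<lambda>A. lH (op_cat C) ?U (RQO S A) n) (\<lambda>k. post (op_cat C) ?U (SOME f. f \<in> rep k) n)"
    by (rule op.descended_functor(1)[OF U(1)]) (fact P E1 E2 E3 E4)+
  have d2: "post (op_cat C) ?U (SOME f. f \<in> rep k) n x = post (op_cat C) ?U f n x"
    if "k \<in> Hom ?E A A'" "f \<in> rep k" "x \<in> carrier (lH (op_cat C) ?U (RQO S A) n)" for A A' k f x
    by (rule op.descended_functor(2)[where E = ?E and P = "RQO S" and rep = rep, OF U(1)]) (fact P E1 E2 E3 E4 that)+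
  define F where "F k = pre C (res S (Dom C (SOME f. f \<in> rep k))) (RQO S B) n (res_lift S (SOME f. f \<in> rep k) n)" for k
  have pre: "pre C (res S (Dom C f)) (RQO S B) n (res_lift S f n) x \<in> carrier (Ext_Ho C S n A' B)"
    "cmp_iso n (RQO S A') (RQO S B) (pre C (res S (Dom C f)) (RQO S B) n (res_lift S f n) x) =
      post (op_cat C) ?U f n (cmp_iso n (RQO S A) (RQO S B) x)"
    if o: "A' \<in> Ob C" "A \<in> Ob C" and f: "f \<in> Hom C (RQO S A') (RQO S A)" and x: "x \<in> carrier (Ext_Ho C S n A B)" for A A' f x
  proof -
    note oA = replacement_objects[OF o(2)] and oA' = replacement_objects[OF o(1)]
    show "pre C (res S (Dom C f)) (RQO S B) n (res_lift S f n) x \<in> carrier (Ext_Ho C S n A' B)"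
      unfolding Ext_Ho_eq hom_dom[OF f]
      by (rule pre_lift_closed[OF resolution(3)[OF oA'(6)] resolution(3)[OF oA(6)] oB(5) res_lift[OF f] x[unfolded Ext_Ho_eq]])
    show "cmp_iso n (RQO S A') (RQO S B) (pre C (res S (Dom C f)) (RQO S B) n (res_lift S f n) x) =
        post (op_cat C) ?U f n (cmp_iso n (RQO S A) (RQO S B) x)"
      unfolding hom_dom[OF f] by (rule cmp_iso_pre[OF oA'(6) oA(6) oB(7) f x[unfolded Ext_Ho_eq]])
  qed
  have some: "(SOME f. f \<in> rep k) \<in> Hom C (RQO S A') (RQO S A)" "A' \<in> Ob C" "A \<in> Ob C"
    if "k \<in> Hom ?E A A'" for A A' k using E1[OF that] some_in_eq[of "rep k"] by auto
  have iso: "cmp_iso n (RQO S A) (RQO S B) \<in> iso (Ext_Ho C S n A B) (lH (op_cat C) ?U (RQO S A) n)" if "A \<in> Ob C" for A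
    unfolding Ext_Ho_eq by (rule cmp_iso(1)[OF replacement_objects(6)[OF that] oB(7)])
  have "ab_functor ?E (\<lambda>A. Ext_Ho C S n A B) F"
  proof (rule ab_functor_transport[where t = "\<lambda>A. cmp_iso n (RQO S A) (RQO S B)"
        and G = "\<lambda>A. lH (op_cat C) ?U (RQO S A) n" and Gm = "\<lambda>k. post (op_cat C) ?U (SOME f. f \<in> rep k) n"])
    show "ab_functor ?E (\<lambda>A. lH (op_cat C) ?U (RQO S A) n) (\<lambda>k. post (op_cat C) ?U (SOME f. f \<in> rep k) n)"
      by (rule d1)
    show "F k x \<in> carrier (Ext_Ho C S n A' B) \<and> cmp_iso n (RQO S A') (RQO S B) (F k x) =
        post (op_cat C) ?U (SOME f. f \<in> rep k) n (cmp_iso n (RQO S A) (RQO S B) x)"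
      if "k \<in> Hom ?E A A'" "x \<in> carrier (Ext_Ho C S n A B)" for A A' k x
      unfolding F_def using pre[OF some(2,3,1)[OF that(1)] that(2)] by blast
  qed (use E1 E3 E4' iso Ext_Ho_group[OF _ B] in auto)
  moreover have "F (gamma C M S f) x = Ext_Ho_fst C S n f B x"
    if f: "f \<in> Arr (op_cat C)" and x: "x \<in> carrier (Ext_Ho C S n (Dom (op_cat C) f) B)" for f x
  proof -
    have f': "f \<in> Arr C" and x': "x \<in> carrier (Ext_Ho C S n (Cod C f) B)" using f x by simp_all
    note o = ob[OF f'] and g = gamma_hom[OF arr_homI[OF f']]
    have gE: "gamma C M S f \<in> Hom ?E (Cod C f) (Dom C f)" using g(1) by simp
    have r: "RQM S f \<in> Hom C (RQO S (Dom C f)) (RQO S (Cod C f))" using RQM_square[OF arr_homI[OF f']] by blast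
    note p1 = pre[OF o some(1)[OF gE] x'] and p2 = pre[OF o r x']
    have y: "cmp_iso n (RQO S (Cod C f)) (RQO S B) x \<in> carrier (lH (op_cat C) ?U (RQO S (Cod C f)) n)"
      by (rule isoD(4)[OF iso[OF o(2)] x'])
    \<comment> \<open>The lifts of the selected representative and of \<open>RQM S f\<close> are
      compared after the injective \<open>cmp_iso\<close>, where the two representatives act
      alike.\<close>
    show ?thesis unfolding F_def Ext_Ho_fst_eq
      by (rule iso_eqI[OF iso[OF o(1)] p1(1) p2(1)]) (use p1(2) p2(2) d2[OF gE g(2) y] in simp)
  qed
  ultimately show ?thesis unfolding descends_def by (intro exI[of _ F]) blast
qed

end

theorem theorem6p5:
  fixes C :: "('o, 'm) add_cat" and M :: "'o triple" and S :: "('o, 'm) choice"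
  assumes "abelian_category C" and "hereditary_model C M" and "choices C M S"
  shows
    "(\<forall>A \<in> Ob C.
        (\<forall>n. additive_ab_functor C (Ext_Ho C S n A) (Ext_Ho_snd C S n A)) \<and>
        long_exact_sequences C (\<lambda>n. Ext_Ho C S n A) (\<lambda>n. Ext_Ho_snd C S n A) \<and>
        (\<forall>n. descends C (Ho C M S) (gamma C M S) (Ext_Ho C S n A) (Ext_Ho_snd C S n A))) \<and>
     (\<forall>B \<in> Ob C.
        (\<forall>n. additive_ab_functor (op_cat C) (\<lambda>A. Ext_Ho C S n A B) (\<lambda>f. Ext_Ho_fst C S n f B)) \<and>
        long_exact_sequences (op_cat C) (\<lambda>n A. Ext_Ho C S n A B) (\<lambda>n f. Ext_Ho_fst C S n f B) \<and>
        (\<forall>n. descends (op_cat C) (op_cat (Ho C M S)) (gamma C M S)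
               (\<lambda>A. Ext_Ho C S n A B) (\<lambda>f. Ext_Ho_fst C S n f B))) \<and>
     (\<forall>n. naturally_isomorphic C
        (Ext_Ho C S n) (Ext_Ho_fst C S n) (Ext_Ho_snd C S n)
        (\<lambda>A B. lExt C S n (QO S A) (RO S B))
        (\<lambda>f B. lExt_fst C S n (QM S f) (RO S B)) (\<lambda>A g. lExt_snd C S n (QO S A) (RM S g))) \<and>
     (\<forall>n. naturally_isomorphic C
        (Ext_Ho C S n) (Ext_Ho_fst C S n) (Ext_Ho_snd C S n)
        (\<lambda>A B. rExt C S n (QO S A) (RO S B))
        (\<lambda>f B. rExt_fst C S n (QM S f) (RO S B)) (\<lambda>A g. rExt_snd C S n (QO S A) (RM S g))) \<and>
     (\<forall>n. \<forall>A \<in> Ob C. \<forall>B \<in> Ob C. \<forall>QA p RB j V.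
        cofibrant_replacement C M A QA p \<and> fibrant_replacement C M B RB j \<longrightarrow>
        (M_resolution C M QA V \<longrightarrow> Ext_Ho C S n A B \<cong> lH C V RB n) \<and>
        (M_resolution C M RB V \<longrightarrow> Ext_Ho C S n A B \<cong> rH C QA V n))"
proof -
  interpret model_choices C M S using assms by (rule model_choices.intro)
  show ?thesis
    by (intro conjI ballI allI impI)
      (blast intro: Ext_Ho_snd_functor Ext_Ho_snd_descends Ext_Ho_fst_functor Ext_Ho_fst_descends
        Ext_Ho_lExt Ext_Ho_rExt canonical_resolution)+
qed

end
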